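(* Let $\langle \mathsf B,\mathcal F\rangle$ be a display map category with units and $\mathcal F$-dependent coproducts, and let $\mathsf p:\mathsf E\to\mathsf B$ be a fibration with $\mathcal F$-products and $\mathcal F$-coproducts, such that $\mathsf B$ has $\mathcal F$-dependent products. Then there exists a fibration $\mathsf p'$ such that $\mathfrak{Dial}_{\mathcal F}(\mathsf p')\cong\mathsf p$ (up to fibred equivalence) if and only if $\mathsf p$ is a dependent Gödel fibration. In particular, $\mathsf p'$ can be taken to be the full subfibration of $(\mathcal F,\prod)$-quantifier-free elements of $\mathsf p$.
   Context: Conventions. Fibrations $\mathsf p:\mathsf E\to\mathsf B$ are cloven Grothendieck fibrations; $\mathsf E_A$ is the fibre over $A\in\mathsf B$, and its objects are also called elements; vertical arrows are those over identities; $u^*:\mathsf E_B\to\mathsf E_A$ is reindexing along $u:A\to B$. Canonical isomorphisms such as $g^*u^*\cong(ug)^*$ are suppressed. Display maps. A display map category $\langle\mathsf B,\mathcal F\rangle$ is a category with a class $\mathcal F$ of morphisms such that pullbacks of $\mathcal F$-maps along arbitrary maps exist and lie in $\mathcal F$. Arrows of $\mathcal F$ are written $\twoheadrightarrow$. It has units if all isomorphisms are in $\mathcal F$, and $\mathcal F$-dependent coproducts if $\mathcal F$ is closed under composition. An $\mathcal F$-dependent product of $f:K\twoheadrightarrow I$ along $g:I\twoheadrightarrow J$ consists of $h:E\twoheadrightarrow J$ in $\mathcal F$, a pullback $Z=I\times_J E$ and $e:Z\to K$ over $I$ (i.e. $fe$ is the projection $Z\to I$), such that for every $h':E'\twoheadrightarrow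 J$ in $\mathcal F$ with pullback $Z'=I\times_J E'$ and $e':Z'\to K$ over $I$ there is a unique pair $w:Z'\to Z$, $k:E'\to E$ with $hk=h'$, $ew=e'$, and $w$ commuting with $k$ and with the projections of the pullbacks. $\mathsf B$ has $\mathcal F$-dependent products if these exist for all such pairs $f,g$ in $\mathcal F$. Fibred (co)products. $\mathsf p$ has $\mathcal F$-coproducts (resp. $\mathcal F$-products) if for each $v\in\mathcal F$ the functor $v^*$ has a left adjoint $\coprod_v$ (resp. right adjoint $\prod_v$), and the Beck–Chevalley condition holds: for every pullback square with $v:L\twoheadrightarrow J$, $f:I\to J$ arbitrary, $u:K\twoheadrightarrow I$, $g:K\to L$, the canonical map $\coprod_u g^*\Rightarrow f^*\coprod_v$ (resp. $f^*\prod_v\Rightarrow\prod_u g^*$) is an isomorphism. Quantifier-freeness. Let $\mathsf p$ have $\mathcal F$-coproducts. $\alpha\in\mathsf E_A$ is $(\mathcal F,\coprod)$-quantifier splitting if for every $u:B\twoheadrightarrow A$ in $\mathcal F$, every $\beta\in\mathsf E_B$ and every vertical $h:\alpha\to\coprod_u\beta$ there is a unique pair consisting of a section $g:A\to B$ of $u$ ($ug=\mathrm{id}_A$, $g$ not necessarily in $\mathcal F$) and a vertical $\overline h:\alpha\to g^*\beta$ with $h=g^*(\eta_\beta)\circ\overline h$, where $\eta$ is the unit of $\coprod_u\dashv u^*$ and $g^*u^*\coprod_u\beta\cong\coprod_u\beta$. It is $(\mathcal F,\coprod)$-quantifier-free if $f^*\alpha$ is $(\mathcal F,\coprod)$-quantifier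 splitting for every $f:I\to A$ in $\mathsf B$. $\mathsf p$ has enough $(\mathcal F,\coprod)$-quantifier-free objects if it has $\mathcal F$-coproducts and for every $\alpha\in\mathsf E_I$ there are $f:A\twoheadrightarrow I$ in $\mathcal F$ and a $(\mathcal F,\coprod)$-quantifier-free $\beta\in\mathsf E_A$ with $\alpha\cong\coprod_f\beta$. Dually, if $\mathsf p$ has $\mathcal F$-products, $\alpha\in\mathsf E_A$ is $(\mathcal F,\prod)$-quantifier splitting if for every $u:B\twoheadrightarrow A$ in $\mathcal F$, $\beta\in\mathsf E_B$ and vertical $h:\prod_u\beta\to\alpha$ there is a unique pair consisting of a section $g$ of $u$ and a vertical $\overline h:g^*\beta\to\alpha$ with $h=\overline h\circ g^*(\varepsilon_\beta)$, where $\varepsilon$ is the counit of $u^*\dashv\prod_u$; it is $(\mathcal F,\prod)$-quantifier-free if all its reindexings are $(\mathcal F,\prod)$-quantifier splitting; $\mathsf p$ has enough $(\mathcal F,\prod)$-quantifier-free objects if it has $\mathcal F$-products and every $\alpha\in\mathsf E_I$ is isomorphic to $\prod_f\beta$ for some $f:A\twoheadrightarrow I$ in $\mathcal F$ and some $(\mathcal F,\prod)$-quantifier-free $\beta\in\mathsf E_A$. Skolem and Gödel fibrations. $\mathsf p$ is a dependent Skolem fibration if: $\mathsf B$ has $\mathcal F$-dependent products; $\mathsf p$ has $\mathcal F$-products; $\mathsf p$ has enough $(\mathcal F,\coprod)$-quantifier-free objects; and for each $(\mathcal F,\coprod)$-quantifier-free $\alpha\in\mathsf E_I$ and $f:I\twoheadrightarrow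 J$ in $\mathcal F$, $\prod_f\alpha$ is $(\mathcal F,\coprod)$-quantifier-free. It is a dependent Gödel fibration if moreover the full subfibration of its $(\mathcal F,\coprod)$-quantifier-free objects (which then has $\mathcal F$-products) has enough $(\mathcal F,\prod)$-quantifier-free objects. Completions. $\Sigma_{\mathcal F}(\mathsf p):\Sigma_{\mathcal F}(\mathsf E)\to\mathsf B$: objects over $I$ are pairs $(g:X\twoheadrightarrow I,\ \alpha\in\mathsf E_X)$ with $g\in\mathcal F$; a morphism $(g:X\twoheadrightarrow I,\alpha)\to(h:Y\twoheadrightarrow J,\beta)$ over $f_0:I\to J$ is a pair of $f_1:X\to Y$ with $hf_1=f_0g$ and $\phi:\alpha\to\beta$ in $\mathsf E$ over $f_1$. $\Pi_{\mathcal F}(\mathsf p):\Pi_{\mathcal F}(\mathsf E)\to\mathsf B$: objects over $I$ are again pairs $(g:X\twoheadrightarrow I,\alpha\in\mathsf E_X)$; a morphism $(g:X\twoheadrightarrow I,\alpha)\to(h:Y\twoheadrightarrow J,\beta)$ over $f_0:I\to J$ consists of $f_1:I\times_JY\to X$ over $I$ and a vertical arrow $\phi:f_1^*\alpha\to (f_0')^*\beta$ over $I\times_JY$, where $f_0':I\times_JY\to Y$ is the projection, with the evident composition (so $\Pi_{\mathcal F}(\mathsf p)$ is the fibrewise opposite of $\Sigma_{\mathcal F}$ applied to the fibrewise opposite of $\mathsf p$). The $\mathcal F$-Dialectica fibration is $\mathfrak{Dial}_{\mathcal F}(\mathsf p):=\Sigma_{\mathcal F}(\Pi_{\mathcal F}(\mathsf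 p))$.
   Formalization: In the last sentence, the (F,∏)-quantifier-free elements are taken inside the full subfibration of (F,∐)-quantifier-free elements of p, not in p itself; the literal reading fails, e.g. for the Dialectica fibration of the identity fibration on sets. *)

theory Defs
  imports Main
begin

section \<open>Categories, functors, adjunctions\<close>

record ('o, 'a) cat =
  Obj :: "'o set"
  Arr :: "'a set"
  Dom :: "'a \<Rightarrow> 'o"
  Cod :: "'a \<Rightarrow> 'o"
  Ide :: "'o \<Rightarrow> 'a"
  Comp :: "'a \<Rightarrow> 'a \<Rightarrow> 'a"  (infixl "\<cdot>\<index>" 70)

text \<open>\<open>g \<cdot>\<^bsub>C\<^esub> f\<close> is \<open>g\<close> after \<open>f\<close>.\<close>

definition hom :: "('o, 'a) cat \<Rightarrow> 'o \<Rightarrow> 'o \<Rightarrow> 'a set" where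
  "hom C a b = {f \<in> Arr C. Dom C f = a \<and> Cod C f = b}"

definition category :: "('o, 'a) cat \<Rightarrow> bool" where
  "category C \<longleftrightarrow>
     (\<forall>f \<in> Arr C. Dom C f \<in> Obj C \<and> Cod C f \<in> Obj C) \<and>
     (\<forall>a \<in> Obj C. Ide C a \<in> hom C a a) \<and>
     (\<forall>f \<in> Arr C. \<forall>g \<in> Arr C. Cod C f = Dom C g \<longrightarrow>
        g \<cdot>\<^bsub>C\<^esub> f \<in> hom C (Dom C f) (Cod C g)) \<and>
     (\<forall>f \<in> Arr C. Ide C (Cod C f) \<cdot>\<^bsub>C\<^esub> f = f \<and> f \<cdot>\<^bsub>C\<^esub> Ide C (Dom C f) = f) \<and>
     (\<forall>f \<in> Arr C. \<forall>g \<in> Arr C. \<forall>h \<in> Arr C. Cod C f = Dom C g \<longrightarrow> Cod C g = Dom C h \<longrightarrow>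
        h \<cdot>\<^bsub>C\<^esub> (g \<cdot>\<^bsub>C\<^esub> f) = (h \<cdot>\<^bsub>C\<^esub> g) \<cdot>\<^bsub>C\<^esub> f)"

definition iso :: "('o, 'a) cat \<Rightarrow> 'a \<Rightarrow> bool" where
  "iso C f \<longleftrightarrow> f \<in> Arr C \<and>
     (\<exists>g \<in> hom C (Cod C f) (Dom C f).
        g \<cdot>\<^bsub>C\<^esub> f = Ide C (Dom C f) \<and> f \<cdot>\<^bsub>C\<^esub> g = Ide C (Cod C f))"

definition isomorphic :: "('o, 'a) cat \<Rightarrow> 'o \<Rightarrow> 'o \<Rightarrow> bool" where
  "isomorphic C a b \<longleftrightarrow> (\<exists>f \<in> hom C a b. iso C f)"

record ('o1, 'a1, 'o2, 'a2) func =
  fobj :: "'o1 \<Rightarrow> 'o2"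
  farr :: "'a1 \<Rightarrow> 'a2"

definition is_functor ::
  "('o1, 'a1) cat \<Rightarrow> ('o2, 'a2) cat \<Rightarrow> ('o1, 'a1, 'o2, 'a2) func \<Rightarrow> bool" where
  "is_functor C D G \<longleftrightarrow>
     (\<forall>a \<in> Obj C. fobj G a \<in> Obj D) \<and>
     (\<forall>f \<in> Arr C. farr G f \<in> hom D (fobj G (Dom C f)) (fobj G (Cod C f))) \<and>
     (\<forall>a \<in> Obj C. farr G (Ide C a) = Ide D (fobj G a)) \<and>
     (\<forall>f \<in> Arr C. \<forall>g \<in> Arr C. Cod C f = Dom C g \<longrightarrow>
        farr G (g \<cdot>\<^bsub>C\<^esub> f) = farr G g \<cdot>\<^bsub>D\<^esub> farr G f)"

definition id_func :: "('o, 'a, 'o, 'a) func" where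
  "id_func = \<lparr>fobj = (\<lambda>a. a), farr = (\<lambda>f. f)\<rparr>"

definition comp_func ::
  "('o2, 'a2, 'o3, 'a3) func \<Rightarrow> ('o1, 'a1, 'o2, 'a2) func \<Rightarrow> ('o1, 'a1, 'o3, 'a3) func" where
  "comp_func H G = \<lparr>fobj = (\<lambda>a. fobj H (fobj G a)), farr = (\<lambda>f. farr H (farr G f))\<rparr>"

definition nat_trans ::
  "('o1, 'a1) cat \<Rightarrow> ('o2, 'a2) cat \<Rightarrow> ('o1, 'a1, 'o2, 'a2) func \<Rightarrow>
   ('o1, 'a1, 'o2, 'a2) func \<Rightarrow> ('o1 \<Rightarrow> 'a2) \<Rightarrow> bool" where
  "nat_trans C D G H \<tau> \<longleftrightarrow>
     (\<forall>a \<in> Obj C. \<tau> a \<in> hom D (fobj G a) (fobj H a)) \<and>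
     (\<forall>f \<in> Arr C. \<tau> (Cod C f) \<cdot>\<^bsub>D\<^esub> farr G f = farr H f \<cdot>\<^bsub>D\<^esub> \<tau> (Dom C f))"

record ('o1, 'a1, 'o2, 'a2) adj =
  ladj :: "('o1, 'a1, 'o2, 'a2) func"
  radj :: "('o2, 'a2, 'o1, 'a1) func"
  aunit :: "'o1 \<Rightarrow> 'a1"
  acounit :: "'o2 \<Rightarrow> 'a2"

definition adjunction ::
  "('o1, 'a1) cat \<Rightarrow> ('o2, 'a2) cat \<Rightarrow> ('o1, 'a1, 'o2, 'a2) adj \<Rightarrow> bool" where
  "adjunction C D T \<longleftrightarrow>
     is_functor C D (ladj T) \<and> is_functor D C (radj T) \<and>
     nat_trans C C id_func (comp_func (radj T) (ladj T)) (aunit T) \<and>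
     nat_trans D D (comp_func (ladj T) (radj T)) id_func (acounit T) \<and>
     (\<forall>a \<in> Obj C. acounit T (fobj (ladj T) a) \<cdot>\<^bsub>D\<^esub> farr (ladj T) (aunit T a)
        = Ide D (fobj (ladj T) a)) \<and>
     (\<forall>b \<in> Obj D. farr (radj T) (acounit T b) \<cdot>\<^bsub>C\<^esub> aunit T (fobj (radj T) b)
        = Ide C (fobj (radj T) b))"


section \<open>Pullbacks and display maps\<close>

text \<open>\<open>is_pullback B f g a b\<close>: the square \<open>f \<cdot> a = g \<cdot> b\<close> is a pullback of the cospan \<open>(f, g)\<close>.\<close>

definition is_pullback :: "('o, 'm) cat \<Rightarrow> 'm \<Rightarrow> 'm \<Rightarrow> 'm \<Rightarrow> 'm \<Rightarrow> bool" where
  "is_pullback B f g a b \<longleftrightarrow>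
     f \<in> Arr B \<and> g \<in> Arr B \<and> a \<in> Arr B \<and> b \<in> Arr B \<and>
     Cod B f = Cod B g \<and> Dom B a = Dom B b \<and> Cod B a = Dom B f \<and> Cod B b = Dom B g \<and>
     f \<cdot>\<^bsub>B\<^esub> a = g \<cdot>\<^bsub>B\<^esub> b \<and>
     (\<forall>x \<in> Arr B. \<forall>y \<in> Arr B.
        Dom B x = Dom B y \<longrightarrow> Cod B x = Dom B f \<longrightarrow> Cod B y = Dom B g \<longrightarrow>
        f \<cdot>\<^bsub>B\<^esub> x = g \<cdot>\<^bsub>B\<^esub> y \<longrightarrow>
        (\<exists>!t. t \<in> hom B (Dom B x) (Dom B a) \<and> a \<cdot>\<^bsub>B\<^esub> t = x \<and> b \<cdot>\<^bsub>B\<^esub> t = y))"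

definition display_map_category :: "('o, 'm) cat \<Rightarrow> 'm set \<Rightarrow> bool" where
  "display_map_category B F \<longleftrightarrow> category B \<and> F \<subseteq> Arr B \<and>
     (\<forall>f \<in> Arr B. \<forall>g \<in> F. Cod B f = Cod B g \<longrightarrow>
        (\<exists>a b. is_pullback B f g a b) \<and> (\<forall>a b. is_pullback B f g a b \<longrightarrow> a \<in> F))"

definition has_units :: "('o, 'm) cat \<Rightarrow> 'm set \<Rightarrow> bool" where
  "has_units B F \<longleftrightarrow> (\<forall>f. iso B f \<longrightarrow> f \<in> F)"

definition has_dependent_coproducts :: "('o, 'm) cat \<Rightarrow> 'm set \<Rightarrow> bool" where
  "has_dependent_coproducts B F \<longleftrightarrow>
     (\<forall>f \<in> F. \<forall>g \<in> F. Cod B f = Dom B g \<longrightarrow> g \<cdot>\<^bsub>B\<^esub> f \<in> F)"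

text \<open>
  The dependent product of \<open>f : K \<rightarrow> I\<close> along \<open>g : I \<rightarrow> J\<close> is given by \<open>h : E \<rightarrow> J\<close>, a pullback
  \<open>Z = I \<times>\<^sub>J E\<close> with projections \<open>z\<^sub>I\<close>, \<open>z\<^sub>E\<close>, and \<open>e : Z \<rightarrow> K\<close> over \<open>I\<close>.
\<close>

definition is_dependent_product ::
  "('o, 'm) cat \<Rightarrow> 'm set \<Rightarrow> 'm \<Rightarrow> 'm \<Rightarrow> 'm \<Rightarrow> 'm \<Rightarrow> 'm \<Rightarrow> 'm \<Rightarrow> bool" where
  "is_dependent_product B F f g h z\<^sub>I z\<^sub>E e \<longleftrightarrow>
     h \<in> F \<and> is_pullback B g h z\<^sub>I z\<^sub>E \<and>
     e \<in> hom B (Dom B z\<^sub>I) (Dom B f) \<and> f \<cdot>\<^bsub>B\<^esub> e = z\<^sub>I \<and>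
     (\<forall>h' \<in> F. \<forall>z\<^sub>I' z\<^sub>E' e'.
        is_pullback B g h' z\<^sub>I' z\<^sub>E' \<longrightarrow>
        e' \<in> hom B (Dom B z\<^sub>I') (Dom B f) \<longrightarrow> f \<cdot>\<^bsub>B\<^esub> e' = z\<^sub>I' \<longrightarrow>
        (\<exists>!wk. case wk of (w, k) \<Rightarrow>
           w \<in> hom B (Dom B z\<^sub>I') (Dom B z\<^sub>I) \<and> k \<in> hom B (Dom B h') (Dom B h) \<and>
           h \<cdot>\<^bsub>B\<^esub> k = h' \<and> e \<cdot>\<^bsub>B\<^esub> w = e' \<and>
           z\<^sub>I \<cdot>\<^bsub>B\<^esub> w = z\<^sub>I' \<and> z\<^sub>E \<cdot>\<^bsub>B\<^esub> w = k \<cdot>\<^bsub>B\<^esub> z\<^sub>E'))"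

definition has_dependent_products :: "('o, 'm) cat \<Rightarrow> 'm set \<Rightarrow> bool" where
  "has_dependent_products B F \<longleftrightarrow>
     (\<forall>f \<in> F. \<forall>g \<in> F. Cod B f = Dom B g \<longrightarrow>
        (\<exists>h z\<^sub>I z\<^sub>E e. is_dependent_product B F f g h z\<^sub>I z\<^sub>E e))"

text \<open>Chosen pullbacks, used in the completions below; \<open>pb_pair\<close> is the induced map into them.\<close>

definition pb :: "('o, 'm) cat \<Rightarrow> 'm \<Rightarrow> 'm \<Rightarrow> 'm \<times> 'm" where
  "pb B f g = (SOME ab. is_pullback B f g (fst ab) (snd ab))"

definition pb1 :: "('o, 'm) cat \<Rightarrow> 'm \<Rightarrow> 'm \<Rightarrow> 'm" where
  "pb1 B f g = fst (pb B f g)"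

definition pb2 :: "('o, 'm) cat \<Rightarrow> 'm \<Rightarrow> 'm \<Rightarrow> 'm" where
  "pb2 B f g = snd (pb B f g)"

definition pb_pair :: "('o, 'm) cat \<Rightarrow> 'm \<Rightarrow> 'm \<Rightarrow> 'm \<Rightarrow> 'm \<Rightarrow> 'm" where
  "pb_pair B f g x y = (THE t. t \<in> hom B (Dom B x) (Dom B (pb1 B f g)) \<and>
     pb1 B f g \<cdot>\<^bsub>B\<^esub> t = x \<and> pb2 B f g \<cdot>\<^bsub>B\<^esub> t = y)"


section \<open>Cloven fibrations\<close>

text \<open>
  \<open>Lift p u \<alpha>\<close> is the chosen cartesian arrow \<open>u\<^sup>*\<alpha> \<rightarrow> \<alpha>\<close> over \<open>u\<close>. The base category is always
  passed separately, as it is shared by all fibrations involved.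
\<close>

record ('o, 'm, 'e, 'f) fibn =
  Tot :: "('e, 'f) cat"
  PObj :: "'e \<Rightarrow> 'o"
  PArr :: "'f \<Rightarrow> 'm"
  Lift :: "'m \<Rightarrow> 'e \<Rightarrow> 'f"

definition cartesian :: "('o, 'm) cat \<Rightarrow> ('o, 'm, 'e, 'f) fibn \<Rightarrow> 'f \<Rightarrow> bool" where
  "cartesian B p c \<longleftrightarrow> c \<in> Arr (Tot p) \<and>
     (\<forall>k \<in> Arr (Tot p). \<forall>w \<in> hom B (PObj p (Dom (Tot p) k)) (PObj p (Dom (Tot p) c)).
        Cod (Tot p) k = Cod (Tot p) c \<longrightarrow> PArr p k = PArr p c \<cdot>\<^bsub>B\<^esub> w \<longrightarrow>
        (\<exists>!x. x \<in> hom (Tot p) (Dom (Tot p) k) (Dom (Tot p) c) \<and>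
              PArr p x = w \<and> c \<cdot>\<^bsub>Tot p\<^esub> x = k))"

definition fibration :: "('o, 'm) cat \<Rightarrow> ('o, 'm, 'e, 'f) fibn \<Rightarrow> bool" where
  "fibration B p \<longleftrightarrow> category B \<and> category (Tot p) \<and>
     is_functor (Tot p) B \<lparr>fobj = PObj p, farr = PArr p\<rparr> \<and>
     (\<forall>u \<in> Arr B. \<forall>\<alpha> \<in> Obj (Tot p). PObj p \<alpha> = Cod B u \<longrightarrow>
        Cod (Tot p) (Lift p u \<alpha>) = \<alpha> \<and> PArr p (Lift p u \<alpha>) = u \<and> cartesian B p (Lift p u \<alpha>))"

definition fibre :: "('o, 'm) cat \<Rightarrow> ('o, 'm, 'e, 'f) fibn \<Rightarrow> 'o \<Rightarrow> ('e, 'f) cat" where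
  "fibre B p A = (Tot p)
     \<lparr>Obj := {\<alpha> \<in> Obj (Tot p). PObj p \<alpha> = A},
      Arr := {\<phi> \<in> Arr (Tot p). PArr p \<phi> = Ide B A}\<rparr>"

text \<open>\<open>vfill B p c k\<close> is the unique vertical \<open>x\<close> with \<open>c \<cdot> x = k\<close>, for cartesian \<open>c\<close>.
  If \<open>k\<close> is cartesian too, it is the canonical isomorphism between their domains.\<close>

definition vfill :: "('o, 'm) cat \<Rightarrow> ('o, 'm, 'e, 'f) fibn \<Rightarrow> 'f \<Rightarrow> 'f \<Rightarrow> 'f" where
  "vfill B p c k = (THE x.
     x \<in> hom (fibre B p (PObj p (Dom (Tot p) k))) (Dom (Tot p) k) (Dom (Tot p) c) \<and>
     c \<cdot>\<^bsub>Tot p\<^esub> x = k)"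

definition reindex ::
  "('o, 'm) cat \<Rightarrow> ('o, 'm, 'e, 'f) fibn \<Rightarrow> 'm \<Rightarrow> ('e, 'f, 'e, 'f) func" where
  "reindex B p u =
     \<lparr>fobj = (\<lambda>\<alpha>. Dom (Tot p) (Lift p u \<alpha>)),
      farr = (\<lambda>\<phi>. vfill B p (Lift p u (Cod (Tot p) \<phi>))
                            (\<phi> \<cdot>\<^bsub>Tot p\<^esub> Lift p u (Dom (Tot p) \<phi>)))\<rparr>"

abbreviation reindO :: "('o, 'm) cat \<Rightarrow> ('o, 'm, 'e, 'f) fibn \<Rightarrow> 'm \<Rightarrow> 'e \<Rightarrow> 'e" where
  "reindO B p u \<equiv> fobj (reindex B p u)"

abbreviation reindA :: "('o, 'm) cat \<Rightarrow> ('o, 'm, 'e, 'f) fibn \<Rightarrow> 'm \<Rightarrow> 'f \<Rightarrow> 'f" where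
  "reindA B p u \<equiv> farr (reindex B p u)"

text \<open>The cartesian arrow \<open>g\<^sup>*u\<^sup>*\<alpha> \<rightarrow> \<alpha>\<close> over \<open>u \<cdot> g\<close>.\<close>

definition Lift2 :: "('o, 'm) cat \<Rightarrow> ('o, 'm, 'e, 'f) fibn \<Rightarrow> 'm \<Rightarrow> 'm \<Rightarrow> 'e \<Rightarrow> 'f" where
  "Lift2 B p u g \<alpha> = Lift p u \<alpha> \<cdot>\<^bsub>Tot p\<^esub> Lift p g (reindO B p u \<alpha>)"

definition full_sub ::
  "('o, 'm, 'e, 'f) fibn \<Rightarrow> ('e \<Rightarrow> bool) \<Rightarrow> ('o, 'm, 'e, 'f) fibn" where
  "full_sub p Q = p\<lparr>Tot := (Tot p)
     \<lparr>Obj := {\<alpha> \<in> Obj (Tot p). Q \<alpha>},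
      Arr := {\<phi> \<in> Arr (Tot p). Q (Dom (Tot p) \<phi>) \<and> Q (Cod (Tot p) \<phi>)}\<rparr>\<rparr>"

definition fibred_functor ::
  "('o, 'm) cat \<Rightarrow> ('o, 'm, 'e1, 'f1) fibn \<Rightarrow> ('o, 'm, 'e2, 'f2) fibn \<Rightarrow>
   ('e1, 'f1, 'e2, 'f2) func \<Rightarrow> bool" where
  "fibred_functor B p q G \<longleftrightarrow> is_functor (Tot p) (Tot q) G \<and>
     (\<forall>\<alpha> \<in> Obj (Tot p). PObj q (fobj G \<alpha>) = PObj p \<alpha>) \<and>
     (\<forall>\<phi> \<in> Arr (Tot p). PArr q (farr G \<phi>) = PArr p \<phi>) \<and>
     (\<forall>\<phi>. cartesian B p \<phi> \<longrightarrow> cartesian B q (farr G \<phi>))"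

definition vertical_nat_iso ::
  "('o, 'm) cat \<Rightarrow> ('o, 'm, 'e1, 'f1) fibn \<Rightarrow> ('o, 'm, 'e2, 'f2) fibn \<Rightarrow>
   ('e1, 'f1, 'e2, 'f2) func \<Rightarrow> ('e1, 'f1, 'e2, 'f2) func \<Rightarrow> ('e1 \<Rightarrow> 'f2) \<Rightarrow> bool" where
  "vertical_nat_iso B p q G H \<tau> \<longleftrightarrow> nat_trans (Tot p) (Tot q) G H \<tau> \<and>
     (\<forall>\<alpha> \<in> Obj (Tot p). PArr q (\<tau> \<alpha>) = Ide B (PObj p \<alpha>) \<and> iso (Tot q) (\<tau> \<alpha>))"

definition fibred_equivalent ::
  "('o, 'm) cat \<Rightarrow> ('o, 'm, 'e1, 'f1) fibn \<Rightarrow> ('o, 'm, 'e2, 'f2) fibn \<Rightarrow> bool" where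
  "fibred_equivalent B p q \<longleftrightarrow>
     (\<exists>G H \<sigma> \<tau>. fibred_functor B p q G \<and> fibred_functor B q p H \<and>
        vertical_nat_iso B p p id_func (comp_func H G) \<sigma> \<and>
        vertical_nat_iso B q q (comp_func G H) id_func \<tau>)"


section \<open>Fibred coproducts and products\<close>

definition coprod_adj ::
  "('o, 'm) cat \<Rightarrow> ('o, 'm, 'e, 'f) fibn \<Rightarrow> 'm \<Rightarrow> ('e, 'f, 'e, 'f) adj" where
  "coprod_adj B p u = (SOME T.
     adjunction (fibre B p (Dom B u)) (fibre B p (Cod B u)) T \<and> radj T = reindex B p u)"

definition prod_adj ::
  "('o, 'm) cat \<Rightarrow> ('o, 'm, 'e, 'f) fibn \<Rightarrow> 'm \<Rightarrow> ('e, 'f, 'e, 'f) adj" where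
  "prod_adj B p u = (SOME T.
     adjunction (fibre B p (Cod B u)) (fibre B p (Dom B u)) T \<and> ladj T = reindex B p u)"

abbreviation coprod :: "('o, 'm) cat \<Rightarrow> ('o, 'm, 'e, 'f) fibn \<Rightarrow> 'm \<Rightarrow> ('e, 'f, 'e, 'f) func" where
  "coprod B p u \<equiv> ladj (coprod_adj B p u)"

abbreviation prodt :: "('o, 'm) cat \<Rightarrow> ('o, 'm, 'e, 'f) fibn \<Rightarrow> 'm \<Rightarrow> ('e, 'f, 'e, 'f) func" where
  "prodt B p u \<equiv> radj (prod_adj B p u)"

text \<open>
  The Beck--Chevalley maps at \<open>\<beta>\<close> for a square \<open>v \<cdot> g = f \<cdot> u\<close> are the mates
  \<open>\<Coprod>\<^sub>u g\<^sup>*\<beta> \<rightarrow> \<Coprod>\<^sub>u g\<^sup>*v\<^sup>*\<Coprod>\<^sub>v \<beta> \<cong> \<Coprod>\<^sub>u u\<^sup>*f\<^sup>*\<Coprod>\<^sub>v \<beta> \<rightarrow> f\<^sup>*\<Coprod>\<^sub>v \<beta>\<close> and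
  \<open>f\<^sup>*\<Prod>\<^sub>v \<beta> \<rightarrow> \<Prod>\<^sub>u u\<^sup>*f\<^sup>*\<Prod>\<^sub>v \<beta> \<cong> \<Prod>\<^sub>u g\<^sup>*v\<^sup>*\<Prod>\<^sub>v \<beta> \<rightarrow> \<Prod>\<^sub>u g\<^sup>*\<beta>\<close>.
\<close>

definition bc_coprod ::
  "('o, 'm) cat \<Rightarrow> ('o, 'm, 'e, 'f) fibn \<Rightarrow> 'm \<Rightarrow> 'm \<Rightarrow> 'm \<Rightarrow> 'm \<Rightarrow> 'e \<Rightarrow> 'f" where
  "bc_coprod B p v f g u \<beta> =
     (let c = fobj (coprod B p v) \<beta> in
      acounit (coprod_adj B p u) (reindO B p f c) \<cdot>\<^bsub>Tot p\<^esub>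
      farr (coprod B p u)
        (vfill B p (Lift2 B p f u c) (Lift2 B p v g c) \<cdot>\<^bsub>Tot p\<^esub>
         reindA B p g (aunit (coprod_adj B p v) \<beta>)))"

definition bc_prod ::
  "('o, 'm) cat \<Rightarrow> ('o, 'm, 'e, 'f) fibn \<Rightarrow> 'm \<Rightarrow> 'm \<Rightarrow> 'm \<Rightarrow> 'm \<Rightarrow> 'e \<Rightarrow> 'f" where
  "bc_prod B p v f g u \<beta> =
     (let c = fobj (prodt B p v) \<beta> in
      farr (prodt B p u)
        (reindA B p g (acounit (prod_adj B p v) \<beta>) \<cdot>\<^bsub>Tot p\<^esub>
         vfill B p (Lift2 B p v g c) (Lift2 B p f u c)) \<cdot>\<^bsub>Tot p\<^esub>
      aunit (prod_adj B p u) (reindO B p f c))"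

definition has_coproducts :: "('o, 'm) cat \<Rightarrow> 'm set \<Rightarrow> ('o, 'm, 'e, 'f) fibn \<Rightarrow> bool" where
  "has_coproducts B F p \<longleftrightarrow>
     (\<forall>v \<in> F. \<exists>T. adjunction (fibre B p (Dom B v)) (fibre B p (Cod B v)) T \<and>
                  radj T = reindex B p v) \<and>
     (\<forall>v f g u. v \<in> F \<longrightarrow> u \<in> F \<longrightarrow> is_pullback B v f g u \<longrightarrow>
        (\<forall>\<beta> \<in> Obj (fibre B p (Dom B v)). iso (fibre B p (Dom B f)) (bc_coprod B p v f g u \<beta>)))"

definition has_products :: "('o, 'm) cat \<Rightarrow> 'm set \<Rightarrow> ('o, 'm, 'e, 'f) fibn \<Rightarrow> bool" where
  "has_products B F p \<longleftrightarrow>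
     (\<forall>v \<in> F. \<exists>T. adjunction (fibre B p (Cod B v)) (fibre B p (Dom B v)) T \<and>
                  ladj T = reindex B p v) \<and>
     (\<forall>v f g u. v \<in> F \<longrightarrow> u \<in> F \<longrightarrow> is_pullback B v f g u \<longrightarrow>
        (\<forall>\<beta> \<in> Obj (fibre B p (Dom B v)). iso (fibre B p (Dom B f)) (bc_prod B p v f g u \<beta>)))"


section \<open>Quantifier-free elements, Skolem and Goedel fibrations\<close>

definition sections :: "('o, 'm) cat \<Rightarrow> 'm \<Rightarrow> 'm set" where
  "sections B u = {g \<in> hom B (Cod B u) (Dom B u). u \<cdot>\<^bsub>B\<^esub> g = Ide B (Cod B u)}"

text \<open>For a section \<open>g\<close> of \<open>u\<close>, \<open>Lift2 B p u g c\<close> is vertical: it is the canonical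
  isomorphism \<open>g\<^sup>*u\<^sup>*c \<cong> c\<close>, with inverse \<open>vfill B p (Lift2 B p u g c) (Ide (Tot p) c)\<close>.\<close>

definition coprod_splitting ::
  "('o, 'm) cat \<Rightarrow> 'm set \<Rightarrow> ('o, 'm, 'e, 'f) fibn \<Rightarrow> 'e \<Rightarrow> bool" where
  "coprod_splitting B F p \<alpha> \<longleftrightarrow>
     (\<forall>u \<in> F. Cod B u = PObj p \<alpha> \<longrightarrow>
       (\<forall>\<beta> \<in> Obj (fibre B p (Dom B u)).
        \<forall>h \<in> hom (fibre B p (PObj p \<alpha>)) \<alpha> (fobj (coprod B p u) \<beta>).
        \<exists>!gk. case gk of (g, k) \<Rightarrow>
          g \<in> sections B u \<and>
          k \<in> hom (fibre B p (PObj p \<alpha>)) \<alpha> (reindO B p g \<beta>) \<and>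
          h = Lift2 B p u g (fobj (coprod B p u) \<beta>) \<cdot>\<^bsub>Tot p\<^esub>
              reindA B p g (aunit (coprod_adj B p u) \<beta>) \<cdot>\<^bsub>Tot p\<^esub> k))"

definition coprod_qf ::
  "('o, 'm) cat \<Rightarrow> 'm set \<Rightarrow> ('o, 'm, 'e, 'f) fibn \<Rightarrow> 'e \<Rightarrow> bool" where
  "coprod_qf B F p \<alpha> \<longleftrightarrow>
     (\<forall>f \<in> Arr B. Cod B f = PObj p \<alpha> \<longrightarrow> coprod_splitting B F p (reindO B p f \<alpha>))"

definition enough_coprod_qf ::
  "('o, 'm) cat \<Rightarrow> 'm set \<Rightarrow> ('o, 'm, 'e, 'f) fibn \<Rightarrow> bool" where
  "enough_coprod_qf B F p \<longleftrightarrow> has_coproducts B F p \<and>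
     (\<forall>\<alpha> \<in> Obj (Tot p). \<exists>f \<in> F. Cod B f = PObj p \<alpha> \<and>
        (\<exists>\<beta> \<in> Obj (fibre B p (Dom B f)). coprod_qf B F p \<beta> \<and>
           isomorphic (fibre B p (PObj p \<alpha>)) \<alpha> (fobj (coprod B p f) \<beta>)))"

definition prod_splitting ::
  "('o, 'm) cat \<Rightarrow> 'm set \<Rightarrow> ('o, 'm, 'e, 'f) fibn \<Rightarrow> 'e \<Rightarrow> bool" where
  "prod_splitting B F p \<alpha> \<longleftrightarrow>
     (\<forall>u \<in> F. Cod B u = PObj p \<alpha> \<longrightarrow>
       (\<forall>\<beta> \<in> Obj (fibre B p (Dom B u)).
        \<forall>h \<in> hom (fibre B p (PObj p \<alpha>)) (fobj (prodt B p u) \<beta>) \<alpha>.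
        \<exists>!gk. case gk of (g, k) \<Rightarrow>
          g \<in> sections B u \<and>
          k \<in> hom (fibre B p (PObj p \<alpha>)) (reindO B p g \<beta>) \<alpha> \<and>
          h = k \<cdot>\<^bsub>Tot p\<^esub> reindA B p g (acounit (prod_adj B p u) \<beta>) \<cdot>\<^bsub>Tot p\<^esub>
              vfill B p (Lift2 B p u g (fobj (prodt B p u) \<beta>))
                        (Ide (Tot p) (fobj (prodt B p u) \<beta>))))"

definition prod_qf ::
  "('o, 'm) cat \<Rightarrow> 'm set \<Rightarrow> ('o, 'm, 'e, 'f) fibn \<Rightarrow> 'e \<Rightarrow> bool" where
  "prod_qf B F p \<alpha> \<longleftrightarrow>
     (\<forall>f \<in> Arr B. Cod B f = PObj p \<alpha> \<longrightarrow> prod_splitting B F p (reindO B p f \<alpha>))"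

definition enough_prod_qf ::
  "('o, 'm) cat \<Rightarrow> 'm set \<Rightarrow> ('o, 'm, 'e, 'f) fibn \<Rightarrow> bool" where
  "enough_prod_qf B F p \<longleftrightarrow> has_products B F p \<and>
     (\<forall>\<alpha> \<in> Obj (Tot p). \<exists>f \<in> F. Cod B f = PObj p \<alpha> \<and>
        (\<exists>\<beta> \<in> Obj (fibre B p (Dom B f)). prod_qf B F p \<beta> \<and>
           isomorphic (fibre B p (PObj p \<alpha>)) \<alpha> (fobj (prodt B p f) \<beta>)))"

definition dependent_Skolem ::
  "('o, 'm) cat \<Rightarrow> 'm set \<Rightarrow> ('o, 'm, 'e, 'f) fibn \<Rightarrow> bool" where
  "dependent_Skolem B F p \<longleftrightarrow>
     has_dependent_products B F \<and> has_products B F p \<and> enough_coprod_qf B F p \<and>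
     (\<forall>f \<in> F. \<forall>\<alpha> \<in> Obj (fibre B p (Dom B f)).
        coprod_qf B F p \<alpha> \<longrightarrow> coprod_qf B F p (fobj (prodt B p f) \<alpha>))"

definition coprod_qf_sub ::
  "('o, 'm) cat \<Rightarrow> 'm set \<Rightarrow> ('o, 'm, 'e, 'f) fibn \<Rightarrow> ('o, 'm, 'e, 'f) fibn" where
  "coprod_qf_sub B F p = full_sub p (coprod_qf B F p)"

definition dependent_Goedel ::
  "('o, 'm) cat \<Rightarrow> 'm set \<Rightarrow> ('o, 'm, 'e, 'f) fibn \<Rightarrow> bool" where
  "dependent_Goedel B F p \<longleftrightarrow>
     dependent_Skolem B F p \<and> enough_prod_qf B F (coprod_qf_sub B F p)"

text \<open>
  Splitting for products is tested inside the subfibration of coproduct-quantifier-free elements,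
  as in the definition of a dependent Goedel fibration; it is not tested in \<open>p\<close> itself.
\<close>

definition qf_sub ::
  "('o, 'm) cat \<Rightarrow> 'm set \<Rightarrow> ('o, 'm, 'e, 'f) fibn \<Rightarrow> ('o, 'm, 'e, 'f) fibn" where
  "qf_sub B F p = full_sub (coprod_qf_sub B F p) (prod_qf B F (coprod_qf_sub B F p))"


section \<open>The completions and the Dialectica fibration\<close>

text \<open>
  An object \<open>(g : X \<rightarrow> I, \<alpha>)\<close> of either completion is the pair \<open>(g, \<alpha>)\<close>. A morphism carries its
  source and target, the base map \<open>f\<^sub>0\<close>, the map \<open>f\<^sub>1\<close> and the arrow \<open>\<phi>\<close>.
\<close>

datatype ('m, 'e, 'f) fam_arr =
  FamArr (src: "'m \<times> 'e") (tgt: "'m \<times> 'e") (bmap: 'm) (imap: 'm) (fmap: 'f)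

definition fam_obj :: "('o, 'm) cat \<Rightarrow> 'm set \<Rightarrow> ('o, 'm, 'e, 'f) fibn \<Rightarrow> ('m \<times> 'e) set" where
  "fam_obj B F p = {(g, \<alpha>). g \<in> F \<and> \<alpha> \<in> Obj (fibre B p (Dom B g))}"

definition Sigma_compl ::
  "('o, 'm) cat \<Rightarrow> 'm set \<Rightarrow> ('o, 'm, 'e, 'f) fibn \<Rightarrow>
   ('o, 'm, 'm \<times> 'e, ('m, 'e, 'f) fam_arr) fibn" where
  "Sigma_compl B F p =
     \<lparr>Tot =
        \<lparr>Obj = fam_obj B F p,
         Arr = {FamArr (g, \<alpha>) (h, \<beta>) f\<^sub>0 f\<^sub>1 \<phi> | g \<alpha> h \<beta> f\<^sub>0 f\<^sub>1 \<phi>.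
                  (g, \<alpha>) \<in> fam_obj B F p \<and> (h, \<beta>) \<in> fam_obj B F p \<and>
                  f\<^sub>0 \<in> hom B (Cod B g) (Cod B h) \<and> f\<^sub>1 \<in> hom B (Dom B g) (Dom B h) \<and>
                  h \<cdot>\<^bsub>B\<^esub> f\<^sub>1 = f\<^sub>0 \<cdot>\<^bsub>B\<^esub> g \<and> \<phi> \<in> hom (Tot p) \<alpha> \<beta> \<and> PArr p \<phi> = f\<^sub>1},
         Dom = src,
         Cod = tgt,
         Ide = (\<lambda>(g, \<alpha>). FamArr (g, \<alpha>) (g, \<alpha>) (Ide B (Cod B g)) (Ide B (Dom B g)) (Ide (Tot p) \<alpha>)),
         Comp = (\<lambda>n m. FamArr (src m) (tgt n) (bmap n \<cdot>\<^bsub>B\<^esub> bmap m) (imap n \<cdot>\<^bsub>B\<^esub> imap m)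
                         (fmap n \<cdot>\<^bsub>Tot p\<^esub> fmap m))\<rparr>,
      PObj = (\<lambda>(g, \<alpha>). Cod B g),
      PArr = bmap,
      Lift = (\<lambda>u (g, \<alpha>). FamArr (pb1 B u g, reindO B p (pb2 B u g) \<alpha>) (g, \<alpha>)
                u (pb2 B u g) (Lift p (pb2 B u g) \<alpha>))\<rparr>"

text \<open>For vertical \<open>\<phi> : s\<^sup>*\<alpha> \<rightarrow> t\<^sup>*\<beta>\<close>, the composite
  \<open>(s \<cdot> r)\<^sup>*\<alpha> \<cong> r\<^sup>*s\<^sup>*\<alpha> \<rightarrow> r\<^sup>*t\<^sup>*\<beta> \<cong> (t \<cdot> r)\<^sup>*\<beta>\<close> whose middle arrow is \<open>r\<^sup>*\<phi>\<close>.\<close>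

definition restr ::
  "('o, 'm) cat \<Rightarrow> ('o, 'm, 'e, 'f) fibn \<Rightarrow> 'm \<Rightarrow> 'e \<Rightarrow> 'm \<Rightarrow> 'e \<Rightarrow> 'm \<Rightarrow> 'f \<Rightarrow> 'f" where
  "restr B p s \<alpha> t \<beta> r \<phi> =
     vfill B p (Lift p (t \<cdot>\<^bsub>B\<^esub> r) \<beta>) (Lift2 B p t r \<beta>) \<cdot>\<^bsub>Tot p\<^esub>
     reindA B p r \<phi> \<cdot>\<^bsub>Tot p\<^esub>
     vfill B p (Lift2 B p s r \<alpha>) (Lift p (s \<cdot>\<^bsub>B\<^esub> r) \<alpha>)"

text \<open>
  Composition in the product completion. For \<open>m : (X \<rightarrow> I, \<alpha>) \<rightarrow> (Y \<rightarrow> J, \<beta>)\<close> and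
  \<open>n : (Y \<rightarrow> J, \<beta>) \<rightarrow> (Z \<rightarrow> K, \<gamma>)\<close> let \<open>q : I \<times>\<^sub>K Z \<rightarrow> J \<times>\<^sub>K Z\<close> be the evident map and
  \<open>r : I \<times>\<^sub>K Z \<rightarrow> I \<times>\<^sub>J Y\<close> be induced by \<open>n\<^sub>1 \<cdot> q\<close>. The composite is given by
  \<open>m\<^sub>1 \<cdot> r : I \<times>\<^sub>K Z \<rightarrow> X\<close> and the composite of the restrictions of the fibre parts along \<open>r\<close>, \<open>q\<close>.
\<close>

definition Pi_comp ::
  "('o, 'm) cat \<Rightarrow> ('o, 'm, 'e, 'f) fibn \<Rightarrow>
   ('m, 'e, 'f) fam_arr \<Rightarrow> ('m, 'e, 'f) fam_arr \<Rightarrow> ('m, 'e, 'f) fam_arr" where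
  "Pi_comp B p n m =
     (let \<alpha> = snd (src m); (h, \<beta>) = tgt m; (k, \<gamma>) = tgt n;
          b = bmap n \<cdot>\<^bsub>B\<^esub> bmap m;
          q = pb_pair B (bmap n) k (bmap m \<cdot>\<^bsub>B\<^esub> pb1 B b k) (pb2 B b k);
          r = pb_pair B (bmap m) h (pb1 B b k) (imap n \<cdot>\<^bsub>B\<^esub> q)
      in FamArr (src m) (tgt n) b (imap m \<cdot>\<^bsub>B\<^esub> r)
           (restr B p (imap n) \<beta> (pb2 B (bmap n) k) \<gamma> q (fmap n) \<cdot>\<^bsub>Tot p\<^esub>
            restr B p (imap m) \<alpha> (pb2 B (bmap m) h) \<beta> r (fmap m)))"

definition Pi_compl ::
  "('o, 'm) cat \<Rightarrow> 'm set \<Rightarrow> ('o, 'm, 'e, 'f) fibn \<Rightarrow>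
   ('o, 'm, 'm \<times> 'e, ('m, 'e, 'f) fam_arr) fibn" where
  "Pi_compl B F p =
     \<lparr>Tot =
        \<lparr>Obj = fam_obj B F p,
         Arr = {FamArr (g, \<alpha>) (h, \<beta>) f\<^sub>0 f\<^sub>1 \<phi> | g \<alpha> h \<beta> f\<^sub>0 f\<^sub>1 \<phi>.
                  (g, \<alpha>) \<in> fam_obj B F p \<and> (h, \<beta>) \<in> fam_obj B F p \<and>
                  f\<^sub>0 \<in> hom B (Cod B g) (Cod B h) \<and>
                  f\<^sub>1 \<in> hom B (Dom B (pb1 B f\<^sub>0 h)) (Dom B g) \<and> g \<cdot>\<^bsub>B\<^esub> f\<^sub>1 = pb1 B f\<^sub>0 h \<and>
                  \<phi> \<in> hom (fibre B p (Dom B (pb1 B f\<^sub>0 h)))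
                        (reindO B p f\<^sub>1 \<alpha>) (reindO B p (pb2 B f\<^sub>0 h) \<beta>)},
         Dom = src,
         Cod = tgt,
         Ide = (\<lambda>(g, \<alpha>). let b = Ide B (Cod B g); x = pb2 B b g in
                  FamArr (g, \<alpha>) (g, \<alpha>) b x (Ide (Tot p) (reindO B p x \<alpha>))),
         Comp = Pi_comp B p\<rparr>,
      PObj = (\<lambda>(g, \<alpha>). Cod B g),
      PArr = bmap,
      Lift = (\<lambda>u (g, \<alpha>). let \<alpha>' = reindO B p (pb2 B u g) \<alpha>; i = Ide B (Dom B (pb1 B u g)) in
                FamArr (pb1 B u g, \<alpha>') (g, \<alpha>) u i (Lift p i \<alpha>'))\<rparr>"

definition Dial ::
  "('o, 'm) cat \<Rightarrow> 'm set \<Rightarrow> ('o, 'm, 'e, 'f) fibn \<Rightarrow>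
   ('o, 'm, 'm \<times> 'm \<times> 'e, ('m, 'm \<times> 'e, ('m, 'e, 'f) fam_arr) fam_arr) fibn" where
  "Dial B F p = Sigma_compl B F (Pi_compl B F p)"

end

theory Submission
  imports Defs
begin

text \<open>
  Coproducts are determined by opcartesian arrows and products by cones \<open>c \<leftarrow> M \<rightarrow> \<beta>\<close> of a cartesian and a vertical arrow,
  so quantifier splitting becomes a unique lifting property that mentions neither the chosen adjoints nor the cleavage.

  If \<open>p\<close> is a Goedel fibration, let \<open>s\<close> be its coproduct-quantifier-free part and \<open>t\<close> the product-quantifier-free part of \<open>s\<close>.
  Sending a family \<open>(g, a)\<close> to the product of \<open>a\<close> along \<open>g\<close> is a functor from the product completion of \<open>t\<close> to \<open>s\<close>. It is full and
  faithful because a map from a product of \<open>a\<close> to a component \<open>b\<close> of the target product splits uniquely when \<open>b\<close> is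
  quantifier-free, and essentially surjective since \<open>s\<close> has enough such elements. The same argument with coproducts in place of
  products identifies the coproduct completion of \<open>s\<close> with \<open>p\<close>.

  Conversely let \<open>p\<close> be the coproduct completion of the product completion \<open>r\<close> of \<open>p'\<close>. The families indexed by identities embed
  \<open>r\<close> into \<open>p\<close>, and up to isomorphism their images are exactly the coproduct-quantifier-free elements. Every element is a
  coproduct of such images, so a product formed in \<open>r\<close> is still a product in \<open>p\<close>. Finally \<open>r\<close> has products given by composition
  of indexing maps, and its product-quantifier-free elements include the families indexed by isomorphisms, which suffice.
\<close>

abbreviation ccomp :: "'a => ('o, 'a) cat => 'a => 'a"  ("_ \<cdot>\<^sub>_ _" [70, 1000, 71] 70) where
  "g \<cdot>\<^sub>C f \<equiv> g \<cdot>\<^bsub>C\<^esub> f"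

abbreviation tcomp :: "'f => ('o, 'm, 'e, 'f) fibn => 'f => 'f"  ("_ \<odot>\<^sub>_ _" [70, 1000, 71] 70) where
  "g \<odot>\<^sub>p f \<equiv> g \<cdot>\<^sub>(Tot p) f"

definition hm :: "('o, 'm, 'e, 'f) fibn => 'm => 'e => 'e => 'f set" where
  "hm p u a b = {f \<in> Arr (Tot p). Dom (Tot p) f = a \<and> Cod (Tot p) f = b \<and> PArr p f = u}"

definition chm :: "('o, 'm) cat => ('o, 'm, 'e, 'f) fibn => 'm => 'e => 'e => 'f set" where
  "chm B p u a b = {f \<in> hm p u a b. cartesian B p f}"

abbreviation vhm :: "('o, 'm) cat => ('o, 'm, 'e, 'f) fibn => 'e => 'e => 'f set" where
  "vhm B p a b \<equiv> hm p (Ide B (PObj p a)) a b"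

definition viso :: "('o, 'm) cat => ('o, 'm, 'e, 'f) fibn => 'e => 'e => 'f => 'f => bool" where
  "viso B p a b j j' \<longleftrightarrow> j \<in> vhm B p a b \<and> j' \<in> vhm B p b a \<and>
     j' \<odot>\<^sub>p j = Ide (Tot p) a \<and> j \<odot>\<^sub>p j' = Ide (Tot p) b"

locale cat =
  fixes C :: "('o, 'a) cat" (structure)
  assumes category: "category C"
begin

lemma dom_obj [simp]: "f \<in> Arr C ==> Dom C f \<in> Obj C"
  and cod_obj [simp]: "f \<in> Arr C ==> Cod C f \<in> Obj C"
  and ide_arr [simp]: "a \<in> Obj C ==> Ide C a \<in> Arr C"
  and ide_dom [simp]: "a \<in> Obj C ==> Dom C (Ide C a) = a"
  and ide_cod [simp]: "a \<in> Obj C ==> Cod C (Ide C a) = a"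
  using category unfolding category_def hom_def by blast+

lemma comp_arr [simp]: "f \<in> Arr C ==> g \<in> Arr C ==> Cod C f = Dom C g ==> g \<cdot> f \<in> Arr C"
  and comp_dom [simp]: "f \<in> Arr C ==> g \<in> Arr C ==> Cod C f = Dom C g ==> Dom C (g \<cdot> f) = Dom C f"
  and comp_cod [simp]: "f \<in> Arr C ==> g \<in> Arr C ==> Cod C f = Dom C g ==> Cod C (g \<cdot> f) = Cod C g"
  using category unfolding category_def hom_def by blast+

lemma ide_l [simp]: "f \<in> Arr C ==> Cod C f = a ==> Ide C a \<cdot> f = f"
  and ide_r [simp]: "f \<in> Arr C ==> Dom C f = a ==> f \<cdot> Ide C a = f"
  using category unfolding category_def by blast+

lemma assoc [simp]:
  "f \<in> Arr C ==> g \<in> Arr C ==> h \<in> Arr C ==> Cod C f = Dom C g ==> Cod C g = Dom C h ==>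
     (h \<cdot> g) \<cdot> f = h \<cdot> (g \<cdot> f)"
  using category unfolding category_def by metis

lemma pre:
  "a \<cdot> b = c ==> a \<in> Arr C ==> b \<in> Arr C ==> Cod C b = Dom C a ==> t \<in> Arr C ==> Cod C t = Dom C b ==>
     a \<cdot> (b \<cdot> t) = c \<cdot> t"
  using assoc by metis

end

lemma hom_iff: "f \<in> hom C a b \<longleftrightarrow> f \<in> Arr C \<and> Dom C f = a \<and> Cod C f = b"
  by (auto simp: hom_def)

lemma fibre_simps [simp]:
  "Obj (fibre B p A) = {\<alpha> \<in> Obj (Tot p). PObj p \<alpha> = A}"
  "Arr (fibre B p A) = {\<phi> \<in> Arr (Tot p). PArr p \<phi> = Ide B A}"
  "Dom (fibre B p A) = Dom (Tot p)" "Cod (fibre B p A) = Cod (Tot p)"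
  "Ide (fibre B p A) = Ide (Tot p)" "Comp (fibre B p A) = Comp (Tot p)"
  by (simp_all add: fibre_def)

lemma hom_fibre: "hom (fibre B p A) a b = hm p (Ide B A) a b"
  by (auto simp: hom_def hm_def)

lemma fibrationI:
  assumes B: "category B"
    and H: "\<And>m u x y. m \<in> hm q u x y ==> x \<in> Obj (Tot q) \<and> y \<in> Obj (Tot q) \<and> u \<in> Arr B \<and> Dom B u = PObj q x \<and> Cod B u = PObj q y"
    and I: "\<And>x. x \<in> Obj (Tot q) ==> PObj q x \<in> Obj B \<and> Ide (Tot q) x \<in> hm q (Ide B (PObj q x)) x x"
    and U: "\<And>m u x y. m \<in> hm q u x y ==> Ide (Tot q) y \<odot>\<^sub>q m = m \<and> m \<odot>\<^sub>q Ide (Tot q) x = m"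
    and C: "\<And>m n u v x y z. m \<in> hm q u x y ==> n \<in> hm q v y z ==> n \<odot>\<^sub>q m \<in> hm q (v \<cdot>\<^sub>B u) x z"
    and A: "\<And>m n l u v w x y z t. m \<in> hm q u x y ==> n \<in> hm q v y z ==> l \<in> hm q w z t ==> l \<odot>\<^sub>q (n \<odot>\<^sub>q m) = l \<odot>\<^sub>q n \<odot>\<^sub>q m"
    and L: "\<And>u x. u \<in> Arr B ==> x \<in> Obj (Tot q) ==> PObj q x = Cod B u ==> \<exists>y. Lift q u x \<in> hm q u y x \<and>
      (\<forall>m w z. m \<in> hm q (u \<cdot>\<^sub>B w) z x --> w \<in> Arr B --> Dom B w = PObj q z --> Cod B w = Dom B u --> (\<exists>n. n \<in> hm q w z y \<and> Lift q u x \<odot>\<^sub>q n = m)) \<and>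
      (\<forall>n n' w z. n \<in> hm q w z y --> n' \<in> hm q w z y --> Lift q u x \<odot>\<^sub>q n = Lift q u x \<odot>\<^sub>q n' --> n = n')"
  shows "fibration B q"
proof -
  have h: "m \<in> hm q (PArr q m) (Dom (Tot q) m) (Cod (Tot q) m)" if "m \<in> Arr (Tot q)" for m using that by (simp add: hm_def)
  have hom: "m \<in> hom (Tot q) x y \<and> PArr q m = u \<longleftrightarrow> m \<in> hm q u x y" for m u x y by (auto simp: hm_def hom_def)
  have ch: "n \<odot>\<^sub>q m \<in> hm q (PArr q n \<cdot>\<^sub>B PArr q m) (Dom (Tot q) m) (Cod (Tot q) n)"
    if "m \<in> Arr (Tot q)" "n \<in> Arr (Tot q)" "Cod (Tot q) m = Dom (Tot q) n" for m n using C[OF h[OF that(1)] h[OF that(2), folded that(3)]] .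
  have "category (Tot q)" unfolding category_def
    using H[OF h] I U[OF h] ch A[OF h] h by (auto simp: hom[symmetric] hom_def)
  moreover have "is_functor (Tot q) B \<lparr>fobj = PObj q, farr = PArr q\<rparr>"
    unfolding is_functor_def using H[OF h] I ch by (auto simp: hom_def hm_def)
  moreover have "Cod (Tot q) (Lift q u x) = x \<and> PArr q (Lift q u x) = u \<and> cartesian B q (Lift q u x)"
    if ux: "u \<in> Arr B" "x \<in> Obj (Tot q)" "PObj q x = Cod B u" for u x
  proof -
    obtain y where y: "Lift q u x \<in> hm q u y x"
      and ex: "\<And>m w z. m \<in> hm q (u \<cdot>\<^sub>B w) z x ==> w \<in> Arr B ==> Dom B w = PObj q z ==> Cod B w = Dom B u ==> \<exists>n. n \<in> hm q w z y \<and> Lift q u x \<odot>\<^sub>q n = m"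
      and un: "\<And>n n' w z. n \<in> hm q w z y ==> n' \<in> hm q w z y ==> Lift q u x \<odot>\<^sub>q n = Lift q u x \<odot>\<^sub>q n' ==> n = n'" using L[OF ux] by blast
    have D: "Lift q u x \<in> Arr (Tot q)" "Dom (Tot q) (Lift q u x) = y" "Cod (Tot q) (Lift q u x) = x" "PArr q (Lift q u x) = u" "Dom B u = PObj q y"
      using y H[OF y] by (auto simp: hm_def)
    have "\<exists>!n. n \<in> hom (Tot q) (Dom (Tot q) m) y \<and> PArr q n = w \<and> Lift q u x \<odot>\<^sub>q n = m"
      if m: "m \<in> Arr (Tot q)" "Cod (Tot q) m = x" "PArr q m = u \<cdot>\<^sub>B w" and w: "w \<in> hom B (PObj q (Dom (Tot q) m)) (PObj q y)" for m w
    proof -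
      have "\<exists>n. n \<in> hm q w (Dom (Tot q) m) y \<and> Lift q u x \<odot>\<^sub>q n = m"
        by (rule ex) (use h[OF m(1)] m w D in \<open>auto simp: hom_def\<close>)
      thus ?thesis unfolding conj_assoc[symmetric] hom using un by blast
    qed
    thus ?thesis using D unfolding cartesian_def by simp
  qed
  ultimately show ?thesis using B unfolding fibration_def by blast
qed

locale fib =
  fixes B :: "('o, 'm) cat" (structure) and p :: "('o, 'm, 'e, 'f) fibn"
  assumes fib: "fibration B p"

sublocale fib \<subseteq> B: cat B
  by unfold_locales (use fib in \<open>simp add: fibration_def\<close>)
sublocale fib \<subseteq> E: cat "Tot p"
  by unfold_locales (use fib in \<open>simp add: fibration_def\<close>)

context fib
begin

abbreviation "Ob \<equiv> Obj (Tot p)"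
abbreviation "idt \<equiv> Ide (Tot p)"
abbreviation "Car \<equiv> chm B p"
abbreviation "Ver \<equiv> vhm B p"
abbreviation "Iso \<equiv> viso B p"
abbreviation "pull \<equiv> reindO B p"
abbreviation "ob \<equiv> PObj p"
abbreviation "pbk \<equiv> is_pullback B"
abbreviation "dm \<equiv> Dom (Tot p)"
abbreviation "cd \<equiv> Cod (Tot p)"
abbreviation "lft \<equiv> Lift p"
abbreviation lcomp (infixl "\<odot>" 70) where "g \<odot> f \<equiv> g \<odot>\<^sub>p f"

lemma parr [simp]: "f \<in> Arr (Tot p) ==> PArr p f \<in> Arr B"
  and pobj [simp]: "a \<in> Ob ==> ob a \<in> Obj B"
  and parr_dom [simp]: "f \<in> Arr (Tot p) ==> Dom B (PArr p f) = ob (dm f)"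
  and parr_cod [simp]: "f \<in> Arr (Tot p) ==> Cod B (PArr p f) = ob (cd f)"
  and parr_ide [simp]: "a \<in> Ob ==> PArr p (idt a) = Ide B (ob a)"
  and parr_comp [simp]: "f \<in> Arr (Tot p) ==> g \<in> Arr (Tot p) ==> cd f = dm g ==>
        PArr p (g \<odot> f) = PArr p g \<cdot> PArr p f"
  using fib unfolding fibration_def is_functor_def by (auto simp: hom_def)

lemma hmD:
  "f \<in> hm p u a b ==> f \<in> Arr (Tot p) \<and> dm f = a \<and> cd f = b \<and> PArr p f = u \<and>
     a \<in> Ob \<and> b \<in> Ob \<and> u \<in> Arr B \<and> Dom B u = ob a \<and> Cod B u = ob b"
  unfolding hm_def by auto

lemma hmI: "f \<in> Arr (Tot p) ==> dm f = a ==> cd f = b ==> PArr p f = u ==> f \<in> hm p u a b"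
  by (simp add: hm_def)

lemma vhmD: "f \<in> Ver a b ==> ob b = ob a"
  using hmD by (metis B.ide_cod pobj)

lemma comp_hm: assumes f: "f \<in> hm p u a b" and g: "g \<in> hm p v b c" shows "g \<odot> f \<in> hm p (v \<cdot> u) a c"
  using hmD[OF f] hmD[OF g] by (simp add: hm_def)

lemma comp_vr: assumes f: "f \<in> Ver a b" and g: "g \<in> hm p v b c" shows "g \<odot> f \<in> hm p v a c"
  using hmD[OF f] hmD[OF g] vhmD[OF f] by (simp add: hm_def)

lemma comp_vl: assumes f: "f \<in> hm p v a b" and g: "g \<in> Ver b c" shows "g \<odot> f \<in> hm p v a c"
  using hmD[OF f] hmD[OF g] vhmD[OF g] by (simp add: hm_def)

lemma ide_hm [simp]: "a \<in> Ob ==> idt a \<in> Ver a a"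
  by (simp add: hm_def)

lemma ac:
  assumes f: "f \<in> hm p u a b" and g: "g \<in> hm p v b c" and h: "h \<in> hm p w c d"
  shows "h \<odot> g \<odot> f = h \<odot> (g \<odot> f)"
  using hmD[OF f] hmD[OF g] hmD[OF h] by simp

lemma idl: "f \<in> hm p u a b ==> idt b \<odot> f = f"
  and idr: "f \<in> hm p u a b ==> f \<odot> idt a = f"
  by (auto dest!: hmD)

lemma chmD: "c \<in> Car u a b ==> c \<in> hm p u a b"
  and chm_cart: "c \<in> Car u a b ==> cartesian B p c"
  by (simp_all add: chm_def)

lemma cart_ex1:
  assumes "c \<in> Car u b a" "k \<in> hm p v d a" "w \<in> Arr B" "Dom B w = ob d" "Cod B w = ob b"
    "v = u \<cdot> w"
  shows "\<exists>!x. x \<in> hm p w d b \<and> c \<odot> x = k"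
proof -
  note [simp] = hmD[OF chmD[OF assms(1)]] hmD[OF assms(2)]
  have "cartesian B p c" using assms by (simp add: chm_def)
  moreover have "w \<in> hom B (ob (dm k)) (ob (dm c))"
    using assms by (simp add: hom_def)
  ultimately have "\<exists>!x. x \<in> hom (Tot p) (dm k) (dm c) \<and> PArr p x = w \<and> c \<odot> x = k"
    using assms(6) unfolding cartesian_def by (metis (no_types, lifting) hmD assms(2) chmD assms(1))
  thus ?thesis by (simp add: hom_def hm_def conj_ac)
qed

lemma cart_fill:
  assumes "c \<in> Car u b a" "k \<in> hm p v d a" "w \<in> Arr B" "Dom B w = ob d" "Cod B w = ob b"
    "v = u \<cdot> w"
  obtains x where "x \<in> hm p w d b" "c \<odot> x = k"
  using cart_ex1[OF assms] by blast

lemma cart_vfill: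
  assumes "c \<in> Car u b a" "k \<in> hm p u d a"
  obtains x where "x \<in> Ver d b" "c \<odot> x = k"
  by (rule cart_fill[OF assms, of "Ide B (ob d)"])
    (use hmD[OF assms(2)] hmD[OF chmD[OF assms(1)]] that in simp_all)

lemma cart_eq:
  assumes "c \<in> Car u b a" "x \<in> hm p w d b" "y \<in> hm p w d b" "c \<odot> x = c \<odot> y"
  shows "x = y"
  using cart_ex1[OF assms(1) comp_hm[OF assms(2) chmD[OF assms(1)]], of w] hmD[OF assms(2)] assms by auto

lemma cartI:
  assumes "c \<in> hm p u b a"
    and "\<And>d v k w. k \<in> hm p v d a ==> w \<in> Arr B ==> Dom B w = ob d ==> Cod B w = ob b ==> v = u \<cdot> w ==>
       \<exists>!x. x \<in> hm p w d b \<and> c \<odot> x = k"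
  shows "c \<in> Car u b a"
proof -
  note [simp] = hmD[OF assms(1)]
  have "\<exists>!x. x \<in> hom (Tot p) (dm k) (dm c) \<and> PArr p x = w \<and> c \<odot> x = k"
    if "k \<in> Arr (Tot p)" "w \<in> hom B (ob (dm k)) (ob (dm c))"
      "cd k = cd c" "PArr p k = PArr p c \<cdot> w" for k w
    using assms(2)[of k "PArr p k" "dm k" w] that by (simp add: hm_def hom_def conj_ac)
  thus ?thesis using assms(1) by (simp add: chm_def cartesian_def)
qed

lemma cart_comp:
  assumes c: "c \<in> Car u b a" and d: "d \<in> Car v e b"
  shows "c \<odot> d \<in> Car (u \<cdot> v) e a"
proof (rule cartI)
  note [simp] = hmD[OF chmD[OF c]] hmD[OF chmD[OF d]]
  show "c \<odot> d \<in> hm p (u \<cdot> v) e a" by (simp add: hm_def)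
  fix f v' k w assume k: "k \<in> hm p v' f a" and w: "w \<in> Arr B" "Dom B w = ob f" "Cod B w = ob e"
    and v': "v' = u \<cdot> v \<cdot> w"
  note [simp] = hmD[OF k] w
  obtain x where x: "x \<in> hm p (v \<cdot> w) f b" "c \<odot> x = k" using cart_fill[OF c k, of "v \<cdot> w"] v' by auto
  obtain y where y: "y \<in> hm p w f e" "d \<odot> y = x" using cart_fill[OF d x(1), of w] by auto
  note [simp] = hmD[OF x(1)] hmD[OF y(1)]
  show "\<exists>!x. x \<in> hm p w f e \<and> c \<odot> d \<odot> x = k"
  proof (rule ex1I[of _ y])
    show "y \<in> hm p w f e \<and> c \<odot> d \<odot> y = k" using x y by simp
    fix z assume z: "z \<in> hm p w f e \<and> c \<odot> d \<odot> z = k"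
    note [simp] = hmD[OF conjunct1[OF z]]
    have "d \<odot> z \<in> hm p (v \<cdot> w) f b" by (simp add: hm_def)
    moreover have "c \<odot> (d \<odot> z) = c \<odot> (d \<odot> y)" using z x y by simp
    ultimately have "d \<odot> z = d \<odot> y" using cart_eq[OF c] x(1) y(2) by blast
    thus "z = y" using cart_eq[OF d] z y by blast
  qed
qed

lemma cart_cancel:
  assumes c: "c \<in> Car u b a" and d: "d \<in> hm p v e b" and cd: "c \<odot> d \<in> Car w e a"
  shows "d \<in> Car v e b"
proof (rule cartI[OF d])
  have w: "w = u \<cdot> v" using hmD[OF chmD[OF cd]] comp_hm[OF d chmD[OF c]] by (auto simp: hm_def)
  note [simp] = hmD[OF chmD[OF c]] hmD[OF d] hmD[OF chmD[OF cd]]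
  fix f v' k t assume k: "k \<in> hm p v' f b" and t: "t \<in> Arr B" "Dom B t = ob f" "Cod B t = ob e"
    and v': "v' = v \<cdot> t"
  note [simp] = hmD[OF k] t
  have ck: "c \<odot> k \<in> hm p (u \<cdot> (v \<cdot> t)) f a" using v' by (simp add: hm_def)
  obtain x where x: "x \<in> hm p t f e" "c \<odot> d \<odot> x = c \<odot> k"
    using cart_fill[OF cd ck, of t] w by auto
  note [simp] = hmD[OF x(1)]
  have "d \<odot> x = k" using cart_eq[OF c comp_hm[OF x(1) d] k[unfolded v']] x(2) by simp
  moreover have "z = x" if z: "z \<in> hm p t f e" "d \<odot> z = k" for z
  proof -
    note [simp] = hmD[OF z(1)]
    show ?thesis using cart_eq[OF cd z(1) x(1)] x(2) z(2) by simp
  qed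
  ultimately show "\<exists>!x. x \<in> hm p t f e \<and> d \<odot> x = k" using x(1) by blast
qed

lemma lift_chm:
  "u \<in> Arr B ==> a \<in> Ob ==> ob a = Cod B u ==> lft u a \<in> Car u (pull u a) a"
  using fib by (auto simp: fibration_def chm_def hm_def reindex_def cartesian_def)

lemma lift_hm:
  "u \<in> Arr B ==> a \<in> Ob ==> ob a = Cod B u ==> lft u a \<in> hm p u (pull u a) a"
  by (simp add: chmD lift_chm)

lemma visoD:
  "Iso a b j j' ==> j \<in> Ver a b \<and> j' \<in> Ver b a \<and> j' \<odot> j = idt a \<and> j \<odot> j' = idt b"
  by (simp add: viso_def)

lemma viso_sym: "Iso a b j j' ==> Iso b a j' j"
  by (simp add: viso_def)

lemma viso_ide: "a \<in> Ob ==> Iso a a (idt a) (idt a)"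
  by (simp add: viso_def)

lemma viso_comp:
  assumes "Iso a b j j'" "Iso b c k k'"
  shows "Iso a c (k \<odot> j) (j' \<odot> k')"
proof -
  have j: "j \<in> Ver a b" "j' \<in> Ver b a" "k \<in> Ver b c" "k' \<in> Ver c b"
    using assms by (auto simp: viso_def)
  note [simp] = hmD[OF j(1)] hmD[OF j(2)] hmD[OF j(3)] hmD[OF j(4)] vhmD[OF j(1)] vhmD[OF j(3)]
  have e: "j' \<odot> j = idt a" "j \<odot> j' = idt b" "k' \<odot> k = idt b" "k \<odot> k' = idt c"
    using assms by (auto simp: viso_def)
  show ?thesis unfolding viso_def by (simp add: hm_def e E.pre[OF e(2)] E.pre[OF e(3)])
qed

lemma viso_cart:
  assumes "Iso a b j j'"
  shows "j \<in> Car (Ide B (ob a)) a b"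
proof (rule cartI)
  have j: "j \<in> Ver a b" "j' \<in> Ver b a" using assms by (auto simp: viso_def)
  show "j \<in> Ver a b" by fact
  note [simp] = hmD[OF j(1)] hmD[OF j(2)] vhmD[OF j(1)]
  have e: "j' \<odot> j = idt a" "j \<odot> j' = idt b" using assms by (auto simp: viso_def)
  fix d v k w assume k: "k \<in> hm p v d b" and w: "w \<in> Arr B" "Dom B w = ob d" "Cod B w = ob a"
    and v: "v = Ide B (ob a) \<cdot> w"
  note [simp] = hmD[OF k] w
  have vw: "v = w" using v by simp
  show "\<exists>!x. x \<in> hm p w d a \<and> j \<odot> x = k"
  proof (rule ex1I[of _ "j' \<odot> k"])
    show "j' \<odot> k \<in> hm p w d a \<and> j \<odot> (j' \<odot> k) = k" by (simp add: hm_def vw E.pre[OF e(2)])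
    fix x assume x: "x \<in> hm p w d a \<and> j \<odot> x = k"
    note [simp] = hmD[OF conjunct1[OF x]]
    show "x = j' \<odot> k" using x E.pre[OF e(1), of x] by simp
  qed
qed

lemma cart_viso:
  assumes c: "c \<in> Car u b a" and d: "d \<in> Car u b' a"
  obtains j j' where "Iso b b' j j'" "d \<odot> j = c" "c \<odot> j' = d"
proof -
  note [simp] = hmD[OF chmD[OF c]] hmD[OF chmD[OF d]]
  obtain j where j: "j \<in> Ver b b'" "d \<odot> j = c" using cart_vfill[OF d chmD[OF c]] by blast
  obtain j' where j': "j' \<in> Ver b' b" "c \<odot> j' = d" using cart_vfill[OF c chmD[OF d]] by blast
  have "j' \<odot> j = idt b"
    using cart_eq[OF c comp_vl[OF j(1) j'(1)] ide_hm] ac[OF j(1) j'(1) chmD[OF c]] j j' by simp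
  moreover have "j \<odot> j' = idt b'"
    using cart_eq[OF d comp_vl[OF j'(1) j(1)] ide_hm] ac[OF j'(1) j(1) chmD[OF d]] j j' by simp
  ultimately show ?thesis using j j' that by (simp add: viso_def)
qed

lemma vcart_viso:
  assumes c: "c \<in> Car (Ide B (ob a)) a b"
  obtains c' where "Iso a b c c'"
proof -
  note [simp] = hmD[OF chmD[OF c]] vhmD[OF chmD[OF c]]
  have i: "idt b \<in> Car (Ide B (ob a)) b b" using viso_cart[OF viso_ide, of b] by simp
  show ?thesis using cart_viso[OF c i] that hmD visoD idl by (metis)
qed

lemma isomorphic_fibre:
  assumes "a \<in> Ob"
  shows "isomorphic (fibre B p (ob a)) a b \<longleftrightarrow> (\<exists>j j'. Iso a b j j')"
proof
  assume "isomorphic (fibre B p (ob a)) a b"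
  then obtain f where f: "f \<in> Ver a b" "iso (fibre B p (ob a)) f"
    by (auto simp: isomorphic_def hom_fibre)
  thus "\<exists>j j'. Iso a b j j'" using vhmD[OF f(1)] hmD[OF f(1)] unfolding iso_def viso_def by (auto simp: hom_fibre)
next
  assume "\<exists>j j'. Iso a b j j'"
  then obtain j j' where j: "Iso a b j j'" by blast
  note [simp] = hmD[OF conjunct1[OF visoD[OF j]]] vhmD[OF conjunct1[OF visoD[OF j]]]
  have "iso (fibre B p (ob a)) j" unfolding iso_def using visoD[OF j] by (auto simp: hom_fibre)
  thus "isomorphic (fibre B p (ob a)) a b" using visoD[OF j] by (auto simp: isomorphic_def hom_fibre)
qed

lemma iso_fibre_viso:
  assumes "f \<in> Ver a b"
  shows "iso (fibre B p (ob a)) f \<longleftrightarrow> (\<exists>f'. Iso a b f f')"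
  using hmD[OF assms] vhmD[OF assms] assms unfolding iso_def viso_def by (auto simp: hom_fibre)

lemma vfill_ex1:
  assumes "c \<in> Car u b a" "k \<in> hm p u d a"
  shows "vfill B p c k \<in> Ver d b \<and> c \<odot> vfill B p c k = k"
proof -
  note [simp] = hmD[OF chmD[OF assms(1)]] hmD[OF assms(2)]
  have [simp]: "ob d = ob b" using hmD[OF chmD[OF assms(1)]] hmD[OF assms(2)] by simp
  have "\<exists>!x. x \<in> hom (fibre B p (ob (dm k))) (dm k) (dm c) \<and> c \<odot> x = k"
    using cart_ex1[OF assms, of "Ide B (ob d)"] by (simp add: hom_fibre)
  from theI'[OF this] show ?thesis unfolding vfill_def by (simp add: hom_fibre)
qed

lemma reind_obj:
  assumes "u \<in> Arr B" "a \<in> Ob" "ob a = Cod B u"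
  shows "pull u a \<in> Ob" "ob (pull u a) = Dom B u"
  using hmD[OF lift_hm[OF assms]] by auto

lemma reindA:
  assumes "u \<in> Arr B" "ob a = Cod B u" "f \<in> Ver a b"
  shows "reindA B p u f \<in> Ver (pull u a) (pull u b)"
    "lft u b \<odot> reindA B p u f = f \<odot> lft u a"
proof -
  note [simp] = hmD[OF assms(3)] vhmD[OF assms(3)] assms
  have "f \<odot> lft u a \<in> hm p u (pull u a) b"
    by (rule comp_vl[OF lift_hm]) (use assms in auto)
  from vfill_ex1[OF lift_chm this] show
    "reindA B p u f \<in> Ver (pull u a) (pull u b)"
    "lft u b \<odot> reindA B p u f = f \<odot> lft u a"
    by (simp_all add: reindex_def)
qed

lemma reindA_ide:
  assumes "u \<in> Arr B" "a \<in> Ob" "ob a = Cod B u"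
  shows "reindA B p u (idt a) = idt (pull u a)"
proof (rule cart_eq[OF lift_chm[OF assms] reindA(1)[OF assms(1,3) ide_hm] ide_hm])
  show "lft u a \<odot> reindA B p u (idt a) = lft u a \<odot> idt (pull u a)"
    using reindA(2)[OF assms(1,3) ide_hm[OF assms(2)]] lift_hm[OF assms]
    by (simp add: idl[OF lift_hm[OF assms]] idr[OF lift_hm[OF assms]])
qed (use assms reind_obj in auto)

lemma reindA_comp:
  assumes u: "u \<in> Arr B" "ob a = Cod B u" and f: "f \<in> Ver a b" and g: "g \<in> Ver b c"
  shows "reindA B p u (g \<odot> f) = reindA B p u g \<odot> reindA B p u f"
proof -
  have ob: "ob b = Cod B u" "ob c = Cod B u" "a \<in> Ob" "b \<in> Ob" "c \<in> Ob"
    using vhmD[OF f] vhmD[OF g] u hmD[OF f] hmD[OF g] by auto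
  note F = reindA[OF u f] and G = reindA[OF u(1) ob(1) g] and H = reindA[OF u comp_vl[OF f g]]
  note L = lift_hm[OF u(1) ob(3) u(2)] lift_hm[OF u(1) ob(4,1)] lift_chm[OF u(1) ob(5,2)]
  have "lft u c \<odot> (reindA B p u g \<odot> reindA B p u f) = g \<odot> (f \<odot> lft u a)"
    using ac[OF F(1) G(1) chmD[OF L(3)]] ac[OF F(1) L(2) g] F(2) G(2) by metis
  also have "\<dots> = lft u c \<odot> reindA B p u (g \<odot> f)" using H(2) ac[OF L(1) f g] by simp
  finally show ?thesis using cart_eq[OF L(3) H(1) comp_vl[OF F(1) G(1)]] by simp
qed

lemma vertical_iff:
  "u \<in> Obj B ==> f \<in> Arr (Tot p) \<and> PArr p f = Ide B u \<longleftrightarrow> ob (dm f) = u \<and> f \<in> Ver (dm f) (cd f)"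
  by (metis (no_types, lifting) B.ide_dom hmD hmI parr_dom)

lemma reind_functor:
  assumes u: "u \<in> Arr B"
  shows "is_functor (fibre B p (Cod B u)) (fibre B p (Dom B u)) (reindex B p u)"
proof -
  have 1: "reindA B p u f \<in> hom (fibre B p (Dom B u)) (pull u (dm f)) (pull u (cd f))"
    if "f \<in> Arr (Tot p)" "PArr p f = Ide B (Cod B u)" for f
    using reindA(1)[OF u, of "dm f" f "cd f"] reind_obj(2)[OF u, of "dm f"]
      vertical_iff[of "Cod B u" f] that u
    by (auto simp add: hom_fibre)
  have 3: "reindA B p u (g \<odot> f) = reindA B p u g \<odot> reindA B p u f"
    if f: "f \<in> Arr (Tot p)" "PArr p f = Ide B (Cod B u)" and g: "g \<in> Arr (Tot p)" "PArr p g = Ide B (Cod B u)"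
      "cd f = dm g" for f g
    using reindA_comp[OF u, of "dm f" f "dm g" g "cd g"] f g u
      vertical_iff[of "Cod B u" f] vertical_iff[of "Cod B u" g] by auto
  show ?thesis unfolding is_functor_def using 1 3 reindA_ide[OF u] reind_obj[OF u] u by auto
qed

end

section \<open>Adjunctions, opcartesian arrows and coproducts\<close>

lemma ex1_transfer:
  assumes "\<And>a. P a ==> Q (m a)" "\<And>a b. P a ==> P b ==> m a = m b ==> a = b" "\<And>q. Q q ==> \<exists>a. P a \<and> m a = q"
  shows "(\<exists>!a. P a) \<longleftrightarrow> (\<exists>!q. Q q)"
  using assms by metis

lemma adjunction_left:
  assumes C: "category C" and D: "category D" and T: "adjunction C D T"
    and a: "a \<in> Obj C" and b: "b \<in> Obj D" and f: "f \<in> hom C a (fobj (radj T) b)"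
  defines "x \<equiv> acounit T b \<cdot>\<^sub>D farr (ladj T) f"
  shows "x \<in> hom D (fobj (ladj T) a) b" "farr (radj T) x \<cdot>\<^sub>C aunit T a = f"
    and "\<And>y. y \<in> hom D (fobj (ladj T) a) b ==> farr (radj T) y \<cdot>\<^sub>C aunit T a = f ==> y = x"
proof -
  interpret C: cat C by (rule cat.intro) fact
  interpret D: cat D by (rule cat.intro) fact
  let ?L = "ladj T" and ?R = "radj T"
  have Lo: "\<And>a. a \<in> Obj C ==> fobj ?L a \<in> Obj D" and Ro: "\<And>a. a \<in> Obj D ==> fobj ?R a \<in> Obj C"
    and La: "\<And>f. f \<in> Arr C ==> farr ?L f \<in> hom D (fobj ?L (Dom C f)) (fobj ?L (Cod C f))"
    and Ra: "\<And>f. f \<in> Arr D ==> farr ?R f \<in> hom C (fobj ?R (Dom D f)) (fobj ?R (Cod D f))"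
    and Lc: "\<And>f g. f \<in> Arr C ==> g \<in> Arr C ==> Cod C f = Dom C g ==> farr ?L (g \<cdot>\<^sub>C f) = farr ?L g \<cdot>\<^sub>D farr ?L f"
    and Rc: "\<And>f g. f \<in> Arr D ==> g \<in> Arr D ==> Cod D f = Dom D g ==> farr ?R (g \<cdot>\<^sub>D f) = farr ?R g \<cdot>\<^sub>C farr ?R f"
    and Eh: "\<And>a. a \<in> Obj C ==> aunit T a \<in> hom C a (fobj ?R (fobj ?L a))"
    and Ch: "\<And>a. a \<in> Obj D ==> acounit T a \<in> hom D (fobj ?L (fobj ?R a)) a"
    and En: "\<And>f. f \<in> Arr C ==> aunit T (Cod C f) \<cdot>\<^sub>C f = farr ?R (farr ?L f) \<cdot>\<^sub>C aunit T (Dom C f)"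
    and Cn: "\<And>f. f \<in> Arr D ==> acounit T (Cod D f) \<cdot>\<^sub>D farr ?L (farr ?R f) = f \<cdot>\<^sub>D acounit T (Dom D f)"
    and t1: "\<And>a. a \<in> Obj C ==> acounit T (fobj ?L a) \<cdot>\<^sub>D farr ?L (aunit T a) = Ide D (fobj ?L a)"
    and t2: "\<And>b. b \<in> Obj D ==> farr ?R (acounit T b) \<cdot>\<^sub>C aunit T (fobj ?R b) = Ide C (fobj ?R b)"
    using T unfolding adjunction_def is_functor_def nat_trans_def comp_func_def id_func_def
    by simp_all
  note [simp] = Lo Ro
  have f': "f \<in> Arr C" "Dom C f = a" "Cod C f = fobj ?R b" using f by (auto simp: hom_iff)
  note [simp] = f' a b
  have [simp]: "farr ?L f \<in> Arr D" "Dom D (farr ?L f) = fobj ?L a" "Cod D (farr ?L f) = fobj ?L (fobj ?R b)"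
    using La[of f] by (auto simp: hom_iff)
  have [simp]: "acounit T b \<in> Arr D" "Dom D (acounit T b) = fobj ?L (fobj ?R b)" "Cod D (acounit T b) = b"
    using Ch[of b] by (auto simp: hom_iff)
  have [simp]: "aunit T a \<in> Arr C" "Dom C (aunit T a) = a" "Cod C (aunit T a) = fobj ?R (fobj ?L a)"
    using Eh[of a] by (auto simp: hom_iff)
  have [simp]: "aunit T (fobj ?R b) \<in> Arr C" "Dom C (aunit T (fobj ?R b)) = fobj ?R b"
    "Cod C (aunit T (fobj ?R b)) = fobj ?R (fobj ?L (fobj ?R b))"
    using Eh[of "fobj ?R b"] by (auto simp: hom_iff)
  show x: "x \<in> hom D (fobj ?L a) b" by (simp add: x_def hom_iff)
  have [simp]: "farr ?R (farr ?L f) \<in> Arr C" "Dom C (farr ?R (farr ?L f)) = fobj ?R (fobj ?L a)"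
    "Cod C (farr ?R (farr ?L f)) = fobj ?R (fobj ?L (fobj ?R b))"
    "farr ?R (acounit T b) \<in> Arr C" "Dom C (farr ?R (acounit T b)) = fobj ?R (fobj ?L (fobj ?R b))"
    "Cod C (farr ?R (acounit T b)) = fobj ?R b"
    using Ra[of "farr ?L f"] Ra[of "acounit T b"] by (auto simp: hom_iff)
  have "farr ?R x \<cdot>\<^sub>C aunit T a = farr ?R (acounit T b) \<cdot>\<^sub>C (farr ?R (farr ?L f) \<cdot>\<^sub>C aunit T a)"
    by (simp add: x_def Rc)
  also have "\<dots> = farr ?R (acounit T b) \<cdot>\<^sub>C (aunit T (fobj ?R b) \<cdot>\<^sub>C f)" using En[of f] by simp
  also have "\<dots> = f" using C.pre[OF t2[OF b], of f] by simp
  finally show "farr ?R x \<cdot>\<^sub>C aunit T a = f" .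
  fix y assume y: "y \<in> hom D (fobj ?L a) b" and yf: "farr ?R y \<cdot>\<^sub>C aunit T a = f"
  have [simp]: "y \<in> Arr D" "Dom D y = fobj ?L a" "Cod D y = b" using y by (auto simp: hom_iff)
  have [simp]: "farr ?R y \<in> Arr C" "Dom C (farr ?R y) = fobj ?R (fobj ?L a)" "Cod C (farr ?R y) = fobj ?R b"
    using Ra[of y] by (auto simp: hom_iff)
  have [simp]: "farr ?L (farr ?R y) \<in> Arr D" "Dom D (farr ?L (farr ?R y)) = fobj ?L (fobj ?R (fobj ?L a))"
    "Cod D (farr ?L (farr ?R y)) = fobj ?L (fobj ?R b)"
    using La[of "farr ?R y"] by (auto simp: hom_iff)
  have [simp]: "farr ?L (aunit T a) \<in> Arr D" "Dom D (farr ?L (aunit T a)) = fobj ?L a"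
    "Cod D (farr ?L (aunit T a)) = fobj ?L (fobj ?R (fobj ?L a))"
    using La[of "aunit T a"] by (auto simp: hom_iff)
  have [simp]: "acounit T (fobj ?L a) \<in> Arr D" "Dom D (acounit T (fobj ?L a)) = fobj ?L (fobj ?R (fobj ?L a))"
    "Cod D (acounit T (fobj ?L a)) = fobj ?L a"
    using Ch[of "fobj ?L a"] by (auto simp: hom_iff)
  have "x = acounit T b \<cdot>\<^sub>D (farr ?L (farr ?R y) \<cdot>\<^sub>D farr ?L (aunit T a))"
    by (simp add: x_def Lc flip: yf)
  also have "\<dots> = y \<cdot>\<^sub>D (acounit T (fobj ?L a) \<cdot>\<^sub>D farr ?L (aunit T a))"
    using D.pre[OF Cn[of y]] by simp
  also have "\<dots> = y" using t1[OF a] by simp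
  finally show "y = x" ..
qed

definition opp :: "('o, 'a) cat => ('o, 'a) cat" where
  "opp C = \<lparr>Obj = Obj C, Arr = Arr C, Dom = Cod C, Cod = Dom C, Ide = Ide C, Comp = (\<lambda>g f. f \<cdot>\<^sub>C g)\<rparr>"

lemma opp_simps [simp]: "Obj (opp C) = Obj C" "Arr (opp C) = Arr C" "Dom (opp C) = Cod C" "Cod (opp C) = Dom C"
  "Ide (opp C) = Ide C" "f \<cdot>\<^sub>(opp C) g = g \<cdot>\<^sub>C f"
  by (simp_all add: opp_def)

lemma hom_opp [simp]: "hom (opp C) a b = hom C b a"
  by (auto simp: hom_def)

lemma category_opp: "category C ==> category (opp C)"
proof -
  assume "category C"
  then interpret C: cat C by (rule cat.intro)
  show "category (opp C)" unfolding category_def by (auto simp: hom_iff)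
qed

lemma functor_opp: "is_functor C D G ==> is_functor (opp C) (opp D) G"
  unfolding is_functor_def by simp

lemma adjunction_opp:
  "adjunction C D T ==> adjunction (opp D) (opp C) \<lparr>ladj = radj T, radj = ladj T, aunit = acounit T, acounit = aunit T\<rparr>"
  unfolding adjunction_def by (auto simp: functor_opp nat_trans_def id_func_def comp_func_def)

lemma adjunction_right:
  assumes C: "category C" and D: "category D" and T: "adjunction C D T"
    and a: "a \<in> Obj C" and b: "b \<in> Obj D" and f: "f \<in> hom D (fobj (ladj T) a) b"
  defines "x \<equiv> farr (radj T) f \<cdot>\<^sub>C aunit T a"
  shows "x \<in> hom C a (fobj (radj T) b)" "acounit T b \<cdot>\<^sub>D farr (ladj T) x = f"
    and "\<And>y. y \<in> hom C a (fobj (radj T) b) ==> acounit T b \<cdot>\<^sub>D farr (ladj T) y = f ==> y = x"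
proof -
  note T' = adjunction_left[OF category_opp[OF D] category_opp[OF C] adjunction_opp[OF T], of b a f,
      simplified, OF b a f, folded x_def]
  show "x \<in> hom C a (fobj (radj T) b)" "acounit T b \<cdot>\<^sub>D farr (ladj T) x = f" by (rule T')+
  show "y = x" if "y \<in> hom C a (fobj (radj T) b)" "acounit T b \<cdot>\<^sub>D farr (ladj T) y = f" for y
    by (rule T'(3)[OF that])
qed

definition opcart :: "('o, 'm) cat => ('o, 'm, 'e, 'f) fibn => 'f => bool" where
  "opcart B p \<iota> \<longleftrightarrow> \<iota> \<in> Arr (Tot p) \<and>
     (\<forall>w k d. w \<in> Arr B --> Dom B w = PObj p (Cod (Tot p) \<iota>) --> k \<in> hm p (w \<cdot>\<^sub>B PArr p \<iota>) (Dom (Tot p) \<iota>) d -->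
       (\<exists>!x. x \<in> hm p w (Cod (Tot p) \<iota>) d \<and> x \<odot>\<^sub>p \<iota> = k))"

definition cin :: "('o, 'm) cat => ('o, 'm, 'e, 'f) fibn => 'm => 'e => 'f" where
  "cin B p v \<beta> = Lift p v (fobj (coprod B p v) \<beta>) \<odot>\<^sub>p aunit (coprod_adj B p v) \<beta>"

text \<open>Unique lifting against all opcartesian arrows over \<open>F\<close> is \<open>coprod_splitting\<close> freed from the chosen coproducts and
  reindexings: the base map of the lift is the section.\<close>

definition cproj :: "('o, 'm) cat => 'm set => ('o, 'm, 'e, 'f) fibn => 'e => bool" where
  "cproj B F p \<alpha> \<longleftrightarrow> (\<forall>u \<in> F. \<forall>\<iota> b c h w. \<iota> \<in> hm p u b c --> opcart B p \<iota> --> h \<in> hm p w \<alpha> c -->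
      (\<exists>!k. k \<in> hom (Tot p) \<alpha> b \<and> \<iota> \<odot>\<^sub>p k = h))"

lemma is_pullbackD:
  assumes "is_pullback B f g a b"
  shows "f \<in> Arr B" "g \<in> Arr B" "a \<in> Arr B" "b \<in> Arr B" "Cod B f = Cod B g" "Dom B b = Dom B a"
    "Cod B a = Dom B f" "Cod B b = Dom B g" "f \<cdot>\<^sub>B a = g \<cdot>\<^sub>B b"
  using assms unfolding is_pullback_def by simp_all

context cat
begin

lemma pb_fill:
  assumes "is_pullback C f g a b" "x \<in> Arr C" "y \<in> Arr C" "Dom C x = Dom C y" "Cod C x = Dom C f" "Cod C y = Dom C g"
    "f \<cdot> x = g \<cdot> y"
  obtains t where "t \<in> Arr C" "Dom C t = Dom C x" "Cod C t = Dom C a" "a \<cdot> t = x" "b \<cdot> t = y"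
  using assms unfolding is_pullback_def hom_def by blast

lemma pb_eq:
  assumes P: "is_pullback C f g a b" and s: "s \<in> Arr C" "Cod C s = Dom C a" and t: "t \<in> Arr C" "Cod C t = Dom C a"
    and d: "Dom C s = Dom C t" and e: "a \<cdot> s = a \<cdot> t" "b \<cdot> s = b \<cdot> t"
  shows "s = t"
proof -
  note [simp] = is_pullbackD[OF P] s t d
  let ?x = "a \<cdot> t" and ?y = "b \<cdot> t"
  have fx: "f \<cdot> ?x = g \<cdot> ?y" using pre[OF is_pullbackD(9)[OF P], of t] by simp

  have q: "\<forall>x\<in>Arr C. \<forall>y\<in>Arr C. Dom C x = Dom C y --> Cod C x = Dom C f --> Cod C y = Dom C g -->
      f \<cdot> x = g \<cdot> y --> (\<exists>!t. t \<in> hom C (Dom C x) (Dom C a) \<and> a \<cdot> t = x \<and> b \<cdot> t = y)"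
    using P unfolding is_pullback_def by (elim conjE)
  have "\<exists>!r. r \<in> hom C (Dom C ?x) (Dom C a) \<and> a \<cdot> r = ?x \<and> b \<cdot> r = ?y"
    by (rule q[rule_format]) (simp_all add: fx)
  moreover have "s \<in> hom C (Dom C ?x) (Dom C a)" "t \<in> hom C (Dom C ?x) (Dom C a)" by (simp_all add: hom_iff)
  ultimately show ?thesis using e by blast
qed

lemma pbI:
  assumes "f \<in> Arr C" "g \<in> Arr C" "a \<in> Arr C" "b \<in> Arr C" "Cod C f = Cod C g" "Dom C b = Dom C a"
    "Cod C a = Dom C f" "Cod C b = Dom C g" "f \<cdot> a = g \<cdot> b"
    and "\<And>x y. x \<in> Arr C ==> y \<in> Arr C ==> Dom C x = Dom C y ==> Cod C x = Dom C f ==> Cod C y = Dom C g ==>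
      f \<cdot> x = g \<cdot> y ==> \<exists>t. t \<in> Arr C \<and> Dom C t = Dom C x \<and> Cod C t = Dom C a \<and> a \<cdot> t = x \<and> b \<cdot> t = y"
    and "\<And>s t. s \<in> Arr C ==> t \<in> Arr C ==> Cod C s = Dom C a ==> Cod C t = Dom C a ==> Dom C s = Dom C t ==>
      a \<cdot> s = a \<cdot> t ==> b \<cdot> s = b \<cdot> t ==> s = t"
  shows "is_pullback C f g a b"
  unfolding is_pullback_def
proof (intro conjI ballI impI)
  fix x y assume xy: "x \<in> Arr C" "y \<in> Arr C" "Dom C x = Dom C y" "Cod C x = Dom C f" "Cod C y = Dom C g"
      "f \<cdot> x = g \<cdot> y"
  obtain t where t: "t \<in> Arr C" "Dom C t = Dom C x" "Cod C t = Dom C a" "a \<cdot> t = x" "b \<cdot> t = y"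
    using assms(10)[OF xy] by blast
  show "\<exists>!t. t \<in> hom C (Dom C x) (Dom C a) \<and> a \<cdot> t = x \<and> b \<cdot> t = y"
    by (rule ex1I[of _ t]) (use t assms(11) in \<open>auto simp: hom_iff\<close>)
qed (use assms(1-9) in simp_all)

lemma pb_sym: "is_pullback C f g a b ==> is_pullback C g f b a"
proof (rule pbI)
  assume P: "is_pullback C f g a b"
  note [simp] = is_pullbackD[OF P]
  show "g \<in> Arr C" "f \<in> Arr C" "b \<in> Arr C" "a \<in> Arr C" "Cod C g = Cod C f" "Dom C a = Dom C b" "Cod C b = Dom C g"
    "Cod C a = Dom C f" "g \<cdot> b = f \<cdot> a" by simp_all
  show "\<exists>t. t \<in> Arr C \<and> Dom C t = Dom C x \<and> Cod C t = Dom C b \<and> b \<cdot> t = x \<and> a \<cdot> t = y"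
    if h: "x \<in> Arr C" "y \<in> Arr C" "Dom C x = Dom C y" "Cod C x = Dom C g" "Cod C y = Dom C f" "g \<cdot> x = f \<cdot> y"
    for x y
  proof -
    obtain t where "t \<in> Arr C" "Dom C t = Dom C y" "Cod C t = Dom C a" "a \<cdot> t = y" "b \<cdot> t = x"
      using pb_fill[OF P h(2,1) h(3)[symmetric] h(5,4) h(6)[symmetric]] by blast
    thus ?thesis using h(3) by auto
  qed
  show "s = t" if "s \<in> Arr C" "t \<in> Arr C" "Cod C s = Dom C b" "Cod C t = Dom C b" "Dom C s = Dom C t"
     "b \<cdot> s = b \<cdot> t" "a \<cdot> s = a \<cdot> t" for s t
    using pb_eq[OF P that(1) _ that(2) _ that(5,7,6)] that by simp
qed

lemma pb_paste:
  assumes P: "is_pullback C w v u g" and P2: "is_pullback C w2 u u2 g2"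
  shows "is_pullback C (w \<cdot> w2) v u2 (g \<cdot> g2)"
proof (rule pbI)
  note pd = is_pullbackD[OF P] and pd2 = is_pullbackD[OF P2]
  note [simp] = pd(1-8) pd2(1-8)
  have "w \<cdot> (w2 \<cdot> u2) = w \<cdot> (u \<cdot> g2)" using pd2(9) by simp
  also have "\<dots> = v \<cdot> (g \<cdot> g2)" using pre[OF pd(9), of g2] by simp
  finally show "w \<cdot> w2 \<cdot> u2 = v \<cdot> (g \<cdot> g2)" by simp
  show "w \<cdot> w2 \<in> Arr C" "v \<in> Arr C" "u2 \<in> Arr C" "g \<cdot> g2 \<in> Arr C" "Cod C (w \<cdot> w2) = Cod C v" "Dom C (g \<cdot> g2) = Dom C u2"
    "Cod C u2 = Dom C (w \<cdot> w2)" "Cod C (g \<cdot> g2) = Dom C v" by simp_all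
next
  note pd = is_pullbackD[OF P] and pd2 = is_pullbackD[OF P2]
  note [simp] = pd(1-8) pd2(1-8)
  fix x y assume h: "x \<in> Arr C" "y \<in> Arr C" "Dom C x = Dom C y" "Cod C x = Dom C (w \<cdot> w2)" "Cod C y = Dom C v"
    "w \<cdot> w2 \<cdot> x = v \<cdot> y"
  note [simp] = h(1-3)
  have cx: "Cod C x = Dom C w2" using h(4) by simp
  have wx: "w \<cdot> (w2 \<cdot> x) = v \<cdot> y" using h(6) cx by simp
  obtain t where t: "t \<in> Arr C" "Dom C t = Dom C (w2 \<cdot> x)" "Cod C t = Dom C u" "u \<cdot> t = w2 \<cdot> x" "g \<cdot> t = y"
  proof -
    have "w2 \<cdot> x \<in> Arr C" "Dom C (w2 \<cdot> x) = Dom C y" "Cod C (w2 \<cdot> x) = Dom C w" using cx by simp_all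
    from pb_fill[OF P this(1) h(2) this(2,3) h(5) wx] show ?thesis using that by blast
  qed
  obtain s where s: "s \<in> Arr C" "Dom C s = Dom C x" "Cod C s = Dom C u2" "u2 \<cdot> s = x" "g2 \<cdot> s = t"
  proof -
    have "Dom C x = Dom C t" using t(2) cx by simp
    from pb_fill[OF P2 h(1) t(1) this cx t(3) t(4)[symmetric]] show ?thesis using that by blast
  qed
  have "g \<cdot> g2 \<cdot> s = y" using s t by simp
  thus "\<exists>t. t \<in> Arr C \<and> Dom C t = Dom C x \<and> Cod C t = Dom C u2 \<and> u2 \<cdot> t = x \<and> (g \<cdot> g2) \<cdot> t = y" using s by blast
next
  note pd = is_pullbackD[OF P] and pd2 = is_pullbackD[OF P2]
  note [simp] = pd(1-8) pd2(1-8)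
  fix s t assume h: "s \<in> Arr C" "t \<in> Arr C" "Cod C s = Dom C u2" "Cod C t = Dom C u2" "Dom C s = Dom C t"
    "u2 \<cdot> s = u2 \<cdot> t" "(g \<cdot> g2) \<cdot> s = (g \<cdot> g2) \<cdot> t"
  note [simp] = h(1-5)
  have "u \<cdot> (g2 \<cdot> s) = u \<cdot> (g2 \<cdot> t)"
    using h(6) pre[OF pd2(9)[symmetric], of s] pre[OF pd2(9)[symmetric], of t] by simp
  hence "g2 \<cdot> s = g2 \<cdot> t" using pb_eq[OF P, of "g2 \<cdot> s" "g2 \<cdot> t"] h(7) by simp
  thus "s = t" using pb_eq[OF P2 h(1,3,2,4,5,6)] by blast
qed

lemma pb_ide:
  assumes "v \<in> Arr C"
  shows "is_pullback C (Ide C (Cod C v)) v v (Ide C (Dom C v))"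
  by (rule pbI) (use assms in auto)

end

context fib
begin

abbreviation "Opc \<equiv> opcart B p"
abbreviation "Cin \<equiv> cin B p"
abbreviation "Cop v \<equiv> fobj (coprod B p v)"
abbreviation "una v \<equiv> aunit (coprod_adj B p v)"
abbreviation "Prd v \<equiv> fobj (prodt B p v)"
abbreviation "cou v \<equiv> acounit (prod_adj B p v)"

lemma fibre_category: "A \<in> Obj B ==> category (fibre B p A)"
proof -
  assume A: "A \<in> Obj B"
  have 1: "ob (dm f) = A \<and> ob (cd f) = A" if "f \<in> Arr (Tot p)" "PArr p f = Ide B A" for f
    using that A parr_dom parr_cod B.ide_dom B.ide_cod by metis
  show ?thesis unfolding category_def using A 1 by (auto simp: hom_fibre hm_def)
qed

lemma opcart_ex1:
  assumes "Opc \<iota>" "\<iota> \<in> hm p u b c" "k \<in> hm p v b d" "w \<in> Arr B" "Dom B w = ob c" "v = w \<cdot> u"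
  shows "\<exists>!x. x \<in> hm p w c d \<and> x \<odot> \<iota> = k"
  using assms hmD[OF assms(2)] unfolding opcart_def by simp

lemma opcart_fill:
  assumes "Opc \<iota>" "\<iota> \<in> hm p u b c" "k \<in> hm p v b d" "w \<in> Arr B" "Dom B w = ob c" "v = w \<cdot> u"
  obtains x where "x \<in> hm p w c d" "x \<odot> \<iota> = k"
  using opcart_ex1[OF assms] by blast

lemma opcart_eq:
  assumes "Opc \<iota>" "\<iota> \<in> hm p u b c" "x \<in> hm p w c d" "y \<in> hm p w c d" "x \<odot> \<iota> = y \<odot> \<iota>"
  shows "x = y"
  using opcart_ex1[OF assms(1,2) comp_hm[OF assms(2,3)], of w] hmD[OF assms(3)] assms by auto

lemma opcartI:
  assumes "\<iota> \<in> hm p u b c"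
    and "\<And>w k d. w \<in> Arr B ==> Dom B w = ob c ==> k \<in> hm p (w \<cdot> u) b d ==> \<exists>x. x \<in> hm p w c d \<and> x \<odot> \<iota> = k"
    and "\<And>w x y d. x \<in> hm p w c d ==> y \<in> hm p w c d ==> x \<odot> \<iota> = y \<odot> \<iota> ==> x = y"
  shows "Opc \<iota>"
  unfolding opcart_def using hmD[OF assms(1)] assms(2,3) by simp metis

lemma opcart_verticalI:
  assumes i: "\<iota> \<in> hm p u b c" and ex: "\<And>d k. k \<in> hm p u b d ==> \<exists>!x. x \<in> Ver c d \<and> x \<odot> \<iota> = k"
  shows "Opc \<iota>"
proof (rule opcartI[OF i])
  note [simp] = hmD[OF i]
  fix w k d assume w: "w \<in> Arr B" "Dom B w = ob c" and k: "k \<in> hm p (w \<cdot> u) b d"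
  have [simp]: "Cod B w = ob d" using hmD[OF k] w by simp
  note [simp] = w hmD[OF k]
  have L: "lft w d \<in> Car w (pull w d) d" using hmD[OF k] by (intro lift_chm) simp_all
  obtain y where y: "y \<in> hm p u b (pull w d)" "lft w d \<odot> y = k"
    using cart_fill[OF L k, of u] hmD[OF chmD[OF L]] by auto
  obtain x where x: "x \<in> Ver c (pull w d)" "x \<odot> \<iota> = y" using ex[OF y(1)] by blast
  show "\<exists>x. x \<in> hm p w c d \<and> x \<odot> \<iota> = k"
    using comp_vr[OF x(1) chmD[OF L]] ac[OF i x(1) chmD[OF L]] x(2) y(2) by auto
next
  note [simp] = hmD[OF i]
  fix w x y d assume x: "x \<in> hm p w c d" and y: "y \<in> hm p w c d" and e: "x \<odot> \<iota> = y \<odot> \<iota>"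
  note [simp] = hmD[OF x] hmD[OF y]
  have L: "lft w d \<in> Car w (pull w d) d" by (intro lift_chm) simp_all
  obtain x' where x': "x' \<in> Ver c (pull w d)" "lft w d \<odot> x' = x" using cart_vfill[OF L x] by blast
  obtain y' where y': "y' \<in> Ver c (pull w d)" "lft w d \<odot> y' = y" using cart_vfill[OF L y] by blast
  have h: "x' \<odot> \<iota> \<in> hm p u b (pull w d)" "y' \<odot> \<iota> \<in> hm p u b (pull w d)"
    using comp_hm[OF i x'(1)] comp_hm[OF i y'(1)] by simp_all
  have "x' \<odot> \<iota> = y' \<odot> \<iota>"
    using cart_eq[OF L h] ac[OF i x'(1) chmD[OF L]] ac[OF i y'(1) chmD[OF L]] x' y' e by simp
  hence "x' = y'" using ex[OF h(1)] x' y' by metis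
  thus "x = y" using x' y' by simp
qed

lemma opcart_viso:
  assumes i: "\<iota> \<in> hm p u b c" "Opc \<iota>" and i': "\<iota>' \<in> hm p u b c'" "Opc \<iota>'"
  obtains j j' where "Iso c c' j j'" "j \<odot> \<iota> = \<iota>'" "j' \<odot> \<iota>' = \<iota>"
proof -
  note [simp] = hmD[OF i(1)] hmD[OF i'(1)]
  have P: "ob c' = ob c" using hmD[OF i(1)] hmD[OF i'(1)] by simp
  obtain j where j: "j \<in> Ver c c'" "j \<odot> \<iota> = \<iota>'"
    using opcart_fill[OF i(2,1) i'(1), of "Ide B (ob c)"] by auto
  obtain j' where j': "j' \<in> Ver c' c" "j' \<odot> \<iota>' = \<iota>"
    using opcart_fill[OF i'(2,1) i(1), of "Ide B (ob c)"] P by auto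
  have "j' \<odot> j = idt c"
    using opcart_eq[OF i(2,1) comp_vl[OF j(1) j'(1)] ide_hm] ac[OF i(1) j(1) j'(1)] idl[OF i(1)] j(2) j'(2) by simp
  moreover have "j \<odot> j' = idt c'"
    using opcart_eq[OF i'(2,1) comp_vl[OF j'(1) j(1)] ide_hm] ac[OF i'(1) j'(1) j(1)] idl[OF i'(1)] j(2) j'(2) by simp
  ultimately show ?thesis using that j j' by (simp add: viso_def)
qed

lemma opcart_post:
  assumes i: "\<iota> \<in> hm p u b c" "Opc \<iota>" and j: "Iso c c' j j'"
  shows "Opc (j \<odot> \<iota>)" "j \<odot> \<iota> \<in> hm p u b c'"
proof -
  have jh: "j \<in> Ver c c'" "j' \<in> Ver c' c" "j' \<odot> j = idt c" "j \<odot> j' = idt c'"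
    using visoD[OF j] by auto
  show h: "j \<odot> \<iota> \<in> hm p u b c'" using comp_vl[OF i(1), of j c'] jh by simp
  show "Opc (j \<odot> \<iota>)"
  proof (rule opcartI[OF h])
    fix w k d assume w: "w \<in> Arr B" "Dom B w = ob c'" and k: "k \<in> hm p (w \<cdot> u) b d"
    obtain x where x: "x \<in> hm p w c d" "x \<odot> \<iota> = k" using opcart_fill[OF i(2,1) k] w vhmD[OF jh(1)] by auto
    note [simp] = hmD[OF i(1)] hmD[OF jh(1)] hmD[OF jh(2)] hmD[OF x(1)] vhmD[OF jh(1)]
    have "x \<odot> j' \<odot> (j \<odot> \<iota>) = k" using E.pre[OF jh(3), of \<iota>] x(2) by simp
    moreover have "x \<odot> j' \<in> hm p w c' d" by (simp add: hm_def)
    ultimately show "\<exists>x. x \<in> hm p w c' d \<and> x \<odot> (j \<odot> \<iota>) = k" by blast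
  next
    fix w x y d assume x: "x \<in> hm p w c' d" and y: "y \<in> hm p w c' d" and e: "x \<odot> (j \<odot> \<iota>) = y \<odot> (j \<odot> \<iota>)"
    have "x \<odot> j = y \<odot> j"
      using opcart_eq[OF i(2,1) comp_vr[OF jh(1), of x w d] comp_vr[OF jh(1), of y w d]] x y e
        ac[OF i(1) jh(1) x] ac[OF i(1) jh(1) y] by simp
    hence "x \<odot> j \<odot> j' = y \<odot> j \<odot> j'" by simp
    thus "x = y" using ac[OF jh(2,1) x] ac[OF jh(2,1) y] jh(4) idr[OF x] idr[OF y] by simp
  qed
qed

lemma opcart_pre:
  assumes i: "\<iota> \<in> hm p u b c" "Opc \<iota>" and j: "Iso b' b j j'"
  shows "Opc (\<iota> \<odot> j)" "\<iota> \<odot> j \<in> hm p u b' c"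
proof -
  have jh: "j \<in> Ver b' b" "j' \<in> Ver b b'" "j' \<odot> j = idt b'" "j \<odot> j' = idt b"
    using visoD[OF j] by auto
  note [simp] = hmD[OF i(1)] hmD[OF jh(1)] hmD[OF jh(2)] vhmD[OF jh(1)]
  show h: "\<iota> \<odot> j \<in> hm p u b' c" using comp_vr[OF jh(1) i(1)] by simp
  show "Opc (\<iota> \<odot> j)"
  proof (rule opcartI[OF h])
    fix w k d assume w: "w \<in> Arr B" "Dom B w = ob c" and k: "k \<in> hm p (w \<cdot> u) b' d"
    note [simp] = hmD[OF k] w
    have kj: "k \<odot> j' \<in> hm p (w \<cdot> u) b d" by (simp add: hm_def)
    obtain x where x: "x \<in> hm p w c d" "x \<odot> \<iota> = k \<odot> j'" using opcart_fill[OF i(2,1) kj, of w] by auto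
    have "x \<odot> (\<iota> \<odot> j) = k" using ac[OF jh(1) i(1) x(1)] x(2) jh(3) by simp
    thus "\<exists>x. x \<in> hm p w c d \<and> x \<odot> (\<iota> \<odot> j) = k" using x by blast
  next
    fix w x y d assume x: "x \<in> hm p w c d" and y: "y \<in> hm p w c d" and e: "x \<odot> (\<iota> \<odot> j) = y \<odot> (\<iota> \<odot> j)"
    have "x \<odot> (\<iota> \<odot> j) \<odot> j' = y \<odot> (\<iota> \<odot> j) \<odot> j'" using e by simp
    hence "x \<odot> \<iota> = y \<odot> \<iota>" using hmD[OF x] hmD[OF y] jh(4) by simp
    thus "x = y" using opcart_eq[OF i(2,1) x y] by simp
  qed
qed

lemma square_fill:
  assumes P: "pbk v f g u" and c: "\<chi> \<in> Car f c' c" and s: "\<psi> \<in> Car g b' b"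
    and i: "\<iota> \<in> hm p v b c" and i': "\<iota>' \<in> hm p u b' c'" and e: "\<chi> \<odot> \<iota>' = \<iota> \<odot> \<psi>"
    and x: "x \<in> hm p s d b" and y: "y \<in> hm p t d c'" and xy: "\<iota> \<odot> x = \<chi> \<odot> y"
  shows "\<exists>!z. z \<in> hom (Tot p) d b' \<and> \<psi> \<odot> z = x \<and> \<iota>' \<odot> z = y"
proof -
  note [simp] = hmD[OF chmD[OF c]] hmD[OF chmD[OF s]] hmD[OF i] hmD[OF i'] hmD[OF x] hmD[OF y]
  have st: "v \<cdot> s = f \<cdot> t"
    using arg_cong[OF xy, of "PArr p"] by simp
  obtain r where r: "r \<in> Arr B" "Dom B r = Dom B s" "Cod B r = Dom B g" "g \<cdot> r = s" "u \<cdot> r = t"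
    by (rule B.pb_fill[OF P _ _ _ _ _ st]) ((simp; fail) | blast)+
  note [simp] = r(1-3)
  obtain z where z: "z \<in> hm p r d b'" "\<psi> \<odot> z = x"
    by (rule cart_fill[OF s x r(1) _ _ r(4)[symmetric]]) ((simp; fail) | blast)+
  note [simp] = hmD[OF z(1)]
  have iz: "\<iota>' \<odot> z \<in> hm p t d c'" using r by (simp add: hm_def)
  have "\<chi> \<odot> (\<iota>' \<odot> z) = \<chi> \<odot> y" using E.pre[OF e, of z] z xy by simp
  hence z': "\<iota>' \<odot> z = y" using cart_eq[OF c iz y] by simp
  show ?thesis
  proof (rule ex1I[of _ z])
    show "z \<in> hom (Tot p) d b' \<and> \<psi> \<odot> z = x \<and> \<iota>' \<odot> z = y" using z z' by (simp add: hom_iff)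
    fix z2 assume a: "z2 \<in> hom (Tot p) d b' \<and> \<psi> \<odot> z2 = x \<and> \<iota>' \<odot> z2 = y"
    hence [simp]: "z2 \<in> Arr (Tot p)" "dm z2 = d" "cd z2 = b'" by (auto simp: hom_iff)
    have "g \<cdot> PArr p z2 = s" "u \<cdot> PArr p z2 = t" using a parr_comp[of z2 \<psi>] parr_comp[of z2 \<iota>'] by auto
    hence "PArr p z2 = r" using B.pb_eq[OF P, of "PArr p z2" r] r by simp
    hence "z2 \<in> hm p r d b'" by (simp add: hm_def)
    thus "z2 = z" using cart_eq[OF s _ z(1)] a z by simp
  qed
qed

end

locale dfib = fib B p for B :: "('o, 'm) cat" (structure) and p :: "('o, 'm, 'e, 'f) fibn" +
  fixes F :: "'m set"
  assumes dmc: "display_map_category B F"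
begin

abbreviation "Fam \<equiv> fam_obj B F p"
abbreviation "Cproj \<equiv> cproj B F p"

lemma F_arr: "f \<in> F ==> f \<in> Arr B"
  using dmc unfolding display_map_category_def by blast

lemma F_pb: assumes "g \<in> F" "f \<in> Arr B" "Cod B f = Cod B g"
  obtains a b where "pbk f g a b" "a \<in> F"
  using dmc assms unfolding display_map_category_def by blast

lemma F_stable: assumes "pbk f g a b" "g \<in> F" shows "a \<in> F"
  using dmc assms is_pullbackD(1,5)[OF assms(1)] unfolding display_map_category_def by blast

end

locale cofib = dfib B p F for B :: "('o, 'm) cat" (structure) and p :: "('o, 'm, 'e, 'f) fibn" and F +
  assumes coproducts: "has_coproducts B F p"
begin

lemma coprod_adjunction:
  assumes "v \<in> F"
  shows "adjunction (fibre B p (Dom B v)) (fibre B p (Cod B v)) (coprod_adj B p v)"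
    and "radj (coprod_adj B p v) = reindex B p v"
proof -
  have "\<exists>T. adjunction (fibre B p (Dom B v)) (fibre B p (Cod B v)) T \<and> radj T = reindex B p v"
    using coproducts assms unfolding has_coproducts_def by blast
  from someI_ex[OF this] show "adjunction (fibre B p (Dom B v)) (fibre B p (Cod B v)) (coprod_adj B p v)"
    "radj (coprod_adj B p v) = reindex B p v" unfolding coprod_adj_def by auto
qed

lemma coprod_obj:
  assumes "v \<in> F" "\<beta> \<in> Ob" "ob \<beta> = Dom B v"
  shows "Cop v \<beta> \<in> Ob" "ob (Cop v \<beta>) = Cod B v"
    "una v \<beta> \<in> Ver \<beta> (pull v (Cop v \<beta>))"
    "Cin v \<beta> \<in> hm p v \<beta> (Cop v \<beta>)"
proof -
  note A = coprod_adjunction[OF assms(1)]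
  show o: "Cop v \<beta> \<in> Ob" "ob (Cop v \<beta>) = Cod B v"
    using A assms unfolding adjunction_def is_functor_def by auto
  show e: "una v \<beta> \<in> Ver \<beta> (pull v (Cop v \<beta>))"
    using A assms unfolding adjunction_def nat_trans_def by (auto simp: hom_fibre comp_func_def id_func_def)
  show "Cin v \<beta> \<in> hm p v \<beta> (Cop v \<beta>)"
    unfolding cin_def by (rule comp_vr[OF e lift_hm]) (use o F_arr[OF assms(1)] in auto)
qed

lemma coprod_transpose:
  assumes v: "v \<in> F" and b: "\<beta> \<in> Ob" "ob \<beta> = Dom B v"
    and f: "f \<in> Ver \<beta> (pull v c)" and c: "c \<in> Ob" "ob c = Cod B v"
  defines "x \<equiv> acounit (coprod_adj B p v) c \<odot> farr (coprod B p v) f"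
  shows "x \<in> Ver (Cop v \<beta>) c" "x \<odot> Cin v \<beta> = lft v c \<odot> f"
    "\<And>y. y \<in> Ver (Cop v \<beta>) c ==> y \<odot> Cin v \<beta> = lft v c \<odot> f ==> y = x"
proof -
  note A = coprod_adjunction[OF v] and o = coprod_obj[OF v b]
  have va: "v \<in> Arr B" using F_arr v by blast
  have C: "category (fibre B p (Dom B v))" "category (fibre B p (Cod B v))" using va by (simp_all add: fibre_category)
  have e: "Ide B (Dom B v) = Ide B (ob \<beta>)" "Ide B (Cod B v) = Ide B (ob (Cop v \<beta>))"
    using b o by simp_all
  have h: "\<beta> \<in> Obj (fibre B p (Dom B v))" "c \<in> Obj (fibre B p (Cod B v))"
     "f \<in> hom (fibre B p (Dom B v)) \<beta> (fobj (radj (coprod_adj B p v)) c)"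
    using b c f unfolding A(2) hom_fibre e by auto
  note T = adjunction_left[OF C A(1) h, unfolded hom_fibre A(2) fibre_simps e, folded x_def]
  have T1: "x \<in> Ver (Cop v \<beta>) c" "reindA B p v x \<odot> una v \<beta> = f"
    "\<And>y. y \<in> Ver (Cop v \<beta>) c ==> reindA B p v y \<odot> una v \<beta> = f ==> y = x"
    by (rule T | assumption)+
  show "x \<in> Ver (Cop v \<beta>) c" by fact
  have L: "lft v c \<in> Car v (pull v c) c" using lift_chm[OF va c] .
  have L': "lft v (Cop v \<beta>) \<in> hm p v (pull v (Cop v \<beta>)) (Cop v \<beta>)"
    using lift_hm[OF va o(1,2)] .
  have key: "y \<odot> Cin v \<beta> = lft v c \<odot> (reindA B p v y \<odot> una v \<beta>) \<and>
      reindA B p v y \<odot> una v \<beta> \<in> Ver \<beta> (pull v c)"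
    if y: "y \<in> Ver (Cop v \<beta>) c" for y
  proof -
    note R = reindA[OF va o(2) y]
    have "reindA B p v y \<odot> una v \<beta> \<in> Ver \<beta> (pull v c)"
      using comp_vl[OF o(3)] R(1) vhmD[OF o(3)] by simp
    thus ?thesis unfolding cin_def using ac[OF o(3) L' y] ac[OF o(3) R(1) chmD[OF L]] R(2) by simp
  qed
  show "x \<odot> Cin v \<beta> = lft v c \<odot> f" using key[OF T1(1)] T1(2) by simp
  fix y assume y: "y \<in> Ver (Cop v \<beta>) c" "y \<odot> Cin v \<beta> = lft v c \<odot> f"
  hence "reindA B p v y \<odot> una v \<beta> = f"
    using cart_eq[OF L conjunct2[OF key[OF y(1)]] f] key[OF y(1)] by simp
  thus "y = x" using T1(3) y by blast
qed

lemma cin_opcart: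
  assumes v: "v \<in> F" and b: "\<beta> \<in> Ob" "ob \<beta> = Dom B v"
  shows "Opc (Cin v \<beta>)"
proof (rule opcart_verticalI[OF coprod_obj(4)[OF assms]])
  fix d k assume k: "k \<in> hm p v \<beta> d"
  have va: "v \<in> Arr B" and d: "d \<in> Ob" "ob d = Cod B v" using hmD[OF k] by auto
  obtain f where f: "f \<in> Ver \<beta> (pull v d)" "lft v d \<odot> f = k"
    using cart_vfill[OF lift_chm[OF va d] k] by blast
  show "\<exists>!x. x \<in> Ver (Cop v \<beta>) d \<and> x \<odot> Cin v \<beta> = k"
    using coprod_transpose[OF assms f(1) d] f(2) by metis
qed

lemma cin_stable:
  assumes P: "pbk v f g u" and v: "v \<in> F" and b: "\<beta> \<in> Ob" "ob \<beta> = Dom B v"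
    and i: "\<iota> \<in> hm p u (pull g \<beta>) (pull f (Cop v \<beta>))"
    and e: "lft f (Cop v \<beta>) \<odot> \<iota> = Cin v \<beta> \<odot> lft g \<beta>"
  shows "Opc \<iota>"
proof -
  note pd = is_pullbackD[OF P] and o = coprod_obj[OF v b]
  have u: "u \<in> F" using F_stable[OF B.pb_sym[OF P] v] .
  let ?c = "Cop v \<beta>"
  have L: "lft f ?c \<in> Car f (pull f ?c) ?c" using lift_chm pd o by simp
  have Lu: "lft u (pull f ?c) \<in> Car u (pull u (pull f ?c)) (pull f ?c)"
    using lift_chm pd o reind_obj by simp
  have Lv: "lft v ?c \<in> Car v (pull v ?c) ?c" using lift_chm pd o by simp
  have Lg: "lft g (pull v ?c) \<in> Car g (pull g (pull v ?c)) (pull v ?c)"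
    using lift_chm pd o reind_obj by simp
  have Lg': "lft g \<beta> \<in> Car g (pull g \<beta>) \<beta>"
    using lift_chm pd b reind_obj by simp
  have L2: "Lift2 B p f u ?c \<in> Car (f \<cdot> u) (pull u (pull f ?c)) ?c"
    "Lift2 B p v g ?c \<in> Car (f \<cdot> u) (pull g (pull v ?c)) ?c"
    unfolding Lift2_def using cart_comp[OF L Lu] cart_comp[OF Lv Lg] pd(9) by simp_all
  define m where "m = vfill B p (Lift2 B p f u ?c) (Lift2 B p v g ?c)"
  have m: "m \<in> Ver (pull g (pull v ?c)) (pull u (pull f ?c))"
    "Lift2 B p f u ?c \<odot> m = Lift2 B p v g ?c"
    using vfill_ex1[OF L2(1) chmD[OF L2(2)]] by (simp_all add: m_def)
  define n where "n = reindA B p g (una v \<beta>)"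
  have n: "n \<in> Ver (pull g \<beta>) (pull g (pull v ?c))"
    "lft g (pull v ?c) \<odot> n = una v \<beta> \<odot> lft g \<beta>"
    using reindA[OF pd(3) _ o(3)] pd b by (simp_all add: n_def)
  have mn: "m \<odot> n \<in> Ver (pull g \<beta>) (pull u (pull f ?c))" by (rule comp_vl[OF n(1) m(1)])
  have b': "pull g \<beta> \<in> Ob" "ob (pull g \<beta>) = Dom B u"
    using reind_obj[OF pd(3) b(1)] b pd by auto
  have c': "pull f ?c \<in> Ob" "ob (pull f ?c) = Cod B u"
    using reind_obj[OF pd(2) o(1)] o pd by auto
  have "\<forall>\<beta>\<in>Obj (fibre B p (Dom B v)). iso (fibre B p (Dom B f)) (bc_coprod B p v f g u \<beta>)"
    using coproducts u v P unfolding has_coproducts_def by blast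
  hence I: "iso (fibre B p (Dom B f)) (bc_coprod B p v f g u \<beta>)" using b by simp
  have e': "Dom B f = ob (Cop u (pull g \<beta>))"
    using coprod_obj(2)[OF u b'] pd by simp
  note [simp] = hmD[OF chmD[OF L]] hmD[OF chmD[OF Lu]] hmD[OF chmD[OF Lv]] hmD[OF chmD[OF Lg]] hmD[OF chmD[OF Lg']]
    hmD[OF m(1)] hmD[OF n(1)] hmD[OF o(3)] pd(1-8)
  have bc: "bc_coprod B p v f g u \<beta> = acounit (coprod_adj B p u) (pull f ?c) \<odot> farr (coprod B p u) (m \<odot> n)"
    by (simp add: bc_coprod_def m_def n_def Let_def)
  note T = coprod_transpose[OF u b' mn c', folded bc]
  obtain j where j: "Iso (Cop u (pull g \<beta>)) (pull f ?c) (bc_coprod B p v f g u \<beta>) j"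
    using iso_fibre_viso[OF T(1)] I[unfolded e'] by blast
  have Lx: "lft f ?c \<odot> (lft u (pull f ?c) \<odot> (m \<odot> n)) = Cin v \<beta> \<odot> lft g \<beta>"
  proof -
    have "lft f ?c \<odot> (lft u (pull f ?c) \<odot> (m \<odot> n)) = Lift2 B p f u ?c \<odot> m \<odot> n"
      by (simp add: Lift2_def)
    also have "\<dots> = lft v ?c \<odot> (lft g (pull v ?c) \<odot> n)" unfolding m(2) by (simp add: Lift2_def)
    also have "\<dots> = Cin v \<beta> \<odot> lft g \<beta>" unfolding n(2) by (simp add: cin_def)
    finally show ?thesis .
  qed
  have h: "lft u (pull f ?c) \<odot> (m \<odot> n) \<in> hm p u (pull g \<beta>) (pull f ?c)"
    by (rule comp_vr[OF mn chmD[OF Lu]])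
  have "\<iota> = bc_coprod B p v f g u \<beta> \<odot> Cin u (pull g \<beta>)"
    using cart_eq[OF L i h] Lx e T(2) by simp
  thus ?thesis using opcart_post(1)[OF coprod_obj(4)[OF u b'] cin_opcart[OF u b'] j] by simp
qed

lemma opcart_stable:
  assumes P: "pbk v f g u" and v: "v \<in> F" and i: "\<iota> \<in> hm p v b c" "Opc \<iota>"
    and c: "\<chi> \<in> Car f c' c" and s: "\<psi> \<in> Car g b' b"
    and i': "\<iota>' \<in> hm p u b' c'" and e: "\<chi> \<odot> \<iota>' = \<iota> \<odot> \<psi>"
  shows "Opc \<iota>'"
proof -
  note pd = is_pullbackD[OF P]
  have b: "b \<in> Ob" "ob b = Dom B v" using hmD[OF i(1)] by auto
  note o = coprod_obj[OF v b]
  let ?c = "Cop v b"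
  obtain j j' where j: "Iso c ?c j j'" "j \<odot> \<iota> = Cin v b"
    using opcart_viso[OF i o(4) cin_opcart[OF v b]] by blast
  have L: "lft f ?c \<in> Car f (pull f ?c) ?c" using lift_chm pd o by simp
  have Lg: "lft g b \<in> Car g (pull g b) b" using lift_chm pd b by simp
  have jh: "j \<in> Ver c ?c" using visoD[OF j(1)] by simp
  have jc: "j \<odot> \<chi> \<in> Car f c' ?c"
    using cart_comp[OF viso_cart[OF j(1)] c] hmD[OF chmD[OF c]] by simp
  obtain k k' where k: "Iso c' (pull f ?c) k k'" "lft f ?c \<odot> k = j \<odot> \<chi>"
    using cart_viso[OF jc L] by blast
  obtain m m' where m: "Iso b' (pull g b) m m'" "lft g b \<odot> m = \<psi>"
    using cart_viso[OF s Lg] by blast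
  have kh: "k \<in> Ver c' (pull f ?c)" "k' \<in> Ver (pull f ?c) c'" "k' \<odot> k = idt c'"
    and mh: "m \<in> Ver b' (pull g b)" "m' \<in> Ver (pull g b) b'" "m \<odot> m' = idt (pull g b)"
     "m' \<odot> m = idt b'"
    using k m by (auto simp: viso_def)
  define \<iota>0 where "\<iota>0 = k \<odot> \<iota>' \<odot> m'"
  note [simp] = hmD[OF kh(1)] hmD[OF kh(2)] hmD[OF mh(1)] hmD[OF mh(2)] hmD[OF jh] hmD[OF i(1)] hmD[OF i'] hmD[OF chmD[OF L]]
    hmD[OF chmD[OF Lg]] hmD[OF chmD[OF s]] hmD[OF chmD[OF c]] vhmD[OF kh(1)] vhmD[OF mh(1)] vhmD[OF jh]
  have i0: "\<iota>0 \<in> hm p u (pull g b) (pull f ?c)" by (simp add: \<iota>0_def hm_def)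
  have "lft f ?c \<odot> \<iota>0 = j \<odot> (\<chi> \<odot> (\<iota>' \<odot> m'))" using E.pre[OF k(2), of "\<iota>' \<odot> m'"] by (simp add: \<iota>0_def)
  also have "\<dots> = j \<odot> (\<iota> \<odot> (\<psi> \<odot> m'))" using E.pre[OF e, of m'] by simp
  also have "\<dots> = Cin v b \<odot> (\<psi> \<odot> m')" using E.pre[OF j(2), of "\<psi> \<odot> m'"] by simp
  also have "\<psi> \<odot> m' = lft g b" using m(2) mh(3) ac[OF mh(2,1), of "lft g b" g b] chmD[OF Lg] by (simp add: hm_def)
  finally have "Opc \<iota>0" using cin_stable[OF P v b i0] by blast
  hence "Opc (\<iota>0 \<odot> m)" "\<iota>0 \<odot> m \<in> hm p u b' (pull f ?c)" using opcart_pre[OF i0 _ m(1)] by auto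
  from opcart_post(1)[OF this(2,1) viso_sym[OF k(1)]] have "Opc (k' \<odot> (\<iota>0 \<odot> m))" .
  moreover have "k' \<odot> (\<iota>0 \<odot> m) = \<iota>'" using E.pre[OF kh(3)] mh(4) by (simp add: \<iota>0_def)
  ultimately show ?thesis by simp
qed

lemma coprod_splitting_iff:
  assumes a: "\<alpha> \<in> Ob"
  shows "coprod_splitting B F p \<alpha> \<longleftrightarrow> (\<forall>u \<in> F. \<forall>\<beta>. Cod B u = ob \<alpha> --> \<beta> \<in> Ob --> ob \<beta> = Dom B u -->
     (\<forall>h \<in> Ver \<alpha> (Cop u \<beta>). \<exists>!k. k \<in> hom (Tot p) \<alpha> \<beta> \<and> Cin u \<beta> \<odot> k = h))"
proof -
  have "(\<exists>!gk. case gk of (g, k) => g \<in> sections B u \<and>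
          k \<in> hom (fibre B p (ob \<alpha>)) \<alpha> (pull g \<beta>) \<and>
          h = Lift2 B p u g (Cop u \<beta>) \<odot> reindA B p g (una u \<beta>) \<odot> k)
     \<longleftrightarrow> (\<exists>!k. k \<in> hom (Tot p) \<alpha> \<beta> \<and> Cin u \<beta> \<odot> k = h)" (is "(\<exists>!gk. ?P gk) \<longleftrightarrow> (\<exists>!k. ?Q k)")
    if u: "u \<in> F" "Cod B u = ob \<alpha>" and b: "\<beta> \<in> Ob" "ob \<beta> = Dom B u"
      and h: "h \<in> Ver \<alpha> (Cop u \<beta>)" for u \<beta> h
  proof (rule ex1_transfer[where m = "\<lambda>(g, k). lft g \<beta> \<odot> k"])
    note o = coprod_obj[OF u(1) b] and ua = F_arr[OF u(1)]
    let ?c = "Cop u \<beta>"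
    have L: "lft u ?c \<in> hm p u (pull u ?c) ?c" using lift_hm[OF ua o(1,2)] .
    note [simp] = hmD[OF o(3)] hmD[OF o(4)] hmD[OF L]
    have eq: "Lift2 B p u g ?c \<odot> reindA B p g (una u \<beta>) \<odot> k = Cin u \<beta> \<odot> (lft g \<beta> \<odot> k)"
      and gh: "lft g \<beta> \<odot> k \<in> hm p g \<alpha> \<beta>" and gA: "g \<in> Arr B" "ob \<beta> = Cod B g"
      if g: "g \<in> sections B u" and k: "k \<in> Ver \<alpha> (pull g \<beta>)" for g k
    proof -
      have "g \<in> Arr B \<and> Cod B g = Dom B u" using g unfolding sections_def hom_def by blast
      thus gA: "g \<in> Arr B" "ob \<beta> = Cod B g" using b(2) by metis+
      have Lb: "lft g \<beta> \<in> hm p g (pull g \<beta>) \<beta>" using lift_hm[OF gA(1) b(1) gA(2)] .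
      have Lg: "lft g (pull u ?c) \<in> hm p g (pull g (pull u ?c)) (pull u ?c)"
        using lift_hm[OF gA(1) reind_obj(1)[OF ua o(1,2)]] reind_obj(2)[OF ua o(1,2)] gA(2) b(2) by metis
      note R = reindA[OF gA o(3)]
      show "lft g \<beta> \<odot> k \<in> hm p g \<alpha> \<beta>" by (rule comp_vr[OF k Lb])
      show "Lift2 B p u g ?c \<odot> reindA B p g (una u \<beta>) \<odot> k = Cin u \<beta> \<odot> (lft g \<beta> \<odot> k)"
        unfolding Lift2_def ac[OF R(1) Lg L] R(2) ac[OF Lb o(3) L, symmetric] cin_def[symmetric] ac[OF k Lb o(4)] ..
    qed
    fix x assume x: "?P x"
    obtain g k where [simp]: "x = (g, k)" by (cases x)
    have gk: "g \<in> sections B u" "k \<in> Ver \<alpha> (pull g \<beta>)" using x by (auto simp: hom_fibre)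
    show "?Q (case x of (g, k) => lft g \<beta> \<odot> k)" using x eq[OF gk] gh[OF gk] by (auto simp: hm_def hom_iff)
    fix y assume y: "?P y" and xy: "(case x of (g, k) => lft g \<beta> \<odot> k) = (case y of (g, k) => lft g \<beta> \<odot> k)"
    obtain g' k' where [simp]: "y = (g', k')" by (cases y)
    have gk': "g' \<in> sections B u" "k' \<in> Ver \<alpha> (pull g' \<beta>)" using y by (auto simp: hom_fibre)
    have g: "g = g'" using hmD[OF gh[OF gk]] hmD[OF gh[OF gk']] xy by auto
    moreover have "k = k'"
      using cart_eq[OF lift_chm[OF gA(1)[OF gk] b(1) gA(2)[OF gk]] gk(2)] gk'(2) xy g by simp
    ultimately show "x = y" by simp
  next
    note o = coprod_obj[OF u(1) b] and ua = F_arr[OF u(1)]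
    let ?c = "Cop u \<beta>"
    have L: "lft u ?c \<in> hm p u (pull u ?c) ?c" using lift_hm[OF ua o(1,2)] .
    fix q assume q: "?Q q"
    define g where "g = PArr p q"
    have qh: "q \<in> hm p g \<alpha> \<beta>" using q by (auto simp: hom_iff hm_def g_def)
    note [simp] = hmD[OF o(3)] hmD[OF o(4)] hmD[OF L] hmD[OF qh] hmD[OF h]
    have "u \<cdot> g = Ide B (ob \<alpha>)" using q comp_hm[OF qh o(4)] h by (auto simp: hm_def)
    hence gs: "g \<in> sections B u" using u b hmD[OF qh] by (simp add: sections_def hom_iff)
    have Lb: "lft g \<beta> \<in> Car g (pull g \<beta>) \<beta>" using lift_chm[of g \<beta>] by simp
    obtain k where k: "k \<in> Ver \<alpha> (pull g \<beta>)" "lft g \<beta> \<odot> k = q" using cart_vfill[OF Lb qh] by blast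
    have Lg: "lft g (pull u ?c) \<in> hm p g (pull g (pull u ?c)) (pull u ?c)"
      using lift_hm[of g "pull u ?c"] reind_obj(2)[OF ua o(1,2)] b(2) hmD[OF qh] hmD[OF L] by metis
    have ga: "g \<in> Arr B" "ob \<beta> = Cod B g" by auto
    note R = reindA[OF ga o(3)]
    note [simp] = hmD[OF chmD[OF Lb]] hmD[OF Lg] hmD[OF R(1)] hmD[OF k(1)]
    have "Lift2 B p u g ?c \<odot> reindA B p g (una u \<beta>) \<odot> k = Cin u \<beta> \<odot> (lft g \<beta> \<odot> k)"
      using E.pre[OF R(2), of k] by (simp add: Lift2_def cin_def)
    thus "\<exists>a. ?P a \<and> (case a of (g, k) => lft g \<beta> \<odot> k) = q"
      using gs k q by (intro exI[of _ "(g, k)"]) (simp add: hom_fibre)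
  qed
  note K = this
  define P where "P u \<beta> h \<longleftrightarrow> (\<exists>!gk. case gk of (g, k) => g \<in> sections B u \<and>
          k \<in> hom (fibre B p (ob \<alpha>)) \<alpha> (pull g \<beta>) \<and>
          h = Lift2 B p u g (Cop u \<beta>) \<odot> reindA B p g (una u \<beta>) \<odot> k)" for u \<beta> h
  define Q where "Q u \<beta> h \<longleftrightarrow> (\<exists>!k. k \<in> hom (Tot p) \<alpha> \<beta> \<and> Cin u \<beta> \<odot> k = h)" for u \<beta> h
  show ?thesis unfolding coprod_splitting_def P_def[symmetric] Q_def[symmetric]
    unfolding fibre_simps hom_fibre mem_Collect_eq
    using K[folded P_def Q_def] by blast
qed

lemma coprod_splitting_cproj:
  assumes a: "\<alpha> \<in> Ob"
  shows "coprod_splitting B F p \<alpha> \<longleftrightarrow> Cproj \<alpha>"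
proof
  assume "Cproj \<alpha>"
  thus "coprod_splitting B F p \<alpha>" unfolding coprod_splitting_iff[OF a] cproj_def
    using coprod_obj(4) cin_opcart by meson
next
  assume S: "coprod_splitting B F p \<alpha>"
  show "Cproj \<alpha>" unfolding cproj_def
  proof (intro ballI allI impI)
    fix v \<iota> b c h w assume v: "v \<in> F" and i: "\<iota> \<in> hm p v b c" "Opc \<iota>" and h: "h \<in> hm p w \<alpha> c"
    note [simp] = hmD[OF i(1)] hmD[OF h]
    obtain u g where P: "pbk w v u g" "u \<in> F" using F_pb[OF v, of w] by auto
    note P' = B.pb_sym[OF P(1)]
    note pd = is_pullbackD[OF P(1)]
    have X: "lft w c \<in> Car w (pull w c) c" and Y: "lft g b \<in> Car g (pull g b) b"
      using lift_chm pd by auto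
    have [simp]: "ob (pull w c) = ob \<alpha>" using hmD[OF chmD[OF X]] hmD[OF h] by metis
    note [simp] = hmD[OF chmD[OF X]] hmD[OF chmD[OF Y]] pd(1-8)
    have iy: "\<iota> \<odot> lft g b \<in> hm p (w \<cdot> u) (pull g b) c" using pd(9) by (simp add: hm_def)
    obtain \<iota>' where i': "\<iota>' \<in> hm p u (pull g b) (pull w c)" "lft w c \<odot> \<iota>' = \<iota> \<odot> lft g b"
      using cart_fill[OF X iy, of u] hmD[OF iy] by auto
    note [simp] = hmD[OF i'(1)]
    have oi: "Opc \<iota>'" using opcart_stable[OF P' v i X Y i'] .
    obtain h' where h': "h' \<in> Ver \<alpha> (pull w c)" "lft w c \<odot> h' = h" using cart_vfill[OF X h] by blast
    note [simp] = hmD[OF h'(1)]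
    let ?b = "pull g b"
    have b: "?b \<in> Ob" "ob ?b = Dom B u" by auto
    obtain j j' where j: "Iso (pull w c) (Cop u ?b) j j'" "j \<odot> \<iota>' = Cin u ?b" "j' \<odot> Cin u ?b = \<iota>'"
      using opcart_viso[OF i'(1) oi coprod_obj(4)[OF P(2) b] cin_opcart[OF P(2) b]] by blast
    have jh: "j \<in> Ver (pull w c) (Cop u ?b)" "j' \<in> Ver (Cop u ?b) (pull w c)"
      "j' \<odot> j = idt (pull w c)"
      using visoD[OF j(1)] by auto
    have jh': "j \<odot> h' \<in> Ver \<alpha> (Cop u ?b)" by (rule comp_vl[OF h'(1) jh(1)])
    note [simp] = hmD[OF jh(1)] hmD[OF jh(2)] hmD[OF coprod_obj(4)[OF P(2) b]]
    have "\<exists>!k. k \<in> hom (Tot p) \<alpha> ?b \<and> Cin u ?b \<odot> k = j \<odot> h'"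
      using S[unfolded coprod_splitting_iff[OF a]] P(2) b jh' by simp
    also have "(\<lambda>k. k \<in> hom (Tot p) \<alpha> ?b \<and> Cin u ?b \<odot> k = j \<odot> h') = (\<lambda>k. k \<in> hom (Tot p) \<alpha> ?b \<and> \<iota>' \<odot> k = h')"
    proof (rule ext)
      fix k
      have "Cin u ?b \<odot> k = j \<odot> h' \<longleftrightarrow> \<iota>' \<odot> k = h'" if "k \<in> hom (Tot p) \<alpha> ?b"
        using E.pre[OF j(3), of k] E.pre[OF j(2), of k] E.pre[OF jh(3), of h'] that by (auto simp: hom_iff)
      thus "(k \<in> hom (Tot p) \<alpha> ?b \<and> Cin u ?b \<odot> k = j \<odot> h') = (k \<in> hom (Tot p) \<alpha> ?b \<and> \<iota>' \<odot> k = h')" by blast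
    qed
    finally have ex: "\<exists>!k. k \<in> hom (Tot p) \<alpha> ?b \<and> \<iota>' \<odot> k = h'" .
    have "(\<exists>!k. k \<in> hom (Tot p) \<alpha> ?b \<and> \<iota>' \<odot> k = h') \<longleftrightarrow> (\<exists>!k. k \<in> hom (Tot p) \<alpha> b \<and> \<iota> \<odot> k = h)"
    proof (rule ex1_transfer[where m = "\<lambda>k. lft g b \<odot> k"])
      fix k assume k: "k \<in> hom (Tot p) \<alpha> ?b \<and> \<iota>' \<odot> k = h'"
      thus "lft g b \<odot> k \<in> hom (Tot p) \<alpha> b \<and> \<iota> \<odot> (lft g b \<odot> k) = h"
        using E.pre[OF i'(2), of k] h'(2) by (auto simp: hom_iff)
    next
      fix k assume k: "k \<in> hom (Tot p) \<alpha> b \<and> \<iota> \<odot> k = h"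
      hence kh: "k \<in> hm p (PArr p k) \<alpha> b" by (auto simp: hom_iff hm_def)
      from square_fill[OF P' X Y i(1) i'(1,2) kh h'(1)] k h'
      show "\<exists>a. (a \<in> hom (Tot p) \<alpha> ?b \<and> \<iota>' \<odot> a = h') \<and> lft g b \<odot> a = k" by auto
    next
      fix k l assume "k \<in> hom (Tot p) \<alpha> ?b \<and> \<iota>' \<odot> k = h'" "l \<in> hom (Tot p) \<alpha> ?b \<and> \<iota>' \<odot> l = h'"
      thus "k = l" using ex by blast
    qed
    thus "\<exists>!k. k \<in> hom (Tot p) \<alpha> b \<and> \<iota> \<odot> k = h" using ex by blast
  qed
qed

lemma cproj_viso:
  assumes "Cproj \<alpha>" and j: "Iso \<alpha> \<alpha>' j j'"
  shows "Cproj \<alpha>'"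
  unfolding cproj_def
proof (intro ballI allI impI)
  fix v \<iota> b c h w assume v: "v \<in> F" and i: "\<iota> \<in> hm p v b c" "Opc \<iota>" and h: "h \<in> hm p w \<alpha>' c"
  have jh: "j \<in> Ver \<alpha> \<alpha>'" "j' \<in> Ver \<alpha>' \<alpha>" "j' \<odot> j = idt \<alpha>" "j \<odot> j' = idt \<alpha>'"
    using visoD[OF j] by auto
  note [simp] = hmD[OF i(1)] hmD[OF h] hmD[OF jh(1)] hmD[OF jh(2)] vhmD[OF jh(1)]
  have "h \<odot> j \<in> hm p w \<alpha> c" by (simp add: hm_def)
  hence ex: "\<exists>!k. k \<in> hom (Tot p) \<alpha> b \<and> \<iota> \<odot> k = h \<odot> j" using assms(1) v i unfolding cproj_def by blast
  have "(\<exists>!k. k \<in> hom (Tot p) \<alpha>' b \<and> \<iota> \<odot> k = h) \<longleftrightarrow> (\<exists>!k. k \<in> hom (Tot p) \<alpha> b \<and> \<iota> \<odot> k = h \<odot> j)"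
  proof (rule ex1_transfer[where m = "\<lambda>k. k \<odot> j"])
    fix k assume "k \<in> hom (Tot p) \<alpha>' b \<and> \<iota> \<odot> k = h"
    thus "k \<odot> j \<in> hom (Tot p) \<alpha> b \<and> \<iota> \<odot> (k \<odot> j) = h \<odot> j"
      using E.assoc[of j k \<iota>] by (auto simp: hom_iff)
  next
    fix k l assume kl: "k \<in> hom (Tot p) \<alpha>' b \<and> \<iota> \<odot> k = h" "l \<in> hom (Tot p) \<alpha>' b \<and> \<iota> \<odot> l = h" "k \<odot> j = l \<odot> j"
    hence "k \<odot> j \<odot> j' = l \<odot> j \<odot> j'" by simp
    thus "k = l" using kl(1,2) jh(4) by (auto simp: hom_iff)
  next
    fix k assume k: "k \<in> hom (Tot p) \<alpha> b \<and> \<iota> \<odot> k = h \<odot> j"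
    have "\<iota> \<odot> (k \<odot> j') = h" using E.pre[of \<iota> k "h \<odot> j" j'] k jh(4) by (auto simp: hom_iff)
    thus "\<exists>a. (a \<in> hom (Tot p) \<alpha>' b \<and> \<iota> \<odot> a = h) \<and> a \<odot> j = k"
      using k jh(3) by (intro exI[of _ "k \<odot> j'"]) (auto simp: hom_iff)
  qed
  thus "\<exists>!k. k \<in> hom (Tot p) \<alpha>' b \<and> \<iota> \<odot> k = h" using ex by blast
qed

lemma coprod_qf_iff:
  assumes a: "\<alpha> \<in> Ob"
  shows "coprod_qf B F p \<alpha> \<longleftrightarrow> (\<forall>f c \<alpha>'. c \<in> Car f \<alpha>' \<alpha> --> Cproj \<alpha>')"
proof
  assume Q: "coprod_qf B F p \<alpha>"
  show "\<forall>f c \<alpha>'. c \<in> Car f \<alpha>' \<alpha> --> Cproj \<alpha>'"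
  proof (intro allI impI)
    fix f c \<alpha>' assume c: "c \<in> Car f \<alpha>' \<alpha>"
    note [simp] = hmD[OF chmD[OF c]]
    have L: "lft f \<alpha> \<in> Car f (pull f \<alpha>) \<alpha>" using lift_chm a by simp
    obtain j j' where "Iso (pull f \<alpha>) \<alpha>' j j'" using cart_viso[OF L c] by blast
    moreover have "Cproj (pull f \<alpha>)"
      using Q coprod_splitting_cproj[of "pull f \<alpha>"] hmD[OF chmD[OF L]] unfolding coprod_qf_def by auto
    ultimately show "Cproj \<alpha>'" using cproj_viso by blast
  qed
next
  assume Q: "\<forall>f c \<alpha>'. c \<in> Car f \<alpha>' \<alpha> --> Cproj \<alpha>'"
  show "coprod_qf B F p \<alpha>" unfolding coprod_qf_def
    using Q lift_chm a coprod_splitting_cproj reind_obj by metis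
qed

lemma coprod_qf_cproj:
  assumes "\<alpha> \<in> Ob" "coprod_qf B F p \<alpha>" shows "Cproj \<alpha>"
  using assms viso_cart[OF viso_ide[OF assms(1)]] unfolding coprod_qf_iff[OF assms(1)] by blast

lemma coprod_qf_cart:
  assumes "c \<in> Car f \<alpha>' \<alpha>" "coprod_qf B F p \<alpha>" shows "coprod_qf B F p \<alpha>'"
  using assms hmD[OF chmD[OF assms(1)]] cart_comp[OF assms(1)] coprod_qf_iff by meson

lemma coprod_qf_viso:
  assumes "Iso \<alpha>' \<alpha> j j'" "coprod_qf B F p \<alpha>" shows "coprod_qf B F p \<alpha>'"
  using coprod_qf_cart[OF viso_cart[OF assms(1)] assms(2)] .

end

section \<open>Stable products\<close>

lemma adjunction_from_universal:
  assumes C: "category C" and D: "category D" and L: "is_functor C D L"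
    and R: "\<And>b. b \<in> Obj D ==> R b \<in> Obj C" and E: "\<And>b. b \<in> Obj D ==> \<xi> b \<in> hom D (fobj L (R b)) b"
    and U: "\<And>a b f. a \<in> Obj C ==> b \<in> Obj D ==> f \<in> hom D (fobj L a) b ==>
       \<exists>!x. x \<in> hom C a (R b) \<and> \<xi> b \<cdot>\<^sub>D farr L x = f"
  shows "\<exists>T. adjunction C D T \<and> ladj T = L"
proof -
  interpret C: cat C by (rule cat.intro) fact
  interpret D: cat D by (rule cat.intro) fact
  define tr where "tr a b f = (THE x. x \<in> hom C a (R b) \<and> \<xi> b \<cdot>\<^sub>D farr L x = f)" for a b f
  have tr: "tr a b f \<in> hom C a (R b)" "\<xi> b \<cdot>\<^sub>D farr L (tr a b f) = f"
    if "a \<in> Obj C" "b \<in> Obj D" "f \<in> hom D (fobj L a) b" for a b f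
    using theI'[OF U[OF that]] by (auto simp: tr_def)
  have eqI: "x = y" if "a \<in> Obj C" "b \<in> Obj D" "x \<in> hom C a (R b)" "y \<in> hom C a (R b)"
     "\<xi> b \<cdot>\<^sub>D farr L x = \<xi> b \<cdot>\<^sub>D farr L y" for a b x y
  proof -
    have "farr L x \<in> hom D (fobj L a) (fobj L (R b))" using L that(3) by (auto simp: is_functor_def hom_iff)
    hence "\<xi> b \<cdot>\<^sub>D farr L x \<in> hom D (fobj L a) b" using E[OF that(2)] by (auto simp: hom_iff)
    from U[OF that(1,2) this] show ?thesis using that by metis
  qed
  have Lo: "fobj L a \<in> Obj D" if "a \<in> Obj C" for a using L that unfolding is_functor_def by blast
  have La: "farr L f \<in> hom D (fobj L a) (fobj L b)" if "f \<in> hom C a b" for f a b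
    using L that unfolding is_functor_def hom_def by blast
  have Lc: "farr L (g \<cdot>\<^sub>C f) = farr L g \<cdot>\<^sub>D farr L f" if "f \<in> hom C a b" "g \<in> hom C b c" for f g a b c
    using L that unfolding is_functor_def hom_def by auto
  have Li: "farr L (Ide C a) = Ide D (fobj L a)" if "a \<in> Obj C" for a
    using L that unfolding is_functor_def by blast
  have Ch: "g \<cdot>\<^sub>C f \<in> hom C a c" if "f \<in> hom C a b" "g \<in> hom C b c" for f g a b c
    using that by (auto simp: hom_iff)
  have Dh: "g \<cdot>\<^sub>D f \<in> hom D a c" if "f \<in> hom D a b" "g \<in> hom D b c" for f g a b c
    using that by (auto simp: hom_iff)
  have Da: "(h \<cdot>\<^sub>D g) \<cdot>\<^sub>D f = h \<cdot>\<^sub>D (g \<cdot>\<^sub>D f)" if "f \<in> hom D a b" "g \<in> hom D b c" "h \<in> hom D c d" for f g h a b c d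
    using that by (auto simp: hom_iff)
  define Ra where "Ra f = tr (R (Dom D f)) (Cod D f) (f \<cdot>\<^sub>D \<xi> (Dom D f))" for f
  have Rah: "Ra f \<in> hom C (R a) (R b)" "\<xi> b \<cdot>\<^sub>D farr L (Ra f) = f \<cdot>\<^sub>D \<xi> a" if f: "f \<in> hom D a b" for f a b
  proof -
    have o: "a \<in> Obj D" "b \<in> Obj D" using f by (auto simp: hom_iff)
    have "f \<cdot>\<^sub>D \<xi> a \<in> hom D (fobj L (R a)) b" using Dh[OF E[OF o(1)] f] .
    from tr[OF R[OF o(1)] o(2) this] f show "Ra f \<in> hom C (R a) (R b)" "\<xi> b \<cdot>\<^sub>D farr L (Ra f) = f \<cdot>\<^sub>D \<xi> a"
      by (auto simp: Ra_def hom_iff)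
  qed
  define \<eta> where "\<eta> a = tr a (fobj L a) (Ide D (fobj L a))" for a
  have eta: "\<eta> a \<in> hom C a (R (fobj L a))" "\<xi> (fobj L a) \<cdot>\<^sub>D farr L (\<eta> a) = Ide D (fobj L a)" if a: "a \<in> Obj C" for a
    using tr[OF a Lo[OF a], of "Ide D (fobj L a)"] Lo[OF a] by (auto simp: \<eta>_def hom_iff)
  define T where "T = \<lparr>ladj = L, radj = \<lparr>fobj = R, farr = Ra\<rparr>, aunit = \<eta>, acounit = \<xi>\<rparr>"
  have "is_functor D C \<lparr>fobj = R, farr = Ra\<rparr>"
  proof -
    have 1: "Ra (Ide D a) = Ide C (R a)" if a: "a \<in> Obj D" for a
    proof (rule eqI[OF R[OF a] a])
      have i: "Ide D a \<in> hom D a a" using a by (simp add: hom_iff)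
      show "Ra (Ide D a) \<in> hom C (R a) (R a)" by (rule Rah(1)[OF i])
      show "Ide C (R a) \<in> hom C (R a) (R a)" using R[OF a] by (simp add: hom_iff)
      show "\<xi> a \<cdot>\<^sub>D farr L (Ra (Ide D a)) = \<xi> a \<cdot>\<^sub>D farr L (Ide C (R a))"
        using Rah(2)[OF i] E[OF a] Li[OF R[OF a]] by (simp add: hom_iff)
    qed
    have 2: "Ra (g \<cdot>\<^sub>D f) = Ra g \<cdot>\<^sub>C Ra f" if f: "f \<in> hom D a b" and g: "g \<in> hom D b c" for f g a b c
    proof (rule eqI)
      have o: "a \<in> Obj D" "b \<in> Obj D" "c \<in> Obj D" using f g by (auto simp: hom_iff)
      show "R a \<in> Obj C" "c \<in> Obj D" using R o by auto
      show "Ra (g \<cdot>\<^sub>D f) \<in> hom C (R a) (R c)" by (rule Rah(1)[OF Dh[OF f g]])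
      show "Ra g \<cdot>\<^sub>C Ra f \<in> hom C (R a) (R c)" by (rule Ch[OF Rah(1)[OF f] Rah(1)[OF g]])
      note F = Rah[OF f] and G = Rah[OF g]
      have "\<xi> c \<cdot>\<^sub>D farr L (Ra g \<cdot>\<^sub>C Ra f) = (g \<cdot>\<^sub>D \<xi> b) \<cdot>\<^sub>D farr L (Ra f)"
        using Lc[OF F(1) G(1)] Da[OF La[OF F(1)] La[OF G(1)] E[OF o(3)]] G(2) by simp
      also have "\<dots> = (g \<cdot>\<^sub>D f) \<cdot>\<^sub>D \<xi> a"
        using Da[OF La[OF F(1)] E[OF o(2)] g] F(2) Da[OF E[OF o(1)] f g] by simp
      finally show "\<xi> c \<cdot>\<^sub>D farr L (Ra (g \<cdot>\<^sub>D f)) = \<xi> c \<cdot>\<^sub>D farr L (Ra g \<cdot>\<^sub>C Ra f)"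
        using Rah(2)[OF Dh[OF f g]] by simp
    qed
    show ?thesis unfolding is_functor_def using R Rah(1) 1 2 by (auto simp: hom_iff)
  qed
  moreover have "nat_trans C C id_func (comp_func \<lparr>fobj = R, farr = Ra\<rparr> L) \<eta>"
  proof -
    have "\<eta> b \<cdot>\<^sub>C f = Ra (farr L f) \<cdot>\<^sub>C \<eta> a" if f: "f \<in> hom C a b" for f a b
    proof (rule eqI)
      have o: "a \<in> Obj C" "b \<in> Obj C" using f by (auto simp: hom_iff)
      show "a \<in> Obj C" "fobj L b \<in> Obj D" using o Lo by auto
      show "\<eta> b \<cdot>\<^sub>C f \<in> hom C a (R (fobj L b))" by (rule Ch[OF f eta(1)[OF o(2)]])
      note F = Rah[OF La[OF f]]
      show "Ra (farr L f) \<cdot>\<^sub>C \<eta> a \<in> hom C a (R (fobj L b))" by (rule Ch[OF eta(1)[OF o(1)] F(1)])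
      have "\<xi> (fobj L b) \<cdot>\<^sub>D farr L (\<eta> b \<cdot>\<^sub>C f) = farr L f"
        using Lc[OF f eta(1)[OF o(2)]] Da[OF La[OF f] La[OF eta(1)[OF o(2)]] E[OF Lo[OF o(2)]]] eta(2)[OF o(2)] La[OF f]
        by (simp add: hom_iff)
      moreover have "\<xi> (fobj L b) \<cdot>\<^sub>D farr L (Ra (farr L f) \<cdot>\<^sub>C \<eta> a) = farr L f \<cdot>\<^sub>D (\<xi> (fobj L a) \<cdot>\<^sub>D farr L (\<eta> a))"
        using Lc[OF eta(1)[OF o(1)] F(1)] Da[OF La[OF eta(1)[OF o(1)]] La[OF F(1)] E[OF Lo[OF o(2)]]] F(2)
          Da[OF La[OF eta(1)[OF o(1)]] E[OF Lo[OF o(1)]] La[OF f]] by simp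
      ultimately show "\<xi> (fobj L b) \<cdot>\<^sub>D farr L (\<eta> b \<cdot>\<^sub>C f) = \<xi> (fobj L b) \<cdot>\<^sub>D farr L (Ra (farr L f) \<cdot>\<^sub>C \<eta> a)"
        using eta(2)[OF o(1)] La[OF f] by (simp add: hom_iff)
    qed
    thus ?thesis unfolding nat_trans_def using eta(1) by (auto simp: id_func_def comp_func_def hom_iff)
  qed
  moreover have "nat_trans D D (comp_func L \<lparr>fobj = R, farr = Ra\<rparr>) id_func \<xi>"
    unfolding nat_trans_def using E Rah(2) by (auto simp: id_func_def comp_func_def hom_iff)
  moreover have "Ra (\<xi> b) \<cdot>\<^sub>C \<eta> (R b) = Ide C (R b)" if b: "b \<in> Obj D" for b
  proof (rule eqI[OF R[OF b] b])
    note e = E[OF b] and h = eta[OF R[OF b]] and r = Rah[OF E[OF b]]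
    show "Ra (\<xi> b) \<cdot>\<^sub>C \<eta> (R b) \<in> hom C (R b) (R b)" by (rule Ch[OF h(1) r(1)])
    show "Ide C (R b) \<in> hom C (R b) (R b)" using R[OF b] by (simp add: hom_iff)
    have "\<xi> b \<cdot>\<^sub>D farr L (Ra (\<xi> b) \<cdot>\<^sub>C \<eta> (R b)) = \<xi> b \<cdot>\<^sub>D (\<xi> (fobj L (R b)) \<cdot>\<^sub>D farr L (\<eta> (R b)))"
      using Lc[OF h(1) r(1)] Da[OF La[OF h(1)] La[OF r(1)] e] r(2) Da[OF La[OF h(1)] E[OF Lo[OF R[OF b]]] e] by simp
    thus "\<xi> b \<cdot>\<^sub>D farr L (Ra (\<xi> b) \<cdot>\<^sub>C \<eta> (R b)) = \<xi> b \<cdot>\<^sub>D farr L (Ide C (R b))"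
      using h(2) Li[OF R[OF b]] by simp
  qed
  ultimately have "adjunction C D T" unfolding adjunction_def T_def using L eta(2) by simp
  thus ?thesis unfolding T_def by force
qed

definition pmed :: "('o, 'm, 'e, 'f) fibn => 'f => 'f => 'f => 'f => 'f => bool" where
  "pmed p \<pi> \<xi> \<pi>' e x \<longleftrightarrow> (\<exists>x' \<in> hm p (PArr p e) (Dom (Tot p) \<pi>') (Dom (Tot p) \<pi>).
      \<pi> \<odot>\<^sub>p x' = x \<odot>\<^sub>p \<pi>' \<and> \<xi> \<odot>\<^sub>p x' = e)"

definition ptest :: "('o, 'm) cat => ('o, 'm, 'e, 'f) fibn => 'f => 'f => 'm => 'm => 'm => bool" where
  "ptest B p \<pi> \<xi> w u g \<longleftrightarrow> (\<forall>\<pi>' N \<gamma> e. \<pi>' \<in> chm B p u N \<gamma> --> e \<in> hm p g N (Cod (Tot p) \<xi>) -->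
     (\<exists>!x. x \<in> hm p w \<gamma> (Cod (Tot p) \<pi>) \<and> pmed p \<pi> \<xi> \<pi>' e x))"

definition pcone :: "('o, 'm) cat => ('o, 'm, 'e, 'f) fibn => 'm => 'f => 'f => 'e => 'e => 'e => bool" where
  "pcone B p v \<pi> \<xi> M c \<beta> \<longleftrightarrow> \<pi> \<in> chm B p v M c \<and> \<xi> \<in> vhm B p M \<beta>"

text \<open>A cone \<open>c \<leftarrow> M \<rightarrow> \<beta>\<close> exhibiting \<open>c\<close> as the product of \<open>\<beta>\<close> along \<open>v\<close>: as an adjoint, and stably under pullback.\<close>

definition nprod :: "('o, 'm) cat => ('o, 'm, 'e, 'f) fibn => 'm => 'f => 'f => 'e => 'e => 'e => bool" where
  "nprod B p v \<pi> \<xi> M c \<beta> \<longleftrightarrow> pcone B p v \<pi> \<xi> M c \<beta> \<and> ptest B p \<pi> \<xi> (Ide B (Cod B v)) v (Ide B (Dom B v))"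

definition sprod :: "('o, 'm) cat => ('o, 'm, 'e, 'f) fibn => 'm => 'f => 'f => 'e => 'e => 'e => bool" where
  "sprod B p v \<pi> \<xi> M c \<beta> \<longleftrightarrow> pcone B p v \<pi> \<xi> M c \<beta> \<and> (\<forall>w u g. is_pullback B w v u g --> ptest B p \<pi> \<xi> w u g)"

context fib
begin

abbreviation "Test \<equiv> ptest B p"
abbreviation "Cone \<equiv> pcone B p"
abbreviation "Nprod \<equiv> nprod B p"
abbreviation "Sprod \<equiv> sprod B p"

lemma pconeD:
  assumes "Cone v \<pi> \<xi> M c \<beta>"
  shows "\<pi> \<in> Car v M c" "\<pi> \<in> hm p v M c" "\<xi> \<in> Ver M \<beta>" "ob \<beta> = ob M" "Ide B (ob M) = Ide B (Dom B v)"
    "ob M = Dom B v" "ob c = Cod B v"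
  using assms hmD[of \<pi> v M c] vhmD[of \<xi> M \<beta>] by (auto simp: pcone_def chmD)

lemma sprod_nprod:
  assumes "Sprod v \<pi> \<xi> M c \<beta>" shows "Nprod v \<pi> \<xi> M c \<beta>"
proof -
  have "v \<in> Arr B" using assms hmD chmD unfolding sprod_def pcone_def by metis
  from B.pb_ide[OF this] show ?thesis using assms by (simp add: sprod_def nprod_def)
qed

lemma pmed_ev:
  assumes C: "Cone v \<pi> \<xi> M c \<beta>" and k: "\<pi>' \<in> Car u N \<gamma>" and x: "x \<in> hm p w \<gamma> c"
    and g: "g \<in> Arr B" "Dom B g = ob N" "Cod B g = Dom B v" "v \<cdot> g = w \<cdot> u"
  obtains x' where "x' \<in> hm p g N M" "\<pi> \<odot> x' = x \<odot> \<pi>'"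
proof -
  have "x \<odot> \<pi>' \<in> hm p (w \<cdot> u) N c" by (rule comp_hm[OF chmD[OF k] x])
  thus ?thesis using cart_fill[OF pconeD(1)[OF C] _ g(1,2)] g pconeD(6)[OF C] that by metis
qed

lemma pmedI:
  assumes "Cone v \<pi> \<xi> M c \<beta>" "\<pi>' \<in> Car u N \<gamma>" "e \<in> hm p g N \<beta>" "x' \<in> hm p g N M"
    "\<pi> \<odot> x' = x \<odot> \<pi>'" "\<xi> \<odot> x' = e"
  shows "pmed p \<pi> \<xi> \<pi>' e x"
  unfolding pmed_def using assms hmD[OF chmD[OF assms(2)]] hmD[OF assms(3)] hmD[OF pconeD(2)[OF assms(1)]] by auto

lemma pmedE:
  assumes "Cone v \<pi> \<xi> M c \<beta>" "\<pi>' \<in> Car u N \<gamma>" "e \<in> hm p g N \<beta>" "pmed p \<pi> \<xi> \<pi>' e x"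
  obtains x' where "x' \<in> hm p g N M" "\<pi> \<odot> x' = x \<odot> \<pi>'" "\<xi> \<odot> x' = e"
  using assms hmD[OF chmD[OF assms(2)]] hmD[OF assms(3)] hmD[OF pconeD(2)[OF assms(1)]]
  unfolding pmed_def by auto

lemma ptestD:
  assumes "Cone v \<pi> \<xi> M c \<beta>" "Test \<pi> \<xi> w u g" "\<pi>' \<in> Car u N \<gamma>" "e \<in> hm p g N \<beta>"
  shows "\<exists>!x. x \<in> hm p w \<gamma> c \<and> pmed p \<pi> \<xi> \<pi>' e x"
  using assms hmD[OF pconeD(2)[OF assms(1)]] hmD[OF pconeD(3)[OF assms(1)]] unfolding ptest_def by simp

lemma pmed_change:
  assumes C: "Cone v \<pi> \<xi> M c \<beta>" and k: "\<pi>' \<in> Car u N \<gamma>" and e: "e \<in> hm p g N \<beta>"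
    and j: "j \<in> Ver N' N" and kj: "\<pi>' \<odot> j \<in> Car u N' \<gamma>" and x: "x \<in> hm p w \<gamma> c" and m: "pmed p \<pi> \<xi> \<pi>' e x"
  shows "pmed p \<pi> \<xi> (\<pi>' \<odot> j) (e \<odot> j) x"
proof -
  obtain x' where x': "x' \<in> hm p g N M" "\<pi> \<odot> x' = x \<odot> \<pi>'" "\<xi> \<odot> x' = e" using pmedE[OF C k e m] by blast
  show ?thesis
    by (rule pmedI[OF C kj comp_vr[OF j e] comp_vr[OF j x'(1)]])
      (use ac[OF j x'(1) pconeD(2)[OF C]] ac[OF j chmD[OF k] x] ac[OF j x'(1) pconeD(3)[OF C]] x' in simp_all)
qed

lemma ptestI:
  assumes C: "Cone v \<pi> \<xi> M c \<beta>" and u: "u \<in> Arr B" "Cod B u = Dom B w"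
    and T: "\<And>\<gamma>. \<gamma> \<in> Ob ==> ob \<gamma> = Dom B w ==> \<exists>\<pi>' N. \<pi>' \<in> Car u N \<gamma> \<and>
       (\<forall>e \<in> hm p g N \<beta>. \<exists>!x. x \<in> hm p w \<gamma> c \<and> pmed p \<pi> \<xi> \<pi>' e x)"
  shows "Test \<pi> \<xi> w u g"
  unfolding ptest_def
proof (intro allI impI)
  fix \<pi>2 N2 \<gamma> e assume k2: "\<pi>2 \<in> Car u N2 \<gamma>" and "e \<in> hm p g N2 (cd \<xi>)"
  hence e: "e \<in> hm p g N2 \<beta>" using hmD[OF pconeD(3)[OF C]] by simp
  obtain \<pi>' N where k: "\<pi>' \<in> Car u N \<gamma>" and ex: "\<forall>e \<in> hm p g N \<beta>. \<exists>!x. x \<in> hm p w \<gamma> c \<and> pmed p \<pi> \<xi> \<pi>' e x"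
    using T[of \<gamma>] hmD[OF chmD[OF k2]] u by metis
  obtain j j' where j: "Iso N N2 j j'" "\<pi>2 \<odot> j = \<pi>'" "\<pi>' \<odot> j' = \<pi>2" using cart_viso[OF k k2] by blast
  have jh: "j \<in> Ver N N2" "j' \<in> Ver N2 N" "j \<odot> j' = idt N2" using visoD[OF j(1)] by auto
  have ej: "e \<odot> j \<in> hm p g N \<beta>" by (rule comp_vr[OF jh(1) e])
  have ejj: "e \<odot> j \<odot> j' = e" using ac[OF jh(2,1) e] jh(3) idr[OF e] by simp
  have "pmed p \<pi> \<xi> \<pi>2 e x \<longleftrightarrow> pmed p \<pi> \<xi> \<pi>' (e \<odot> j) x" if x: "x \<in> hm p w \<gamma> c" for x
    using pmed_change[OF C k2 e jh(1) _ x] pmed_change[OF C k ej jh(2) _ x] k k2 j ejj by auto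
  hence "(\<exists>!x. x \<in> hm p w \<gamma> c \<and> pmed p \<pi> \<xi> \<pi>2 e x) \<longleftrightarrow> (\<exists>!x. x \<in> hm p w \<gamma> c \<and> pmed p \<pi> \<xi> \<pi>' (e \<odot> j) x)" by metis
  thus "\<exists>!x. x \<in> hm p w \<gamma> (cd \<pi>) \<and> pmed p \<pi> \<xi> \<pi>2 e x"
    using ex ej hmD[OF pconeD(2)[OF C]] by simp
qed

lemma ptest_viso:
  assumes C: "Cone v \<pi> \<xi> M c \<beta>" and C2: "Cone v \<pi>2 \<xi>2 M2 c2 \<beta>2"
    and j: "Iso c c2 j j'" and m: "Iso M M2 m m'" and n: "Iso \<beta> \<beta>2 n n'"
    and e1: "\<pi>2 \<odot> m = j \<odot> \<pi>" and e2: "\<xi>2 \<odot> m = n \<odot> \<xi>" and T: "Test \<pi> \<xi> w u g"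
  shows "Test \<pi>2 \<xi>2 w u g"
  unfolding ptest_def
proof (intro allI impI)
  fix \<pi>' N \<gamma> e assume k: "\<pi>' \<in> Car u N \<gamma>" and "e \<in> hm p g N (cd \<xi>2)"
  hence e: "e \<in> hm p g N \<beta>2" using hmD[OF pconeD(3)[OF C2]] by simp
  have jh: "j \<in> Ver c c2" "j' \<in> Ver c2 c" "j' \<odot> j = idt c" "j \<odot> j' = idt c2"
    and mh: "m \<in> Ver M M2" "m' \<in> Ver M2 M" "m' \<odot> m = idt M" "m \<odot> m' = idt M2"
    and nh: "n \<in> Ver \<beta> \<beta>2" "n' \<in> Ver \<beta>2 \<beta>" "n' \<odot> n = idt \<beta>" "n \<odot> n' = idt \<beta>2"
    using visoD[OF j] visoD[OF m] visoD[OF n] by auto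
  note K = pconeD(2)[OF C] pconeD(3)[OF C] pconeD(2)[OF C2] pconeD(3)[OF C2]
  have n'e: "n' \<odot> e \<in> hm p g N \<beta>" by (rule comp_vl[OF e nh(2)])
  have 1: "pmed p \<pi>2 \<xi>2 \<pi>' e (j \<odot> x)" if x: "x \<in> hm p w \<gamma> c" and p: "pmed p \<pi> \<xi> \<pi>' (n' \<odot> e) x" for x
  proof -
    obtain x' where x': "x' \<in> hm p g N M" "\<pi> \<odot> x' = x \<odot> \<pi>'" "\<xi> \<odot> x' = n' \<odot> e" using pmedE[OF C k n'e p] by blast
    show ?thesis
    proof (rule pmedI[OF C2 k e comp_vl[OF x'(1) mh(1)]])
      show "\<pi>2 \<odot> (m \<odot> x') = j \<odot> x \<odot> \<pi>'"
        using ac[OF x'(1) mh(1) K(3)] e1 ac[OF x'(1) K(1) jh(1)] x'(2) ac[OF chmD[OF k] x jh(1)] by simp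
      show "\<xi>2 \<odot> (m \<odot> x') = e"
        using ac[OF x'(1) mh(1) K(4)] e2 ac[OF x'(1) K(2) nh(1)] x'(3) ac[OF e nh(2,1)] nh(4) idl[OF e] by simp
    qed
  qed
  have 2: "pmed p \<pi> \<xi> \<pi>' (n' \<odot> e) (j' \<odot> x)" if x: "x \<in> hm p w \<gamma> c2" and p: "pmed p \<pi>2 \<xi>2 \<pi>' e x" for x
  proof -
    obtain x' where x': "x' \<in> hm p g N M2" "\<pi>2 \<odot> x' = x \<odot> \<pi>'" "\<xi>2 \<odot> x' = e" using pmedE[OF C2 k e p] by blast
    have 3: "m \<odot> (m' \<odot> x') = x'" using ac[OF x'(1) mh(2,1)] mh(4) idl[OF x'(1)] by simp
    note mx = comp_vl[OF x'(1) mh(2)]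
    show ?thesis
    proof (rule pmedI[OF C k n'e mx])
      have "j \<odot> (\<pi> \<odot> (m' \<odot> x')) = \<pi>2 \<odot> (m \<odot> (m' \<odot> x'))"
        using ac[OF mx mh(1) K(3)] ac[OF mx K(1) jh(1)] e1 by simp
      also have "\<dots> = x \<odot> \<pi>'" using 3 x'(2) by simp
      finally have "j' \<odot> (j \<odot> (\<pi> \<odot> (m' \<odot> x'))) = j' \<odot> (x \<odot> \<pi>')" by simp
      thus "\<pi> \<odot> (m' \<odot> x') = j' \<odot> x \<odot> \<pi>'"
        using ac[OF comp_hm[OF mx K(1)] jh(1,2)] jh(3) idl[OF comp_hm[OF mx K(1)]] ac[OF chmD[OF k] x jh(2)] by simp
      have "n \<odot> (\<xi> \<odot> (m' \<odot> x')) = \<xi>2 \<odot> (m \<odot> (m' \<odot> x'))"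
        using ac[OF mx mh(1) K(4)] ac[OF mx K(2) nh(1)] e2 by simp
      also have "\<dots> = e" using 3 x'(3) by simp
      finally have "n' \<odot> (n \<odot> (\<xi> \<odot> (m' \<odot> x'))) = n' \<odot> e" by simp
      thus "\<xi> \<odot> (m' \<odot> x') = n' \<odot> e"
        using ac[OF comp_hm[OF mx K(2)] nh(1,2)] nh(3) idl[OF comp_hm[OF mx K(2)]] by simp
    qed
  qed
  have "(\<exists>!x. x \<in> hm p w \<gamma> c2 \<and> pmed p \<pi>2 \<xi>2 \<pi>' e x) \<longleftrightarrow> (\<exists>!x. x \<in> hm p w \<gamma> c \<and> pmed p \<pi> \<xi> \<pi>' (n' \<odot> e) x)"
  proof (rule ex1_transfer[where m = "\<lambda>x. j' \<odot> x"])
    fix x assume "x \<in> hm p w \<gamma> c2 \<and> pmed p \<pi>2 \<xi>2 \<pi>' e x"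
    thus "j' \<odot> x \<in> hm p w \<gamma> c \<and> pmed p \<pi> \<xi> \<pi>' (n' \<odot> e) (j' \<odot> x)" using 2 comp_vl[OF _ jh(2)] by blast
  next
    fix x y assume a: "x \<in> hm p w \<gamma> c2 \<and> pmed p \<pi>2 \<xi>2 \<pi>' e x" "y \<in> hm p w \<gamma> c2 \<and> pmed p \<pi>2 \<xi>2 \<pi>' e y" "j' \<odot> x = j' \<odot> y"
    hence "j \<odot> (j' \<odot> x) = j \<odot> (j' \<odot> y)" by simp
    thus "x = y" using ac[OF conjunct1[OF a(1)] jh(2,1)] ac[OF conjunct1[OF a(2)] jh(2,1)] jh(4)
      idl[OF conjunct1[OF a(1)]] idl[OF conjunct1[OF a(2)]] by simp
  next
    fix x assume x: "x \<in> hm p w \<gamma> c \<and> pmed p \<pi> \<xi> \<pi>' (n' \<odot> e) x"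
    hence "j \<odot> x \<in> hm p w \<gamma> c2" "pmed p \<pi>2 \<xi>2 \<pi>' e (j \<odot> x)" using 1 comp_vl[OF _ jh(1)] by blast+
    moreover have "j' \<odot> (j \<odot> x) = x" using ac[OF conjunct1[OF x] jh(1,2)] jh(3) idl[OF conjunct1[OF x]] by simp
    ultimately show "\<exists>a. (a \<in> hm p w \<gamma> c2 \<and> pmed p \<pi>2 \<xi>2 \<pi>' e a) \<and> j' \<odot> a = x" by blast
  qed
  thus "\<exists>!x. x \<in> hm p w \<gamma> (cd \<pi>2) \<and> pmed p \<pi>2 \<xi>2 \<pi>' e x"
    using ptestD[OF C T k n'e] hmD[OF K(3)] by simp
qed

lemma nprod_uniqueE:
  assumes P1: "Nprod v \<pi> \<xi> M c \<beta>" and P2: "Nprod v \<pi>2 \<xi>2 M2 c2 \<beta>"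
  obtains j j' m m' where "Iso c c2 j j'" "Iso M M2 m m'" "\<pi>2 \<odot> m = j \<odot> \<pi>" "\<xi>2 \<odot> m = \<xi>"
     "\<pi> \<odot> m' = j' \<odot> \<pi>2" "\<xi> \<odot> m' = \<xi>2"
proof -
  have med: "\<exists>j m. j \<in> Ver c c2 \<and> m \<in> Ver M M2 \<and> \<pi>2 \<odot> m = j \<odot> \<pi> \<and> \<xi>2 \<odot> m = \<xi>"
    if P1: "Nprod v \<pi> \<xi> M c \<beta>" and P2: "Nprod v \<pi>2 \<xi>2 M2 c2 \<beta>" for \<pi> \<pi>2 \<xi> \<xi>2 M M2 c c2
  proof -
    have C: "Cone v \<pi> \<xi> M c \<beta>" and C2: "Cone v \<pi>2 \<xi>2 M2 c2 \<beta>" and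
      T: "Test \<pi>2 \<xi>2 (Ide B (Cod B v)) v (Ide B (Dom B v))" using P1 P2 by (auto simp: nprod_def)
    obtain j where j: "j \<in> hm p (Ide B (Cod B v)) c c2" "pmed p \<pi>2 \<xi>2 \<pi> \<xi> j"
      using ptestD[OF C2 T pconeD(1)[OF C] pconeD(3)[OF C, unfolded pconeD(5)[OF C]]] by blast
    obtain m where "m \<in> hm p (Ide B (Dom B v)) M M2" "\<pi>2 \<odot> m = j \<odot> \<pi>" "\<xi>2 \<odot> m = \<xi>"
      using pmedE[OF C2 pconeD(1)[OF C] pconeD(3)[OF C, unfolded pconeD(5)[OF C]] j(2)] by blast
    thus ?thesis using j(1) pconeD(5-7)[OF C] by auto
  qed
  have uni: "j = idt c \<and> m = idt M" if P1: "Nprod v \<pi> \<xi> M c \<beta>"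
     and j: "j \<in> Ver c c" and m: "m \<in> Ver M M" and e: "\<pi> \<odot> m = j \<odot> \<pi>" "\<xi> \<odot> m = \<xi>" for \<pi> \<xi> M c j m
  proof -
    have C: "Cone v \<pi> \<xi> M c \<beta>" and
      T: "Test \<pi> \<xi> (Ide B (Cod B v)) v (Ide B (Dom B v))" using P1 by (auto simp: nprod_def)
    note K = pconeD(2)[OF C] pconeD(3)[OF C]
    have ee: "\<xi> \<in> hm p (Ide B (Dom B v)) M \<beta>" using K(2) pconeD(5)[OF C] by simp
    have Ih: "idt M \<in> Ver M M" "idt c \<in> Ver c c" using hmD[OF K(1)] by simp_all
    have "pmed p \<pi> \<xi> \<pi> \<xi> j"
      by (rule pmedI[OF C pconeD(1)[OF C] ee _ e]) (use m pconeD(5)[OF C] in simp)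
    moreover have "pmed p \<pi> \<xi> \<pi> \<xi> (idt c)"
      by (rule pmedI[OF C pconeD(1)[OF C] ee, of "idt M"])
        (use Ih pconeD(5)[OF C] idl[OF K(1)] idr[OF K(1)] idr[OF K(2)] in simp_all)
    ultimately have "j = idt c" using ptestD[OF C T pconeD(1)[OF C] ee] j Ih(2) pconeD(7)[OF C] by auto
    moreover hence "m = idt M" using cart_eq[OF pconeD(1)[OF C] m Ih(1)] e(1) idl[OF K(1)] idr[OF K(1)] by simp
    ultimately show ?thesis by blast
  qed
  obtain j m where jm: "j \<in> Ver c c2" "m \<in> Ver M M2" "\<pi>2 \<odot> m = j \<odot> \<pi>" "\<xi>2 \<odot> m = \<xi>" using med[OF P1 P2] by blast
  obtain j' m' where jm': "j' \<in> Ver c2 c" "m' \<in> Ver M2 M" "\<pi> \<odot> m' = j' \<odot> \<pi>2" "\<xi> \<odot> m' = \<xi>2" using med[OF P2 P1] by blast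
  have C: "Cone v \<pi> \<xi> M c \<beta>" and C2: "Cone v \<pi>2 \<xi>2 M2 c2 \<beta>" using P1 P2 by (auto simp: nprod_def)
  note K = pconeD(2)[OF C] pconeD(3)[OF C] pconeD(2)[OF C2] pconeD(3)[OF C2]
  have "j' \<odot> j = idt c \<and> m' \<odot> m = idt M"
    by (rule uni[OF P1 comp_vl[OF jm(1) jm'(1)] comp_vl[OF jm(2) jm'(2)]])
      (use ac[OF jm(2) jm'(2) K(1)] ac[OF jm(2) K(3) jm'(1)] ac[OF K(1) jm(1) jm'(1)] ac[OF jm(2) jm'(2) K(2)] jm jm' in simp_all)
  moreover have "j \<odot> j' = idt c2 \<and> m \<odot> m' = idt M2"
    by (rule uni[OF P2 comp_vl[OF jm'(1) jm(1)] comp_vl[OF jm'(2) jm(2)]])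
      (use ac[OF jm'(2) jm(2) K(3)] ac[OF jm'(2) K(1) jm(1)] ac[OF K(3) jm'(1) jm(1)] ac[OF jm'(2) jm(2) K(4)] jm jm' in simp_all)
  ultimately show ?thesis using that[of j j' m m'] jm jm' unfolding viso_def by blast
qed

lemma nprod_sprod:
  assumes P1: "Nprod v \<pi> \<xi> M c \<beta>" and P2: "Sprod v \<pi>2 \<xi>2 M2 c2 \<beta>"
  shows "Sprod v \<pi> \<xi> M c \<beta>"
proof -
  obtain j j' m m' where j: "Iso c2 c j j'" "Iso M2 M m m'" "\<pi> \<odot> m = j \<odot> \<pi>2" "\<xi> \<odot> m = \<xi>2"
    using nprod_uniqueE[OF sprod_nprod[OF P2] P1] by metis
  have C: "Cone v \<pi> \<xi> M c \<beta>" and C2: "Cone v \<pi>2 \<xi>2 M2 c2 \<beta>" using P1 P2 by (auto simp: nprod_def sprod_def)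
  note b = hmD[OF pconeD(3)[OF C]]
  have "\<xi> \<odot> m = idt \<beta> \<odot> \<xi>2" using j(4) idl[OF pconeD(3)[OF C2]] by simp
  thus ?thesis using ptest_viso[OF C2 C j(1,2) viso_ide j(3)] b P2 C unfolding sprod_def by blast
qed

lemma nprod_viso:
  assumes P: "Nprod v \<pi> \<xi> M c \<beta>" and C2: "Cone v \<pi>2 \<xi>2 M2 c2 \<beta>2"
    and "Iso c c2 j j'" and "Iso M M2 m m'" and "Iso \<beta> \<beta>2 n n'"
    and "\<pi>2 \<odot> m = j \<odot> \<pi>" and "\<xi>2 \<odot> m = n \<odot> \<xi>"
  shows "Nprod v \<pi>2 \<xi>2 M2 c2 \<beta>2"
  using ptest_viso[OF _ C2 assms(3-7)] P C2 unfolding nprod_def by blast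

lemma nprod_post:
  assumes N: "Nprod v \<pi> \<xi> M c \<beta>" and n: "Iso \<beta> \<beta>2 n n'"
  shows "Nprod v \<pi> (n \<odot> \<xi>) M c \<beta>2"
proof -
  have C: "Cone v \<pi> \<xi> M c \<beta>" using N by (simp add: nprod_def)
  note K = pconeD(2)[OF C] pconeD(3)[OF C]
  have "n \<in> Ver \<beta> \<beta>2" using visoD[OF n] by blast
  hence ne: "n \<odot> \<xi> \<in> Ver M \<beta>2" using comp_vl[OF K(2)] pconeD(4)[OF C] by simp
  have C2: "Cone v \<pi> (n \<odot> \<xi>) M c \<beta>2" unfolding pcone_def using pconeD(1)[OF C] ne by blast
  have o: "c \<in> Ob" "M \<in> Ob" using hmD[OF K(1)] by blast+
  show ?thesis
    by (rule nprod_viso[OF N C2 viso_ide[OF o(1)] viso_ide[OF o(2)] n]) (simp_all only: idr[OF K(1)] idl[OF K(1)] idr[OF ne])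
qed

lemma pmed_restrict:
  assumes C: "Cone v \<pi> \<xi> M c \<beta>" and wv: "w \<cdot> u = v \<cdot> g"
    and X: "\<chi> \<in> Car w c' c" and k: "\<pi>' \<in> Car u M' c'" and m: "m \<in> hm p g M' M" "\<pi> \<odot> m = \<chi> \<odot> \<pi>'"
    and Y: "\<psi> \<in> Car g \<beta>' \<beta>" and e: "\<xi>' \<in> Ver M' \<beta>'" "\<psi> \<odot> \<xi>' = \<xi> \<odot> m"
    and k2: "\<pi>2 \<in> Car u2 N \<gamma>" and f: "f \<in> hm p g2 N \<beta>'" and x: "x \<in> hm p w2 \<gamma> c'" and wu: "w2 \<cdot> u2 = u \<cdot> g2"
  shows "pmed p \<pi>' \<xi>' \<pi>2 f x \<longleftrightarrow> pmed p \<pi> \<xi> \<pi>2 (\<psi> \<odot> f) (\<chi> \<odot> x)"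
proof
  have C': "Cone u \<pi>' \<xi>' M' c' \<beta>'" using k e by (simp add: pcone_def)
  note K = pconeD(2)[OF C] pconeD(3)[OF C] chmD[OF k] chmD[OF X] chmD[OF Y]
  have Yf: "\<psi> \<odot> f \<in> hm p (g \<cdot> g2) N \<beta>" by (rule comp_hm[OF f K(5)])
  have mc: "m \<in> Car g M' M"
    by (rule cart_cancel[OF pconeD(1)[OF C] m(1)]) (use cart_comp[OF X k] m(2) in simp)
  { assume px: "pmed p \<pi>' \<xi>' \<pi>2 f x"
    obtain x' where x': "x' \<in> hm p g2 N M'" "\<pi>' \<odot> x' = x \<odot> \<pi>2" "\<xi>' \<odot> x' = f" using pmedE[OF C' k2 f px] by blast
    show "pmed p \<pi> \<xi> \<pi>2 (\<psi> \<odot> f) (\<chi> \<odot> x)"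
      by (rule pmedI[OF C k2 Yf comp_hm[OF x'(1) m(1)]])
       (use ac[OF x'(1) m(1) K(1)] ac[OF x'(1) K(3,4)] ac[OF chmD[OF k2] x K(4)] ac[OF x'(1) m(1) K(2)] ac[OF x'(1) e(1) K(5)] x' m(2) e(2)
        in simp_all) }
  assume px: "pmed p \<pi> \<xi> \<pi>2 (\<psi> \<odot> f) (\<chi> \<odot> x)"
  obtain y where y: "y \<in> hm p (g \<cdot> g2) N M" "\<pi> \<odot> y = \<chi> \<odot> x \<odot> \<pi>2" "\<xi> \<odot> y = \<psi> \<odot> f" using pmedE[OF C k2 Yf px] by blast
  have g2: "g2 \<in> Arr B" "Dom B g2 = ob N" "Cod B g2 = ob M'" using hmD[OF f] vhmD[OF e(1)] by auto
  obtain x' where x': "x' \<in> hm p g2 N M'" "m \<odot> x' = y" using cart_fill[OF mc y(1) g2] by blast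
  have "\<chi> \<odot> (\<pi>' \<odot> x') = \<chi> \<odot> (x \<odot> \<pi>2)"
    using ac[OF x'(1) K(3,4)] m(2) ac[OF x'(1) m(1) K(1)] x'(2) y(2) ac[OF chmD[OF k2] x K(4)] by simp
  hence a: "\<pi>' \<odot> x' = x \<odot> \<pi>2"
    using cart_eq[OF X comp_hm[OF x'(1) K(3)]] comp_hm[OF chmD[OF k2] x] wu by simp
  have "\<psi> \<odot> (\<xi>' \<odot> x') = \<psi> \<odot> f"
    using ac[OF x'(1) e(1) K(5)] e(2) ac[OF x'(1) m(1) K(2)] x'(2) y(3) by simp
  hence "\<xi>' \<odot> x' = f" using cart_eq[OF Y comp_vl[OF x'(1) _] f] e(1) vhmD[OF e(1)] pconeD[OF C'] by simp
  thus "pmed p \<pi>' \<xi>' \<pi>2 f x" by (rule pmedI[OF C' k2 f x'(1) a])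
qed

lemma sprod_restrict:
  assumes S: "Sprod v \<pi> \<xi> M c \<beta>" and P: "pbk w v u g"
    and X: "\<chi> \<in> Car w c' c" and k: "\<pi>' \<in> Car u M' c'" and m: "m \<in> hm p g M' M" "\<pi> \<odot> m = \<chi> \<odot> \<pi>'"
    and Y: "\<psi> \<in> Car g \<beta>' \<beta>" and e: "\<xi>' \<in> Ver M' \<beta>'" "\<psi> \<odot> \<xi>' = \<xi> \<odot> m"
  shows "Sprod u \<pi>' \<xi>' M' c' \<beta>'"
  unfolding sprod_def
proof (intro conjI allI impI)
  show C': "Cone u \<pi>' \<xi>' M' c' \<beta>'" using k e by (simp add: pcone_def)
  have C: "Cone v \<pi> \<xi> M c \<beta>" using S by (simp add: sprod_def)
  note pd = is_pullbackD[OF P]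
  fix w2 u2 g2 assume P2: "pbk w2 u u2 g2"
  note pd2 = is_pullbackD[OF P2]
  have PP: "pbk (w \<cdot> w2) v u2 (g \<cdot> g2)" by (rule B.pb_paste[OF P P2])
  have T: "Test \<pi> \<xi> (w \<cdot> w2) u2 (g \<cdot> g2)" using S PP by (simp add: sprod_def)
  note K = pconeD(2)[OF C] pconeD(3)[OF C] chmD[OF k] chmD[OF X] chmD[OF Y]
  show "Test \<pi>' \<xi>' w2 u2 g2" unfolding ptest_def
  proof (intro allI impI)
    fix \<pi>2 N \<gamma> f assume k2: "\<pi>2 \<in> Car u2 N \<gamma>" and "f \<in> hm p g2 N (cd \<xi>')"
    hence f: "f \<in> hm p g2 N \<beta>'" using hmD[OF e(1)] by simp
    have Yf: "\<psi> \<odot> f \<in> hm p (g \<cdot> g2) N \<beta>" by (rule comp_hm[OF f K(5)])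
    note og = hmD[OF chmD[OF k2]]
    have 1: "pmed p \<pi> \<xi> \<pi>2 (\<psi> \<odot> f) (\<chi> \<odot> x)" if x: "x \<in> hm p w2 \<gamma> c'" and px: "pmed p \<pi>' \<xi>' \<pi>2 f x" for x
      using pmed_restrict[OF C pd(9) X k m Y e k2 f x pd2(9)] px by blast
    have 2: "pmed p \<pi>' \<xi>' \<pi>2 f x" if x: "x \<in> hm p w2 \<gamma> c'" and px: "pmed p \<pi> \<xi> \<pi>2 (\<psi> \<odot> f) (\<chi> \<odot> x)" for x
      using pmed_restrict[OF C pd(9) X k m Y e k2 f x pd2(9)] px by blast
    have "(\<exists>!x. x \<in> hm p w2 \<gamma> c' \<and> pmed p \<pi>' \<xi>' \<pi>2 f x) \<longleftrightarrow> (\<exists>!x. x \<in> hm p (w \<cdot> w2) \<gamma> c \<and> pmed p \<pi> \<xi> \<pi>2 (\<psi> \<odot> f) x)"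
    proof (rule ex1_transfer[where m = "\<lambda>x. \<chi> \<odot> x"])
      fix x assume "x \<in> hm p w2 \<gamma> c' \<and> pmed p \<pi>' \<xi>' \<pi>2 f x"
      thus "\<chi> \<odot> x \<in> hm p (w \<cdot> w2) \<gamma> c \<and> pmed p \<pi> \<xi> \<pi>2 (\<psi> \<odot> f) (\<chi> \<odot> x)" using 1 comp_hm[OF _ K(4)] by blast
    next
      fix x y assume "x \<in> hm p w2 \<gamma> c' \<and> pmed p \<pi>' \<xi>' \<pi>2 f x" "y \<in> hm p w2 \<gamma> c' \<and> pmed p \<pi>' \<xi>' \<pi>2 f y" "\<chi> \<odot> x = \<chi> \<odot> y"
      thus "x = y" using cart_eq[OF X] by blast
    next
      fix x assume x: "x \<in> hm p (w \<cdot> w2) \<gamma> c \<and> pmed p \<pi> \<xi> \<pi>2 (\<psi> \<odot> f) x"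
      have w2: "w2 \<in> Arr B" "Dom B w2 = ob \<gamma>" "Cod B w2 = ob c'" using og hmD[OF K(4)] pd2 pd by auto
      obtain y where "y \<in> hm p w2 \<gamma> c'" "\<chi> \<odot> y = x" using cart_fill[OF X conjunct1[OF x] w2] by blast
      thus "\<exists>a. (a \<in> hm p w2 \<gamma> c' \<and> pmed p \<pi>' \<xi>' \<pi>2 f a) \<and> \<chi> \<odot> a = x" using 2 x by blast
    qed
    thus "\<exists>!x. x \<in> hm p w2 \<gamma> (cd \<pi>') \<and> pmed p \<pi>' \<xi>' \<pi>2 f x"
      using ptestD[OF C T k2 Yf] hmD[OF K(3)] by simp
  qed
qed

end

section \<open>Splitting of products\<close>

text \<open>For \<open>\<chi>\<close> into the apex of the cone \<open>(\<pi>, \<xi>)\<close>, \<open>psol B p \<pi> \<xi> \<chi> h l k\<close> says that \<open>h\<close> factors through the component of \<open>\<chi>\<close> at the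
  base map of the cartesian arrow \<open>l\<close>, with second factor \<open>k\<close>. For \<open>\<chi>\<close> an identity this is the factorisation
  in \<open>prod_splitting\<close>; arbitrary \<open>\<chi>\<close> allow base change.\<close>

definition psol :: "('o, 'm) cat => ('o, 'm, 'e, 'f) fibn => 'f => 'f => 'f => 'f => 'f => 'f => bool" where
  "psol B p \<pi> \<xi> \<chi> h l k \<longleftrightarrow> (\<exists>x e. x \<in> hm p (PArr p l) (Dom (Tot p) \<chi>) (Dom (Tot p) \<pi>) \<and> \<pi> \<odot>\<^sub>p x = \<chi> \<and>
     e \<in> vhm B p (Dom (Tot p) \<chi>) (Dom (Tot p) l) \<and> l \<odot>\<^sub>p e = \<xi> \<odot>\<^sub>p x \<and>
     k \<in> hm p (PArr p h) (Dom (Tot p) l) (Cod (Tot p) h) \<and> k \<odot>\<^sub>p e = h)"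

definition psplit :: "('o, 'm) cat => ('o, 'm, 'e, 'f) fibn => 'f => 'f => 'f => 'f => bool" where
  "psplit B p \<pi> \<xi> \<chi> h \<longleftrightarrow>
     (\<exists>g b l k. l \<in> chm B p g b (Cod (Tot p) \<xi>) \<and> psol B p \<pi> \<xi> \<chi> h l k) \<and>
     (\<forall>g b l k g' b' l' k'. l \<in> chm B p g b (Cod (Tot p) \<xi>) --> psol B p \<pi> \<xi> \<chi> h l k -->
        l' \<in> chm B p g' b' (Cod (Tot p) \<xi>) --> psol B p \<pi> \<xi> \<chi> h l' k' --> g = g' \<and> (l = l' --> k = k'))"

definition prod_ok :: "('o, 'm) cat => ('o, 'm, 'e, 'f) fibn => 'm => bool" where
  "prod_ok B p v \<longleftrightarrow> v \<in> Arr B \<and> adjunction (fibre B p (Cod B v)) (fibre B p (Dom B v)) (prod_adj B p v) \<and>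
     ladj (prod_adj B p v) = reindex B p v"

lemma prod_okI:
  assumes "\<exists>T. adjunction (fibre B p (Cod B v)) (fibre B p (Dom B v)) T \<and> ladj T = reindex B p v" "v \<in> Arr B"
  shows "prod_ok B p v"
  using someI_ex[OF assms(1)] assms(2) unfolding prod_adj_def prod_ok_def by blast

context fib
begin

abbreviation "Sol \<equiv> psol B p"
abbreviation "Split \<equiv> psplit B p"
abbreviation "Ok \<equiv> prod_ok B p"

lemma prod_obj:
  assumes "Ok v" "\<beta> \<in> Ob" "ob \<beta> = Dom B v"
  shows "Prd v \<beta> \<in> Ob" "ob (Prd v \<beta>) = Cod B v"
    "cou v \<beta> \<in> Ver (pull v (Prd v \<beta>)) \<beta>"
    "Cone v (lft v (Prd v \<beta>)) (cou v \<beta>)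
        (pull v (Prd v \<beta>)) (Prd v \<beta>) \<beta>"
proof -
  have A: "v \<in> Arr B" "adjunction (fibre B p (Cod B v)) (fibre B p (Dom B v)) (prod_adj B p v)"
    "ladj (prod_adj B p v) = reindex B p v" using assms by (auto simp: prod_ok_def)
  show o: "Prd v \<beta> \<in> Ob" "ob (Prd v \<beta>) = Cod B v"
    using A assms unfolding adjunction_def is_functor_def by auto
  have "cou v \<beta> \<in> hm p (Ide B (Dom B v)) (pull v (Prd v \<beta>)) \<beta>"
    using A assms unfolding adjunction_def nat_trans_def by (auto simp: hom_fibre comp_func_def id_func_def)
  thus e: "cou v \<beta> \<in> Ver (pull v (Prd v \<beta>)) \<beta>"
    using reind_obj(2)[OF A(1) o] by simp
  show "Cone v (lft v (Prd v \<beta>)) (cou v \<beta>)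
        (pull v (Prd v \<beta>)) (Prd v \<beta>) \<beta>"
    unfolding pcone_def using lift_chm[OF A(1) o] e by simp
qed

lemma prod_transpose:
  assumes v: "Ok v" and b: "\<beta> \<in> Ob" "ob \<beta> = Dom B v"
    and c: "\<gamma> \<in> Ob" "ob \<gamma> = Cod B v" and f: "f \<in> hm p (Ide B (Dom B v)) (pull v \<gamma>) \<beta>"
  defines "x \<equiv> farr (prodt B p v) f \<odot> aunit (prod_adj B p v) \<gamma>"
  shows "x \<in> hm p (Ide B (Cod B v)) \<gamma> (Prd v \<beta>)" "cou v \<beta> \<odot> reindA B p v x = f"
    "\<And>y. y \<in> hm p (Ide B (Cod B v)) \<gamma> (Prd v \<beta>) ==> cou v \<beta> \<odot> reindA B p v y = f ==> y = x"
proof -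
  have A: "v \<in> Arr B" "adjunction (fibre B p (Cod B v)) (fibre B p (Dom B v)) (prod_adj B p v)"
    "ladj (prod_adj B p v) = reindex B p v" using assms by (auto simp: prod_ok_def)
  have C: "category (fibre B p (Cod B v))" "category (fibre B p (Dom B v))" using A(1) by (simp_all add: fibre_category)
  have h: "\<gamma> \<in> Obj (fibre B p (Cod B v))" "\<beta> \<in> Obj (fibre B p (Dom B v))"
     "f \<in> hom (fibre B p (Dom B v)) (fobj (ladj (prod_adj B p v)) \<gamma>) \<beta>"
    using b c f unfolding A(3) hom_fibre by auto
  note T = adjunction_right[OF C A(2) h, unfolded hom_fibre A(3) fibre_simps, folded x_def]
  show "x \<in> hm p (Ide B (Cod B v)) \<gamma> (Prd v \<beta>)" "cou v \<beta> \<odot> reindA B p v x = f"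
    "\<And>y. y \<in> hm p (Ide B (Cod B v)) \<gamma> (Prd v \<beta>) ==> cou v \<beta> \<odot> reindA B p v y = f ==> y = x"
    by (rule T | assumption)+
qed

lemma prod_nprod:
  assumes v: "Ok v" and b: "\<beta> \<in> Ob" "ob \<beta> = Dom B v"
  defines "c \<equiv> Prd v \<beta>"
  shows "Nprod v (lft v c) (cou v \<beta>) (pull v c) c \<beta>"
proof -
  have va: "v \<in> Arr B" using v by (simp add: prod_ok_def)
  note o = prod_obj[OF v b, folded c_def]
  note C = o(4)
  have "Test (lft v c) (cou v \<beta>) (Ide B (Cod B v)) v (Ide B (Dom B v))"
  proof (rule ptestI[OF C])
    show "v \<in> Arr B" "Cod B v = Dom B (Ide B (Cod B v))" using va by simp_all
    fix \<gamma> assume g: "\<gamma> \<in> Ob" "ob \<gamma> = Dom B (Ide B (Cod B v))"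
    hence g': "ob \<gamma> = Cod B v" using va by simp
    have L: "lft v \<gamma> \<in> Car v (pull v \<gamma>) \<gamma>" by (rule lift_chm[OF va g(1) g'])
    have "\<exists>!x. x \<in> hm p (Ide B (Cod B v)) \<gamma> c \<and> pmed p (lft v c) (cou v \<beta>) (lft v \<gamma>) e x"
      if e: "e \<in> hm p (Ide B (Dom B v)) (pull v \<gamma>) \<beta>" for e
    proof -
      have eq: "pmed p (lft v c) (cou v \<beta>) (lft v \<gamma>) e x \<longleftrightarrow>
         cou v \<beta> \<odot> reindA B p v x = e" if x: "x \<in> hm p (Ide B (Cod B v)) \<gamma> c" for x
      proof -
        note R = reindA[OF va g' x[folded g']]
        have R1: "reindA B p v x \<in> hm p (Ide B (Dom B v)) (pull v \<gamma>) (pull v c)"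
          using R(1) reind_obj(2)[OF va g(1) g'] by simp
        show ?thesis
        proof
          assume "pmed p (lft v c) (cou v \<beta>) (lft v \<gamma>) e x"
          then obtain x' where x': "x' \<in> hm p (Ide B (Dom B v)) (pull v \<gamma>) (pull v c)"
            "lft v c \<odot> x' = x \<odot> lft v \<gamma>" "cou v \<beta> \<odot> x' = e"
            using pmedE[OF C L e] by blast
          hence "x' = reindA B p v x" using cart_eq[OF pconeD(1)[OF C] x'(1) R1] R(2) by simp
          thus "cou v \<beta> \<odot> reindA B p v x = e" using x' by simp
        next
          assume "cou v \<beta> \<odot> reindA B p v x = e"
          thus "pmed p (lft v c) (cou v \<beta>) (lft v \<gamma>) e x"
            by (rule pmedI[OF C L e R1 R(2)])
        qed
      qed
      note T = prod_transpose[OF v b g(1) g' e, folded c_def]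
      show ?thesis using T eq by metis
    qed
    thus "\<exists>\<pi>' N. \<pi>' \<in> Car v N \<gamma> \<and> (\<forall>e\<in>hm p (Ide B (Dom B v)) N \<beta>.
        \<exists>!x. x \<in> hm p (Ide B (Cod B v)) \<gamma> c \<and> pmed p (lft v c) (cou v \<beta>) \<pi>' e x)"
      using L by blast
  qed
  thus ?thesis using C by (simp add: nprod_def)
qed

lemma bc_prod_setup:
  assumes P: "pbk w v u g" and v: "Ok v" and u: "Ok u"
    and b: "\<beta> \<in> Ob" "ob \<beta> = Dom B v"
  defines "c \<equiv> Prd v \<beta>"
  obtains y m where "m \<in> hm p g (pull u (pull w c)) (pull v c)"
    "lft v c \<odot> m = lft w c \<odot> lft u (pull w c)"
    "y \<in> hm p (Ide B (Dom B u)) (pull u (pull w c)) (pull g \<beta>)"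
    "lft g \<beta> \<odot> y = cou v \<beta> \<odot> m"
    "bc_prod B p v w g u \<beta> \<in> hm p (Ide B (Cod B u)) (pull w c) (Prd u (pull g \<beta>))"
    "cou u (pull g \<beta>) \<odot> reindA B p u (bc_prod B p v w g u \<beta>) = y"
    "\<And>x. x \<in> hm p (Ide B (Cod B u)) (pull w c) (Prd u (pull g \<beta>)) ==>
       cou u (pull g \<beta>) \<odot> reindA B p u x = y ==> x = bc_prod B p v w g u \<beta>"
proof -
  note o = prod_obj[OF v b, folded c_def] and pd = is_pullbackD[OF P]
  have va: "v \<in> Arr B" using v by (simp add: prod_ok_def)
  let ?wc = "pull w c" and ?vc = "pull v c"
  have oo: "?wc \<in> Ob" "ob ?wc = Cod B u" "?vc \<in> Ob" "ob ?vc = Cod B g"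
    using reind_obj[OF pd(1) o(1)] reind_obj[OF va o(1)] o(2) pd by auto
  have L: "lft w c \<in> Car w ?wc c" using lift_chm pd o by simp
  have Lu: "lft u ?wc \<in> Car u (pull u ?wc) ?wc" using lift_chm[OF pd(3) oo(1,2)] .
  have Lv: "lft v c \<in> Car v ?vc c" using lift_chm pd o by simp
  have Lg: "lft g ?vc \<in> Car g (pull g ?vc) ?vc" using lift_chm[OF pd(4) oo(3,4)] .
  have bg: "ob \<beta> = Cod B g" using b pd by simp
  have Lb: "lft g \<beta> \<in> Car g (pull g \<beta>) \<beta>" using lift_chm[OF pd(4) b(1) bg] .
  have L2: "Lift2 B p v g c \<in> Car (w \<cdot> u) (pull g ?vc) c" "Lift2 B p w u c \<in> Car (w \<cdot> u) (pull u ?wc) c"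
    unfolding Lift2_def using cart_comp[OF L Lu] cart_comp[OF Lv Lg] pd(9) by simp_all
  define n where "n = vfill B p (Lift2 B p v g c) (Lift2 B p w u c)"
  have n: "n \<in> Ver (pull u ?wc) (pull g ?vc)" "Lift2 B p v g c \<odot> n = Lift2 B p w u c"
    using vfill_ex1[OF L2(1) chmD[OF L2(2)]] by (simp_all add: n_def)
  have e: "cou v \<beta> \<in> Ver ?vc \<beta>" by (rule o(3))
  note R = reindA[OF pd(4) oo(4) e]
  define m where "m = lft g ?vc \<odot> n"
  have m: "m \<in> hm p g (pull u ?wc) ?vc" unfolding m_def by (rule comp_vr[OF n(1) chmD[OF Lg]])
  have m2: "lft v c \<odot> m = lft w c \<odot> lft u ?wc"
    using n(2) unfolding m_def Lift2_def by (simp add: ac[OF n(1) chmD[OF Lg] chmD[OF Lv]])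
  define y where "y = reindA B p g (cou v \<beta>) \<odot> n"
  have yv: "y \<in> Ver (pull u ?wc) (pull g \<beta>)" unfolding y_def by (rule comp_vl[OF n(1) R(1)])
  have du: "ob (pull u ?wc) = Dom B u" "ob (pull g \<beta>) = Dom B u" "pull g \<beta> \<in> Ob"
    using reind_obj[OF pd(3) oo(1,2)] reind_obj[OF pd(4) b(1) bg] pd by auto
  have y: "y \<in> hm p (Ide B (Dom B u)) (pull u ?wc) (pull g \<beta>)" using yv du by simp
  have y2: "lft g \<beta> \<odot> y = cou v \<beta> \<odot> m"
    unfolding y_def m_def using ac[OF n(1) R(1) chmD[OF Lb]] R(2) ac[OF n(1) chmD[OF Lg] e] by simp
  have bc: "bc_prod B p v w g u \<beta> = farr (prodt B p u) y \<odot> aunit (prod_adj B p u) ?wc"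
    by (simp add: bc_prod_def y_def n_def c_def Let_def)
  note T = prod_transpose[OF u du(3,2) oo(1,2) y, folded bc]
  show ?thesis by (rule that[OF m m2 y y2 T])
qed

lemma bc_iso_sprod:
  assumes v: "Ok v" and b: "\<beta> \<in> Ob" "ob \<beta> = Dom B v"
    and bc: "\<And>w u g. pbk w v u g ==> Ok u \<and> iso (fibre B p (Dom B w)) (bc_prod B p v w g u \<beta>)"
  defines "c \<equiv> Prd v \<beta>"
  shows "Sprod v (lft v c) (cou v \<beta>) (pull v c) c \<beta>"
  unfolding sprod_def
proof (intro conjI allI impI)
  note o = prod_obj[OF v b, folded c_def]
  show C: "Cone v (lft v c) (cou v \<beta>) (pull v c) c \<beta>" by (rule o(4))
  let ?\<xi> = "cou v \<beta>"
  fix w u g assume P: "pbk w v u g"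
  note pd = is_pullbackD[OF P]
  have u: "Ok u" and isB: "iso (fibre B p (Dom B w)) (bc_prod B p v w g u \<beta>)" using bc[OF P] by auto
  let ?wc = "pull w c" and ?vc = "pull v c" and ?gb = "pull g \<beta>"
  have oo: "?wc \<in> Ob" "ob ?wc = Cod B u"
    using reind_obj[OF pd(1) o(1)] o(2) pd by auto
  have bg: "ob \<beta> = Cod B g" using b pd by simp
  have gb: "?gb \<in> Ob" "ob ?gb = Dom B u" using reind_obj[OF pd(4) b(1) bg] pd by auto
  have L: "lft w c \<in> Car w ?wc c" using lift_chm pd o by simp
  have Lu: "lft u ?wc \<in> Car u (pull u ?wc) ?wc" using lift_chm[OF pd(3) oo(1,2)] .
  have Lb: "lft g \<beta> \<in> Car g ?gb \<beta>" using lift_chm[OF pd(4) b(1) bg] .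
  obtain y m where m: "m \<in> hm p g (pull u ?wc) ?vc" "lft v c \<odot> m = lft w c \<odot> lft u ?wc"
    and y: "y \<in> hm p (Ide B (Dom B u)) (pull u ?wc) ?gb" "lft g \<beta> \<odot> y = ?\<xi> \<odot> m"
    and bch: "bc_prod B p v w g u \<beta> \<in> hm p (Ide B (Cod B u)) ?wc (Prd u ?gb)"
     "cou u ?gb \<odot> reindA B p u (bc_prod B p v w g u \<beta>) = y"
    using bc_prod_setup[OF P v u b, folded c_def] by metis
  have yv: "y \<in> Ver (pull u ?wc) ?gb" using y(1) reind_obj(2)[OF pd(3) oo] by simp
  have bv: "bc_prod B p v w g u \<beta> \<in> Ver ?wc (Prd u ?gb)" using bch oo(2) by simp
  obtain j where j: "Iso ?wc (Prd u ?gb) (bc_prod B p v w g u \<beta>) j"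
    using iso_fibre_viso[OF bv] isB oo pd by auto
  note RA = reindA[OF pd(3) oo(2) bv]
  have D: "Cone u (lft u ?wc) y (pull u ?wc) ?wc ?gb" using Lu yv by (simp add: pcone_def)
  let ?bc = "bc_prod B p v w g u \<beta>"
  have jh: "j \<in> Ver (Prd u ?gb) ?wc" "?bc \<odot> j = idt (Prd u ?gb)"
     "j \<odot> ?bc = idt ?wc"
    using visoD[OF j] by auto
  note u' = prod_obj[OF u gb]
  note RJ = reindA[OF pd(3) u'(2) jh(1)]
  have R: "Iso (pull u (Prd u ?gb)) (pull u ?wc) (reindA B p u j) (reindA B p u ?bc)"
    unfolding viso_def using RA(1) RJ(1) reindA_comp[OF pd(3) oo(2) bv jh(1)] reindA_comp[OF pd(3) u'(2) jh(1) bv] jh(2,3)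
      reindA_ide[OF pd(3) oo] reindA_ide[OF pd(3) u'(1,2)] by simp
  have "Nprod u (lft u ?wc) y (pull u ?wc) ?wc ?gb"
  proof (rule nprod_viso[OF prod_nprod[OF u gb] D viso_sym[OF j] R viso_ide])
    show "y \<odot> reindA B p u j = idt ?gb \<odot> cou u ?gb"
      using bch(2) ac[OF RJ(1) RA(1) u'(3)] visoD[OF R] idr[OF u'(3)] idl[OF u'(3)] by simp
  qed (use RJ gb in auto)
  hence T: "Test (lft u ?wc) y (Ide B (Cod B u)) u (Ide B (Dom B u))" by (simp add: nprod_def)
  show "Test (lft v c) ?\<xi> w u g" unfolding ptest_def
  proof (intro allI impI)
    fix \<pi>' N \<gamma> e assume k: "\<pi>' \<in> Car u N \<gamma>" and "e \<in> hm p g N (cd ?\<xi>)"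
    hence e: "e \<in> hm p g N \<beta>" using hmD[OF o(3)] by simp
    obtain f where f: "f \<in> Ver N ?gb" "lft g \<beta> \<odot> f = e" using cart_vfill[OF Lb e] by blast
    have f': "f \<in> hm p (Ide B (Dom B u)) N ?gb" using f(1) hmD[OF chmD[OF k]] by simp
    have ec: "Ide B (Cod B u) = Ide B (ob \<gamma>)" using hmD[OF chmD[OF k]] by simp
    have pm: "pmed p (lft u ?wc) y \<pi>' f x \<longleftrightarrow> pmed p (lft v c) ?\<xi> \<pi>' e (lft w c \<odot> x)"
      if "x \<in> hm p (Ide B (Cod B u)) \<gamma> ?wc" for x
      using pmed_restrict[OF C pd(9) L Lu m Lb yv y(2) k f' that] f(2) pd by simp
    have "(\<exists>!x. x \<in> hm p (Ide B (Cod B u)) \<gamma> ?wc \<and> pmed p (lft u ?wc) y \<pi>' f x) \<longleftrightarrow>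
       (\<exists>!x. x \<in> hm p w \<gamma> c \<and> pmed p (lft v c) ?\<xi> \<pi>' e x)"
    proof (rule ex1_transfer[where m = "\<lambda>x. lft w c \<odot> x"])
      fix x assume "x \<in> hm p (Ide B (Cod B u)) \<gamma> ?wc \<and> pmed p (lft u ?wc) y \<pi>' f x"
      thus "lft w c \<odot> x \<in> hm p w \<gamma> c \<and> pmed p (lft v c) ?\<xi> \<pi>' e (lft w c \<odot> x)"
        using pm comp_vr[OF _ chmD[OF L]] unfolding ec by blast
    next
      fix x z assume "x \<in> hm p (Ide B (Cod B u)) \<gamma> ?wc \<and> pmed p (lft u ?wc) y \<pi>' f x"
        "z \<in> hm p (Ide B (Cod B u)) \<gamma> ?wc \<and> pmed p (lft u ?wc) y \<pi>' f z" "lft w c \<odot> x = lft w c \<odot> z"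
      thus "x = z" using cart_eq[OF L] by blast
    next
      fix x assume x: "x \<in> hm p w \<gamma> c \<and> pmed p (lft v c) ?\<xi> \<pi>' e x"
      obtain z where "z \<in> hm p (Ide B (Cod B u)) \<gamma> ?wc" "lft w c \<odot> z = x" using cart_vfill[OF L conjunct1[OF x]] unfolding ec by blast
      thus "\<exists>a. (a \<in> hm p (Ide B (Cod B u)) \<gamma> ?wc \<and> pmed p (lft u ?wc) y \<pi>' f a) \<and> lft w c \<odot> a = x" using pm x by blast
    qed
    thus "\<exists>!x. x \<in> hm p w \<gamma> (cd (lft v c)) \<and> pmed p (lft v c) ?\<xi> \<pi>' e x"
      using ptestD[OF D T k f'] hmD[OF chmD[OF pconeD(1)[OF C]]] by simp
  qed
qed

lemma sprod_bc_iso: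
  assumes P: "pbk w v u g" and v: "Ok v" and u: "Ok u"
    and b: "\<beta> \<in> Ob" "ob \<beta> = Dom B v" and S0: "Sprod v \<pi>0 \<xi>0 M0 c0 \<beta>"
  shows "iso (fibre B p (Dom B w)) (bc_prod B p v w g u \<beta>)"
proof -
  define c where "c = Prd v \<beta>"
  have S: "Sprod v (lft v c) (cou v \<beta>) (pull v c) c \<beta>"
    unfolding c_def by (rule nprod_sprod[OF prod_nprod[OF v b] S0])
  note o = prod_obj[OF v b, folded c_def]
  let ?\<xi> = "cou v \<beta>"
  note pd = is_pullbackD[OF P]
  let ?wc = "pull w c" and ?vc = "pull v c" and ?gb = "pull g \<beta>"
  have oo: "?wc \<in> Ob" "ob ?wc = Cod B u"
    using reind_obj[OF pd(1) o(1)] o(2) pd by auto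
  have bg: "ob \<beta> = Cod B g" using b pd by simp
  have gb: "?gb \<in> Ob" "ob ?gb = Dom B u" using reind_obj[OF pd(4) b(1) bg] pd by auto
  have L: "lft w c \<in> Car w ?wc c" using lift_chm pd o by simp
  have Lu: "lft u ?wc \<in> Car u (pull u ?wc) ?wc" using lift_chm[OF pd(3) oo(1,2)] .
  have Lb: "lft g \<beta> \<in> Car g ?gb \<beta>" using lift_chm[OF pd(4) b(1) bg] .
  obtain y m where m: "m \<in> hm p g (pull u ?wc) ?vc" "lft v c \<odot> m = lft w c \<odot> lft u ?wc"
    and y: "y \<in> hm p (Ide B (Dom B u)) (pull u ?wc) ?gb" "lft g \<beta> \<odot> y = ?\<xi> \<odot> m"
    and bch: "\<And>x. x \<in> hm p (Ide B (Cod B u)) ?wc (Prd u ?gb) ==>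
       cou u ?gb \<odot> reindA B p u x = y ==> x = bc_prod B p v w g u \<beta>"
    using bc_prod_setup[OF P v u b, folded c_def] by metis
  have yv: "y \<in> Ver (pull u ?wc) ?gb" using y(1) reind_obj(2)[OF pd(3) oo] by simp
  have "Sprod u (lft u ?wc) y (pull u ?wc) ?wc ?gb"
    by (rule sprod_restrict[OF S P L Lu m Lb yv y(2)])
  note N = nprod_uniqueE[OF sprod_nprod[OF this] prod_nprod[OF u gb]]
  obtain j j' n n' where j: "Iso ?wc (Prd u ?gb) j j'"
    "Iso (pull u ?wc) (pull u (Prd u ?gb)) n n'"
    "lft u (Prd u ?gb) \<odot> n = j \<odot> lft u ?wc" "cou u ?gb \<odot> n = y"
    using N by metis
  have jh: "j \<in> Ver ?wc (Prd u ?gb)" "n \<in> Ver (pull u ?wc) (pull u (Prd u ?gb))"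
    using j(1,2) by (simp_all add: viso_def)
  note u' = prod_obj[OF u gb]
  have "n = reindA B p u j"
    using cart_eq[OF lift_chm[OF pd(3) u'(1,2)] jh(2) reindA(1)[OF pd(3) oo(2) jh(1)]] reindA(2)[OF pd(3) oo(2) jh(1)] j(3) by simp
  hence "j = bc_prod B p v w g u \<beta>" using bch[of j] j(4) jh(1) oo(2) by simp
  thus ?thesis using j(1) iso_fibre_viso[OF jh(1)] oo(2) pd by auto
qed

lemma universal_prod_ok:
  assumes v: "v \<in> Arr B" and S: "\<And>\<beta>. \<beta> \<in> Ob ==> ob \<beta> = Dom B v ==> \<exists>\<pi> \<xi> M c. Nprod v \<pi> \<xi> M c \<beta>"
  shows "Ok v"
proof (rule prod_okI[OF _ v])
  have ch: "\<exists>c \<xi>. c \<in> Ob \<and> ob c = Cod B v \<and> \<xi> \<in> hm p (Ide B (Dom B v)) (pull v c) \<beta> \<and>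
     (\<forall>\<gamma> f. \<gamma> \<in> Ob --> ob \<gamma> = Cod B v --> f \<in> hm p (Ide B (Dom B v)) (pull v \<gamma>) \<beta> -->
        (\<exists>!x. x \<in> hm p (Ide B (Cod B v)) \<gamma> c \<and> \<xi> \<odot> reindA B p v x = f))"
    if b: "\<beta> \<in> Ob" "ob \<beta> = Dom B v" for \<beta>
  proof -
    obtain \<pi> \<xi>0 M c where N: "Nprod v \<pi> \<xi>0 M c \<beta>" using S[OF b] by blast
    have C: "Cone v \<pi> \<xi>0 M c \<beta>" and T: "Test \<pi> \<xi>0 (Ide B (Cod B v)) v (Ide B (Dom B v))"
      using N by (auto simp: nprod_def)
    note K = pconeD[OF C]
    have c: "c \<in> Ob" "ob c = Cod B v" using hmD[OF K(2)] by auto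
    have L: "lft v c \<in> Car v (pull v c) c" by (rule lift_chm[OF v c])
    obtain i i' where i: "Iso (pull v c) M i i'" "\<pi> \<odot> i = lft v c" using cart_viso[OF L K(1)] by blast
    have ih: "i \<in> Ver (pull v c) M" using i by (simp add: viso_def)
    define \<xi> where "\<xi> = \<xi>0 \<odot> i"
    have e: "\<xi> \<in> hm p (Ide B (Dom B v)) (pull v c) \<beta>"
      unfolding \<xi>_def using comp_vr[OF ih K(3)] K(5) by simp
    have "\<exists>!x. x \<in> hm p (Ide B (Cod B v)) \<gamma> c \<and> \<xi> \<odot> reindA B p v x = f"
      if g: "\<gamma> \<in> Ob" "ob \<gamma> = Cod B v" and f: "f \<in> hm p (Ide B (Dom B v)) (pull v \<gamma>) \<beta>" for \<gamma> f
    proof -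
      have Lg: "lft v \<gamma> \<in> Car v (pull v \<gamma>) \<gamma>" by (rule lift_chm[OF v g])
      have eq: "pmed p \<pi> \<xi>0 (lft v \<gamma>) f x \<longleftrightarrow> \<xi> \<odot> reindA B p v x = f" if x: "x \<in> hm p (Ide B (Cod B v)) \<gamma> c" for x
      proof -
        note R = reindA[OF v g(2) x[folded g(2)]]
        have iR: "i \<odot> reindA B p v x \<in> hm p (Ide B (Dom B v)) (pull v \<gamma>) M"
          using comp_vl[OF R(1) ih] reind_obj(2)[OF v g] by simp
        have a: "\<pi> \<odot> (i \<odot> reindA B p v x) = x \<odot> lft v \<gamma>"
          using ac[OF R(1) ih K(2)] i(2) R(2) by simp
        have b: "\<xi>0 \<odot> (i \<odot> reindA B p v x) = \<xi> \<odot> reindA B p v x"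
          unfolding \<xi>_def using ac[OF R(1) ih K(3)] by simp
        show ?thesis
        proof
          assume "pmed p \<pi> \<xi>0 (lft v \<gamma>) f x"
          then obtain x' where x': "x' \<in> hm p (Ide B (Dom B v)) (pull v \<gamma>) M"
            "\<pi> \<odot> x' = x \<odot> lft v \<gamma>" "\<xi>0 \<odot> x' = f"
            using pmedE[OF C Lg f] by blast
          hence "x' = i \<odot> reindA B p v x" using cart_eq[OF K(1) x'(1) iR] a by simp
          thus "\<xi> \<odot> reindA B p v x = f" using x' b by simp
        next
          assume "\<xi> \<odot> reindA B p v x = f"
          thus "pmed p \<pi> \<xi>0 (lft v \<gamma>) f x" by (intro pmedI[OF C Lg f iR a]) (simp add: b)
        qed
      qed
      have "\<exists>!x. x \<in> hm p (Ide B (Cod B v)) \<gamma> c \<and> pmed p \<pi> \<xi>0 (lft v \<gamma>) f x" by (rule ptestD[OF C T Lg f])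
      thus ?thesis using eq by metis
    qed
    thus ?thesis using c e by blast
  qed
  obtain R \<xi> where RE: "\<And>\<beta>. \<beta> \<in> Ob ==> ob \<beta> = Dom B v ==> R \<beta> \<in> Ob \<and> ob (R \<beta>) = Cod B v \<and>
     \<xi> \<beta> \<in> hm p (Ide B (Dom B v)) (pull v (R \<beta>)) \<beta> \<and>
     (\<forall>\<gamma> f. \<gamma> \<in> Ob --> ob \<gamma> = Cod B v --> f \<in> hm p (Ide B (Dom B v)) (pull v \<gamma>) \<beta> -->
        (\<exists>!x. x \<in> hm p (Ide B (Cod B v)) \<gamma> (R \<beta>) \<and> \<xi> \<beta> \<odot> reindA B p v x = f))"
    using ch by metis
  show "\<exists>T. adjunction (fibre B p (Cod B v)) (fibre B p (Dom B v)) T \<and> ladj T = reindex B p v"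
    by (rule adjunction_from_universal[OF _ _ reind_functor[OF v], of R \<xi>])
      (use RE v in \<open>auto simp: hom_fibre fibre_category\<close>)
qed

end

context dfib
begin

lemma has_productsI:
  assumes "\<And>v \<beta>. v \<in> F ==> \<beta> \<in> Ob ==> ob \<beta> = Dom B v ==> \<exists>\<pi> \<xi> M c. Sprod v \<pi> \<xi> M c \<beta>"
  shows "has_products B F p"
proof -
  have ok: "Ok v" if "v \<in> F" for v
    using universal_prod_ok[OF F_arr[OF that]] assms[OF that] sprod_nprod by metis
  have "iso (fibre B p (Dom B f)) (bc_prod B p v f g u \<beta>)"
    if "v \<in> F" "u \<in> F" "pbk v f g u" "\<beta> \<in> Obj (fibre B p (Dom B v))" for v f g u \<beta>
    using sprod_bc_iso[OF B.pb_sym[OF that(3)] ok[OF that(1)] ok[OF that(2)]] assms[OF that(1), of \<beta>] that(4) by auto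
  thus ?thesis unfolding has_products_def using ok unfolding prod_ok_def by blast
qed

end

locale profib = dfib B p F for B :: "('o, 'm) cat" (structure) and p :: "('o, 'm, 'e, 'f) fibn" and F +
  assumes products: "has_products B F p"
begin

lemma prod_ok: "v \<in> F ==> Ok v"
  using products F_arr unfolding has_products_def by (intro prod_okI) blast+

lemma prod_sprod:
  assumes v: "v \<in> F" and b: "\<beta> \<in> Ob" "ob \<beta> = Dom B v"
  defines "c \<equiv> Prd v \<beta>"
  shows "Sprod v (lft v c) (cou v \<beta>) (pull v c) c \<beta>"
  unfolding c_def
proof (rule bc_iso_sprod[OF prod_ok[OF v] b])
  fix w u g assume P: "pbk w v u g"
  have u: "u \<in> F" by (rule F_stable[OF P v])
  have "\<beta> \<in> Obj (fibre B p (Dom B v))" using b by simp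
  thus "Ok u \<and> iso (fibre B p (Dom B w)) (bc_prod B p v w g u \<beta>)"
    using products v u B.pb_sym[OF P] prod_ok[OF u] unfolding has_products_def by blast
qed

lemma nprod_is_sprod:
  assumes "v \<in> F" "Nprod v \<pi> \<xi> M c \<beta>"
  shows "Sprod v \<pi> \<xi> M c \<beta>"
proof -
  have "Cone v \<pi> \<xi> M c \<beta>" using assms by (simp add: nprod_def)
  hence "\<beta> \<in> Ob" "ob \<beta> = Dom B v" using pconeD hmD by metis+
  from nprod_sprod[OF assms(2) prod_sprod[OF assms(1) this]] show ?thesis .
qed

end

context fib
begin

lemma psolI:
  assumes C: "Cone v \<pi> \<xi> M c \<beta>" and "\<chi> \<in> hm p w N c" "l \<in> hm p g b \<beta>" "h \<in> hm p y N \<alpha>"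
    and "x \<in> hm p g N M" "\<pi> \<odot> x = \<chi>" "e \<in> Ver N b" "l \<odot> e = \<xi> \<odot> x" "k \<in> hm p y b \<alpha>" "k \<odot> e = h"
  shows "Sol \<pi> \<xi> \<chi> h l k"
  unfolding psol_def
  using assms(5-) hmD[OF assms(2)] hmD[OF assms(3)] hmD[OF assms(4)] hmD[OF pconeD(2)[OF C]]
  by (intro exI[of _ x] exI[of _ e]) simp

lemma psolE:
  assumes C: "Cone v \<pi> \<xi> M c \<beta>" and "\<chi> \<in> hm p w N c" "l \<in> hm p g b \<beta>" "h \<in> hm p y N \<alpha>" "Sol \<pi> \<xi> \<chi> h l k"
  obtains x e where "x \<in> hm p g N M" "\<pi> \<odot> x = \<chi>" "e \<in> Ver N b" "l \<odot> e = \<xi> \<odot> x" "k \<in> hm p y b \<alpha>" "k \<odot> e = h"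
proof -
  have D: "dm \<chi> = N" "PArr p l = g" "dm \<pi> = M" "dm l = b" "PArr p h = y" "cd h = \<alpha>"
    using hmD[OF assms(2)] hmD[OF assms(3)] hmD[OF assms(4)] hmD[OF pconeD(2)[OF C]] by blast+
  show ?thesis using assms(5)[unfolded psol_def D] that by blast
qed

lemma psplit_ex:
  assumes C: "Cone v \<pi> \<xi> M c \<beta>" and "Split \<pi> \<xi> \<chi> h"
  obtains g b l k where "l \<in> Car g b \<beta>" "Sol \<pi> \<xi> \<chi> h l k"
  using assms(2) hmD[OF pconeD(3)[OF C]] unfolding psplit_def by auto

lemma psplit_un:
  assumes C: "Cone v \<pi> \<xi> M c \<beta>" and "Split \<pi> \<xi> \<chi> h" "l \<in> Car g b \<beta>" "Sol \<pi> \<xi> \<chi> h l k"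
    "l' \<in> Car g' b' \<beta>" "Sol \<pi> \<xi> \<chi> h l' k'"
  shows "g = g'" "l = l' ==> k = k'"
proof -
  have E: "cd \<xi> = \<beta>" using hmD[OF pconeD(3)[OF C]] by blast
  show "g = g'" "l = l' ==> k = k'" using assms(2-) unfolding psplit_def E by blast+
qed

lemma psplitI:
  assumes C: "Cone v \<pi> \<xi> M c \<beta>" and "l \<in> Car g b \<beta>" "Sol \<pi> \<xi> \<chi> h l k"
    and "\<And>g b l k g' b' l' k'. l \<in> Car g b \<beta> ==> Sol \<pi> \<xi> \<chi> h l k ==>
        l' \<in> Car g' b' \<beta> ==> Sol \<pi> \<xi> \<chi> h l' k' ==> g = g' \<and> (l = l' --> k = k')"
  shows "Split \<pi> \<xi> \<chi> h"
proof -
  have E: "cd \<xi> = \<beta>" using hmD[OF pconeD(3)[OF C]] by blast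
  show ?thesis unfolding psplit_def E using assms(2-) by blast
qed

lemma psol_change:
  assumes C: "Cone v \<pi> \<xi> M c \<beta>" and X: "\<chi> \<in> hm p w N c" and h: "h \<in> hm p y N \<alpha>"
    and l: "l \<in> Car g b \<beta>" and s: "Sol \<pi> \<xi> \<chi> h l k" and i: "Iso b b' i i'" and l': "l' \<in> Car g b' \<beta>" "l' \<odot> i = l"
  shows "Sol \<pi> \<xi> \<chi> h l' (k \<odot> i')"
proof -
  obtain x e where s: "x \<in> hm p g N M" "\<pi> \<odot> x = \<chi>" "e \<in> Ver N b" "l \<odot> e = \<xi> \<odot> x" "k \<in> hm p y b \<alpha>" "k \<odot> e = h"
    using psolE[OF C X chmD[OF l] h s] by blast
  have ih: "i \<in> Ver b b'" "i' \<in> Ver b' b" "i' \<odot> i = idt b" using visoD[OF i] by auto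
  show ?thesis
  proof (rule psolI[OF C X chmD[OF l'(1)] h s(1,2) comp_vl[OF s(3) ih(1)]])
    show "l' \<odot> (i \<odot> e) = \<xi> \<odot> x" using ac[OF s(3) ih(1) chmD[OF l'(1)]] l'(2) s(4) by simp
    show "k \<odot> i' \<in> hm p y b' \<alpha>" by (rule comp_vr[OF ih(2) s(5)])
    have "k \<odot> i' \<odot> (i \<odot> e) = k \<odot> (i' \<odot> i \<odot> e)"
      using ac[OF s(3) ih(1,2)] ac[OF comp_vl[OF s(3) ih(1)] ih(2) s(5)] by simp
    thus "k \<odot> i' \<odot> (i \<odot> e) = h" using ih(3) s(6) idl[OF s(3)] by simp
  qed
qed

lemma psplit_chosenI:
  assumes C: "Cone v \<pi> \<xi> M c \<beta>" and X: "\<chi> \<in> hm p w N c" and h: "h \<in> hm p y N \<alpha>"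
    and ex: "l \<in> Car g b \<beta>" "Sol \<pi> \<xi> \<chi> h l k"
    and L: "\<And>g. g \<in> Arr B ==> Cod B g = ob \<beta> ==> Lc g \<in> Car g (Lo g) \<beta>"
    and un: "\<And>g1 k1 g2 k2. g1 \<in> Arr B ==> Cod B g1 = ob \<beta> ==> Sol \<pi> \<xi> \<chi> h (Lc g1) k1 ==>
      g2 \<in> Arr B ==> Cod B g2 = ob \<beta> ==> Sol \<pi> \<xi> \<chi> h (Lc g2) k2 ==> g1 = g2 \<and> k1 = k2"
  shows "Split \<pi> \<xi> \<chi> h"
proof (rule psplitI[OF C ex])
  have ch: "\<exists>i i'. Iso b' (Lo g) i i' \<and> Lc g \<odot> i = l" "g \<in> Arr B" "Cod B g = ob \<beta>"
    if l: "l \<in> Car g b' \<beta>" for l g b'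
  proof -
    show g: "g \<in> Arr B" "Cod B g = ob \<beta>" using hmD[OF chmD[OF l]] by auto
    show "\<exists>i i'. Iso b' (Lo g) i i' \<and> Lc g \<odot> i = l" using cart_viso[OF l L[OF g]] by metis
  qed
  fix g1 b1 l1 k1 g2 b2 l2 k2
  assume l1: "l1 \<in> Car g1 b1 \<beta>" "Sol \<pi> \<xi> \<chi> h l1 k1" and l2: "l2 \<in> Car g2 b2 \<beta>" "Sol \<pi> \<xi> \<chi> h l2 k2"
  note G1 = ch(2,3)[OF l1(1)] and G2 = ch(2,3)[OF l2(1)]
  obtain i i' where i: "Iso b1 (Lo g1) i i'" "Lc g1 \<odot> i = l1" using ch(1)[OF l1(1)] by blast
  obtain j j' where j: "Iso b2 (Lo g2) j j'" "Lc g2 \<odot> j = l2" using ch(1)[OF l2(1)] by blast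
  have s1: "Sol \<pi> \<xi> \<chi> h (Lc g1) (k1 \<odot> i')" by (rule psol_change[OF C X h l1 i(1) L[OF G1] i(2)])
  have s2: "Sol \<pi> \<xi> \<chi> h (Lc g2) (k2 \<odot> j')" by (rule psol_change[OF C X h l2 j(1) L[OF G2] j(2)])
  have eq: "g1 = g2" "k1 \<odot> i' = k2 \<odot> j'" using un[OF G1 s1 G2 s2] by auto
  have "k1 = k2" if "l1 = l2"
  proof -
    have bb: "b1 = b2" using that hmD[OF chmD[OF l1(1)]] hmD[OF chmD[OF l2(1)]] by blast
    have ih: "i \<in> Ver b1 (Lo g1)" "i' \<in> Ver (Lo g1) b1" "i' \<odot> i = idt b1"
      using visoD[OF i(1)] by auto
    have jh: "j \<in> Ver b1 (Lo g1)" "j' \<in> Ver (Lo g1) b1" "j' \<odot> j = idt b1"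
      using visoD[OF j(1)] bb eq by auto
    have ij: "i = j" using cart_eq[OF L[OF G1] ih(1) jh(1)] i(2) j(2) that eq by simp
    have k: "k1 \<in> hm p y b1 \<alpha>" "k2 \<in> hm p y b1 \<alpha>"
      using psolE[OF C X chmD[OF l1(1)] h l1(2)] psolE[OF C X chmD[OF l2(1)] h l2(2)] bb by metis+
    have "k1 \<odot> i' \<odot> i = k2 \<odot> j' \<odot> j" using eq ij by simp
    thus "k1 = k2" using ac[OF ih(1,2) k(1)] ac[OF jh(1,2) k(2)] ih(3) jh(3) idr[OF k(1)] idr[OF k(2)] by simp
  qed
  thus "g1 = g2 \<and> (l1 = l2 --> k1 = k2)" using eq by blast
qed

lemma psplit_lift_iff:
  assumes C: "Cone v \<pi> \<xi> M c \<beta>" and X: "\<chi> \<in> hm p w N c" and h: "h \<in> hm p y N \<alpha>"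
  shows "Split \<pi> \<xi> \<chi> h \<longleftrightarrow>
     (\<exists>!gk. case gk of (g, k) => g \<in> Arr B \<and> Cod B g = ob \<beta> \<and> Sol \<pi> \<xi> \<chi> h (lft g \<beta>) k)"
proof -
  have b: "\<beta> \<in> Ob" using hmD[OF pconeD(3)[OF C]] by blast
  have L: "lft g \<beta> \<in> Car g (pull g \<beta>) \<beta>" if "g \<in> Arr B" "Cod B g = ob \<beta>" for g
    using lift_chm[OF that(1) b] that by simp
  have ch: "\<exists>i i'. Iso b' (pull g \<beta>) i i' \<and> lft g \<beta> \<odot> i = l" "g \<in> Arr B" "Cod B g = ob \<beta>"
    if l: "l \<in> Car g b' \<beta>" for l g b'
  proof -
    show g: "g \<in> Arr B" "Cod B g = ob \<beta>" using hmD[OF chmD[OF l]] by auto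
    show "\<exists>i i'. Iso b' (pull g \<beta>) i i' \<and> lft g \<beta> \<odot> i = l" using cart_viso[OF l L[OF g]] by metis
  qed
  show ?thesis
  proof
    assume S: "Split \<pi> \<xi> \<chi> h"
    obtain g b' l k where l: "l \<in> Car g b' \<beta>" "Sol \<pi> \<xi> \<chi> h l k" by (rule psplit_ex[OF C S])
    note g = ch(2,3)[OF l(1)]
    obtain i i' where i: "Iso b' (pull g \<beta>) i i'" "lft g \<beta> \<odot> i = l" using ch(1)[OF l(1)] by blast
    have s: "Sol \<pi> \<xi> \<chi> h (lft g \<beta>) (k \<odot> i')" by (rule psol_change[OF C X h l i(1) L[OF g] i(2)])
    show "\<exists>!gk. case gk of (g, k) => g \<in> Arr B \<and> Cod B g = ob \<beta> \<and> Sol \<pi> \<xi> \<chi> h (lft g \<beta>) k"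
    proof (rule ex1I[of _ "(g, k \<odot> i')"])
      show "case (g, k \<odot> i') of (g, k) => g \<in> Arr B \<and> Cod B g = ob \<beta> \<and> Sol \<pi> \<xi> \<chi> h (lft g \<beta>) k"
        using g s by simp
      fix gk assume a: "case gk of (g, k) => g \<in> Arr B \<and> Cod B g = ob \<beta> \<and> Sol \<pi> \<xi> \<chi> h (lft g \<beta>) k"
      obtain g2 k2 where [simp]: "gk = (g2, k2)" by (cases gk)
      have a2: "g2 \<in> Arr B" "Cod B g2 = ob \<beta>" "Sol \<pi> \<xi> \<chi> h (lft g2 \<beta>) k2" using a by auto
      have "g2 = g" using psplit_un(1)[OF C S L[OF a2(1,2)] a2(3) L[OF g] s] .
      thus "gk = (g, k \<odot> i')" using psplit_un(2)[OF C S L[OF a2(1,2)] a2(3) L[OF g] s] by simp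
    qed
  next
    assume E: "\<exists>!gk. case gk of (g, k) => g \<in> Arr B \<and> Cod B g = ob \<beta> \<and> Sol \<pi> \<xi> \<chi> h (lft g \<beta>) k"
    then obtain g k where g: "g \<in> Arr B" "Cod B g = ob \<beta>" "Sol \<pi> \<xi> \<chi> h (lft g \<beta>) k" by auto
    have un: "g1 = g2 \<and> k1 = k2" if "g1 \<in> Arr B" "Cod B g1 = ob \<beta>" "Sol \<pi> \<xi> \<chi> h (lft g1 \<beta>) k1"
      "g2 \<in> Arr B" "Cod B g2 = ob \<beta>" "Sol \<pi> \<xi> \<chi> h (lft g2 \<beta>) k2" for g1 k1 g2 k2
    proof -
      have "(g1, k1) = (g2, k2)" using E that by (metis (mono_tags, lifting) case_prodI)
      thus ?thesis by simp
    qed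
    show "Split \<pi> \<xi> \<chi> h"
      by (rule psplit_chosenI[OF C X h L[OF g(1,2)] g(3) L un])
  qed
qed

lemma psol_iso:
  assumes C: "Cone v \<pi> \<xi> M c \<beta>" and C2: "Cone v \<pi>2 \<xi>2 M2 c2 \<beta>2" and j: "j \<in> Ver c c2" and m: "m \<in> Ver M M2" and n: "n \<in> Ver \<beta> \<beta>2"
    and e1: "\<pi>2 \<odot> m = j \<odot> \<pi>" and e2: "\<xi>2 \<odot> m = n \<odot> \<xi>" and X: "\<chi> \<in> hm p w N c" and h: "h \<in> hm p y N \<alpha>"
    and t: "t \<in> Ver N' N" and i: "i \<in> Ver \<alpha> \<alpha>'" and l: "l \<in> Car g b \<beta>" and s: "Sol \<pi> \<xi> \<chi> h l k"
  shows "Sol \<pi>2 \<xi>2 (j \<odot> \<chi> \<odot> t) (i \<odot> h \<odot> t) (n \<odot> l) (i \<odot> k)"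
proof -
  obtain x e where s: "x \<in> hm p g N M" "\<pi> \<odot> x = \<chi>" "e \<in> Ver N b" "l \<odot> e = \<xi> \<odot> x" "k \<in> hm p y b \<alpha>" "k \<odot> e = h"
    using psolE[OF C X chmD[OF l] h s] by blast
  note K = pconeD(2)[OF C] pconeD(3)[OF C] pconeD(2)[OF C2] pconeD(3)[OF C2]
  note mx = comp_vl[OF s(1) m] and nl = comp_vl[OF chmD[OF l] n] and ik = comp_vl[OF s(5) i]
  show ?thesis
  proof (rule psolI[OF C2 comp_vr[OF t comp_vl[OF X j]] nl comp_vr[OF t comp_vl[OF h i]] comp_vr[OF t mx] _ comp_vl[OF t s(3)] _ ik])
    show "\<pi>2 \<odot> (m \<odot> x \<odot> t) = j \<odot> \<chi> \<odot> t" using ac[OF t mx K(3)] ac[OF s(1) m K(3)] ac[OF s(1) K(1) j] e1 s(2) by simp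
    show "n \<odot> l \<odot> (e \<odot> t) = \<xi>2 \<odot> (m \<odot> x \<odot> t)"
      using ac[OF t s(3) nl] ac[OF s(3) chmD[OF l] n] ac[OF t mx K(4)] ac[OF s(1) m K(4)] ac[OF s(1) K(2) n] e2 s(4) by simp
    show "i \<odot> k \<odot> (e \<odot> t) = i \<odot> h \<odot> t" using ac[OF t s(3) ik] ac[OF s(3,5) i] s(6) by simp
  qed
qed

lemma viso_swap:
  assumes m: "Iso M M2 m m'" and j: "Iso c c2 j j'" and a: "a \<in> hm p v M c" and b: "b \<in> hm p v M2 c2"
    and e: "b \<odot> m = j \<odot> a"
  shows "a \<odot> m' = j' \<odot> b"
proof -
  have mh: "m \<in> Ver M M2" "m' \<in> Ver M2 M" "m \<odot> m' = idt M2" using visoD[OF m] by auto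
  have jh: "j \<in> Ver c c2" "j' \<in> Ver c2 c" "j' \<odot> j = idt c" using visoD[OF j] by auto
  have "j' \<odot> (b \<odot> m) \<odot> m' = j' \<odot> (j \<odot> a) \<odot> m'" using e by simp
  moreover have "j' \<odot> (b \<odot> m) \<odot> m' = j' \<odot> b"
    using ac[OF mh(2) comp_vr[OF mh(1) b] jh(2)] ac[OF mh(2,1) b] mh(3) idr[OF b] by simp
  moreover have "j' \<odot> (j \<odot> a) \<odot> m' = a \<odot> m'" using ac[OF a jh(1,2)] jh(3) idl[OF a] by simp
  ultimately show ?thesis by simp
qed

lemma viso_cancel:
  assumes j: "Iso a b j j'" and f: "f \<in> hm p u d a" shows "j' \<odot> (j \<odot> f) = f"
proof -
  have jh: "j \<in> Ver a b" "j' \<in> Ver b a" "j' \<odot> j = idt a" using visoD[OF j] by blast+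
  show ?thesis using ac[OF f jh(1,2)] jh(3) idl[OF f] by simp
qed

lemma psplit_iso:
  assumes C: "Cone v \<pi> \<xi> M c \<beta>" and C2: "Cone v \<pi>2 \<xi>2 M2 c2 \<beta>2" and j: "Iso c c2 j j'" and m: "Iso M M2 m m'" and n: "Iso \<beta> \<beta>2 n n'"
    and e1: "\<pi>2 \<odot> m = j \<odot> \<pi>" and e2: "\<xi>2 \<odot> m = n \<odot> \<xi>" and X: "\<chi> \<in> hm p w N c" and h: "h \<in> hm p y N \<alpha>"
    and t: "Iso N' N t t'" and i: "Iso \<alpha> \<alpha>' i i'" and S: "Split \<pi> \<xi> \<chi> h"
  shows "Split \<pi>2 \<xi>2 (j \<odot> \<chi> \<odot> t) (i \<odot> h \<odot> t)"
proof -
  have jh: "j \<in> Ver c c2" "j' \<in> Ver c2 c" and mh: "m \<in> Ver M M2" "m' \<in> Ver M2 M" and nh: "n \<in> Ver \<beta> \<beta>2" "n' \<in> Ver \<beta>2 \<beta>"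
    and th: "t \<in> Ver N' N" "t' \<in> Ver N N'" "t \<odot> t' = idt N" and ih: "i \<in> Ver \<alpha> \<alpha>'" "i' \<in> Ver \<alpha>' \<alpha>"
    using visoD[OF j] visoD[OF m] visoD[OF n] visoD[OF t] visoD[OF i] by auto
  note K = pconeD(2)[OF C] pconeD(3)[OF C] pconeD(2)[OF C2] pconeD(3)[OF C2]
  have PM: "ob M2 = ob M" using vhmD[OF mh(1)] .
  have e1': "\<pi> \<odot> m' = j' \<odot> \<pi>2" by (rule viso_swap[OF m j K(1,3) e1])
  have e2': "\<xi> \<odot> m' = n' \<odot> \<xi>2" by (rule viso_swap[OF m n K(2) _ e2]) (use K(4) PM in simp)
  note jX = comp_vl[OF X jh(1)] and ii = comp_vl[OF h ih(1)]
  have inv: "j' \<odot> (j \<odot> \<chi> \<odot> t) \<odot> t' = \<chi>" "i' \<odot> (i \<odot> h \<odot> t) \<odot> t' = h"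
    using ac[OF th(2) comp_vr[OF th(1) jX] jh(2)] ac[OF th(2,1) jX] th(3) idr[OF jX] viso_cancel[OF j X]
      ac[OF th(2) comp_vr[OF th(1) ii] ih(2)] ac[OF th(2,1) ii] idr[OF ii] viso_cancel[OF i h] by simp_all
  have cl: "n \<odot> l \<in> Car g b \<beta>2" if "Iso \<beta> \<beta>2 n n'" "l \<in> Car g b \<beta>" for l g b n n' \<beta> \<beta>2
    using chm_cart[OF cart_comp[OF viso_cart[OF that(1)] that(2)]] comp_vl[OF chmD[OF that(2)]] visoD[OF that(1)] by (simp add: chm_def)
  obtain g b l k where l: "l \<in> Car g b \<beta>" "Sol \<pi> \<xi> \<chi> h l k" by (rule psplit_ex[OF C S])
  show ?thesis
  proof (rule psplitI[OF C2 cl[OF n l(1)] psol_iso[OF C C2 jh(1) mh(1) nh(1) e1 e2 X h th(1) ih(1) l]])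
    fix g1 b1 l1 k1 g2 b2 l2 k2
    assume l1: "l1 \<in> Car g1 b1 \<beta>2" "Sol \<pi>2 \<xi>2 (j \<odot> \<chi> \<odot> t) (i \<odot> h \<odot> t) l1 k1"
      and l2: "l2 \<in> Car g2 b2 \<beta>2" "Sol \<pi>2 \<xi>2 (j \<odot> \<chi> \<odot> t) (i \<odot> h \<odot> t) l2 k2"
    note X2 = comp_vr[OF th(1) jX] and h2 = comp_vr[OF th(1) ii] and n' = viso_sym[OF n]
    note Q = psol_iso[OF C2 C jh(2) mh(2) nh(2) e1' e2' X2 h2 th(2) ih(2), unfolded inv]
    note U = psplit_un[OF C S cl[OF n' l1(1)] Q[OF l1] cl[OF n' l2(1)] Q[OF l2]]
    obtain x1 e1 where "k1 \<in> hm p y b1 \<alpha>'" by (rule psolE[OF C2 X2 chmD[OF l1(1)] h2 l1(2)])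
    moreover obtain x2 e2 where "k2 \<in> hm p y b2 \<alpha>'" by (rule psolE[OF C2 X2 chmD[OF l2(1)] h2 l2(2)])
    ultimately show "g1 = g2 \<and> (l1 = l2 --> k1 = k2)" using U viso_cancel[OF viso_sym[OF i]] by metis
  qed
qed

text \<open>Sections of the pullback \<open>u\<close> of \<open>v\<close> along \<open>w\<close> correspond to lifts of \<open>w\<close> along \<open>v\<close>.\<close>

lemma psplit_restrict:
  assumes C: "Cone v \<pi> \<xi> M c \<beta>" and P: "pbk w v u g0"
    and X: "\<chi> \<in> Car w c' c" and k: "\<pi>' \<in> Car u M' c'" and m: "m \<in> hm p g0 M' M" "\<pi> \<odot> m = \<chi> \<odot> \<pi>'"
    and Y: "\<psi> \<in> Car g0 \<beta>' \<beta>" and e: "\<xi>' \<in> Ver M' \<beta>'" "\<psi> \<odot> \<xi>' = \<xi> \<odot> m"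
    and Z: "\<zeta> \<in> Car y \<alpha>' \<alpha>" and h: "h' \<in> Ver c' \<alpha>'"
    and S: "Split \<pi>' \<xi>' (idt c') h'"
  shows "Split \<pi> \<xi> \<chi> (\<zeta> \<odot> h')"
proof -
  have C': "Cone u \<pi>' \<xi>' M' c' \<beta>'" using k e by (simp add: pcone_def)
  note pd = is_pullbackD[OF P]
  note K = pconeD(2)[OF C] pconeD(3)[OF C] chmD[OF k] chmD[OF X] chmD[OF Y]
  have c': "c' \<in> Ob" using hmD[OF h] by blast
  note I = ide_hm[OF c']
  have mc: "m \<in> Car g0 M' M"
    by (rule cart_cancel[OF pconeD(1)[OF C] m(1)]) (use cart_comp[OF X k] m(2) in simp)
  have Zh: "\<zeta> \<odot> h' \<in> hm p y c' \<alpha>" by (rule comp_vr[OF h chmD[OF Z]])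
  have fw: "Sol \<pi> \<xi> \<chi> (\<zeta> \<odot> h') (\<psi> \<odot> l) (\<zeta> \<odot> t)"
    if l: "l \<in> Car g b \<beta>'" and s: "Sol \<pi>' \<xi>' (idt c') h' l t" for l g b t
  proof -
    obtain x f where s: "x \<in> hm p g c' M'" "\<pi>' \<odot> x = idt c'" "f \<in> Ver c' b" "l \<odot> f = \<xi>' \<odot> x"
      "t \<in> Ver c' \<alpha>' \<or> True" "t \<in> hm p (Ide B (ob c')) b \<alpha>'" "t \<odot> f = h'"
      using psolE[OF C' I chmD[OF l] h s] by metis
    have Zt: "\<zeta> \<odot> t \<in> hm p y b \<alpha>" using comp_vr[of t b \<alpha>' \<zeta> y \<alpha>] s(6) chmD[OF Z] vhmD[OF s(3)] by simp
    show ?thesis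
    proof (rule psolI[OF C K(4) comp_hm[OF chmD[OF l] K(5)] Zh comp_hm[OF s(1) m(1)] _ s(3) _ Zt])
      show "\<pi> \<odot> (m \<odot> x) = \<chi>" using ac[OF s(1) m(1) K(1)] m(2) ac[OF s(1) K(3,4)] s(2) idr[OF K(4)] by simp
      show "\<psi> \<odot> l \<odot> f = \<xi> \<odot> (m \<odot> x)"
        using ac[OF s(3) chmD[OF l] K(5)] s(4) ac[OF s(1) e(1) K(5)] e(2) ac[OF s(1) m(1) K(2)] by simp
      show "\<zeta> \<odot> t \<odot> f = \<zeta> \<odot> h'" using ac[OF s(3,6) chmD[OF Z]] s(7) by simp
    qed
  qed
  have bw: "\<exists>g' l' t'. g = g0 \<cdot> g' \<and> l' \<in> Car g' b \<beta>' \<and> \<psi> \<odot> l' = l \<and> t = \<zeta> \<odot> t' \<and> Sol \<pi>' \<xi>' (idt c') h' l' t'"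
    if l: "l \<in> Car g b \<beta>" and s: "Sol \<pi> \<xi> \<chi> (\<zeta> \<odot> h') l t" for l g b t
  proof -
    obtain x f where s: "x \<in> hm p g c' M" "\<pi> \<odot> x = \<chi>" "f \<in> Ver c' b" "l \<odot> f = \<xi> \<odot> x"
      "t \<in> hm p y b \<alpha>" "t \<odot> f = \<zeta> \<odot> h'"
      using psolE[OF C K(4) chmD[OF l] Zh s] by metis
    have vg: "v \<cdot> g = w" using hmD[OF comp_hm[OF s(1) K(1)]] s(2) hmD[OF K(4)] by simp
    have D: "Dom B g = ob c'" "Cod B g = ob M" "g \<in> Arr B" "Cod B u = ob c'" "Dom B w = ob c'"
      "ob M = Dom B v" "w \<in> Arr B"
      using hmD[OF s(1)] hmD[OF K(3)] pd pconeD[OF C] by auto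
    have wi: "w \<cdot> Ide B (ob c') = v \<cdot> g" using vg D by simp
    have ide: "Ide B (ob c') \<in> Arr B" "Dom B (Ide B (ob c')) = ob c'" "Cod B (Ide B (ob c')) = ob c'"
      using hmD[OF I] by auto
    obtain g' where g': "g' \<in> Arr B" "Dom B g' = ob c'" "Cod B g' = Dom B u" "u \<cdot> g' = Ide B (ob c')" "g0 \<cdot> g' = g"
      using B.pb_fill[OF P ide(1) D(3) _ _ _ wi] ide D pd by metis
    have PM: "ob M' = Dom B u" "ob \<beta>' = Dom B u" using pconeD[OF C'] by auto
    have gf: "g = g0 \<cdot> g'" using g' by simp
    obtain x' where x': "x' \<in> hm p g' c' M'" "m \<odot> x' = x" using cart_fill[OF mc s(1) g'(1,2) _ gf] g'(3) PM by auto
    have "\<chi> \<odot> (\<pi>' \<odot> x') = \<chi> \<odot> idt c'"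
      using ac[OF x'(1) K(3,4)] m(2) ac[OF x'(1) m(1) K(1)] x'(2) s(2) idr[OF K(4)] by simp
    hence kx: "\<pi>' \<odot> x' = idt c'"
      using cart_eq[OF X _ I] comp_hm[OF x'(1) K(3)] g'(4) by simp
    have g'b: "Dom B g' = ob b" "Cod B g' = ob \<beta>'" using g' vhmD[OF s(3)] PM by auto
    obtain l' where l': "l' \<in> hm p g' b \<beta>'" "\<psi> \<odot> l' = l" using cart_fill[OF Y chmD[OF l] g'(1) g'b gf] by blast
    have l'c: "l' \<in> Car g' b \<beta>'" using cart_cancel[OF Y l'(1)] l l'(2) by simp
    have "\<psi> \<odot> (l' \<odot> f) = \<psi> \<odot> (\<xi>' \<odot> x')"
      using ac[OF s(3) l'(1) K(5)] l'(2) s(4) ac[OF x'(1) e(1) K(5)] e(2) ac[OF x'(1) m(1) K(2)] x'(2) by simp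
    hence lf: "l' \<odot> f = \<xi>' \<odot> x'" using cart_eq[OF Y comp_vr[OF s(3) l'(1)] comp_vl[OF x'(1)]] e(1) by simp
    obtain t' where t': "t' \<in> Ver b \<alpha>'" "\<zeta> \<odot> t' = t" using cart_vfill[OF Z s(5)] by blast
    have t'h: "t' \<in> hm p (Ide B (ob c')) b \<alpha>'" using t'(1) vhmD[OF s(3)] by simp
    have "\<zeta> \<odot> (t' \<odot> f) = \<zeta> \<odot> h'" using ac[OF s(3) t'(1) chmD[OF Z]] t'(2) s(6) by simp
    hence tf: "t' \<odot> f = h'" using cart_eq[OF Z comp_vl[OF s(3) t'(1)] h] by simp
    have "Sol \<pi>' \<xi>' (idt c') h' l' t'"
      by (rule psolI[OF C' I l'(1) h x'(1) kx s(3) lf t'h tf])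
    thus ?thesis using gf l'c l' t' by blast
  qed
  obtain g b l t where l: "l \<in> Car g b \<beta>'" "Sol \<pi>' \<xi>' (idt c') h' l t" by (rule psplit_ex[OF C' S])
  show ?thesis
  proof (rule psplitI[OF C cart_comp[OF Y l(1)] fw[OF l]])
    fix g1 b1 l1 k1 g2 b2 l2 k2
    assume l1: "l1 \<in> Car g1 b1 \<beta>" "Sol \<pi> \<xi> \<chi> (\<zeta> \<odot> h') l1 k1"
      and l2: "l2 \<in> Car g2 b2 \<beta>" "Sol \<pi> \<xi> \<chi> (\<zeta> \<odot> h') l2 k2"
    obtain g1' l1' k1' where q1: "g1 = g0 \<cdot> g1'" "l1' \<in> Car g1' b1 \<beta>'" "\<psi> \<odot> l1' = l1" "k1 = \<zeta> \<odot> k1'"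
      "Sol \<pi>' \<xi>' (idt c') h' l1' k1'" using bw[OF l1] by blast
    obtain g2' l2' k2' where q2: "g2 = g0 \<cdot> g2'" "l2' \<in> Car g2' b2 \<beta>'" "\<psi> \<odot> l2' = l2" "k2 = \<zeta> \<odot> k2'"
      "Sol \<pi>' \<xi>' (idt c') h' l2' k2'" using bw[OF l2] by blast
    note U = psplit_un[OF C' S q1(2,5) q2(2,5)]
    have "k1 = k2" if "l1 = l2"
    proof -
      have bb: "b1 = b2" using that hmD[OF chmD[OF l1(1)]] hmD[OF chmD[OF l2(1)]] by blast
      have "l1' = l2'" using cart_eq[OF Y chmD[OF q1(2)]] chmD[OF q2(2)] q1(3) q2(3) that U(1) bb by simp
      thus "k1 = k2" using U(2) q1 q2 by simp
    qed
    thus "g1 = g2 \<and> (l1 = l2 --> k1 = k2)" using U(1) q1 q2 by simp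
  qed
qed

end

context profib
begin

lemma prod_splitting_iff:
  assumes a: "\<alpha> \<in> Ob"
  shows "prod_splitting B F p \<alpha> \<longleftrightarrow> (\<forall>u \<in> F. \<forall>\<beta>. Cod B u = ob \<alpha> --> \<beta> \<in> Ob --> ob \<beta> = Dom B u -->
     (\<forall>h \<in> hm p (Ide B (ob \<alpha>)) (Prd u \<beta>) \<alpha>.
        Split (lft u (Prd u \<beta>)) (cou u \<beta>) (idt (Prd u \<beta>)) h))"
proof -
  define PP where "PP u \<beta> h \<longleftrightarrow> (\<exists>!gk. case gk of (g, k) => g \<in> sections B u \<and>
          k \<in> hom (fibre B p (ob \<alpha>)) (pull g \<beta>) \<alpha> \<and>
          h = k \<odot> reindA B p g (cou u \<beta>) \<odot>\<^sub>p
              vfill B p (Lift2 B p u g (Prd u \<beta>)) (idt (Prd u \<beta>)))" for u \<beta> h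
  have K: "PP u \<beta> h \<longleftrightarrow> Split (lft u (Prd u \<beta>)) (cou u \<beta>) (idt (Prd u \<beta>)) h"
    if u: "u \<in> F" "Cod B u = ob \<alpha>" and b: "\<beta> \<in> Ob" "ob \<beta> = Dom B u"
      and h: "h \<in> hm p (Ide B (ob \<alpha>)) (Prd u \<beta>) \<alpha>" for u \<beta> h
  proof -
    define c where "c = Prd u \<beta>"
    define \<pi> where "\<pi> = lft u c"
    define \<xi> where "\<xi> = cou u \<beta>"
    have ua: "u \<in> Arr B" by (rule F_arr[OF u(1)])
    note o = prod_obj[OF prod_ok[OF u(1)] b, folded c_def \<xi>_def, folded \<pi>_def]
    note C = o(4)
    let ?uc = "pull u c"
    have cP: "ob c = ob \<alpha>" "Ide B (ob c) = Ide B (ob \<alpha>)" using o(2) u(2) by simp_all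
    have h': "h \<in> Ver c \<alpha>" using h cP unfolding c_def by simp
    have ucP: "ob ?uc = Dom B u" "?uc \<in> Ob" using reind_obj[OF ua o(1,2)] by auto
    have I: "idt c \<in> Ver c c" by (rule ide_hm[OF o(1)])
    have core: "(g \<in> sections B u \<and> k \<in> hm p (Ide B (ob \<alpha>)) (pull g \<beta>) \<alpha> \<and>
          h = k \<odot> reindA B p g \<xi> \<odot> vfill B p (Lift2 B p u g c) (idt c)) \<longleftrightarrow>
         (g \<in> Arr B \<and> Cod B g = ob \<beta> \<and> Sol \<pi> \<xi> (idt c) h (lft g \<beta>) k)" for g k
    proof -
      have main: "Sol \<pi> \<xi> (idt c) h (lft g \<beta>) k \<longleftrightarrow> k \<in> hm p (Ide B (ob \<alpha>)) (pull g \<beta>) \<alpha> \<and>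
          h = k \<odot> reindA B p g \<xi> \<odot> vfill B p (Lift2 B p u g c) (idt c)"
        if g: "g \<in> Arr B" "Cod B g = Dom B u" "Dom B g = Cod B u" "u \<cdot> g = Ide B (Cod B u)"
      proof -
        have Lb: "lft g \<beta> \<in> Car g (pull g \<beta>) \<beta>" using lift_chm[OF g(1) b(1)] g b by simp
        have Lg: "lft g ?uc \<in> Car g (pull g ?uc) ?uc" using lift_chm[OF g(1) ucP(2)] g ucP by simp
        have ucg: "ob ?uc = Cod B g" using g ucP by simp
        have e: "\<xi> \<in> Ver ?uc \<beta>" by (rule o(3))
        note R = reindA[OF g(1) ucg e]
        have L2: "Lift2 B p u g c \<in> Car (Ide B (ob c)) (pull g ?uc) c"
          unfolding Lift2_def using cart_comp[OF pconeD(1)[OF C, unfolded \<pi>_def] Lg] g o by simp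
        define j where "j = vfill B p (Lift2 B p u g c) (idt c)"
        have j: "j \<in> Ver c (pull g ?uc)" "Lift2 B p u g c \<odot> j = idt c"
          unfolding j_def using vfill_ex1[OF L2 I] by auto
        define x0 where "x0 = lft g ?uc \<odot> j"
        have x0: "x0 \<in> hm p g c ?uc" "\<pi> \<odot> x0 = idt c"
          unfolding x0_def using comp_vr[OF j(1) chmD[OF Lg]] j(2) ac[OF j(1) chmD[OF Lg] pconeD(2)[OF C]]
          by (simp_all add: Lift2_def \<pi>_def)
        define e0 where "e0 = reindA B p g \<xi> \<odot> j"
        have e0: "e0 \<in> Ver c (pull g \<beta>)" "lft g \<beta> \<odot> e0 = \<xi> \<odot> x0"
          unfolding e0_def x0_def
          using comp_vl[OF j(1) R(1)] ac[OF j(1) R(1) chmD[OF Lb]] R(2) ac[OF j(1) chmD[OF Lg] e] by simp_all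
        have kk: "k \<odot> reindA B p g \<xi> \<odot> j = k \<odot> e0" if "k \<in> hm p (Ide B (ob \<alpha>)) (pull g \<beta>) \<alpha>"
          unfolding e0_def using ac[OF j(1) R(1) that] by simp
        show ?thesis
        proof
          assume s: "Sol \<pi> \<xi> (idt c) h (lft g \<beta>) k"
          obtain x f where s: "x \<in> hm p g c ?uc" "\<pi> \<odot> x = idt c" "f \<in> Ver c (pull g \<beta>)"
            "lft g \<beta> \<odot> f = \<xi> \<odot> x" "k \<in> hm p (Ide B (ob c)) (pull g \<beta>) \<alpha>" "k \<odot> f = h"
            using psolE[OF C I chmD[OF Lb] h' s] by metis
          have "x = x0" using cart_eq[OF pconeD(1)[OF C] s(1) x0(1)] s(2) x0(2) by simp
          hence "f = e0" using cart_eq[OF Lb s(3) e0(1)] s(4) e0(2) by simp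
          thus "k \<in> hm p (Ide B (ob \<alpha>)) (pull g \<beta>) \<alpha> \<and>
              h = k \<odot> reindA B p g \<xi> \<odot> vfill B p (Lift2 B p u g c) (idt c)"
            using s(5,6) cP kk unfolding j_def by simp
        next
          assume s: "k \<in> hm p (Ide B (ob \<alpha>)) (pull g \<beta>) \<alpha> \<and>
              h = k \<odot> reindA B p g \<xi> \<odot> vfill B p (Lift2 B p u g c) (idt c)"
          hence k: "k \<in> hm p (Ide B (ob c)) (pull g \<beta>) \<alpha>" "k \<odot> e0 = h" using kk cP unfolding j_def by auto
          show "Sol \<pi> \<xi> (idt c) h (lft g \<beta>) k"
            by (rule psolI[OF C I chmD[OF Lb] h' x0 e0 k])
        qed
      qed
      have sec: "g \<in> sections B u" if g: "g \<in> Arr B" "Cod B g = ob \<beta>" and s: "Sol \<pi> \<xi> (idt c) h (lft g \<beta>) k"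
      proof -
        have Lb: "lft g \<beta> \<in> hm p g (pull g \<beta>) \<beta>" using lift_hm[OF g(1) b(1)] g by simp
        obtain x where x: "x \<in> hm p g c ?uc" "\<pi> \<odot> x = idt c" using psolE[OF C I Lb h' s] by metis
        have "u \<cdot> g = Ide B (ob c)" using hmD[OF comp_hm[OF x(1) pconeD(2)[OF C]]] x(2) hmD[OF I] by simp
        thus ?thesis using hmD[OF x(1)] o(2) ucP g(1) unfolding sections_def hom_def by simp
      qed
      have sec': "g \<in> Arr B \<and> Cod B g = Dom B u \<and> Dom B g = Cod B u \<and> u \<cdot> g = Ide B (Cod B u)" if "g \<in> sections B u"
        using that unfolding sections_def hom_def by blast
      show ?thesis using main sec sec' b(2) by metis
    qed
    show ?thesis
      unfolding PP_def psplit_lift_iff[OF C I h', unfolded \<pi>_def \<xi>_def c_def] hom_fibre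
      using core unfolding \<pi>_def \<xi>_def c_def by simp
  qed
  show ?thesis unfolding prod_splitting_def PP_def[symmetric]
    unfolding fibre_simps hom_fibre mem_Collect_eq using K by blast
qed

lemma prod_splitting_viso:
  assumes S: "prod_splitting B F p \<alpha>" and j: "Iso \<alpha> \<alpha>' j j'"
  shows "prod_splitting B F p \<alpha>'"
proof -
  have jh: "j \<in> Ver \<alpha> \<alpha>'" "j' \<in> Ver \<alpha>' \<alpha>" "j \<odot> j' = idt \<alpha>'" using visoD[OF j] by auto
  have o: "\<alpha> \<in> Ob" "\<alpha>' \<in> Ob" and P: "ob \<alpha>' = ob \<alpha>" using hmD[OF jh(1)] vhmD[OF jh(1)] by auto
  show ?thesis unfolding prod_splitting_iff[OF o(2)]
  proof (intro ballI allI impI)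
    fix u \<beta> h assume u: "u \<in> F" "Cod B u = ob \<alpha>'" and b: "\<beta> \<in> Ob" "ob \<beta> = Dom B u"
      and h: "h \<in> hm p (Ide B (ob \<alpha>')) (Prd u \<beta>) \<alpha>'"
    let ?c = "Prd u \<beta>"
    have C: "Cone u (lft u ?c) (cou u \<beta>) (pull u ?c) ?c \<beta>" and c: "?c \<in> Ob"
      using prod_obj[OF prod_ok[OF u(1)] b] by auto
    have h': "j' \<odot> h \<in> hm p (Ide B (ob \<alpha>)) ?c \<alpha>" using comp_vl[OF h jh(2)] P by simp
    have s: "Split (lft u ?c) (cou u \<beta>) (idt ?c) (j' \<odot> h)"
      using S[unfolded prod_splitting_iff[OF o(1)]] u b h' P by simp
    note K = pconeD(2)[OF C] pconeD(3)[OF C]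
    have M: "pull u ?c \<in> Ob" using hmD[OF K(1)] by blast
    from psplit_iso[OF C C viso_ide[OF c] viso_ide[OF M] viso_ide[OF b(1)] _ _ ide_hm[OF c] h' viso_ide[OF c] j s]
    show "Split (lft u ?c) (cou u \<beta>) (idt ?c) h"
      using idl[OF K(1)] idr[OF K(1)] idl[OF K(2)] idr[OF K(2)] viso_cancel[OF viso_sym[OF j] h] idl[OF ide_hm[OF c]] idr[OF h] by simp
  qed
qed

lemma prod_splittingI:
  assumes a: "\<alpha> \<in> Ob"
    and H: "\<And>u \<beta>. u \<in> F ==> Cod B u = ob \<alpha> ==> \<beta> \<in> Ob ==> ob \<beta> = Dom B u ==>
      \<exists>\<pi> \<xi> M c \<beta>' n n'. Nprod u \<pi> \<xi> M c \<beta>' \<and> Iso \<beta>' \<beta> n n' \<and> (\<forall>h \<in> Ver c \<alpha>. Split \<pi> \<xi> (idt c) h)"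
  shows "prod_splitting B F p \<alpha>"
  unfolding prod_splitting_iff[OF a]
proof (intro ballI allI impI)
  fix v \<beta> h assume v: "v \<in> F" "Cod B v = ob \<alpha>" and b: "\<beta> \<in> Ob" "ob \<beta> = Dom B v"
    and h: "h \<in> hm p (Ide B (ob \<alpha>)) (Prd v \<beta>) \<alpha>"
  let ?c = "Prd v \<beta>"
  obtain \<pi> \<xi> M c \<beta>' n n' where N: "Nprod v \<pi> \<xi> M c \<beta>'" and n: "Iso \<beta>' \<beta> n n'"
    and S: "\<forall>h \<in> Ver c \<alpha>. Split \<pi> \<xi> (idt c) h"
    using H[OF v b] by blast
  have C: "Cone v \<pi> \<xi> M c \<beta>'" using N by (simp add: nprod_def)
  note o = prod_obj[OF prod_ok[OF v(1)] b]
  obtain j j' m m' where j: "Iso c ?c j j'" "Iso M (pull v ?c) m m'"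
    "lft v ?c \<odot> m = j \<odot> \<pi>" "cou v \<beta> \<odot> m = n \<odot> \<xi>"
    by (rule nprod_uniqueE[OF nprod_post[OF N n] prod_nprod[OF prod_ok[OF v(1)] b]])
  have jh: "j \<in> Ver c ?c" "j' \<in> Ver ?c c" "j \<odot> j' = idt ?c" using visoD[OF j(1)] by auto
  have hv: "h \<in> Ver ?c \<alpha>" using h o(2) v(2) by simp
  have hj: "h \<odot> j \<in> Ver c \<alpha>" using comp_vr[OF jh(1) hv] vhmD[OF jh(1)] by simp
  have ic: "idt c \<in> Ver c c" using hmD[OF jh(1)] by (intro ide_hm) simp
  from psplit_iso[OF C o(4) j(1,2) n j(3,4) ic hj viso_sym[OF j(1)] viso_ide[OF a]] S hj
  show "Split (lft v ?c) (cou v \<beta>) (idt ?c) h"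
    using jh(3) ac[OF jh(2,1) hv] idr[OF hv] idr[OF jh(1)] idl[OF hj] by simp
qed

lemma prod_qf_cart:
  assumes c: "c \<in> Car f \<alpha>' \<alpha>" and Q: "prod_qf B F p \<alpha>"
  shows "prod_qf B F p \<alpha>'" "prod_splitting B F p \<alpha>'"
proof -
  have sp: "prod_splitting B F p \<alpha>''" if c: "c \<in> Car f \<alpha>'' \<alpha>" for c f \<alpha>''
  proof -
    note h = hmD[OF chmD[OF c]]
    have L: "lft f \<alpha> \<in> Car f (pull f \<alpha>) \<alpha>" using lift_chm h by simp
    obtain j j' where "Iso (pull f \<alpha>) \<alpha>'' j j'" using cart_viso[OF L c] by blast
    moreover have "prod_splitting B F p (pull f \<alpha>)" using Q h unfolding prod_qf_def by blast
    ultimately show ?thesis using prod_splitting_viso by blast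
  qed
  show "prod_splitting B F p \<alpha>'" by (rule sp[OF c])
  show "prod_qf B F p \<alpha>'" unfolding prod_qf_def
  proof (intro ballI impI)
    fix g assume g: "g \<in> Arr B" "Cod B g = ob \<alpha>'"
    have "lft g \<alpha>' \<in> Car g (pull g \<alpha>') \<alpha>'" using lift_chm[OF g(1)] g hmD[OF chmD[OF c]] by simp
    from sp[OF cart_comp[OF c this]] show "prod_splitting B F p (pull g \<alpha>')" .
  qed
qed

lemma prod_qf_psplit:
  assumes Q: "prod_qf B F p \<alpha>" and v: "v \<in> F" and S: "Sprod v \<pi> \<xi> M c \<beta>"
    and X: "\<chi> \<in> Car w N c" and h: "h \<in> hm p y N \<alpha>"
  shows "Split \<pi> \<xi> \<chi> h"
proof -
  have C: "Cone v \<pi> \<xi> M c \<beta>" using S by (simp add: sprod_def)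
  note K = pconeD[OF C]
  have w: "w \<in> Arr B" "Cod B w = Cod B v" using hmD[OF chmD[OF X]] K(7) by auto
  obtain u g0 where P: "pbk w v u g0" "u \<in> F" using F_pb[OF v w] by metis
  note pd = is_pullbackD[OF P(1)]
  have NP: "ob N = Cod B u" "N \<in> Ob" using hmD[OF chmD[OF X]] pd by auto
  have bP: "ob \<beta> = Cod B g0" "\<beta> \<in> Ob" using K pd hmD[OF K(3)] by auto
  let ?M = "pull u N" and ?b = "pull g0 \<beta>"
  have k: "lft u N \<in> Car u ?M N" by (rule lift_chm[OF pd(3) NP(2,1)])
  have Y: "lft g0 \<beta> \<in> Car g0 ?b \<beta>" by (rule lift_chm[OF pd(4) bP(2,1)])
  have MP: "ob ?M = Dom B u" "ob ?b = Dom B u" "?b \<in> Ob"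
    using reind_obj[OF pd(3) NP(2,1)] reind_obj[OF pd(4) bP(2,1)] pd by auto
  have "\<chi> \<odot> lft u N \<in> hm p (w \<cdot> u) ?M c" by (rule comp_hm[OF chmD[OF k] chmD[OF X]])
  then obtain m where m: "m \<in> hm p g0 ?M M" "\<pi> \<odot> m = \<chi> \<odot> lft u N"
    using cart_fill[OF K(1) _ pd(4) _ _ pd(9)] pd MP K(6) by metis
  have "\<xi> \<odot> m \<in> hm p g0 ?M \<beta>" by (rule comp_vl[OF m(1) K(3)])
  then obtain \<xi>' where e: "\<xi>' \<in> Ver ?M ?b" "lft g0 \<beta> \<odot> \<xi>' = \<xi> \<odot> m" using cart_vfill[OF Y] by blast
  have S': "Sprod u (lft u N) \<xi>' ?M N ?b" by (rule sprod_restrict[OF S P(1) X k m Y e])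
  have C': "Cone u (lft u N) \<xi>' ?M N ?b" using S' by (simp add: sprod_def)
  have aP: "\<alpha> \<in> Ob" "y \<in> Arr B" "ob \<alpha> = Cod B y" "Dom B y = ob N" using hmD[OF h] by auto
  let ?a = "pull y \<alpha>"
  have Z: "lft y \<alpha> \<in> Car y ?a \<alpha>" by (rule lift_chm[OF aP(2,1,3)])
  obtain h' where h': "h' \<in> Ver N ?a" "lft y \<alpha> \<odot> h' = h" using cart_vfill[OF Z h] by blast
  have aS: "prod_splitting B F p ?a" by (rule prod_qf_cart(2)[OF Z Q])
  have ao: "?a \<in> Ob" "ob ?a = Cod B u" using reind_obj[OF aP(2,1,3)] aP(4) NP by auto
  let ?c1 = "Prd u ?b"
  note o = prod_obj[OF prod_ok[OF P(2)] MP(3,2)]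
  note SC = prod_nprod[OF prod_ok[OF P(2)] MP(3,2)]
  obtain j j' n n' where j: "Iso ?c1 N j j'" "Iso (pull u ?c1) ?M n n'"
     "lft u N \<odot> n = j \<odot> lft u ?c1" "\<xi>' \<odot> n = cou u ?b"
    using nprod_uniqueE[OF SC sprod_nprod[OF S']] by metis
  have jh: "j \<in> Ver ?c1 N" "j' \<in> Ver N ?c1" "j \<odot> j' = idt N" using visoD[OF j(1)] by auto
  have h2: "h' \<odot> j \<in> Ver ?c1 ?a" using comp_vr[OF jh(1) h'(1)] vhmD[OF jh(1)] by simp
  have i1: "idt ?c1 \<in> Ver ?c1 ?c1" by (rule ide_hm[OF o(1)])
  have "Split (lft u ?c1) (cou u ?b) (idt ?c1) (h' \<odot> j)"
    using aS[unfolded prod_splitting_iff[OF ao(1)]] P(2) ao(2) MP(2,3) h2 o(2) by simp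
  from psplit_iso[OF o(4) C' j(1,2) viso_ide[OF MP(3)] j(3) _ i1 h2 viso_sym[OF j(1)] viso_ide[OF ao(1)] this]
  have "Split (lft u N) \<xi>' (idt N) h'"
    using j(4) idl[OF o(3)] idr[OF jh(1)] idl[OF h2] jh(3) ac[OF jh(2,1) h'(1)] idr[OF h'(1)] by simp
  from psplit_restrict[OF C P(1) X k m Y e Z h'(1) this] show ?thesis using h'(2) by simp
qed

end

section \<open>Full subfibrations and fibred equivalence\<close>

lemma full_sub_simps [simp]:
  "Obj (Tot (full_sub p Q)) = {\<alpha> \<in> Obj (Tot p). Q \<alpha>}"
  "Arr (Tot (full_sub p Q)) = {\<phi> \<in> Arr (Tot p). Q (Dom (Tot p) \<phi>) \<and> Q (Cod (Tot p) \<phi>)}"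
  "Dom (Tot (full_sub p Q)) = Dom (Tot p)" "Cod (Tot (full_sub p Q)) = Cod (Tot p)"
  "Ide (Tot (full_sub p Q)) = Ide (Tot p)" "Comp (Tot (full_sub p Q)) = Comp (Tot p)"
  "PObj (full_sub p Q) = PObj p" "PArr (full_sub p Q) = PArr p" "Lift (full_sub p Q) = Lift p"
  by (simp_all add: full_sub_def)

lemma full_sub_hm: "hm (full_sub p Q) u a b = {f \<in> hm p u a b. Q a \<and> Q b}"
  by (auto simp: hm_def)

lemma full_sub_hom: "hom (Tot (full_sub p Q)) a b = {f \<in> hom (Tot p) a b. Q a \<and> Q b}"
  by (auto simp: hom_def)

lemma full_sub_reindO: "reindO B (full_sub p Q) u = reindO B p u"
  by (simp add: reindex_def)

lemma full_sub_viso: "viso B (full_sub p Q) a b j j' \<longleftrightarrow> viso B p a b j j' \<and> Q a \<and> Q b"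
  by (auto simp: viso_def full_sub_hm)

context fib
begin

lemma full_sub_cartesian:
  assumes "cartesian B p c" "Q (dm c)" "Q (cd c)"
  shows "cartesian B (full_sub p Q) c"
  using assms unfolding cartesian_def full_sub_hom by simp

lemma full_sub_fibration:
  assumes Q: "\<And>u \<alpha>. u \<in> Arr B ==> \<alpha> \<in> Ob ==> ob \<alpha> = Cod B u ==> Q \<alpha> ==> Q (pull u \<alpha>)"
  shows "fibration B (full_sub p Q)"
proof -
  have "category (Tot (full_sub p Q))" unfolding category_def by (auto simp: hom_iff)
  moreover have "is_functor (Tot (full_sub p Q)) B \<lparr>fobj = PObj p, farr = PArr p\<rparr>"
    unfolding is_functor_def by (auto simp: hom_iff)
  moreover have "cd (lft u \<alpha>) = \<alpha> \<and> PArr p (lft u \<alpha>) = u \<and> cartesian B (full_sub p Q) (lft u \<alpha>)"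
    if "u \<in> Arr B" "\<alpha> \<in> Ob" "Q \<alpha>" "ob \<alpha> = Cod B u" for u \<alpha>
  proof -
    note L = lift_chm[OF that(1,2,4)]
    show ?thesis using hmD[OF chmD[OF L]] full_sub_cartesian[OF chm_cart[OF L]] Q[OF that(1,2,4,3)] that by simp
  qed
  ultimately show ?thesis unfolding fibration_def using B.category by simp
qed

lemma full_sub_chm:
  assumes "fibration B (full_sub p Q)"
  shows "chm B (full_sub p Q) u a b = {f \<in> Car u a b. Q a \<and> Q b}"
proof -
  interpret s: fib B "full_sub p Q" by (rule fib.intro) fact
  have "c \<in> Car u a b" if c: "c \<in> chm B (full_sub p Q) u a b" for c
  proof -
    note h = s.hmD[OF s.chmD[OF c]]
    have h': "u \<in> Arr B" "b \<in> Ob" "ob b = Cod B u" using h by auto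
    note L = lift_chm[OF h']
    have Ls: "lft u b \<in> chm B (full_sub p Q) u (pull u b) b"
      using s.lift_chm[of u b] h full_sub_reindO[of B p Q u] by simp
    obtain j j' where j: "viso B (full_sub p Q) a (pull u b) j j'" "lft u b \<odot>\<^sub>(full_sub p Q) j = c"
      using s.cart_viso[OF c Ls] by blast
    hence j': "Iso a (pull u b) j j'" by (simp add: full_sub_viso)
    have "c \<in> hm p u a b" using s.chmD[OF c] by (simp add: full_sub_hm)
    thus ?thesis using chm_cart[OF cart_comp[OF L viso_cart[OF j']]] j(2) by (simp add: chm_def)
  qed
  thus ?thesis using full_sub_cartesian s.chmD by (auto simp: chm_def full_sub_hm hm_def)
qed

end

definition fun_over :: "('o, 'm, 'e1, 'f1) fibn => ('o, 'm, 'e2, 'f2) fibn => ('e1, 'f1, 'e2, 'f2) func => bool" where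
  "fun_over p q G \<longleftrightarrow> is_functor (Tot p) (Tot q) G \<and> (\<forall>\<alpha> \<in> Obj (Tot p). PObj q (fobj G \<alpha>) = PObj p \<alpha>) \<and>
     (\<forall>\<phi> \<in> Arr (Tot p). PArr q (farr G \<phi>) = PArr p \<phi>)"

definition fully_faithful :: "('o, 'm, 'e1, 'f1) fibn => ('o, 'm, 'e2, 'f2) fibn => ('e1, 'f1, 'e2, 'f2) func => bool" where
  "fully_faithful p q G \<longleftrightarrow> (\<forall>a \<in> Obj (Tot p). \<forall>b \<in> Obj (Tot p). \<forall>h \<in> hom (Tot q) (fobj G a) (fobj G b).
     \<exists>!f. f \<in> hom (Tot p) a b \<and> farr G f = h)"

definition ess_surj :: "('o, 'm) cat => ('o, 'm, 'e1, 'f1) fibn => ('o, 'm, 'e2, 'f2) fibn => ('e1, 'f1, 'e2, 'f2) func => bool" where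
  "ess_surj B p q G \<longleftrightarrow> (\<forall>\<alpha> \<in> Obj (Tot q). \<exists>a \<in> Obj (Tot p). \<exists>j j'. viso B q (fobj G a) \<alpha> j j')"

locale fibfun = p: fib B p + q: fib B q
  for B :: "('o, 'm) cat" (structure) and p :: "('o, 'm, 'e1, 'f1) fibn" and q :: "('o, 'm, 'e2, 'f2) fibn" +
  fixes G :: "('e1, 'f1, 'e2, 'f2) func"
  assumes over: "fun_over p q G" and ff: "fully_faithful p q G"
begin

abbreviation "Go \<equiv> fobj G"
abbreviation "Ga \<equiv> farr G"

lemma G_obj: "a \<in> Obj (Tot p) ==> Go a \<in> Obj (Tot q)" "a \<in> Obj (Tot p) ==> PObj q (Go a) = PObj p a"
  using over unfolding fun_over_def is_functor_def by blast+

lemma G_hm: "f \<in> hm p u a b ==> Ga f \<in> hm q u (Go a) (Go b)"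
  using over unfolding fun_over_def is_functor_def hm_def hom_def by blast

lemma G_comp: "f \<in> hm p u a b ==> g \<in> hm p v b c ==> Ga (g \<odot> f) = Ga g \<odot>\<^sub>q Ga f"
  using over unfolding fun_over_def is_functor_def hm_def hom_def by auto

lemma G_ide: "a \<in> Obj (Tot p) ==> Ga (Ide (Tot p) a) = Ide (Tot q) (Go a)"
  using over unfolding fun_over_def is_functor_def by blast

lemma G_vhm: "f \<in> vhm B p a b ==> Ga f \<in> vhm B q (Go a) (Go b)"
  using G_hm[of f] G_obj(2)[of a] p.hmD[of f] by metis

lemma G_full:
  assumes "h \<in> hm q u (Go a) (Go b)" "a \<in> Obj (Tot p)" "b \<in> Obj (Tot p)"
  obtains f where "f \<in> hm p u a b" "Ga f = h"
proof -
  have "h \<in> hom (Tot q) (Go a) (Go b)" using assms(1) by (auto simp: hm_def hom_def)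
  then obtain f where f: "f \<in> hom (Tot p) a b" "Ga f = h" using ff assms unfolding fully_faithful_def by blast
  have "PArr p f = PArr q (Ga f)" using over f(1) unfolding fun_over_def hom_def by auto
  hence "f \<in> hm p u a b" using f assms(1) by (auto simp: hm_def hom_def)
  thus ?thesis using that f by blast
qed

lemma G_faithful:
  assumes "f \<in> hm p u a b" "g \<in> hm p v a b" "Ga f = Ga g"
  shows "f = g"
proof -
  have o: "a \<in> Obj (Tot p)" "b \<in> Obj (Tot p)" using p.hmD[OF assms(1)] by auto
  have "Ga f \<in> hom (Tot q) (Go a) (Go b)" using G_hm[OF assms(1)] by (auto simp: hm_def hom_def)
  moreover have "f \<in> hom (Tot p) a b" "g \<in> hom (Tot p) a b" using assms by (auto simp: hm_def hom_def)
  ultimately show ?thesis using ff o assms(3) unfolding fully_faithful_def by metis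
qed

lemma G_full_v:
  assumes "h \<in> vhm B q (Go a) (Go b)" "a \<in> Obj (Tot p)" "b \<in> Obj (Tot p)"
  obtains f where "f \<in> vhm B p a b" "Ga f = h"
  using G_full[OF assms(1,2,3)] G_obj(2)[OF assms(2)] by metis

lemma G_viso:
  assumes "viso B p a b j j'" shows "viso B q (Go a) (Go b) (Ga j) (Ga j')"
proof -
  have jh: "j \<in> vhm B p a b" "j' \<in> vhm B p b a" "j' \<odot> j = Ide (Tot p) a" "j \<odot> j' = Ide (Tot p) b"
    using p.visoD[OF assms] by auto
  have o: "a \<in> Obj (Tot p)" "b \<in> Obj (Tot p)" using p.hmD[OF jh(1)] by auto
  show ?thesis unfolding viso_def using G_vhm[OF jh(1)] G_vhm[OF jh(2)] G_comp[OF jh(1,2)] G_comp[OF jh(2,1)] G_ide[OF o(1)] G_ide[OF o(2)] jh(3,4) by simp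
qed

lemma viso_reflect:
  assumes "viso B q (Go a) (Go b) h h'" "a \<in> Obj (Tot p)" "b \<in> Obj (Tot p)"
  obtains j j' where "viso B p a b j j'" "Ga j = h" "Ga j' = h'"
proof -
  have hh: "h \<in> vhm B q (Go a) (Go b)" "h' \<in> vhm B q (Go b) (Go a)" "h' \<odot>\<^sub>q h = Ide (Tot q) (Go a)" "h \<odot>\<^sub>q h' = Ide (Tot q) (Go b)"
    using q.visoD[OF assms(1)] by auto
  obtain j where j: "j \<in> vhm B p a b" "Ga j = h" using G_full_v[OF hh(1) assms(2,3)] .
  obtain j' where j': "j' \<in> vhm B p b a" "Ga j' = h'" using G_full_v[OF hh(2) assms(3,2)] .
  have "j' \<odot> j = Ide (Tot p) a"
    by (rule G_faithful[OF p.comp_vl[OF j(1) j'(1)] p.ide_hm[OF assms(2)]]) (use G_comp[OF j(1) j'(1)] G_ide[OF assms(2)] hh j j' in simp)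
  moreover have "j \<odot> j' = Ide (Tot p) b"
    by (rule G_faithful[OF p.comp_vl[OF j'(1) j(1)] p.ide_hm[OF assms(3)]]) (use G_comp[OF j'(1) j(1)] G_ide[OF assms(3)] hh j j' in simp)
  ultimately show ?thesis using that j j' by (simp add: viso_def)
qed

lemma reflect_cart:
  assumes f: "f \<in> hm p u a b" and c: "Ga f \<in> chm B q u (Go a) (Go b)"
  shows "f \<in> chm B p u a b"
proof (rule p.cartI[OF f])
  fix d v k w assume k: "k \<in> hm p v d b" and w: "w \<in> Arr B" "Dom B w = PObj p d" "Cod B w = PObj p a" and v: "v = u \<cdot> w"
  have o: "a \<in> Obj (Tot p)" "b \<in> Obj (Tot p)" "d \<in> Obj (Tot p)" using p.hmD[OF f] p.hmD[OF k] by auto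
  obtain x where x: "x \<in> hm q w (Go d) (Go a)" "Ga f \<odot>\<^sub>q x = Ga k"
    using q.cart_fill[OF c G_hm[OF k] w(1) _ _ v] w G_obj(2)[OF o(1)] G_obj(2)[OF o(3)] by auto
  obtain y where y: "y \<in> hm p w d a" "Ga y = x" using G_full[OF x(1) o(3,1)] .
  have fy: "f \<odot> y = k"
    by (rule G_faithful[OF p.comp_hm[OF y(1) f] k]) (use G_comp[OF y(1) f] x y in simp)
  have "z = y" if z: "z \<in> hm p w d a" "f \<odot> z = k" for z
    by (rule G_faithful[OF z(1) y(1)], rule q.cart_eq[OF c G_hm[OF z(1)] G_hm[OF y(1)]])
      (use G_comp[OF z(1) f] G_comp[OF y(1) f] z fy in simp)
  thus "\<exists>!x. x \<in> hm p w d a \<and> f \<odot> x = k" using y fy by blast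
qed

lemma preserve_cart:
  assumes E: "ess_surj B p q G" and c: "c \<in> chm B p u a b"
  shows "Ga c \<in> chm B q u (Go a) (Go b)"
proof (rule q.cartI[OF G_hm[OF p.chmD[OF c]]])
  note ch = p.chmD[OF c]
  fix d v k w assume k: "k \<in> hm q v d (Go b)" and w: "w \<in> Arr B" "Dom B w = PObj q d" "Cod B w = PObj q (Go a)" and v: "v = u \<cdot> w"
  have o: "a \<in> Obj (Tot p)" "b \<in> Obj (Tot p)" "d \<in> Obj (Tot q)" using p.hmD[OF ch] q.hmD[OF k] by auto
  obtain e j j' where e: "e \<in> Obj (Tot p)" and j: "viso B q (Go e) d j j'" using E o(3) unfolding ess_surj_def by blast
  have jh: "j \<in> vhm B q (Go e) d" "j' \<in> vhm B q d (Go e)" "j' \<odot>\<^sub>q j = Ide (Tot q) (Go e)" "j \<odot>\<^sub>q j' = Ide (Tot q) d"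
    using q.visoD[OF j] by auto
  obtain k0 where k0: "k0 \<in> hm p v e b" "Ga k0 = k \<odot>\<^sub>q j" using G_full[OF q.comp_vr[OF jh(1) k] e o(2)] .
  have we: "Dom B w = PObj p e" "Cod B w = PObj p a" using w G_obj(2)[OF e] G_obj(2)[OF o(1)] q.vhmD[OF jh(1)] by auto
  obtain x0 where x0: "x0 \<in> hm p w e a" "c \<odot> x0 = k0" using p.cart_fill[OF c k0(1) w(1) we v] .
  have xh: "Ga x0 \<odot>\<^sub>q j' \<in> hm q w d (Go a)" by (rule q.comp_vr[OF jh(2) G_hm[OF x0(1)]])
  have kj: "k \<odot>\<^sub>q j \<odot>\<^sub>q j' = k" using q.ac[OF jh(2,1) k] jh(4) q.idr[OF k] by simp
  have cx: "Ga c \<odot>\<^sub>q (Ga x0 \<odot>\<^sub>q j') = k"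
    using q.ac[OF jh(2) G_hm[OF x0(1)] G_hm[OF ch]] G_comp[OF x0(1) ch] x0(2) k0(2) kj by simp
  have "z = Ga x0 \<odot>\<^sub>q j'" if z: "z \<in> hm q w d (Go a)" "Ga c \<odot>\<^sub>q z = k" for z
  proof -
    obtain z0 where z0: "z0 \<in> hm p w e a" "Ga z0 = z \<odot>\<^sub>q j" using G_full[OF q.comp_vr[OF jh(1) z(1)] e o(1)] .
    have "c \<odot> z0 = k0"
      by (rule G_faithful[OF p.comp_hm[OF z0(1) ch] k0(1)])
        (use G_comp[OF z0(1) ch] z0(2) q.ac[OF jh(1) z(1) G_hm[OF ch]] z(2) k0(2) in simp)
    hence "z0 = x0" using p.cart_eq[OF c z0(1) x0(1)] x0(2) by simp
    hence "z \<odot>\<^sub>q j \<odot>\<^sub>q j' = Ga x0 \<odot>\<^sub>q j'" using z0(2) by simp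
    thus ?thesis using q.ac[OF jh(2,1) z(1)] jh(4) q.idr[OF z(1)] by simp
  qed
  thus "\<exists>!x. x \<in> hm q w d (Go a) \<and> Ga c \<odot>\<^sub>q x = k" using xh cx by blast
qed

lemma equivalenceI:
  assumes E: "ess_surj B p q G"
  shows "fibred_equivalent B p q"
proof -
  have "\<forall>\<alpha>. \<exists>a j j'. \<alpha> \<in> Obj (Tot q) --> a \<in> Obj (Tot p) \<and> viso B q (Go a) \<alpha> j j'"
    using E unfolding ess_surj_def by blast
  then obtain Ho t t' where H: "\<And>\<alpha>. \<alpha> \<in> Obj (Tot q) ==> Ho \<alpha> \<in> Obj (Tot p) \<and> viso B q (Go (Ho \<alpha>)) \<alpha> (t \<alpha>) (t' \<alpha>)" by metis
  have Ho: "Ho \<alpha> \<in> Obj (Tot p)" and tv: "viso B q (Go (Ho \<alpha>)) \<alpha> (t \<alpha>) (t' \<alpha>)"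
    and th: "t \<alpha> \<in> vhm B q (Go (Ho \<alpha>)) \<alpha>" "t' \<alpha> \<in> vhm B q \<alpha> (Go (Ho \<alpha>))"
      "t' \<alpha> \<odot>\<^sub>q t \<alpha> = Ide (Tot q) (Go (Ho \<alpha>))" "t \<alpha> \<odot>\<^sub>q t' \<alpha> = Ide (Tot q) \<alpha>"
    and PH: "PObj p (Ho \<alpha>) = PObj q \<alpha>"
    if "\<alpha> \<in> Obj (Tot q)" for \<alpha>
    using H[OF that] q.visoD[of "Go (Ho \<alpha>)" \<alpha> "t \<alpha>" "t' \<alpha>"] G_obj(2)[of "Ho \<alpha>"] q.vhmD[of "t \<alpha>" "Go (Ho \<alpha>)" \<alpha>] by auto
  define Ha where "Ha \<phi> = (THE f. f \<in> hom (Tot p) (Ho (Dom (Tot q) \<phi>)) (Ho (Cod (Tot q) \<phi>)) \<and>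
      Ga f = t' (Cod (Tot q) \<phi>) \<odot>\<^sub>q \<phi> \<odot>\<^sub>q t (Dom (Tot q) \<phi>))" for \<phi>
  have Ha: "Ha \<phi> \<in> hm p u (Ho \<alpha>) (Ho \<beta>)" "Ga (Ha \<phi>) = t' \<beta> \<odot>\<^sub>q \<phi> \<odot>\<^sub>q t \<alpha>" if f: "\<phi> \<in> hm q u \<alpha> \<beta>" for \<phi> u \<alpha> \<beta>
  proof -
    have D: "Dom (Tot q) \<phi> = \<alpha>" "Cod (Tot q) \<phi> = \<beta>" and o: "\<alpha> \<in> Obj (Tot q)" "\<beta> \<in> Obj (Tot q)" using q.hmD[OF f] by auto
    have "t' \<beta> \<odot>\<^sub>q \<phi> \<odot>\<^sub>q t \<alpha> \<in> hm q u (Go (Ho \<alpha>)) (Go (Ho \<beta>))"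
      using q.comp_vr[OF th(1)[OF o(1)] q.comp_vl[OF f th(2)[OF o(2)]]] .
    then obtain f where f: "f \<in> hm p u (Ho \<alpha>) (Ho \<beta>)" "Ga f = t' \<beta> \<odot>\<^sub>q \<phi> \<odot>\<^sub>q t \<alpha>"
      using G_full Ho o by metis
    have "Ha \<phi> = f" unfolding Ha_def D
    proof (rule the_equality)
      show "f \<in> hom (Tot p) (Ho \<alpha>) (Ho \<beta>) \<and> Ga f = t' \<beta> \<odot>\<^sub>q \<phi> \<odot>\<^sub>q t \<alpha>" using f by (auto simp: hm_def hom_def)
      fix g assume g: "g \<in> hom (Tot p) (Ho \<alpha>) (Ho \<beta>) \<and> Ga g = t' \<beta> \<odot>\<^sub>q \<phi> \<odot>\<^sub>q t \<alpha>"
      hence "g \<in> hm p (PArr p g) (Ho \<alpha>) (Ho \<beta>)" by (auto simp: hm_def hom_def)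
      thus "g = f" using G_faithful[OF _ f(1)] g f(2) by auto
    qed
    thus "Ha \<phi> \<in> hm p u (Ho \<alpha>) (Ho \<beta>)" "Ga (Ha \<phi>) = t' \<beta> \<odot>\<^sub>q \<phi> \<odot>\<^sub>q t \<alpha>" using f by auto
  qed
  define H where "H = \<lparr>fobj = Ho, farr = Ha\<rparr>"
  have arrq: "\<phi> \<in> hm q (PArr q \<phi>) (Dom (Tot q) \<phi>) (Cod (Tot q) \<phi>)" if "\<phi> \<in> Arr (Tot q)" for \<phi> using that by (simp add: hm_def)
  have arrp: "\<phi> \<in> hm p (PArr p \<phi>) (Dom (Tot p) \<phi>) (Cod (Tot p) \<phi>)" if "\<phi> \<in> Arr (Tot p)" for \<phi> using that by (simp add: hm_def)
  have Hid: "Ha (Ide (Tot q) \<alpha>) = Ide (Tot p) (Ho \<alpha>)" if a: "\<alpha> \<in> Obj (Tot q)" for \<alpha>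
  proof -
    note F = Ha[OF q.ide_hm[OF a]]
    show ?thesis
      by (rule G_faithful[OF F(1) p.ide_hm[OF Ho[OF a]]]) (use F(2) th[OF a] q.idr[OF th(2)[OF a]] G_ide[OF Ho[OF a]] in simp)
  qed
  have Hc: "Ha (\<psi> \<odot>\<^sub>q \<phi>) = Ha \<psi> \<odot> Ha \<phi>" if f: "\<phi> \<in> hm q u \<alpha> \<beta>" and g: "\<psi> \<in> hm q v \<beta> \<gamma>" for \<phi> \<psi> u v \<alpha> \<beta> \<gamma>
  proof -
    have o: "\<alpha> \<in> Obj (Tot q)" "\<beta> \<in> Obj (Tot q)" "\<gamma> \<in> Obj (Tot q)" using q.hmD[OF f] q.hmD[OF g] by auto
    note F = Ha[OF f] and GG = Ha[OF g] and GF = Ha[OF q.comp_hm[OF f g]]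
    note A = th(1)[OF o(1)] and B1 = th(1)[OF o(2)] and B2 = th(2)[OF o(2)] and C = th(2)[OF o(3)]
    show ?thesis
    proof (rule G_faithful[OF GF(1) p.comp_hm[OF F(1) GG(1)]])
      have 1: "t \<beta> \<odot>\<^sub>q (t' \<beta> \<odot>\<^sub>q \<phi> \<odot>\<^sub>q t \<alpha>) = \<phi> \<odot>\<^sub>q t \<alpha>"
        using q.ac[OF A f B2] q.ac[OF q.comp_vr[OF A f] B2 B1] th(4)[OF o(2)] q.idl[OF q.comp_vr[OF A f]] by simp
      have "Ga (Ha \<psi> \<odot> Ha \<phi>) = t' \<gamma> \<odot>\<^sub>q \<psi> \<odot>\<^sub>q t \<beta> \<odot>\<^sub>q (t' \<beta> \<odot>\<^sub>q \<phi> \<odot>\<^sub>q t \<alpha>)"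
        using G_comp[OF F(1) GG(1)] F(2) GG(2) by simp
      also have "\<dots> = t' \<gamma> \<odot>\<^sub>q \<psi> \<odot>\<^sub>q (\<phi> \<odot>\<^sub>q t \<alpha>)"
        using q.ac[OF q.comp_vr[OF A q.comp_vl[OF f B2]] B1 q.comp_vl[OF g C]] 1 by simp
      also have "\<dots> = t' \<gamma> \<odot>\<^sub>q (\<psi> \<odot>\<^sub>q \<phi>) \<odot>\<^sub>q t \<alpha>"
        using q.ac[OF A f q.comp_vl[OF g C]] q.ac[OF f g C] by simp
      finally show "Ga (Ha (\<psi> \<odot>\<^sub>q \<phi>)) = Ga (Ha \<psi> \<odot> Ha \<phi>)" using GF(2) by simp
    qed
  qed
  have HF: "is_functor (Tot q) (Tot p) H"
    unfolding is_functor_def H_def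
  proof (simp add: Ho Hid, intro conjI ballI impI)
    fix f assume f: "f \<in> Arr (Tot q)"
    show "Ha f \<in> hom (Tot p) (Ho (Dom (Tot q) f)) (Ho (Cod (Tot q) f))" using Ha(1)[OF arrq[OF f]] by (auto simp: hm_def hom_def)
    fix g assume g: "g \<in> Arr (Tot q)" "Cod (Tot q) f = Dom (Tot q) g"
    show "Ha (g \<odot>\<^sub>q f) = Ha g \<odot> Ha f" using Hc[OF arrq[OF f] arrq[OF g(1), folded g(2)]] .
  qed
  have GF: "is_functor (Tot p) (Tot q) G" using over by (simp add: fun_over_def)
  have "fibred_functor B p q G" unfolding fibred_functor_def
  proof (intro conjI ballI allI impI)
    fix \<phi> assume c: "cartesian B p \<phi>"
    hence "\<phi> \<in> chm B p (PArr p \<phi>) (Dom (Tot p) \<phi>) (Cod (Tot p) \<phi>)" using arrp by (simp add: chm_def cartesian_def)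
    thus "cartesian B q (Ga \<phi>)" using preserve_cart[OF E] q.chm_cart by blast
  qed (use over in \<open>auto simp: fun_over_def\<close>)
  moreover have "fibred_functor B q p H" unfolding fibred_functor_def
  proof (intro conjI ballI allI impI)
    show "PObj p (fobj H \<alpha>) = PObj q \<alpha>" if "\<alpha> \<in> Obj (Tot q)" for \<alpha> using PH[OF that] by (simp add: H_def)
    show "PArr p (farr H \<phi>) = PArr q \<phi>" if "\<phi> \<in> Arr (Tot q)" for \<phi> using p.hmD[OF Ha(1)[OF arrq[OF that]]] by (simp add: H_def)
    fix \<phi> assume c: "cartesian B q \<phi>"
    define u \<alpha> \<beta> where uab: "u = PArr q \<phi>" "\<alpha> = Dom (Tot q) \<phi>" "\<beta> = Cod (Tot q) \<phi>"
    have c': "\<phi> \<in> chm B q u \<alpha> \<beta>" using arrq c by (simp add: chm_def cartesian_def uab)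
    note f = q.chmD[OF c']
    have o: "\<alpha> \<in> Obj (Tot q)" "\<beta> \<in> Obj (Tot q)" using q.hmD[OF f] by auto
    have "t' \<beta> \<odot>\<^sub>q \<phi> \<odot>\<^sub>q t \<alpha> \<in> hm q u (Go (Ho \<alpha>)) (Go (Ho \<beta>))"
      using q.comp_vr[OF th(1)[OF o(1)] q.comp_vl[OF f th(2)[OF o(2)]]] .
    hence "t' \<beta> \<odot>\<^sub>q \<phi> \<odot>\<^sub>q t \<alpha> \<in> chm B q u (Go (Ho \<alpha>)) (Go (Ho \<beta>))"
      using q.chm_cart[OF q.cart_comp[OF q.cart_comp[OF q.viso_cart[OF q.viso_sym[OF tv[OF o(2)]]] c'] q.viso_cart[OF tv[OF o(1)]]]]
      by (simp add: chm_def)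
    from reflect_cart[OF Ha(1)[OF f]] this Ha(2)[OF f] show "cartesian B p (farr H \<phi>)"
      using p.chm_cart by (simp add: H_def)
  qed (rule HF)
  moreover have "vertical_nat_iso B q q (comp_func G H) id_func t"
    unfolding vertical_nat_iso_def nat_trans_def
  proof (intro conjI ballI)
    fix \<alpha> assume a: "\<alpha> \<in> Obj (Tot q)"
    show "t \<alpha> \<in> hom (Tot q) (fobj (comp_func G H) \<alpha>) (fobj id_func \<alpha>)"
      using th(1)[OF a] by (auto simp: comp_func_def id_func_def H_def hom_def hm_def)
    show "PArr q (t \<alpha>) = Ide B (PObj q \<alpha>)" using q.hmD[OF th(1)[OF a]] PH[OF a] G_obj(2)[OF Ho[OF a]] by auto
    show "iso (Tot q) (t \<alpha>)" unfolding iso_def using th[OF a] q.hmD[OF th(1)[OF a]] q.hmD[OF th(2)[OF a]] by (auto simp: hom_def)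
  next
    fix \<phi> assume f: "\<phi> \<in> Arr (Tot q)"
    note fh = arrq[OF f]
    have o: "Dom (Tot q) \<phi> \<in> Obj (Tot q)" "Cod (Tot q) \<phi> \<in> Obj (Tot q)" using f by auto
    show "t (Cod (Tot q) \<phi>) \<odot>\<^sub>q farr (comp_func G H) \<phi> = farr id_func \<phi> \<odot>\<^sub>q t (Dom (Tot q) \<phi>)"
      using Ha(2)[OF fh] q.ac[OF th(1)[OF o(1)] fh th(2)[OF o(2)]] th(4)[OF o(2)] q.idl[OF q.comp_vr[OF th(1)[OF o(1)] fh]]
        q.ac[OF q.comp_vr[OF th(1)[OF o(1)] fh] th(2)[OF o(2)] th(1)[OF o(2)]]
      by (simp add: comp_func_def id_func_def H_def)
  qed
  moreover have "\<exists>\<sigma>. vertical_nat_iso B p p id_func (comp_func H G) \<sigma>"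
  proof -
    have "\<exists>j j'. viso B p a (Ho (Go a)) j j' \<and> Ga j = t' (Go a)" if a: "a \<in> Obj (Tot p)" for a
    proof -
      have g: "Go a \<in> Obj (Tot q)" by (rule G_obj(1)[OF a])
      show ?thesis using viso_reflect[OF q.viso_sym[OF tv[OF g]] a Ho[OF g]] by metis
    qed
    then obtain s s' where s: "\<And>a. a \<in> Obj (Tot p) ==> viso B p a (Ho (Go a)) (s a) (s' a) \<and> Ga (s a) = t' (Go a)" by metis
    have sh: "s a \<in> vhm B p a (Ho (Go a))" "s' a \<in> vhm B p (Ho (Go a)) a" "s' a \<odot> s a = Ide (Tot p) a" "s a \<odot> s' a = Ide (Tot p) (Ho (Go a))"
      "Ga (s a) = t' (Go a)" if "a \<in> Obj (Tot p)" for a using s[OF that] p.visoD by auto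
    have "vertical_nat_iso B p p id_func (comp_func H G) s"
      unfolding vertical_nat_iso_def nat_trans_def
    proof (intro conjI ballI)
      fix a assume a: "a \<in> Obj (Tot p)"
      show "s a \<in> hom (Tot p) (fobj id_func a) (fobj (comp_func H G) a)"
        using sh(1)[OF a] by (auto simp: comp_func_def id_func_def H_def hom_def hm_def)
      show "PArr p (s a) = Ide B (PObj p a)" using p.hmD[OF sh(1)[OF a]] by auto
      show "iso (Tot p) (s a)" unfolding iso_def using sh[OF a] p.hmD[OF sh(1)[OF a]] p.hmD[OF sh(2)[OF a]] by (auto simp: hom_def)
    next
      fix f assume f: "f \<in> Arr (Tot p)"
      define u a b where uab: "u = PArr p f" "a = Dom (Tot p) f" "b = Cod (Tot p) f"
      have fh: "f \<in> hm p u a b" using arrp[OF f] by (simp add: uab)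
      have o: "a \<in> Obj (Tot p)" "b \<in> Obj (Tot p)" using p.hmD[OF fh] by auto
      have oq: "Go a \<in> Obj (Tot q)" "Go b \<in> Obj (Tot q)" using G_obj o by auto
      note F = Ha[OF G_hm[OF fh]]
      have "s b \<odot> f = Ha (Ga f) \<odot> s a"
      proof (rule G_faithful[OF p.comp_vl[OF fh sh(1)[OF o(2)]] p.comp_vr[OF sh(1)[OF o(1)] F(1)]])
        have "Ga (Ha (Ga f)) \<odot>\<^sub>q t' (Go a) = t' (Go b) \<odot>\<^sub>q Ga f"
          using F(2) q.ac[OF th(2,1)[OF oq(1)] q.comp_vl[OF G_hm[OF fh] th(2)[OF oq(2)]]] th(4)[OF oq(1)]
            q.idr[OF q.comp_vl[OF G_hm[OF fh] th(2)[OF oq(2)]]] by simp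
        thus "Ga (s b \<odot> f) = Ga (Ha (Ga f) \<odot> s a)"
          using G_comp[OF fh sh(1)[OF o(2)]] G_comp[OF sh(1)[OF o(1)] F(1)] sh(5)[OF o(1)] sh(5)[OF o(2)] by simp
      qed
      thus "s (Cod (Tot p) f) \<odot> farr id_func f = farr (comp_func H G) f \<odot> s (Dom (Tot p) f)"
        by (simp add: comp_func_def id_func_def H_def uab)
    qed
    thus ?thesis by blast
  qed
  ultimately show ?thesis unfolding fibred_equivalent_def by blast
qed

end

lemma equivalenceD:
  assumes P: "fibration B p" and Q: "fibration B q" and E: "fibred_equivalent B p q"
  obtains G where "fun_over p q G" "fully_faithful p q G" "ess_surj B p q G"
proof -
  interpret p: fib B p by (rule fib.intro) fact
  interpret q: fib B q by (rule fib.intro) fact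
  obtain G H s t where G: "fibred_functor B p q G" and H: "fibred_functor B q p H"
    and s: "vertical_nat_iso B p p id_func (comp_func H G) s"
    and t: "vertical_nat_iso B q q (comp_func G H) id_func t"
    using E unfolding fibred_equivalent_def by blast
  have O: "fun_over p q G" using G by (simp add: fibred_functor_def fun_over_def)
  have Hh: "farr H \<phi> \<in> hm p u (fobj H \<alpha>) (fobj H \<beta>)" if "\<phi> \<in> hm q u \<alpha> \<beta>" for \<phi> u \<alpha> \<beta>
    using H that unfolding fibred_functor_def is_functor_def hm_def hom_def by auto
  have Gh: "farr G \<phi> \<in> hm q u (fobj G \<alpha>) (fobj G \<beta>)" if "\<phi> \<in> hm p u \<alpha> \<beta>" for \<phi> u \<alpha> \<beta>
    using G that unfolding fibred_functor_def is_functor_def hm_def hom_def by auto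
  have Go: "fobj G a \<in> Obj (Tot q)" "PObj q (fobj G a) = PObj p a" if "a \<in> Obj (Tot p)" for a
    using G that unfolding fibred_functor_def is_functor_def by auto
  have Ho: "fobj H a \<in> Obj (Tot p)" "PObj p (fobj H a) = PObj q a" if "a \<in> Obj (Tot q)" for a
    using H that unfolding fibred_functor_def is_functor_def by auto
  have inv: "\<exists>j'. viso B r a b j j'" if R: "fibration B r" and i: "iso (Tot r) j" and j: "j \<in> vhm B r a b" for r :: "('a, 'b, 'x, 'y) fibn" and a b j
  proof -
    interpret r: fib B r by (rule fib.intro) fact
    obtain g where g: "g \<in> hom (Tot r) b a" "g \<odot>\<^sub>r j = Ide (Tot r) a" "j \<odot>\<^sub>r g = Ide (Tot r) b"
      using i r.hmD[OF j] unfolding iso_def by auto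
    have P: "PObj r b = PObj r a" by (rule r.vhmD[OF j])
    have gh: "g \<in> Arr (Tot r)" "Dom (Tot r) g = b" "Cod (Tot r) g = a" using g(1) by (auto simp: hom_iff)
    have "PArr r (g \<odot>\<^sub>r j) = PArr r g" using r.hmD[OF j] gh P by simp
    hence "PArr r g = Ide B (PObj r a)" using g(2) r.hmD[OF j] by simp
    hence "g \<in> vhm B r b a" using gh P by (simp add: hm_def)
    thus ?thesis using j g by (auto simp: viso_def)
  qed
  have sv: "\<exists>s'. viso B p a (fobj H (fobj G a)) (s a) s'" if "a \<in> Obj (Tot p)" for a
    by (rule inv[OF P]) (use s that in \<open>auto simp: vertical_nat_iso_def nat_trans_def comp_func_def id_func_def hm_def hom_def\<close>)
  have tv: "\<exists>s'. viso B q (fobj G (fobj H a)) a (t a) s'" if "a \<in> Obj (Tot q)" for a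
    by (rule inv[OF Q]) (use t that Ho[OF that] Go[OF Ho(1)[OF that]] in \<open>auto simp: vertical_nat_iso_def nat_trans_def comp_func_def id_func_def hm_def hom_def\<close>)
  have sn: "s b \<odot>\<^sub>p f = farr H (farr G f) \<odot>\<^sub>p s a" if "f \<in> hm p u a b" for f u a b
    using s that by (auto simp: vertical_nat_iso_def nat_trans_def comp_func_def id_func_def hm_def)
  have tn: "t b \<odot>\<^sub>q farr G (farr H f) = f \<odot>\<^sub>q t a" if "f \<in> hm q u a b" for f u a b
    using t that by (auto simp: vertical_nat_iso_def nat_trans_def comp_func_def id_func_def hm_def)
  have Gf: "f = g" if f: "f \<in> hm p u a b" and g: "g \<in> hm p v a b" and e: "farr G f = farr G g" for f g u v a b
  proof -
    have o: "b \<in> Obj (Tot p)" using p.hmD[OF f] by blast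
    obtain s' where s': "viso B p b (fobj H (fobj G b)) (s b) s'" using sv[OF o] by blast
    have sh: "s b \<in> vhm B p b (fobj H (fobj G b))" "s' \<in> vhm B p (fobj H (fobj G b)) b" "s' \<odot>\<^sub>p s b = Ide (Tot p) b"
      using p.visoD[OF s'] by auto
    have "s' \<odot>\<^sub>p (s b \<odot>\<^sub>p f) = s' \<odot>\<^sub>p (s b \<odot>\<^sub>p g)" using sn[OF f] sn[OF g] e by simp
    thus ?thesis using p.ac[OF f sh(1,2)] p.ac[OF g sh(1,2)] sh(3) p.idl[OF f] p.idl[OF g] by simp
  qed
  have Hf: "f = g" if f: "f \<in> hm q u a b" and g: "g \<in> hm q v a b" and e: "farr H f = farr H g" for f g u v a b
  proof -
    have o: "a \<in> Obj (Tot q)" using q.hmD[OF f] by blast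
    obtain t' where t': "viso B q (fobj G (fobj H a)) a (t a) t'" using tv[OF o] by blast
    have th: "t a \<in> vhm B q (fobj G (fobj H a)) a" "t' \<in> vhm B q a (fobj G (fobj H a))" "t a \<odot>\<^sub>q t' = Ide (Tot q) a"
      using q.visoD[OF t'] by auto
    have "f \<odot>\<^sub>q t a \<odot>\<^sub>q t' = g \<odot>\<^sub>q t a \<odot>\<^sub>q t'" using tn[OF f] tn[OF g] e by simp
    thus ?thesis using q.ac[OF th(2,1) f] q.ac[OF th(2,1) g] th(3) q.idr[OF f] q.idr[OF g] by simp
  qed
  have "fully_faithful p q G" unfolding fully_faithful_def
  proof (intro ballI)
    fix a b h assume o: "a \<in> Obj (Tot p)" "b \<in> Obj (Tot p)" and "h \<in> hom (Tot q) (fobj G a) (fobj G b)"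
    then obtain u where h: "h \<in> hm q u (fobj G a) (fobj G b)" by (auto simp: hm_def hom_def)
    obtain s' where s': "viso B p b (fobj H (fobj G b)) (s b) s'" using sv[OF o(2)] by blast
    have sh: "s b \<in> vhm B p b (fobj H (fobj G b))" "s' \<in> vhm B p (fobj H (fobj G b)) b" "s b \<odot>\<^sub>p s' = Ide (Tot p) (fobj H (fobj G b))"
      using p.visoD[OF s'] by auto
    obtain r' where r': "viso B p a (fobj H (fobj G a)) (s a) r'" using sv[OF o(1)] by blast
    have rh: "s a \<in> vhm B p a (fobj H (fobj G a))" "r' \<in> vhm B p (fobj H (fobj G a)) a" "s a \<odot>\<^sub>p r' = Ide (Tot p) (fobj H (fobj G a))"
      using p.visoD[OF r'] by auto
    define f where "f = s' \<odot>\<^sub>p (farr H h \<odot>\<^sub>p s a)"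
    have Hs: "farr H h \<odot>\<^sub>p s a \<in> hm p u a (fobj H (fobj G b))" by (rule p.comp_vr[OF rh(1) Hh[OF h]])
    have f: "f \<in> hm p u a b" unfolding f_def by (rule p.comp_vl[OF Hs sh(2)])
    have "farr H (farr G f) \<odot>\<^sub>p s a = farr H h \<odot>\<^sub>p s a"
      using sn[OF f] p.ac[OF Hs sh(2,1)] sh(3) p.idl[OF Hs] by (simp add: f_def)
    hence "farr H (farr G f) \<odot>\<^sub>p s a \<odot>\<^sub>p r' = farr H h \<odot>\<^sub>p s a \<odot>\<^sub>p r'" by simp
    hence "farr H (farr G f) = farr H h"
      using p.ac[OF rh(2,1) Hh[OF h]] p.ac[OF rh(2,1) Hh[OF Gh[OF f]]] rh(3) p.idr[OF Hh[OF h]] p.idr[OF Hh[OF Gh[OF f]]] by simp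
    hence "farr G f = h" using Hf[OF Gh[OF f] h] by simp
    moreover have "g = f" if "g \<in> hom (Tot p) a b" "farr G g = h" for g
    proof -
      have "g \<in> hm p (PArr p g) a b" using that by (auto simp: hm_def hom_def)
      thus ?thesis using Gf[OF _ f] that(2) \<open>farr G f = h\<close> by auto
    qed
    ultimately show "\<exists>!f. f \<in> hom (Tot p) a b \<and> farr G f = h" using f by (intro ex1I[of _ f]) (auto simp: hm_def hom_def)
  qed
  moreover have "ess_surj B p q G" unfolding ess_surj_def using tv Ho(1) by blast
  ultimately show ?thesis using that O by blast
qed

section \<open>The coproduct completion\<close>

lemma (in dfib) pb_chosen:
  assumes "g \<in> F" "f \<in> Arr B" "Cod B f = Cod B g"
  shows "pbk f g (pb1 B f g) (pb2 B f g)" "pb1 B f g \<in> F"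
proof -
  obtain a b where "pbk f g a b" by (rule F_pb[OF assms])
  hence "pbk f g (fst (a, b)) (snd (a, b))" by simp
  from someI[of "\<lambda>ab. pbk f g (fst ab) (snd ab)", OF this]
  show "pbk f g (pb1 B f g) (pb2 B f g)" unfolding pb1_def pb2_def pb_def .
  from F_stable[OF this assms(1)] show "pb1 B f g \<in> F" .
qed

context dfib
begin

abbreviation "S \<equiv> Sigma_compl B F p"

lemma fam_obj_iff: "(g, a) \<in> Fam \<longleftrightarrow> g \<in> F \<and> a \<in> Ob \<and> ob a = Dom B g"
  by (auto simp: fam_obj_def)

lemma S_simps [simp]:
  "Obj (Tot S) = Fam" "Dom (Tot S) = src" "Cod (Tot S) = tgt" "PObj S (g, a) = Cod B g" "PArr S = bmap"
  "Ide (Tot S) (g, a) = FamArr (g, a) (g, a) (Ide B (Cod B g)) (Ide B (Dom B g)) (idt a)"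
  "n \<odot>\<^sub>S m = FamArr (src m) (tgt n) (bmap n \<cdot> bmap m) (imap n \<cdot> imap m) (fmap n \<odot> fmap m)"
  by (simp_all add: Sigma_compl_def)

lemma S_arr_iff: "m \<in> Arr (Tot S) \<longleftrightarrow> (\<exists>g a h b u f \<phi>. m = FamArr (g, a) (h, b) u f \<phi> \<and> g \<in> F \<and> h \<in> F \<and>
    u \<in> Arr B \<and> Dom B u = Cod B g \<and> Cod B u = Cod B h \<and> ob a = Dom B g \<and> ob b = Dom B h \<and>
    h \<cdot> f = u \<cdot> g \<and> \<phi> \<in> hm p f a b)" (is "_ \<longleftrightarrow> ?R")
proof
  assume "m \<in> Arr (Tot S)"
  then obtain g a h b u f \<phi> where "m = FamArr (g, a) (h, b) u f \<phi>" "(g, a) \<in> Fam" "(h, b) \<in> Fam"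
    "u \<in> hom B (Cod B g) (Cod B h)" "f \<in> hom B (Dom B g) (Dom B h)" "h \<cdot> f = u \<cdot> g" "\<phi> \<in> hom (Tot p) a b" "PArr p \<phi> = f"
    by (auto simp: Sigma_compl_def)
  thus ?R by (auto simp: fam_obj_iff hom_def hm_def)
next
  assume ?R
  then obtain g a h b u f \<phi> where m: "m = FamArr (g, a) (h, b) u f \<phi>" "g \<in> F" "h \<in> F"
    "u \<in> Arr B" "Dom B u = Cod B g" "Cod B u = Cod B h" "ob a = Dom B g" "ob b = Dom B h" "h \<cdot> f = u \<cdot> g" "\<phi> \<in> hm p f a b"
    by blast
  note h = hmD[OF m(10)]
  have "(g, a) \<in> Fam" "(h, b) \<in> Fam" "u \<in> hom B (Cod B g) (Cod B h)" "\<phi> \<in> hom (Tot p) a b"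
    using m(2-8) h unfolding fam_obj_iff hom_def by blast+
  moreover have "f \<in> hom B (Dom B g) (Dom B h)" using h m(7,8) unfolding hom_def by auto
  ultimately show "m \<in> Arr (Tot S)" using m(1,9) h unfolding Sigma_compl_def by auto
qed

lemma S_hm_iff: "m \<in> hm S u (g, a) (h, b) \<longleftrightarrow> (\<exists>f \<phi>. m = FamArr (g, a) (h, b) u f \<phi> \<and> g \<in> F \<and> h \<in> F \<and>
    u \<in> Arr B \<and> Dom B u = Cod B g \<and> Cod B u = Cod B h \<and> ob a = Dom B g \<and> ob b = Dom B h \<and>
    h \<cdot> f = u \<cdot> g \<and> \<phi> \<in> hm p f a b)"
  unfolding hm_def[of S] S_simps mem_Collect_eq S_arr_iff by auto

lemma S_hmI:
  assumes "g \<in> F" "h \<in> F" "u \<in> Arr B" "Dom B u = Cod B g" "Cod B u = Cod B h" "ob a = Dom B g" "ob b = Dom B h"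
    "h \<cdot> f = u \<cdot> g" "\<phi> \<in> hm p f a b"
  shows "FamArr (g, a) (h, b) u f \<phi> \<in> hm S u (g, a) (h, b)"
  using assms unfolding S_hm_iff by blast

lemma S_hmE:
  assumes "m \<in> hm S u (g, a) (h, b)"
  obtains f \<phi> where "m = FamArr (g, a) (h, b) u f \<phi>" "g \<in> F" "h \<in> F" "u \<in> Arr B" "Dom B u = Cod B g" "Cod B u = Cod B h"
    "ob a = Dom B g" "ob b = Dom B h" "h \<cdot> f = u \<cdot> g" "\<phi> \<in> hm p f a b"
  using assms unfolding S_hm_iff by blast

lemma S_arr_hm: "m \<in> Arr (Tot S) ==> m \<in> hm S (bmap m) (src m) (tgt m)"
  by (simp add: hm_def)

lemma S_ide_hm: assumes "(g, a) \<in> Fam" shows "Ide (Tot S) (g, a) \<in> hm S (Ide B (Cod B g)) (g, a) (g, a)"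
proof -
  have g: "g \<in> F" "g \<in> Arr B" "a \<in> Ob" "ob a = Dom B g" using assms F_arr by (auto simp: fam_obj_iff)
  show ?thesis unfolding S_simps
    by (rule S_hmI) (use g ide_hm[OF g(3)] in auto)
qed

lemma S_comp_hm:
  assumes "m \<in> hm S u (g, a) (h, b)" "n \<in> hm S v (h, b) (k, c)"
  shows "n \<odot>\<^sub>S m \<in> hm S (v \<cdot> u) (g, a) (k, c)"
proof -
  obtain f \<phi> where m: "m = FamArr (g, a) (h, b) u f \<phi>" "g \<in> F" "h \<in> F" "u \<in> Arr B" "Dom B u = Cod B g" "Cod B u = Cod B h"
    "ob a = Dom B g" "ob b = Dom B h" "h \<cdot> f = u \<cdot> g" "\<phi> \<in> hm p f a b" by (rule S_hmE[OF assms(1)])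
  obtain f2 \<phi>2 where n: "n = FamArr (h, b) (k, c) v f2 \<phi>2" "h \<in> F" "k \<in> F" "v \<in> Arr B" "Dom B v = Cod B h" "Cod B v = Cod B k"
    "ob b = Dom B h" "ob c = Dom B k" "k \<cdot> f2 = v \<cdot> h" "\<phi>2 \<in> hm p f2 b c" by (rule S_hmE[OF assms(2)])
  have A: "g \<in> Arr B" "h \<in> Arr B" "k \<in> Arr B" "f \<in> Arr B" "f2 \<in> Arr B" "Cod B f = Dom B h" "Dom B f = Dom B g" "Dom B f2 = Dom B h" "Cod B f2 = Dom B k"
    using F_arr m n hmD[OF m(10)] hmD[OF n(10)] by auto
  have e: "k \<cdot> (f2 \<cdot> f) = v \<cdot> u \<cdot> g"
  proof -
    have "k \<cdot> (f2 \<cdot> f) = v \<cdot> h \<cdot> f" using B.pre[OF n(9)] A by simp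
    also have "\<dots> = v \<cdot> (u \<cdot> g)" using A m n by simp
    finally show ?thesis using A m n by simp
  qed
  show ?thesis unfolding S_simps m(1) n(1) fam_arr.sel
    by (rule S_hmI[OF m(2) n(3)]) (use m n A e comp_hm[OF m(10) n(10)] in simp_all)
qed

lemma S_fibration: "fibration B S"
proof (rule fibrationI[OF B.category])
  fix m u x y assume m: "m \<in> hm S u x y"
  obtain g a h b where xy: "x = (g, a)" "y = (h, b)" by (cases x, cases y)
  obtain f \<phi> where e: "m = FamArr (g, a) (h, b) u f \<phi>" "g \<in> F" "h \<in> F" "u \<in> Arr B" "Dom B u = Cod B g" "Cod B u = Cod B h"
    "ob a = Dom B g" "ob b = Dom B h" "h \<cdot> f = u \<cdot> g" "\<phi> \<in> hm p f a b" by (rule S_hmE[OF m[unfolded xy]])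
  show "x \<in> Obj (Tot S) \<and> y \<in> Obj (Tot S) \<and> u \<in> Arr B \<and> Dom B u = PObj S x \<and> Cod B u = PObj S y"
    using e(2-8) hmD[OF e(10)] unfolding xy by (simp add: fam_obj_iff)
  show "Ide (Tot S) y \<odot>\<^sub>S m = m \<and> m \<odot>\<^sub>S Ide (Tot S) x = m" unfolding xy using e hmD[OF e(10)] by simp
  fix n v z assume n: "n \<in> hm S v y z"
  obtain k c where z: "z = (k, c)" by (cases z)
  show "n \<odot>\<^sub>S m \<in> hm S (v \<cdot> u) x z" using S_comp_hm m n unfolding xy z by blast
  obtain f2 \<phi>2 where e2: "n = FamArr (h, b) (k, c) v f2 \<phi>2" "v \<in> Arr B" "Dom B v = Cod B h" "Cod B v = Cod B k" "\<phi>2 \<in> hm p f2 b c"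
    by (rule S_hmE[OF n[unfolded xy z]])
  fix l w t assume l: "l \<in> hm S w z t"
  obtain r d where t: "t = (r, d)" by (cases t)
  obtain f3 \<phi>3 where e3: "l = FamArr (k, c) (r, d) w f3 \<phi>3" "w \<in> Arr B" "Dom B w = Cod B k" "\<phi>3 \<in> hm p f3 c d"
    by (rule S_hmE[OF l[unfolded z t]])
  show "l \<odot>\<^sub>S (n \<odot>\<^sub>S m) = l \<odot>\<^sub>S n \<odot>\<^sub>S m"
    using e(1,4,6) e2(1-4) e3(1-3) hmD[OF e(10)] hmD[OF e2(5)] hmD[OF e3(4)] by simp
next
  fix x assume "x \<in> Obj (Tot S)"
  thus "PObj S x \<in> Obj B \<and> Ide (Tot S) x \<in> hm S (Ide B (PObj S x)) x x" using S_ide_hm F_arr by (cases x) (auto simp: fam_obj_iff)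
next
  fix u x assume u: "u \<in> Arr B" and x: "x \<in> Obj (Tot S)" "PObj S x = Cod B u"
  obtain g a where xe: "x = (g, a)" by (cases x)
  have g: "g \<in> F" "a \<in> Ob" "ob a = Dom B g" "Cod B u = Cod B g" using x by (auto simp: fam_obj_iff xe)
  note P = pb_chosen[OF g(1) u g(4)]
  note pd = is_pullbackD[OF P(1)]
  let ?q1 = "pb1 B u g" and ?q2 = "pb2 B u g"
  have aq: "ob a = Cod B ?q2" using g pd by simp
  have L: "lft ?q2 a \<in> Car ?q2 (pull ?q2 a) a" by (rule lift_chm[OF pd(4) g(2) aq])
  let ?a = "pull ?q2 a" and ?L = "Lift S u (g, a)"
  have oa: "?a \<in> Ob" "ob ?a = Dom B ?q1" using reind_obj[OF pd(4) g(2) aq] pd by auto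
  have Le: "?L = FamArr (?q1, ?a) (g, a) u ?q2 (lft ?q2 a)" by (simp add: Sigma_compl_def)
  have Lh: "?L \<in> hm S u (?q1, ?a) (g, a)" unfolding Le
    by (rule S_hmI[OF P(2) g(1) u _ g(4) oa(2) g(3) _ chmD[OF L]]) (use pd in simp_all)
  have ex: "\<exists>n. n \<in> hm S w z (?q1, ?a) \<and> ?L \<odot>\<^sub>S n = m"
    if m: "m \<in> hm S (u \<cdot> w) z (g, a)" and w: "w \<in> Arr B" "Dom B w = PObj S z" "Cod B w = Dom B u" for m w z
  proof -
    obtain e d where z: "z = (e, d)" by (cases z)
    obtain f \<phi> where M: "m = FamArr (e, d) (g, a) (u \<cdot> w) f \<phi>" "e \<in> F" "ob d = Dom B e" "g \<cdot> f = (u \<cdot> w) \<cdot> e" "\<phi> \<in> hm p f d a"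
      by (rule S_hmE[OF m[unfolded z]])
    have w': "Dom B w = Cod B e" using w z by simp
    have ea: "e \<in> Arr B" using F_arr M by blast
    have F: "f \<in> Arr B" "Dom B f = Dom B e" "Cod B f = Dom B g" using hmD[OF M(5)] g M(3) by auto
    have we: "w \<cdot> e \<in> Arr B" "Dom B (w \<cdot> e) = Dom B f" "Cod B (w \<cdot> e) = Dom B u" using w w' ea F by simp_all
    have uwe: "u \<cdot> (w \<cdot> e) = g \<cdot> f" using M(4) w w' ea u by simp
    obtain t where t: "t \<in> Arr B" "Dom B t = Dom B (w \<cdot> e)" "Cod B t = Dom B ?q1" "?q1 \<cdot> t = w \<cdot> e" "?q2 \<cdot> t = f"
      using B.pb_fill[OF P(1) we(1) F(1) we(2,3) F(3) uwe] by metis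
    have tD: "Dom B t = ob d" "Cod B t = ob ?a" using t we F M(3) oa by auto
    obtain \<phi>' where f': "\<phi>' \<in> hm p t d ?a" "lft ?q2 a \<odot> \<phi>' = \<phi>"
      using cart_fill[OF L M(5) t(1) tD t(5)[symmetric]] .
    have "FamArr (e, d) (?q1, ?a) w t \<phi>' \<in> hm S w (e, d) (?q1, ?a)"
      by (rule S_hmI[OF M(2) P(2) w(1) w' _ M(3) oa(2) t(4) f'(1)]) (use w pd in simp)
    thus ?thesis using t(5) f'(2) unfolding Le z by (intro exI conjI) (assumption, simp add: M(1))
  qed
  have un: "n = n'" if n: "n \<in> hm S w z (?q1, ?a)" "n' \<in> hm S w z (?q1, ?a)" and e: "?L \<odot>\<^sub>S n = ?L \<odot>\<^sub>S n'" for n n' w z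
  proof -
    obtain k d where z: "z = (k, d)" by (cases z)
    obtain t \<phi> where N: "n = FamArr (k, d) (?q1, ?a) w t \<phi>" "?q1 \<cdot> t = w \<cdot> k" "\<phi> \<in> hm p t d ?a" by (rule S_hmE[OF n(1)[unfolded z]])
    obtain t' \<phi>' where N': "n' = FamArr (k, d) (?q1, ?a) w t' \<phi>'" "?q1 \<cdot> t' = w \<cdot> k" "\<phi>' \<in> hm p t' d ?a" by (rule S_hmE[OF n(2)[unfolded z]])
    have E: "?q2 \<cdot> t = ?q2 \<cdot> t'" "lft ?q2 a \<odot> \<phi> = lft ?q2 a \<odot> \<phi>'" using e unfolding Le S_simps N(1) N'(1) by auto
    have T: "t \<in> Arr B" "Cod B t = Dom B ?q1" "t' \<in> Arr B" "Cod B t' = Dom B ?q1" "Dom B t = Dom B t'"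
      using hmD[OF N(3)] hmD[OF N'(3)] oa by auto
    have "t = t'" by (rule B.pb_eq[OF P(1) T]) (simp_all only: N(2) N'(2) E)
    thus ?thesis using cart_eq[OF L N(3)] N'(3) E(2) by (simp add: N(1) N'(1))
  qed
  show "\<exists>y. Lift S u x \<in> hm S u y x \<and>
      (\<forall>m w z. m \<in> hm S (u \<cdot> w) z x --> w \<in> Arr B --> Dom B w = PObj S z --> Cod B w = Dom B u --> (\<exists>n. n \<in> hm S w z y \<and> Lift S u x \<odot>\<^sub>S n = m)) \<and>
      (\<forall>n n' w z. n \<in> hm S w z y --> n' \<in> hm S w z y --> Lift S u x \<odot>\<^sub>S n = Lift S u x \<odot>\<^sub>S n' --> n = n')"
    unfolding xe using Lh ex un by blast
qed

end

locale coprod_ff = r: dfib B r F + p: cofib B p F + fibfun B r p K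
  for B :: "('o, 'm) cat" (structure) and r :: "('o, 'm, 'e1, 'f1) fibn" and p :: "('o, 'm, 'e2, 'f2) fibn" and F K +
  assumes K_cproj: "\<And>a. a \<in> Obj (Tot r) ==> cproj B F p (fobj K a)"
begin

definition "Lo x = (case x of (g, a) => fobj (coprod B p g) (Go a))"
definition "inn x = (case x of (g, a) => cin B p g (Go a))"
definition "La m = (THE x. x \<in> hm p (bmap m) (Lo (src m)) (Lo (tgt m)) \<and> x \<odot> inn (src m) = inn (tgt m) \<odot> Ga (fmap m))"
definition "L = \<lparr>fobj = Lo, farr = La\<rparr>"

lemma inn:
  assumes "(g, a) \<in> fam_obj B F r"
  shows "Lo (g, a) \<in> Obj (Tot p)" "PObj p (Lo (g, a)) = Cod B g" "inn (g, a) \<in> hm p g (Go a) (Lo (g, a))" "opcart B p (inn (g, a))"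
proof -
  have g: "g \<in> F" "Go a \<in> Obj (Tot p)" "PObj p (Go a) = Dom B g" using assms G_obj by (auto simp: r.fam_obj_iff)
  show "Lo (g, a) \<in> Obj (Tot p)" "PObj p (Lo (g, a)) = Cod B g" "inn (g, a) \<in> hm p g (Go a) (Lo (g, a))" "opcart B p (inn (g, a))"
    unfolding Lo_def inn_def using p.coprod_obj[OF g] p.cin_opcart[OF g] by auto
qed

lemma La:
  assumes "m \<in> hm r.S u (g, a) (h, b)"
  shows "La m \<in> hm p u (Lo (g, a)) (Lo (h, b))" "La m \<odot> inn (g, a) = inn (h, b) \<odot> Ga (fmap m)"
    "\<And>x. x \<in> hm p u (Lo (g, a)) (Lo (h, b)) ==> x \<odot> inn (g, a) = inn (h, b) \<odot> Ga (fmap m) ==> x = La m"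
proof -
  obtain f \<phi> where m: "m = FamArr (g, a) (h, b) u f \<phi>" "g \<in> F" "h \<in> F" "u \<in> Arr B" "Dom B u = Cod B g" "Cod B u = Cod B h"
    "PObj r a = Dom B g" "PObj r b = Dom B h" "h \<cdot> f = u \<cdot> g" "\<phi> \<in> hm r f a b" by (rule r.S_hmE[OF assms])
  have o: "(g, a) \<in> fam_obj B F r" "(h, b) \<in> fam_obj B F r" using m r.hmD[OF m(10)] by (auto simp: r.fam_obj_iff)
  note g = inn[OF o(1)] and h = inn[OF o(2)]
  have "inn (h, b) \<odot> Ga \<phi> \<in> hm p (h \<cdot> f) (Go a) (Lo (h, b))" by (rule p.comp_hm[OF G_hm[OF m(10)] h(3)])
  from p.opcart_ex1[OF g(4,3) this m(4) _ m(9)] m(5) g(2)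
  have ex: "\<exists>!x. x \<in> hm p u (Lo (g, a)) (Lo (h, b)) \<and> x \<odot> inn (g, a) = inn (h, b) \<odot> Ga \<phi>" by simp
  have e: "La m = (THE x. x \<in> hm p u (Lo (g, a)) (Lo (h, b)) \<and> x \<odot> inn (g, a) = inn (h, b) \<odot> Ga \<phi>)"
    unfolding La_def m(1) fam_arr.sel ..
  have t: "La m \<in> hm p u (Lo (g, a)) (Lo (h, b)) \<and> La m \<odot> inn (g, a) = inn (h, b) \<odot> Ga \<phi>"
    unfolding e by (rule theI'[OF ex])
  show "La m \<in> hm p u (Lo (g, a)) (Lo (h, b))" "La m \<odot> inn (g, a) = inn (h, b) \<odot> Ga (fmap m)"
    "\<And>x. x \<in> hm p u (Lo (g, a)) (Lo (h, b)) ==> x \<odot> inn (g, a) = inn (h, b) \<odot> Ga (fmap m) ==> x = La m"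
    using t ex unfolding m(1) fam_arr.sel by blast+
qed

lemma L_fun_over: "fun_over r.S p L"
proof -
  have "is_functor (Tot r.S) (Tot p) L" unfolding is_functor_def
  proof (intro conjI ballI impI)
    fix x assume x: "x \<in> Obj (Tot r.S)"
    obtain g a where xe: "x = (g, a)" by (cases x)
    hence o: "(g, a) \<in> fam_obj B F r" using x by simp
    note I = inn[OF o]
    show "fobj L x \<in> Obj (Tot p)" using I xe by (simp add: L_def)
    have oa: "a \<in> Obj (Tot r)" using o by (simp add: r.fam_obj_iff)
    show "farr L (Ide (Tot r.S) x) = Ide (Tot p) (fobj L x)"
      using La(3)[OF r.S_ide_hm[OF o], of "Ide (Tot p) (Lo (g, a))"] p.ide_hm[OF I(1)] I(2) p.idl[OF I(3)] p.idr[OF I(3)] G_ide[OF oa]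
      by (simp add: L_def xe)
  next
    fix m assume "m \<in> Arr (Tot r.S)"
    hence m: "m \<in> hm r.S (bmap m) (fst (src m), snd (src m)) (fst (tgt m), snd (tgt m))" using r.S_arr_hm by simp
    show "farr L m \<in> hom (Tot p) (fobj L (Dom (Tot r.S) m)) (fobj L (Cod (Tot r.S) m))"
      using La(1)[OF m] by (auto simp: L_def hm_def hom_def)
    fix n assume n0: "n \<in> Arr (Tot r.S)" "Cod (Tot r.S) m = Dom (Tot r.S) n"
    hence n: "n \<in> hm r.S (bmap n) (fst (tgt m), snd (tgt m)) (fst (tgt n), snd (tgt n))" using r.S_arr_hm by simp
    have o: "(fst (src m), snd (src m)) \<in> fam_obj B F r" "(fst (tgt m), snd (tgt m)) \<in> fam_obj B F r" "(fst (tgt n), snd (tgt n)) \<in> fam_obj B F r"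
      using r.S_hmE[OF m] r.S_hmE[OF n] r.hmD by (metis r.fam_obj_iff)+
    obtain f \<phi> where f: "m = FamArr (fst (src m), snd (src m)) (fst (tgt m), snd (tgt m)) (bmap m) f \<phi>" "\<phi> \<in> hm r f (snd (src m)) (snd (tgt m))"
      by (rule r.S_hmE[OF m])
    obtain f2 \<phi>2 where f2: "n = FamArr (fst (tgt m), snd (tgt m)) (fst (tgt n), snd (tgt n)) (bmap n) f2 \<phi>2" "\<phi>2 \<in> hm r f2 (snd (tgt m)) (snd (tgt n))"
      by (rule r.S_hmE[OF n])
    have fm: "fmap m \<in> hm r f (snd (src m)) (snd (tgt m))" "fmap n \<in> hm r f2 (snd (tgt m)) (snd (tgt n))" using f f2 by (metis fam_arr.sel(5))+
    note M = La[OF m] and N = La[OF n]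
    note I = inn[OF o(1)] and J = inn[OF o(2)] and H = inn[OF o(3)]
    have "La n \<odot> La m \<odot> inn (src m) = inn (tgt n) \<odot> (Ga (fmap n) \<odot> Ga (fmap m))"
      using p.ac[OF I(3) M(1) N(1)] M(2) p.ac[OF G_hm[OF fm(1)] J(3) N(1)] N(2) p.ac[OF G_hm[OF fm(1)] G_hm[OF fm(2)] H(3)] by simp
    also have "\<dots> = inn (tgt n) \<odot> Ga (fmap (n \<odot>\<^sub>r.S m))" using G_comp[OF fm] by simp
    finally have "La n \<odot> La m = La (n \<odot>\<^sub>r.S m)"
      using La(3)[OF r.S_comp_hm[OF m n] p.comp_hm[OF M(1) N(1)]] by simp
    thus "farr L (n \<odot>\<^sub>r.S m) = farr L n \<odot> farr L m" by (simp add: L_def)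
  qed
  moreover have "PArr p (farr L m) = PArr r.S m" if "m \<in> Arr (Tot r.S)" for m
    using La(1)[of m "bmap m" "fst (src m)" "snd (src m)" "fst (tgt m)" "snd (tgt m)"] r.S_arr_hm[OF that] by (auto simp: L_def hm_def)
  moreover have "PObj p (fobj L x) = PObj r.S x" if "x \<in> Obj (Tot r.S)" for x
    using inn(2)[of "fst x" "snd x"] that by (cases x) (simp add: L_def)
  ultimately show ?thesis unfolding fun_over_def by blast
qed

lemma L_ff: "fully_faithful r.S p L"
  unfolding fully_faithful_def
proof (intro ballI)
  fix x y h assume x: "x \<in> Obj (Tot r.S)" and y: "y \<in> Obj (Tot r.S)" and h: "h \<in> hom (Tot p) (fobj L x) (fobj L y)"
  obtain g a where xe: "x = (g, a)" by (cases x)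
  obtain k b where ye: "y = (k, b)" by (cases y)
  have o: "(g, a) \<in> fam_obj B F r" "(k, b) \<in> fam_obj B F r" using x y xe ye by auto
  note I = inn[OF o(1)] and J = inn[OF o(2)]
  have oo: "g \<in> F" "a \<in> Obj (Tot r)" "PObj r a = Dom B g" "k \<in> F" "b \<in> Obj (Tot r)" "PObj r b = Dom B k" using o by (auto simp: r.fam_obj_iff)
  define u where "u = PArr p h"
  have hh: "h \<in> hm p u (Lo (g, a)) (Lo (k, b))" using h by (auto simp: hom_def hm_def u_def L_def xe ye)
  have hi: "h \<odot> inn (g, a) \<in> hm p (u \<cdot> g) (Go a) (Lo (k, b))" by (rule p.comp_hm[OF I(3) hh])
  have ex: "\<exists>!z. z \<in> hom (Tot p) (Go a) (Go b) \<and> inn (k, b) \<odot> z = h \<odot> inn (g, a)"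
    using K_cproj[OF oo(2)] oo(4) J(3,4) hi unfolding cproj_def by blast
  then obtain z where z: "z \<in> hom (Tot p) (Go a) (Go b)" "inn (k, b) \<odot> z = h \<odot> inn (g, a)" by blast
  have zh: "z \<in> hm p (PArr p z) (Go a) (Go b)" using z(1) by (auto simp: hom_def hm_def)
  obtain \<phi> where f: "\<phi> \<in> hm r (PArr p z) a b" "Ga \<phi> = z" using G_full[OF zh oo(2,5)] .
  have kz: "k \<cdot> PArr p z = u \<cdot> g" using p.hmD[OF hi] p.hmD[OF p.comp_hm[OF zh J(3)]] z(2) by metis
  have m: "FamArr (g, a) (k, b) u (PArr p z) \<phi> \<in> hm r.S u (g, a) (k, b)"
    by (rule r.S_hmI[OF oo(1,4) _ _ _ oo(3,6) kz f(1)]) (use p.hmD[OF hh] I(2) J(2) in simp_all)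
  show "\<exists>!f. f \<in> hom (Tot r.S) x y \<and> farr L f = h"
  proof (rule ex1I[of _ "FamArr (g, a) (k, b) u (PArr p z) \<phi>"])
    have "h = La (FamArr (g, a) (k, b) u (PArr p z) \<phi>)" by (rule La(3)[OF m hh]) (simp add: f z)
    thus "FamArr (g, a) (k, b) u (PArr p z) \<phi> \<in> hom (Tot r.S) x y \<and> farr L (FamArr (g, a) (k, b) u (PArr p z) \<phi>) = h"
      using m by (auto simp: L_def xe ye hom_def hm_def)
    fix n assume n: "n \<in> hom (Tot r.S) x y \<and> farr L n = h"
    hence nh: "n \<in> hm r.S (bmap n) (g, a) (k, b)" by (auto simp: hom_def hm_def xe ye)
    have bn: "bmap n = u" using p.hmD[OF La(1)[OF nh]] n by (auto simp: u_def L_def)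
    obtain f2 \<phi>2 where n2: "n = FamArr (g, a) (k, b) u f2 \<phi>2" "\<phi>2 \<in> hm r f2 a b" using r.S_hmE[OF nh] bn by metis
    have "inn (k, b) \<odot> Ga \<phi>2 = h \<odot> inn (g, a)" using La(2)[OF nh] n n2(1) by (simp add: L_def)
    moreover have "Ga \<phi>2 \<in> hom (Tot p) (Go a) (Go b)" using G_hm[OF n2(2)] by (auto simp: hom_def hm_def)
    ultimately have "Ga \<phi>2 = z" using ex z by blast
    hence "\<phi>2 = \<phi>" using G_faithful[OF n2(2) f(1)] f(2) by simp
    thus "n = FamArr (g, a) (k, b) u (PArr p z) \<phi>" using n2 r.hmD[OF f(1)] r.hmD[OF n2(2)] by auto
  qed
qed

lemma L_equivalence:
  assumes "\<And>\<alpha>. \<alpha> \<in> Obj (Tot p) ==> \<exists>g \<in> F. \<exists>a \<in> Obj (Tot r). \<exists>\<iota>. \<iota> \<in> hm p g (Go a) \<alpha> \<and> opcart B p \<iota>"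
  shows "fibred_equivalent B r.S p"
proof -
  interpret S: fib B r.S by (rule fib.intro) (rule r.S_fibration)
  interpret L: fibfun B r.S p L by unfold_locales (rule L_fun_over L_ff)+
  have "ess_surj B r.S p L" unfolding ess_surj_def
  proof
    fix \<alpha> assume "\<alpha> \<in> Obj (Tot p)"
    then obtain g a \<iota> where g: "g \<in> F" "a \<in> Obj (Tot r)" "\<iota> \<in> hm p g (Go a) \<alpha>" "opcart B p \<iota>" using assms by blast
    have o: "(g, a) \<in> fam_obj B F r" using g p.hmD[OF g(3)] G_obj(2)[OF g(2)] by (auto simp: r.fam_obj_iff)
    obtain j j' where "viso B p (Lo (g, a)) \<alpha> j j'" using p.opcart_viso[OF inn(3,4)[OF o] g(3,4)] by blast
    thus "\<exists>a\<in>Obj (Tot r.S). \<exists>j j'. viso B p (fobj L a) \<alpha> j j'" using o by (intro bexI[of _ "(g, a)"]) (auto simp: L_def)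
  qed
  thus ?thesis by (rule L.equivalenceI)
qed

end

context fibfun
begin

lemma G_pcone:
  assumes pc: "\<And>c u a b. c \<in> chm B p u a b ==> Ga c \<in> chm B q u (Go a) (Go b)"
    and C: "pcone B p v \<pi> \<xi> M c \<beta>"
  shows "pcone B q v (Ga \<pi>) (Ga \<xi>) (Go M) (Go c) (Go \<beta>)"
  unfolding pcone_def using pc[OF p.pconeD(1)[OF C]] G_vhm[OF p.pconeD(3)[OF C]] by simp

lemma psplit_transfer:
  assumes pc: "\<And>c u a b. c \<in> chm B p u a b ==> Ga c \<in> chm B q u (Go a) (Go b)"
    and C: "pcone B p v \<pi> \<xi> M c \<beta>" and X: "\<chi> \<in> hm p w N c" and h: "h \<in> hm p y N \<alpha>"
    and S: "psplit B p \<pi> \<xi> \<chi> h"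
  shows "psplit B q (Ga \<pi>) (Ga \<xi>) (Ga \<chi>) (Ga h)"
proof -
  note C' = G_pcone[OF pc C]
  note K = p.pconeD(2)[OF C] p.pconeD(3)[OF C]
  have o: "\<beta> \<in> Obj (Tot p)" "\<alpha> \<in> Obj (Tot p)" "N \<in> Obj (Tot p)" "M \<in> Obj (Tot p)"
    using p.hmD[OF K(2)] p.hmD[OF h] by auto
  obtain g b l k where l: "l \<in> chm B p g b \<beta>" "psol B p \<pi> \<xi> \<chi> h l k" by (rule p.psplit_ex[OF C S])
  have fw: "psol B q (Ga \<pi>) (Ga \<xi>) (Ga \<chi>) (Ga h) (Ga l) (Ga k)"
  proof -
    obtain x e where s: "x \<in> hm p g N M" "\<pi> \<odot> x = \<chi>" "e \<in> vhm B p N b" "l \<odot> e = \<xi> \<odot> x" "k \<in> hm p y b \<alpha>" "k \<odot> e = h"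
      by (rule p.psolE[OF C X p.chmD[OF l(1)] h l(2)])
    show ?thesis
      by (rule q.psolI[OF C' G_hm[OF X] G_hm[OF p.chmD[OF l(1)]] G_hm[OF h] G_hm[OF s(1)] _ G_vhm[OF s(3)] _ G_hm[OF s(5)]])
        (use G_comp[OF s(1) K(1)] G_comp[OF s(3) p.chmD[OF l(1)]] G_comp[OF s(1) K(2)] G_comp[OF s(3,5)] s in simp_all)
  qed
  have L: "Lift p g \<beta> \<in> chm B p g (reindO B p g \<beta>) \<beta>" if "g \<in> Arr B" "Cod B g = PObj q (Go \<beta>)" for g
    using p.lift_chm[OF that(1) o(1)] that G_obj(2)[OF o(1)] by simp
  have bw: "\<exists>k0. Ga k0 = k \<and> psol B p \<pi> \<xi> \<chi> h (Lift p g \<beta>) k0"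
    if g: "g \<in> Arr B" "Cod B g = PObj q (Go \<beta>)" and s: "psol B q (Ga \<pi>) (Ga \<xi>) (Ga \<chi>) (Ga h) (Ga (Lift p g \<beta>)) k" for g k
  proof -
    note l = L[OF g]
    have ob: "reindO B p g \<beta> \<in> Obj (Tot p)" using p.hmD[OF p.chmD[OF l]] by blast
    obtain x e where s: "x \<in> hm q g (Go N) (Go M)" "Ga \<pi> \<odot>\<^sub>q x = Ga \<chi>" "e \<in> vhm B q (Go N) (Go (reindO B p g \<beta>))"
      "Ga (Lift p g \<beta>) \<odot>\<^sub>q e = Ga \<xi> \<odot>\<^sub>q x" "k \<in> hm q y (Go (reindO B p g \<beta>)) (Go \<alpha>)" "k \<odot>\<^sub>q e = Ga h"
      by (rule q.psolE[OF C' G_hm[OF X] G_hm[OF p.chmD[OF l]] G_hm[OF h] s])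
    obtain x0 where x0: "x0 \<in> hm p g N M" "Ga x0 = x" using G_full[OF s(1) o(3,4)] .
    obtain e0 where e0: "e0 \<in> vhm B p N (reindO B p g \<beta>)" "Ga e0 = e" using G_full_v[OF s(3) o(3) ob] .
    obtain k0 where k0: "k0 \<in> hm p y (reindO B p g \<beta>) \<alpha>" "Ga k0 = k" using G_full[OF s(5) ob o(2)] .
    have "psol B p \<pi> \<xi> \<chi> h (Lift p g \<beta>) k0"
    proof (rule p.psolI[OF C X p.chmD[OF l] h x0(1) _ e0(1) _ k0(1)])
      show "\<pi> \<odot> x0 = \<chi>" by (rule G_faithful[OF p.comp_hm[OF x0(1) K(1)] X]) (use G_comp[OF x0(1) K(1)] x0 s in simp)
      show "Lift p g \<beta> \<odot> e0 = \<xi> \<odot> x0"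
        by (rule G_faithful[OF p.comp_hm[OF e0(1) p.chmD[OF l]] p.comp_hm[OF x0(1) K(2)]])
          (use G_comp[OF e0(1) p.chmD[OF l]] G_comp[OF x0(1) K(2)] x0 e0 s in simp)
      show "k0 \<odot> e0 = h" by (rule G_faithful[OF p.comp_hm[OF e0(1) k0(1)] h]) (use G_comp[OF e0(1) k0(1)] e0 k0 s in simp)
    qed
    thus ?thesis using k0 by blast
  qed
  show ?thesis
  proof (rule q.psplit_chosenI[OF C' G_hm[OF X] G_hm[OF h] pc[OF l(1)] fw])
    show "Ga (Lift p g \<beta>) \<in> chm B q g (Go (reindO B p g \<beta>)) (Go \<beta>)" if "g \<in> Arr B" "Cod B g = PObj q (Go \<beta>)" for g
      by (rule pc[OF L[OF that]])
    fix g1 k1 g2 k2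
    assume 1: "g1 \<in> Arr B" "Cod B g1 = PObj q (Go \<beta>)" "psol B q (Ga \<pi>) (Ga \<xi>) (Ga \<chi>) (Ga h) (Ga (Lift p g1 \<beta>)) k1"
      and 2: "g2 \<in> Arr B" "Cod B g2 = PObj q (Go \<beta>)" "psol B q (Ga \<pi>) (Ga \<xi>) (Ga \<chi>) (Ga h) (Ga (Lift p g2 \<beta>)) k2"
    obtain m1 where m1: "Ga m1 = k1" "psol B p \<pi> \<xi> \<chi> h (Lift p g1 \<beta>) m1" using bw[OF 1] by blast
    obtain m2 where m2: "Ga m2 = k2" "psol B p \<pi> \<xi> \<chi> h (Lift p g2 \<beta>) m2" using bw[OF 2] by blast
    note U = p.psplit_un[OF C S L[OF 1(1,2)] m1(2) L[OF 2(1,2)] m2(2)]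
    show "g1 = g2 \<and> k1 = k2" using U m1 m2 by auto
  qed
qed

end

lemma (in cofib) coprod_qf_sub_fibration: "fibration B (coprod_qf_sub B F p)"
  unfolding coprod_qf_sub_def
  by (rule full_sub_fibration) (use coprod_qf_cart[OF lift_chm] in blast)

lemma (in profib) prod_qf_sub_fibration: "fibration B (full_sub p (prod_qf B F p))"
  by (rule full_sub_fibration) (use prod_qf_cart(1)[OF lift_chm] in blast)

lemma (in fib) full_sub_pcone:
  assumes "fibration B (full_sub p Q)"
  shows "pcone B (full_sub p Q) v \<pi> \<xi> M c \<beta> \<longleftrightarrow> Cone v \<pi> \<xi> M c \<beta> \<and> Q M \<and> Q c \<and> Q \<beta>"
  unfolding pcone_def full_sub_chm[OF assms] full_sub_hm by (auto simp: full_sub_simps)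

lemma (in fib) full_sub_sprod:
  assumes F: "fibration B (full_sub p Q)" and S: "Sprod v \<pi> \<xi> M c \<beta>" and Q: "Q M" "Q c" "Q \<beta>"
  shows "sprod B (full_sub p Q) v \<pi> \<xi> M c \<beta>"
proof -
  have C: "Cone v \<pi> \<xi> M c \<beta>" using S by (simp add: sprod_def)
  note K = hmD[OF pconeD(2)[OF C]] hmD[OF pconeD(3)[OF C]]
  have "ptest B (full_sub p Q) \<pi> \<xi> w u g" if "pbk w v u g" for w u g
    unfolding ptest_def
  proof (intro allI impI)
    fix \<pi>' N \<gamma> e assume k: "\<pi>' \<in> chm B (full_sub p Q) u N \<gamma>" and e: "e \<in> hm (full_sub p Q) g N (Cod (Tot (full_sub p Q)) \<xi>)"
    have k': "\<pi>' \<in> Car u N \<gamma>" "Q N" "Q \<gamma>" using k by (auto simp: full_sub_chm[OF F])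
    have e': "e \<in> hm p g N \<beta>" using e K by (simp add: full_sub_hm)
    have "pmed (full_sub p Q) \<pi> \<xi> \<pi>' e x \<longleftrightarrow> pmed p \<pi> \<xi> \<pi>' e x" for x
      unfolding pmed_def full_sub_hm using K hmD[OF chmD[OF k'(1)]] k' Q by simp
    moreover have "\<exists>!x. x \<in> hm p w \<gamma> c \<and> pmed p \<pi> \<xi> \<pi>' e x" using ptestD[OF C _ k'(1) e'] S that by (simp add: sprod_def)
    ultimately show "\<exists>!x. x \<in> hm (full_sub p Q) w \<gamma> (Cod (Tot (full_sub p Q)) \<pi>) \<and> pmed (full_sub p Q) \<pi> \<xi> \<pi>' e x"
      using K k' Q by (simp add: full_sub_hm)
  qed
  thus ?thesis using C Q unfolding sprod_def full_sub_pcone[OF F] by blast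
qed

locale densefun = coprod_ff B r p F K
  for B :: "('o, 'm) cat" (structure) and r :: "('o, 'm, 'e1, 'f1) fibn" and p :: "('o, 'm, 'e2, 'f2) fibn" and F K +
  assumes dense: "\<And>\<alpha>. \<alpha> \<in> Obj (Tot p) ==> \<exists>g \<in> F. \<exists>a \<in> Obj (Tot r). \<exists>\<iota>. \<iota> \<in> hm p g (fobj K a) \<alpha> \<and> opcart B p \<iota>"
begin

lemma K_cart:
  assumes c: "c \<in> chm B r u a' a"
  shows "Ga c \<in> chm B p u (Go a') (Go a)"
proof (rule p.cartI[OF G_hm[OF r.chmD[OF c]]])
  note ch = r.chmD[OF c]
  have o: "a' \<in> Obj (Tot r)" "a \<in> Obj (Tot r)" using r.hmD[OF ch] by auto
  fix \<delta> v k w assume k: "k \<in> hm p v \<delta> (Go a)" and w: "w \<in> Arr B" "Dom B w = PObj p \<delta>" "Cod B w = PObj p (Go a')"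
    and v: "v = u \<cdot> w"
  have d: "\<delta> \<in> Obj (Tot p)" using p.hmD[OF k] by blast
  obtain g d \<iota> where g: "g \<in> F" "d \<in> Obj (Tot r)" "\<iota> \<in> hm p g (Go d) \<delta>" "opcart B p \<iota>" using dense[OF d] by blast
  note gh = p.hmD[OF g(3)]
  have uD: "Dom B u = PObj r a'" "u \<in> Arr B" using r.hmD[OF ch] by auto
  have wg: "w \<cdot> g \<in> Arr B" "Dom B (w \<cdot> g) = PObj r d" "Cod B (w \<cdot> g) = PObj r a'"
    using w gh G_obj(2)[OF g(2)] G_obj(2)[OF o(1)] by auto
  have vg: "v \<cdot> g = u \<cdot> (w \<cdot> g)" using v w gh uD G_obj(2)[OF o(1)] by simp
  obtain k0 where k0: "k0 \<in> hm r (v \<cdot> g) d a" "Ga k0 = k \<odot> \<iota>" using G_full[OF p.comp_hm[OF g(3) k] g(2) o(2)] .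
  obtain x0 where x0: "x0 \<in> hm r (w \<cdot> g) d a'" "c \<odot>\<^sub>r x0 = k0" using r.cart_fill[OF c k0(1) wg vg] .
  obtain y where y: "y \<in> hm p w \<delta> (Go a')" "y \<odot> \<iota> = Ga x0"
    using p.opcart_fill[OF g(4,3) G_hm[OF x0(1)] w(1,2)] by blast
  have cy: "Ga c \<odot> y = k"
  proof (rule p.opcart_eq[OF g(4,3) _ k])
    show "Ga c \<odot> y \<in> hm p v \<delta> (Go a)" unfolding v by (rule p.comp_hm[OF y(1) G_hm[OF ch]])
    show "Ga c \<odot> y \<odot> \<iota> = k \<odot> \<iota>"
      using p.ac[OF g(3) y(1) G_hm[OF ch]] y(2) G_comp[OF x0(1) ch] x0(2) k0(2) by simp
  qed
  have "z = y" if z: "z \<in> hm p w \<delta> (Go a')" "Ga c \<odot> z = k" for z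
  proof (rule p.opcart_eq[OF g(4,3) z(1) y(1)])
    obtain z0 where z0: "z0 \<in> hm r (w \<cdot> g) d a'" "Ga z0 = z \<odot> \<iota>" using G_full[OF p.comp_hm[OF g(3) z(1)] g(2) o(1)] .
    have "c \<odot>\<^sub>r z0 = c \<odot>\<^sub>r x0"
      by (rule G_faithful[OF r.comp_hm[OF z0(1) ch] r.comp_hm[OF x0(1) ch]])
        (use G_comp[OF z0(1) ch] G_comp[OF x0(1) ch] z0 p.ac[OF g(3) z(1) G_hm[OF ch]] z x0 k0 in simp)
    thus "z \<odot> \<iota> = y \<odot> \<iota>" using r.cart_eq[OF c z0(1) x0(1)] z0 y by simp
  qed
  thus "\<exists>!x. x \<in> hm p w \<delta> (Go a') \<and> Ga c \<odot> x = k" using y(1) cy by blast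
qed

lemma K_reindex:
  assumes c: "c \<in> chm B p u \<alpha> (Go a)" and a: "a \<in> Obj (Tot r)"
  obtains j j' where "viso B p (Go (reindO B r u a)) \<alpha> j j'" "c \<odot> j = Ga (Lift r u a)" "Lift r u a \<in> chm B r u (reindO B r u a) a"
proof -
  have u: "u \<in> Arr B" "PObj r a = Cod B u" using p.hmD[OF p.chmD[OF c]] G_obj(2)[OF a] by auto
  note L = r.lift_chm[OF u(1) a u(2)]
  show ?thesis using p.cart_viso[OF K_cart[OF L] c] that L by metis
qed

lemma K_coprod_qf:
  assumes a: "a \<in> Obj (Tot r)"
  shows "coprod_qf B F p (Go a)"
  unfolding p.coprod_qf_iff[OF G_obj(1)[OF a]]
proof (intro allI impI)
  fix u c \<alpha> assume c: "c \<in> chm B p u \<alpha> (Go a)"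
  obtain j j' where "viso B p (Go (reindO B r u a)) \<alpha> j j'" "Lift r u a \<in> chm B r u (reindO B r u a) a"
    by (rule K_reindex[OF c a])
  thus "cproj B F p \<alpha>" using p.cproj_viso[OF K_cproj] r.hmD[OF r.chmD] by blast
qed

lemma coprod_qf_K:
  assumes a: "\<alpha> \<in> Obj (Tot p)" and q: "coprod_qf B F p \<alpha>"
  obtains a j j' where "a \<in> Obj (Tot r)" "viso B p (Go a) \<alpha> j j'"
proof -
  obtain g d \<iota> where g: "g \<in> F" "d \<in> Obj (Tot r)" "\<iota> \<in> hm p g (Go d) \<alpha>" "opcart B p \<iota>" using dense[OF a] by blast
  note i = p.ide_hm[OF a]
  have "cproj B F p \<alpha>" by (rule p.coprod_qf_cproj[OF a q])
  then obtain k where k: "k \<in> hom (Tot p) \<alpha> (Go d)" "\<iota> \<odot> k = Ide (Tot p) \<alpha>"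
    using g i unfolding cproj_def by blast
  define s where "s = PArr p k"
  have kh: "k \<in> hm p s \<alpha> (Go d)" using k(1) by (auto simp: hom_def hm_def s_def)
  have gs: "g \<cdot> s = Ide B (PObj p \<alpha>)" using p.hmD[OF p.comp_hm[OF kh g(3)]] k(2) p.hmD[OF i] by simp
  have sd: "s \<in> Arr B" "PObj r d = Cod B s" using p.hmD[OF kh] G_obj(2)[OF g(2)] by auto
  note L = r.lift_chm[OF sd(1) g(2) sd(2)]
  note KL = K_cart[OF L]
  let ?d = "reindO B r s d"
  have od: "?d \<in> Obj (Tot r)" using r.hmD[OF r.chmD[OF L]] by blast
  obtain k1 where k1: "k1 \<in> vhm B p \<alpha> (Go ?d)" "Ga (Lift r s d) \<odot> k1 = k" using p.cart_vfill[OF KL kh] .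
  have P: "PObj p (Go ?d) = PObj p \<alpha>" using p.vhmD[OF k1(1)] .
  define m where "m = \<iota> \<odot> Ga (Lift r s d)"
  have mh: "m \<in> vhm B p (Go ?d) \<alpha>" using p.comp_hm[OF p.chmD[OF KL] g(3)] gs P by (simp add: m_def)
  have mk: "m \<odot> k1 = Ide (Tot p) \<alpha>" unfolding m_def using p.ac[OF k1(1) p.chmD[OF KL] g(3)] k1(2) k(2) by simp
  have "k1 \<odot> m = Ide (Tot p) (Go ?d)"
  proof (rule p.cart_eq[OF KL p.comp_vl[OF mh k1(1)] p.ide_hm[OF G_obj(1)[OF od]]])
    have km: "Ga (Lift r s d) \<odot> (k1 \<odot> m) \<in> hom (Tot p) (Go ?d) (Go d)"
      "Ga (Lift r s d) \<in> hom (Tot p) (Go ?d) (Go d)"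
      using p.comp_hm[OF p.comp_vl[OF mh k1(1)] p.chmD[OF KL]] p.chmD[OF KL] by (auto simp: hom_def hm_def)
    have "\<iota> \<odot> (Ga (Lift r s d) \<odot> (k1 \<odot> m)) = m \<odot> k1 \<odot> m"
      using p.ac[OF p.comp_vl[OF mh k1(1)] p.chmD[OF KL] g(3)] p.ac[OF mh k1(1) mh] by (simp add: m_def)
    also have "\<dots> = m" using mk p.idl[OF mh] by simp
    finally have e: "\<iota> \<odot> (Ga (Lift r s d) \<odot> (k1 \<odot> m)) = m" .
    have "\<exists>!z. z \<in> hom (Tot p) (Go ?d) (Go d) \<and> \<iota> \<odot> z = m"
      using K_cproj[OF od] g mh unfolding cproj_def by blast
    thus "Ga (Lift r s d) \<odot> (k1 \<odot> m) = Ga (Lift r s d) \<odot> Ide (Tot p) (Go ?d)"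
      using e km m_def p.idr[OF p.chmD[OF KL]] by metis
  qed
  hence "viso B p (Go ?d) \<alpha> m k1" using mh k1(1) mk P by (simp add: viso_def)
  thus ?thesis using that od by blast
qed

lemma enough: "enough_coprod_qf B F p"
  unfolding enough_coprod_qf_def
proof (intro conjI ballI)
  show "has_coproducts B F p" by (rule p.coproducts)
  fix \<alpha> assume a: "\<alpha> \<in> Obj (Tot p)"
  obtain g d \<iota> where g: "g \<in> F" "d \<in> Obj (Tot r)" "\<iota> \<in> hm p g (Go d) \<alpha>" "opcart B p \<iota>" using dense[OF a] by blast
  have o: "Go d \<in> Obj (Tot p)" "PObj p (Go d) = Dom B g" "Cod B g = PObj p \<alpha>" using p.hmD[OF g(3)] by auto
  obtain j j' where "viso B p \<alpha> (fobj (coprod B p g) (Go d)) j j'"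
    using p.opcart_viso[OF g(3,4) p.coprod_obj(4)[OF g(1) o(1,2)] p.cin_opcart[OF g(1) o(1,2)]] by metis
  hence "isomorphic (fibre B p (PObj p \<alpha>)) \<alpha> (fobj (coprod B p g) (Go d))" using p.isomorphic_fibre[OF a] by blast
  thus "\<exists>f\<in>F. Cod B f = PObj p \<alpha> \<and> (\<exists>\<beta>\<in>Obj (fibre B p (Dom B f)). coprod_qf B F p \<beta> \<and>
      isomorphic (fibre B p (PObj p \<alpha>)) \<alpha> (fobj (coprod B p f) \<beta>))"
    using g(1) o K_coprod_qf[OF g(2)] by (intro bexI[of _ g] conjI bexI[of _ "Go d"]) auto
qed

abbreviation "s \<equiv> coprod_qf_sub B F p"

lemma K_sub: "fibfun B r s K" "ess_surj B r s K"
proof -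
  interpret s: fib B s by (rule fib.intro) (rule p.coprod_qf_sub_fibration)
  have Q: "coprod_qf B F p (Go a)" if "a \<in> Obj (Tot r)" for a by (rule K_coprod_qf[OF that])
  have "fun_over r s K"
    using over Q unfolding fun_over_def is_functor_def coprod_qf_sub_def by (auto simp: hom_def)
  moreover have "fully_faithful r s K"
    using ff Q unfolding fully_faithful_def coprod_qf_sub_def full_sub_hom by auto
  ultimately show "fibfun B r s K" by unfold_locales
  show "ess_surj B r s K" unfolding ess_surj_def
  proof
    fix \<alpha> assume "\<alpha> \<in> Obj (Tot s)"
    hence a: "\<alpha> \<in> Obj (Tot p)" "coprod_qf B F p \<alpha>" by (auto simp: coprod_qf_sub_def)
    obtain d j j' where "d \<in> Obj (Tot r)" "viso B p (Go d) \<alpha> j j'" by (rule coprod_qf_K[OF a])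
    thus "\<exists>a\<in>Obj (Tot r). \<exists>j j'. viso B s (Go a) \<alpha> j j'"
      using a Q unfolding coprod_qf_sub_def full_sub_viso by blast
  qed
qed

text \<open>A map out of \<open>\<gamma>\<close>, pulled back along \<open>v\<close>, is tested on an
  opcartesian arrow from the image of \<open>K\<close>, which is stable under that pullback.\<close>

lemma sprod_nprod_K:
  assumes v: "v \<in> F" and S: "sprod B r v \<pi> \<xi> M c b"
  shows "nprod B p v (Ga \<pi>) (Ga \<xi>) (Go M) (Go c) (Go b)"
proof -
  have C: "pcone B r v \<pi> \<xi> M c b" using S by (simp add: sprod_def)
  note Ck = G_pcone[OF K_cart C]
  note R = r.pconeD[OF C]
  have oc: "c \<in> Obj (Tot r)" "b \<in> Obj (Tot r)" "M \<in> Obj (Tot r)" using r.hmD[OF R(2)] r.hmD[OF R(3)] by auto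
  have va: "v \<in> Arr B" using p.F_arr[OF v] .
  have "ptest B p (Ga \<pi>) (Ga \<xi>) (Ide B (Cod B v)) v (Ide B (Dom B v))"
    unfolding ptest_def
  proof (intro allI impI)
    fix \<pi>' N \<gamma> e assume k: "\<pi>' \<in> chm B p v N \<gamma>" and "e \<in> hm p (Ide B (Dom B v)) N (Cod (Tot p) (Ga \<xi>))"
    hence e: "e \<in> hm p (Ide B (Dom B v)) N (Go b)" using p.hmD[OF p.pconeD(3)[OF Ck]] by simp
    note kh = p.chmD[OF k]
    have go: "\<gamma> \<in> Obj (Tot p)" "PObj p \<gamma> = Cod B v" "PObj p N = Dom B v" using p.hmD[OF kh] by auto
    have ev: "e \<in> vhm B p N (Go b)" using e go by simp
    have cI: "Ide B (Cod B v) = Ide B (PObj p \<gamma>)" using go by simp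
    obtain g d \<iota> where g: "g \<in> F" "d \<in> Obj (Tot r)" "\<iota> \<in> hm p g (Go d) \<gamma>" "opcart B p \<iota>" using dense[OF go(1)] by blast
    have ga: "g \<in> Arr B" "Cod B g = Cod B v" "PObj r d = Dom B g" using p.hmD[OF g(3)] go G_obj(2)[OF g(2)] by auto
    obtain k0 g' where P: "is_pullback B g v k0 g'" using p.F_pb[OF v ga(1,2)] by metis
    note pd = is_pullbackD[OF P]
    have dk: "PObj r d = Cod B k0" using ga pd by simp
    note L = r.lift_chm[OF pd(3) g(2) dk]
    let ?d = "reindO B r k0 d" and ?l = "Lift r k0 d"
    note KL = K_cart[OF L]
    have od: "?d \<in> Obj (Tot r)" "PObj r ?d = Dom B k0" using r.reind_obj[OF pd(3) g(2) dk] by auto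
    have il: "\<iota> \<odot> Ga ?l \<in> hm p (g \<cdot> k0) (Go ?d) \<gamma>" by (rule p.comp_hm[OF p.chmD[OF KL] g(3)])
    obtain i where i: "i \<in> hm p g' (Go ?d) N" "\<pi>' \<odot> i = \<iota> \<odot> Ga ?l"
      using p.cart_fill[OF k il pd(4) _ _ pd(9)] pd od G_obj(2)[OF od(1)] go by metis
    have io: "opcart B p i" by (rule p.opcart_stable[OF P g(1,3,4) k KL i])
    have ei: "e \<odot> i \<in> hm p g' (Go ?d) (Go b)" using p.comp_vl[OF i(1) ev] .
    obtain e0 where e0: "e0 \<in> hm r g' ?d b" "Ga e0 = e \<odot> i" using G_full[OF ei od(1) oc(2)] .
    have "ptest B r \<pi> \<xi> g k0 g'" using S P by (simp add: sprod_def)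
    from r.ptestD[OF C this L e0(1)] have ex: "\<exists>!x. x \<in> hm r g d c \<and> pmed r \<pi> \<xi> ?l e0 x" .
    have fw: "pmed r \<pi> \<xi> ?l e0 x" if y: "y \<in> vhm B p \<gamma> (Go c)" and m: "pmed p (Ga \<pi>) (Ga \<xi>) \<pi>' e y"
      and x: "x \<in> hm r g d c" "Ga x = y \<odot> \<iota>" for x y
    proof -
      obtain y' where y': "y' \<in> hm p (Ide B (Dom B v)) N (Go M)" "Ga \<pi> \<odot> y' = y \<odot> \<pi>'" "Ga \<xi> \<odot> y' = e"
        using p.pmedE[OF Ck k e m] .
      have y'v: "y' \<in> vhm B p N (Go M)" using y'(1) go by simp
      obtain z where z: "z \<in> hm r g' ?d M" "Ga z = y' \<odot> i" using G_full[OF p.comp_vl[OF i(1) y'v] od(1) oc(3)] .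
      show ?thesis
      proof (rule r.pmedI[OF C L e0(1) z(1)])
        have "vg": "v \<cdot> g' = g \<cdot> k0" using pd(9) by simp
        show "\<pi> \<odot>\<^sub>r z = x \<odot>\<^sub>r ?l"
          by (rule G_faithful[OF r.comp_hm[OF z(1) R(2)] r.comp_hm[OF r.chmD[OF L] x(1)]])
            (use G_comp[OF z(1) R(2)] G_comp[OF r.chmD[OF L] x(1)] z(2) x(2) p.ac[OF i(1) y'v p.pconeD(2)[OF Ck]] y'(2)
              p.ac[OF i(1) kh y] i(2) p.ac[OF p.chmD[OF KL] g(3) y] in simp)
        show "\<xi> \<odot>\<^sub>r z = e0"
          by (rule G_faithful[OF r.comp_hm[OF z(1) R(3)] e0(1)])
            (use G_comp[OF z(1) R(3)] z(2) p.ac[OF i(1) y'v p.pconeD(3)[OF Ck]] y'(3) e0(2) in simp)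
      qed
    qed
    have bw: "pmed p (Ga \<pi>) (Ga \<xi>) \<pi>' e y" if y: "y \<in> vhm B p \<gamma> (Go c)" and m: "pmed r \<pi> \<xi> ?l e0 x"
      and x: "x \<in> hm r g d c" "Ga x = y \<odot> \<iota>" for x y
    proof -
      obtain z where z: "z \<in> hm r g' ?d M" "\<pi> \<odot>\<^sub>r z = x \<odot>\<^sub>r ?l" "\<xi> \<odot>\<^sub>r z = e0" using r.pmedE[OF C L e0(1) m] .
      have vI: "v \<cdot> Ide B (Dom B v) = Ide B (Cod B v) \<cdot> v" using va by simp
      have yc: "y \<in> hm p (Ide B (Cod B v)) \<gamma> (Go c)" using y go by simp
      obtain y' where y': "y' \<in> hm p (Ide B (Dom B v)) N (Go M)" "Ga \<pi> \<odot> y' = y \<odot> \<pi>'"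
        using p.pmed_ev[OF Ck k yc _ _ _ vI] va go by auto
      have y'v: "y' \<in> vhm B p N (Go M)" using y'(1) go by simp
      have "Ga \<pi> \<odot> (y' \<odot> i) = Ga \<pi> \<odot> Ga z"
        using p.ac[OF i(1) y'v p.pconeD(2)[OF Ck]] y'(2) p.ac[OF i(1) kh y] i(2) p.ac[OF p.chmD[OF KL] g(3) y] x(2)
          G_comp[OF z(1) R(2)] z(2) G_comp[OF r.chmD[OF L] x(1)] by simp
      hence yi: "y' \<odot> i = Ga z"
        using p.cart_eq[OF p.pconeD(1)[OF Ck] p.comp_vl[OF i(1) y'v] G_hm[OF z(1)]] by simp
      have "Ga \<xi> \<odot> y' = e"
      proof (rule p.opcart_eq[OF io i(1) p.comp_vl[OF y'v] ev])
        show "Ga \<xi> \<in> vhm B p (Go M) (Go b)" by (rule p.pconeD(3)[OF Ck])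
        show "Ga \<xi> \<odot> y' \<odot> i = e \<odot> i"
          using p.ac[OF i(1) y'v p.pconeD(3)[OF Ck]] yi G_comp[OF z(1) R(3)] z(3) e0(2) by simp
      qed
      from p.pmedI[OF Ck k e y' this] show ?thesis .
    qed
    have up: "\<exists>x. x \<in> hm r g d c \<and> Ga x = y \<odot> \<iota>" if y: "y \<in> vhm B p \<gamma> (Go c)" for y
      using G_full[OF p.comp_vl[OF g(3) y] g(2) oc(1)] by metis
    have "\<exists>!y. y \<in> vhm B p \<gamma> (Go c) \<and> pmed p (Ga \<pi>) (Ga \<xi>) \<pi>' e y"
    proof -
      obtain x where x: "x \<in> hm r g d c" "pmed r \<pi> \<xi> ?l e0 x" using ex by blast
      obtain y where y: "y \<in> vhm B p \<gamma> (Go c)" "y \<odot> \<iota> = Ga x"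
      proof -
        have "Ide B (PObj p \<gamma>) \<in> Arr B" "Dom B (Ide B (PObj p \<gamma>)) = PObj p \<gamma>" "g = Ide B (PObj p \<gamma>) \<cdot> g"
          using p.hmD[OF p.ide_hm[OF go(1)]] p.hmD[OF g(3)] by simp_all
        from p.opcart_fill[OF g(4,3) G_hm[OF x(1)] this] show ?thesis using that by blast
      qed
      show ?thesis
      proof (rule ex1I[of _ y])
        show "y \<in> vhm B p \<gamma> (Go c) \<and> pmed p (Ga \<pi>) (Ga \<xi>) \<pi>' e y" using bw[OF y(1) x(2,1)] y by simp
        fix z assume z: "z \<in> vhm B p \<gamma> (Go c) \<and> pmed p (Ga \<pi>) (Ga \<xi>) \<pi>' e z"
        then obtain xz where xz: "xz \<in> hm r g d c" "Ga xz = z \<odot> \<iota>" using up by blast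
        have "pmed r \<pi> \<xi> ?l e0 xz" using fw[OF conjunct1[OF z] conjunct2[OF z] xz] .
        hence "xz = x" using ex xz(1) x by blast
        hence "z \<odot> \<iota> = y \<odot> \<iota>" using xz(2) y(2) by metis
        thus "z = y" by (rule p.opcart_eq[OF g(4,3) conjunct1[OF z] y(1)])
      qed
    qed
    thus "\<exists>!y. y \<in> hm p (Ide B (Cod B v)) \<gamma> (Cod (Tot p) (Ga \<pi>)) \<and> pmed p (Ga \<pi>) (Ga \<xi>) \<pi>' e y"
      using p.hmD[OF p.pconeD(2)[OF Ck]] cI by simp
  qed
  thus ?thesis using Ck by (simp add: nprod_def)
qed

lemma goedel:
  assumes dp: "has_dependent_products B F" and hp: "has_products B F p" and er: "enough_prod_qf B F r"
  shows "dependent_Goedel B F p"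
proof -
  interpret pp: profib B p F by unfold_locales (rule hp)
  interpret rp: profib B r F by unfold_locales (use er in \<open>simp add: enough_prod_qf_def\<close>)
  interpret s: fib B s by (rule fib.intro) (rule p.coprod_qf_sub_fibration)
  interpret s: dfib B s F by unfold_locales (rule p.dmc)
  interpret Ks: fibfun B r s K by (rule K_sub(1))
  note E = K_sub(2)
  let ?Q = "coprod_qf B F p"
  have sF: "fibration B (full_sub p ?Q)" using s.fib by (simp add: coprod_qf_sub_def)
  have KQ: "?Q (Go a)" if "a \<in> Obj (Tot r)" for a by (rule K_coprod_qf[OF that])
  have prodcone: "\<exists>\<pi> \<xi> M c. sprod B p v (Ga \<pi>) \<xi> (Go M) (Go c) \<beta> \<and> M \<in> Obj (Tot r) \<and> c \<in> Obj (Tot r)"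
    if v: "v \<in> F" and b: "\<beta> \<in> Obj (Tot p)" "PObj p \<beta> = Dom B v" "?Q \<beta>" for v \<beta>
  proof -
    obtain b n n' where b0: "b \<in> Obj (Tot r)" "viso B p (Go b) \<beta> n n'" by (rule coprod_qf_K[OF b(1,3)])
    have nh: "n \<in> vhm B p (Go b) \<beta>" using p.visoD[OF b0(2)] by blast
    have bP: "PObj r b = Dom B v" using p.vhmD[OF nh] b(2) G_obj(2)[OF b0(1)] by simp
    note S = rp.prod_sprod[OF v b0(1) bP]
    define \<pi> \<xi> M c where "\<pi> = Lift r v (fobj (prodt B r v) b)" "\<xi> = acounit (prod_adj B r v) b"
      "M = reindO B r v (fobj (prodt B r v) b)" "c = fobj (prodt B r v) b"
    have S: "sprod B r v \<pi> \<xi> M c b" using S by (simp add: \<pi>_\<xi>_M_c_def)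
    have C: "pcone B r v \<pi> \<xi> M c b" using S by (simp add: sprod_def)
    have o: "M \<in> Obj (Tot r)" "c \<in> Obj (Tot r)" using r.hmD[OF r.pconeD(2)[OF C]] by auto
    note N = sprod_nprod_K[OF v S]
    from p.nprod_post[OF N b0(2)] have "nprod B p v (Ga \<pi>) (n \<odot> Ga \<xi>) (Go M) (Go c) \<beta>" .
    from pp.nprod_is_sprod[OF v this] show ?thesis using o by blast
  qed
  have sk: "dependent_Skolem B F p"
    unfolding dependent_Skolem_def
  proof (intro conjI ballI impI)
    fix f \<alpha> assume f: "f \<in> F" and "\<alpha> \<in> Obj (fibre B p (Dom B f))" and q: "?Q \<alpha>"
    hence a: "\<alpha> \<in> Obj (Tot p)" "PObj p \<alpha> = Dom B f" by auto
    obtain \<pi> \<xi> M c where S: "sprod B p f (Ga \<pi>) \<xi> (Go M) (Go c) \<alpha>" "c \<in> Obj (Tot r)" using prodcone[OF f a q] by blast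
    obtain j j' where "viso B p (fobj (prodt B p f) \<alpha>) (Go c) j j'"
      using p.nprod_uniqueE[OF p.prod_nprod[OF pp.prod_ok[OF f] a] p.sprod_nprod[OF S(1)]] by metis
    thus "?Q (fobj (prodt B p f) \<alpha>)" using p.coprod_qf_viso KQ[OF S(2)] by blast
  qed (use dp hp enough in auto)
  have hs: "has_products B F s"
  proof (rule s.has_productsI)
    fix v \<beta> assume v: "v \<in> F" and b: "\<beta> \<in> Obj (Tot s)" "PObj s \<beta> = Dom B v"
    hence b': "\<beta> \<in> Obj (Tot p)" "PObj p \<beta> = Dom B v" "?Q \<beta>" by (auto simp: coprod_qf_sub_def)
    obtain \<pi> \<xi> M c where S: "sprod B p v (Ga \<pi>) \<xi> (Go M) (Go c) \<beta>" "M \<in> Obj (Tot r)" "c \<in> Obj (Tot r)"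
      using prodcone[OF v b'] by blast
    from p.full_sub_sprod[OF sF S(1) KQ KQ b'(3)] S
    show "\<exists>\<pi> \<xi> M c. sprod B s v \<pi> \<xi> M c \<beta>" unfolding coprod_qf_sub_def by blast
  qed
  interpret sp: profib B s F by unfold_locales (rule hs)
  have Kc: "Ga c \<in> chm B s u (Go a') (Go a)" if "c \<in> chm B r u a' a" for c u a' a
    by (rule Ks.preserve_cart[OF E that])
  have KS: "sprod B s v (Ga \<pi>) (Ga \<xi>) (Go M) (Go c) (Go b)"
    if v: "v \<in> F" and S: "sprod B r v \<pi> \<xi> M c b" for v \<pi> \<xi> M c b
  proof -
    have C: "pcone B r v \<pi> \<xi> M c b" using S by (simp add: sprod_def)
    have o: "M \<in> Obj (Tot r)" "c \<in> Obj (Tot r)" "b \<in> Obj (Tot r)" using r.hmD[OF r.pconeD(2)[OF C]] r.hmD[OF r.pconeD(3)[OF C]] by auto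
    show ?thesis unfolding coprod_qf_sub_def
      by (rule p.full_sub_sprod[OF sF pp.nprod_is_sprod[OF v sprod_nprod_K[OF v S]] KQ KQ KQ]) (use o in auto)
  qed
  have split: "prod_splitting B F s (Go a)" if a: "a \<in> Obj (Tot r)" and q: "prod_qf B F r a" for a
  proof (rule sp.prod_splittingI[OF Ks.G_obj(1)[OF a]])
    fix v \<beta> assume v: "v \<in> F" "Cod B v = PObj s (Go a)" and b: "\<beta> \<in> Obj (Tot s)" "PObj s \<beta> = Dom B v"
    obtain b n n' where b0: "b \<in> Obj (Tot r)" "viso B s (Go b) \<beta> n n'" using E b(1) unfolding ess_surj_def by blast
    have nh: "n \<in> vhm B s (Go b) \<beta>" using s.visoD[OF b0(2)] by blast
    have bP: "PObj r b = Dom B v" using s.vhmD[OF nh] b(2) Ks.G_obj(2)[OF b0(1)] by simp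
    define \<pi> \<xi> M c where "\<pi> = Lift r v (fobj (prodt B r v) b)" "\<xi> = acounit (prod_adj B r v) b"
      "M = reindO B r v (fobj (prodt B r v) b)" "c = fobj (prodt B r v) b"
    have S: "sprod B r v \<pi> \<xi> M c b" using rp.prod_sprod[OF v(1) b0(1) bP] by (simp add: \<pi>_\<xi>_M_c_def)
    have C: "pcone B r v \<pi> \<xi> M c b" using S by (simp add: sprod_def)
    have oc: "c \<in> Obj (Tot r)" using r.hmD[OF r.pconeD(2)[OF C]] by blast
    have ic: "Ide (Tot r) c \<in> chm B r (Ide B (PObj r c)) c c" using r.viso_cart[OF r.viso_ide[OF oc]] .
    have "psplit B s (Ga \<pi>) (Ga \<xi>) (Ide (Tot s) (Go c)) h" if h: "h \<in> vhm B s (Go c) (Go a)" for h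
    proof -
      obtain h0 where h0: "h0 \<in> vhm B r c a" "Ga h0 = h" using Ks.G_full_v[OF h oc a] .
      have "psplit B r \<pi> \<xi> (Ide (Tot r) c) h0" by (rule rp.prod_qf_psplit[OF q v(1) S ic h0(1)])
      from Ks.psplit_transfer[OF Kc C r.chmD[OF ic] h0(1) this] show ?thesis using h0(2) Ks.G_ide[OF oc] by simp
    qed
    hence "\<forall>h\<in>vhm B s (Go c) (Go a). psplit B s (Ga \<pi>) (Ga \<xi>) (Ide (Tot s) (Go c)) h" by (rule ballI)
    with s.sprod_nprod[OF KS[OF v(1) S]] b0(2)
    show "\<exists>\<pi> \<xi> M c \<beta>' n n'. nprod B s v \<pi> \<xi> M c \<beta>' \<and> viso B s \<beta>' \<beta> n n' \<and>
        (\<forall>h\<in>vhm B s c (Go a). psplit B s \<pi> \<xi> (Ide (Tot s) c) h)" by (intro exI conjI)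
  qed
  have qf: "prod_qf B F s (Go a)" if a: "a \<in> Obj (Tot r)" and q: "prod_qf B F r a" for a
    unfolding prod_qf_def
  proof (intro ballI impI)
    fix f assume f: "f \<in> Arr B" "Cod B f = PObj s (Go a)"
    have fa: "PObj r a = Cod B f" using f Ks.G_obj(2)[OF a] by simp
    note L = r.lift_chm[OF f(1) a fa]
    have Ls: "Lift s f (Go a) \<in> chm B s f (reindO B s f (Go a)) (Go a)"
      using s.lift_chm[OF f(1) Ks.G_obj(1)[OF a]] f by simp
    obtain j j' where j: "viso B s (Go (reindO B r f a)) (reindO B s f (Go a)) j j'"
      using s.cart_viso[OF Kc[OF L] Ls] by metis
    have "reindO B r f a \<in> Obj (Tot r)" using r.hmD[OF r.chmD[OF L]] by blast
    from sp.prod_splitting_viso[OF split[OF this rp.prod_qf_cart(1)[OF L q]] j]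
    show "prod_splitting B F s (reindO B s f (Go a))" .
  qed
  have "enough_prod_qf B F s" unfolding enough_prod_qf_def
  proof (intro conjI ballI)
    show "has_products B F s" by (rule hs)
    fix \<alpha> assume a: "\<alpha> \<in> Obj (Tot s)"
    obtain a j j' where a0: "a \<in> Obj (Tot r)" "viso B s (Go a) \<alpha> j j'" using E a unfolding ess_surj_def by blast
    obtain f b where f: "f \<in> F" "Cod B f = PObj r a" "b \<in> Obj (Tot r)" "PObj r b = Dom B f" "prod_qf B F r b"
      "isomorphic (fibre B r (PObj r a)) a (fobj (prodt B r f) b)"
      using er a0(1) unfolding enough_prod_qf_def by auto
    obtain i i' where i: "viso B r a (fobj (prodt B r f) b) i i'" using f(6) r.isomorphic_fibre[OF a0(1)] by blast
    note Sk = KS[OF f(1) rp.prod_sprod[OF f(1,3,4)]]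
    have kb: "Go b \<in> Obj (Tot s)" "PObj s (Go b) = Dom B f" using Ks.G_obj[OF f(3)] f(4) by auto
    obtain t t' where t: "viso B s (Go (fobj (prodt B r f) b)) (fobj (prodt B s f) (Go b)) t t'"
      using s.nprod_uniqueE[OF s.sprod_nprod[OF Sk] s.prod_nprod[OF sp.prod_ok[OF f(1)] kb]] by metis
    have V: "\<exists>j j'. viso B s \<alpha> (fobj (prodt B s f) (Go b)) j j'"
      using s.viso_comp[OF s.viso_sym[OF a0(2)] s.viso_comp[OF Ks.G_viso[OF i] t]] by blast
    have "PObj s \<alpha> = PObj r a" using s.vhmD[of j "Go a" \<alpha>] s.visoD[OF a0(2)] Ks.G_obj(2)[OF a0(1)] by simp
    thus "\<exists>f\<in>F. Cod B f = PObj s \<alpha> \<and> (\<exists>\<beta>\<in>Obj (fibre B s (Dom B f)). prod_qf B F s \<beta> \<and>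
        isomorphic (fibre B s (PObj s \<alpha>)) \<alpha> (fobj (prodt B s f) \<beta>))"
      using f(1,2) kb qf[OF f(3,5)] V s.isomorphic_fibre[OF a] by (intro bexI[of _ f] conjI bexI[of _ "Go b"]) auto
  qed
  thus ?thesis using sk unfolding dependent_Goedel_def by blast
qed

end

section \<open>The product completion\<close>

definition sq :: "('o, 'm) cat => 'm => 'm => 'm => 'm => bool" where
  "sq B f h u y \<longleftrightarrow> u \<in> Arr B \<and> y \<in> Arr B \<and> Dom B y = Dom B u \<and> Cod B u = Dom B f \<and> Cod B y = Dom B h \<and> f \<cdot>\<^sub>B u = h \<cdot>\<^sub>B y"

text \<open>
  A morphism \<open>m : (g, a) \<rightarrow> (h, b)\<close> of the product completion acts on generalised elements \<open>(u, y)\<close> of the pullback of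
  \<open>bmap m\<close> and \<open>h\<close>: \<open>ix m u y\<close> is the element of the domain of \<open>g\<close> named by \<open>m\<close>, and \<open>reps B p m u y \<pi> \<psi>\<close> says that the
  fibre part of \<open>m\<close> at \<open>(u, y)\<close> is the span \<open>a \<leftarrow> N \<rightarrow> b\<close> formed by the cartesian arrow \<open>\<pi>\<close> over \<open>ix m u y\<close> and by \<open>\<psi>\<close>.
  This makes composition in the completion composition of spans.
\<close>

definition ix :: "('o, 'm) cat => ('m, 'e, 'f) fam_arr => 'm => 'm => 'm" where
  "ix B m u y = imap m \<cdot>\<^sub>B pb_pair B (bmap m) (fst (tgt m)) u y"

definition reps :: "('o, 'm) cat => ('o, 'm, 'e, 'f) fibn => ('m, 'e, 'f) fam_arr => 'm => 'm => 'f => 'f => bool" where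
  "reps B p m u y \<pi> \<psi> \<longleftrightarrow> (\<exists>N z. \<pi> \<in> chm B p (ix B m u y) N (snd (src m)) \<and> \<psi> \<in> hm p y N (snd (tgt m)) \<and>
     z \<in> hm p (pb_pair B (bmap m) (fst (tgt m)) u y) N (reindO B p (imap m) (snd (src m))) \<and>
     Lift p (imap m) (snd (src m)) \<odot>\<^sub>p z = \<pi> \<and>
     Lift p (pb2 B (bmap m) (fst (tgt m))) (snd (tgt m)) \<odot>\<^sub>p (fmap m \<odot>\<^sub>p z) = \<psi>)"

context fib
begin

lemma restr_char:
  assumes s: "s \<in> Arr B" "\<alpha> \<in> Ob" "ob \<alpha> = Cod B s" and t: "t \<in> Arr B" "\<beta> \<in> Ob" "ob \<beta> = Cod B t"
    and st: "Dom B t = Dom B s" and r: "r \<in> Arr B" "Cod B r = Dom B s"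
    and f: "\<phi> \<in> hm p (Ide B (Dom B s)) (pull s \<alpha>) (pull t \<beta>)"
  shows "restr B p s \<alpha> t \<beta> r \<phi> \<in> hm p (Ide B (Dom B r)) (pull (s \<cdot> r) \<alpha>) (pull (t \<cdot> r) \<beta>)"
    "\<And>w N x z. x \<in> hm p w N (pull (s \<cdot> r) \<alpha>) ==> z \<in> hm p (r \<cdot> w) N (pull s \<alpha>) ==>
       lft s \<alpha> \<odot> z = lft (s \<cdot> r) \<alpha> \<odot> x ==>
       lft (t \<cdot> r) \<beta> \<odot> (restr B p s \<alpha> t \<beta> r \<phi> \<odot> x) = lft t \<beta> \<odot> (\<phi> \<odot> z)"
proof -
  let ?sa = "pull s \<alpha>" and ?tb = "pull t \<beta>"
  have oS: "?sa \<in> Ob" "ob ?sa = Cod B r" and oT: "?tb \<in> Ob" "ob ?tb = Cod B r"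
    using reind_obj[OF s] reind_obj[OF t] st r by auto
  have sr: "s \<cdot> r \<in> Arr B" "ob \<alpha> = Cod B (s \<cdot> r)" "Dom B (s \<cdot> r) = Dom B r"
    and tr: "t \<cdot> r \<in> Arr B" "ob \<beta> = Cod B (t \<cdot> r)" "Dom B (t \<cdot> r) = Dom B r" using s t r st by auto
  note Ls = lift_chm[OF s] and Lt = lift_chm[OF t] and Lsr = lift_chm[OF sr(1) s(2) sr(2)] and Ltr = lift_chm[OF tr(1) t(2) tr(2)]
  note Lrs = lift_chm[OF r(1) oS] and Lrt = lift_chm[OF r(1) oT]
  have L2: "Lift2 B p s r \<alpha> \<in> Car (s \<cdot> r) (pull r ?sa) \<alpha>" "Lift2 B p t r \<beta> \<in> Car (t \<cdot> r) (pull r ?tb) \<beta>"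
    unfolding Lift2_def using cart_comp[OF Ls Lrs] cart_comp[OF Lt Lrt] by auto
  have fv: "\<phi> \<in> Ver ?sa ?tb" using f oS r by simp
  note R = reindA[OF r(1) oS(2) fv]
  define i where "i = vfill B p (Lift2 B p s r \<alpha>) (lft (s \<cdot> r) \<alpha>)"
  define j where "j = vfill B p (lft (t \<cdot> r) \<beta>) (Lift2 B p t r \<beta>)"
  have i: "i \<in> Ver (pull (s \<cdot> r) \<alpha>) (pull r ?sa)" "Lift2 B p s r \<alpha> \<odot> i = lft (s \<cdot> r) \<alpha>"
    using vfill_ex1[OF L2(1) chmD[OF Lsr]] by (auto simp: i_def)
  have j: "j \<in> Ver (pull r ?tb) (pull (t \<cdot> r) \<beta>)" "lft (t \<cdot> r) \<beta> \<odot> j = Lift2 B p t r \<beta>"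
    using vfill_ex1[OF Ltr chmD[OF L2(2)]] by (auto simp: j_def)
  have e: "restr B p s \<alpha> t \<beta> r \<phi> = j \<odot> reindA B p r \<phi> \<odot> i" by (simp add: restr_def i_def j_def)
  note jR = comp_vl[OF R(1) j(1)]
  have h: "restr B p s \<alpha> t \<beta> r \<phi> \<in> Ver (pull (s \<cdot> r) \<alpha>) (pull (t \<cdot> r) \<beta>)"
    unfolding e using comp_vr[OF i(1) jR] vhmD[OF i(1)] by simp
  thus "restr B p s \<alpha> t \<beta> r \<phi> \<in> hm p (Ide B (Dom B r)) (pull (s \<cdot> r) \<alpha>) (pull (t \<cdot> r) \<beta>)"
    using reind_obj(2)[OF sr(1) s(2) sr(2)] sr by simp
  fix w N x z assume x: "x \<in> hm p w N (pull (s \<cdot> r) \<alpha>)" and z: "z \<in> hm p (r \<cdot> w) N ?sa"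
    and xz: "lft s \<alpha> \<odot> z = lft (s \<cdot> r) \<alpha> \<odot> x"
  note ix = comp_vl[OF x i(1)]
  have "lft s \<alpha> \<odot> (lft r ?sa \<odot> (i \<odot> x)) = lft s \<alpha> \<odot> z"
    using ac[OF ix chmD[OF Lrs] chmD[OF Ls]] i(2) ac[OF x i(1) chmD[OF L2(1)]] xz by (simp add: Lift2_def)
  hence z': "lft r ?sa \<odot> (i \<odot> x) = z" using cart_eq[OF Ls comp_hm[OF ix chmD[OF Lrs]] z] by simp
  have "lft (t \<cdot> r) \<beta> \<odot> (restr B p s \<alpha> t \<beta> r \<phi> \<odot> x) = lft (t \<cdot> r) \<beta> \<odot> (j \<odot> (reindA B p r \<phi> \<odot> (i \<odot> x)))"
    unfolding e using ac[OF x i(1) jR] ac[OF ix R(1) j(1)] by simp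
  also have "\<dots> = lft t \<beta> \<odot> (lft r ?tb \<odot> (reindA B p r \<phi> \<odot> (i \<odot> x)))"
    using ac[OF comp_vl[OF ix R(1)] j(1) chmD[OF Ltr]] j(2) ac[OF comp_vl[OF ix R(1)] chmD[OF Lrt] chmD[OF Lt]] by (simp add: Lift2_def)
  also have "\<dots> = lft t \<beta> \<odot> (\<phi> \<odot> z)"
    using ac[OF ix R(1) chmD[OF Lrt]] R(2) ac[OF ix chmD[OF Lrs] fv] z' by simp
  finally show "lft (t \<cdot> r) \<beta> \<odot> (restr B p s \<alpha> t \<beta> r \<phi> \<odot> x) = lft t \<beta> \<odot> (\<phi> \<odot> z)" .
qed

end

context dfib
begin

abbreviation "Reps \<equiv> reps B p"
abbreviation "R \<equiv> Pi_compl B F p"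

lemma
  assumes "h \<in> F" "f \<in> Arr B" "Cod B f = Cod B h" "sq B f h u y"
  shows pb_pair: "pb_pair B f h u y \<in> Arr B" "Dom B (pb_pair B f h u y) = Dom B u" "Cod B (pb_pair B f h u y) = Dom B (pb1 B f h)"
    "pb1 B f h \<cdot> pb_pair B f h u y = u" "pb2 B f h \<cdot> pb_pair B f h u y = y"
    and pb_pair_unique: "\<And>t. t \<in> Arr B ==> Cod B t = Dom B (pb1 B f h) ==> pb1 B f h \<cdot> t = u ==> pb2 B f h \<cdot> t = y ==> t = pb_pair B f h u y"
proof -
  note P = pb_chosen[OF assms(1-3)]
  have s: "u \<in> Arr B" "y \<in> Arr B" "Dom B u = Dom B y" "Cod B u = Dom B f" "Cod B y = Dom B h" "f \<cdot> u = h \<cdot> y" using assms(4) by (auto simp: sq_def)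
  obtain t where t: "t \<in> Arr B" "Dom B t = Dom B u" "Cod B t = Dom B (pb1 B f h)" "pb1 B f h \<cdot> t = u" "pb2 B f h \<cdot> t = y"
    using B.pb_fill[OF P(1) s] by metis
  note pd = is_pullbackD[OF P(1)]
  have un: "t' = t" if t': "t' \<in> Arr B" "Cod B t' = Dom B (pb1 B f h)" "pb1 B f h \<cdot> t' = u" "pb2 B f h \<cdot> t' = y" for t'
  proof -
    have "Dom B t' = Dom B t" using B.comp_dom[OF t'(1) pd(3) t'(2)] t'(3) t(2) by simp
    thus ?thesis using B.pb_eq[OF P(1) t'(1,2) t(1,3)] t' t by simp
  qed
  have e: "pb_pair B f h u y = t" unfolding pb_pair_def
  proof (rule the_equality)
    show "t \<in> hom B (Dom B u) (Dom B (pb1 B f h)) \<and> pb1 B f h \<cdot> t = u \<and> pb2 B f h \<cdot> t = y" using t by (simp add: hom_def)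
  next
    fix s assume "s \<in> hom B (Dom B u) (Dom B (pb1 B f h)) \<and> pb1 B f h \<cdot> s = u \<and> pb2 B f h \<cdot> s = y"
    thus "s = t" using un[of s] unfolding hom_def by blast
  qed
  show "pb_pair B f h u y \<in> Arr B" "Dom B (pb_pair B f h u y) = Dom B u" "Cod B (pb_pair B f h u y) = Dom B (pb1 B f h)"
    "pb1 B f h \<cdot> pb_pair B f h u y = u" "pb2 B f h \<cdot> pb_pair B f h u y = y"
    "\<And>t. t \<in> Arr B ==> Cod B t = Dom B (pb1 B f h) ==> pb1 B f h \<cdot> t = u ==> pb2 B f h \<cdot> t = y ==> t = pb_pair B f h u y"
    unfolding e by (rule t un | assumption)+
qed

lemma sq_restr: "sq B f h u y ==> t \<in> Arr B ==> Cod B t = Dom B u ==> f \<in> Arr B ==> h \<in> Arr B ==> sq B f h (u \<cdot> t) (y \<cdot> t)"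
  using B.pre[of f u "h \<cdot> y" t] by (auto simp: sq_def)

lemma pb_sq: "pbk f h u y ==> sq B f h u y"
  using is_pullbackD[of B f h u y] by (auto simp: sq_def)

lemma pb_pair_restr:
  assumes h: "h \<in> F" "f \<in> Arr B" "Cod B f = Cod B h" and s: "sq B f h u y" and t: "t \<in> Arr B" "Cod B t = Dom B u"
  shows "pb_pair B f h (u \<cdot> t) (y \<cdot> t) = pb_pair B f h u y \<cdot> t"
proof -
  note P = pb_pair[OF h s]
  note Q = pb_pair_unique[OF h sq_restr[OF s t h(2) F_arr[OF h(1)]]]
  note pd = is_pullbackD[OF pb_chosen(1)[OF h]]
  show ?thesis
  proof (rule Q[symmetric])
    show "pb1 B f h \<cdot> (pb_pair B f h u y \<cdot> t) = u \<cdot> t" using B.pre[OF P(4) pd(3) P(1) P(3) t(1)] P(2) t(2) by simp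
    show "pb2 B f h \<cdot> (pb_pair B f h u y \<cdot> t) = y \<cdot> t" using B.pre[OF P(5) pd(4) P(1) _ t(1)] P(2,3) t(2) pd(6) by simp
  qed (use P(1-3) t in simp_all)
qed

lemma R_simps [simp]:
  "Obj (Tot R) = Fam" "Dom (Tot R) = src" "Cod (Tot R) = tgt" "PObj R (g, a) = Cod B g" "PArr R = bmap"
  "Comp (Tot R) = Pi_comp B p"
  by (simp_all add: Pi_compl_def)

definition "rmor f0 g a h b f1 \<phi> \<longleftrightarrow> g \<in> F \<and> h \<in> F \<and> a \<in> Ob \<and> b \<in> Ob \<and> ob a = Dom B g \<and> ob b = Dom B h \<and>
    f0 \<in> Arr B \<and> Dom B f0 = Cod B g \<and> Cod B f0 = Cod B h \<and> f1 \<in> Arr B \<and> Dom B f1 = Dom B (pb1 B f0 h) \<and> Cod B f1 = Dom B g \<and>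
    g \<cdot> f1 = pb1 B f0 h \<and> \<phi> \<in> hm p (Ide B (Dom B (pb1 B f0 h))) (pull f1 a) (pull (pb2 B f0 h) b)"

lemma R_arr_iff: "m \<in> Arr (Tot R) \<longleftrightarrow> (\<exists>g a h b f0 f1 \<phi>. m = FamArr (g, a) (h, b) f0 f1 \<phi> \<and> rmor f0 g a h b f1 \<phi>)"
  unfolding Pi_compl_def rmor_def by (auto simp: fam_obj_def hom_fibre hom_def hm_def)

lemma R_hm_iff: "m \<in> hm R f0 (g, a) (h, b) \<longleftrightarrow> (\<exists>f1 \<phi>. m = FamArr (g, a) (h, b) f0 f1 \<phi> \<and> rmor f0 g a h b f1 \<phi>)"
  unfolding hm_def[of R] R_simps mem_Collect_eq R_arr_iff by auto

lemma R_hmE: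
  assumes "m \<in> hm R f0 (g, a) (h, b)"
  obtains f1 \<phi> where "m = FamArr (g, a) (h, b) f0 f1 \<phi>" "rmor f0 g a h b f1 \<phi>"
  using assms unfolding R_hm_iff by blast

lemma R_arr_hm: "m \<in> Arr (Tot R) ==> m \<in> hm R (bmap m) (fst (src m), snd (src m)) (fst (tgt m), snd (tgt m))"
  by (simp add: hm_def)

lemma rmorD:
  assumes "rmor f0 g a h b f1 \<phi>"
  shows "g \<in> F" "h \<in> F" "g \<in> Arr B" "h \<in> Arr B" "a \<in> Ob" "b \<in> Ob" "ob a = Dom B g" "ob b = Dom B h"
    "f0 \<in> Arr B" "Dom B f0 = Cod B g" "Cod B f0 = Cod B h" "f1 \<in> Arr B" "Dom B f1 = Dom B (pb1 B f0 h)" "Cod B f1 = Dom B g"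
    "g \<cdot> f1 = pb1 B f0 h" "\<phi> \<in> hm p (Ide B (Dom B (pb1 B f0 h))) (pull f1 a) (pull (pb2 B f0 h) b)"
  using assms F_arr unfolding rmor_def by blast+

lemma rmor_lifts:
  assumes "rmor f0 g a h b f1 \<phi>"
  shows "pbk f0 h (pb1 B f0 h) (pb2 B f0 h)"
    "lft f1 a \<in> Car f1 (pull f1 a) a" "lft (pb2 B f0 h) b \<in> Car (pb2 B f0 h) (pull (pb2 B f0 h) b) b"
    "\<phi> \<in> Ver (pull f1 a) (pull (pb2 B f0 h) b)"
proof -
  note D = rmorD[OF assms]
  show P: "pbk f0 h (pb1 B f0 h) (pb2 B f0 h)" by (rule pb_chosen(1)[OF D(2,9,11)])
  note pd = is_pullbackD[OF P]
  have a: "ob a = Cod B f1" "ob b = Cod B (pb2 B f0 h)" using D pd by auto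
  show "lft f1 a \<in> Car f1 (pull f1 a) a" by (rule lift_chm[OF D(12,5) a(1)])
  show "lft (pb2 B f0 h) b \<in> Car (pb2 B f0 h) (pull (pb2 B f0 h) b) b" by (rule lift_chm[OF pd(4) D(6) a(2)])
  show "\<phi> \<in> Ver (pull f1 a) (pull (pb2 B f0 h) b)" using D(16) reind_obj(2)[OF D(12,5) a(1)] D(13) by simp
qed

lemma R_ix:
  assumes m: "m \<in> hm R f0 (g, a) (h, b)" and s: "sq B f0 h u y"
  shows "ix B m u y \<in> Arr B" "Dom B (ix B m u y) = Dom B u" "Cod B (ix B m u y) = Dom B g" "g \<cdot> ix B m u y = u"
    "ob a = Cod B (ix B m u y)" "a \<in> Ob"
proof -
  obtain f1 \<phi> where e: "m = FamArr (g, a) (h, b) f0 f1 \<phi>" and r: "rmor f0 g a h b f1 \<phi>" by (rule R_hmE[OF m])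
  note D = rmorD[OF r]
  note P = pb_pair[OF D(2,9,11) s]
  have i: "ix B m u y = f1 \<cdot> pb_pair B f0 h u y" by (simp add: ix_def e)
  show "ix B m u y \<in> Arr B" "Dom B (ix B m u y) = Dom B u" "Cod B (ix B m u y) = Dom B g" "ob a = Cod B (ix B m u y)" "a \<in> Ob" unfolding i using D P by simp_all
  show "g \<cdot> ix B m u y = u" unfolding i using B.pre[OF D(15), of "pb_pair B f0 h u y"] D P by simp
qed

lemma repsD:
  assumes m: "m \<in> hm R f0 (g, a) (h, b)" and "Reps m u y \<pi> \<psi>"
  obtains N where "\<pi> \<in> Car (ix B m u y) N a" "\<psi> \<in> hm p y N b"
  using assms hmD unfolding reps_def R_hm_iff by auto

lemma reps_eq:
  assumes m: "m \<in> hm R f0 (g, a) (h, b)" and r: "Reps m u y \<pi> \<psi>" and c: "\<pi> \<in> hm p x N a"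
  shows "\<psi> \<in> hm p y N b" "ix B m u y = x" "\<pi> \<in> Car x N a"
proof -
  obtain N' where n: "\<pi> \<in> Car (ix B m u y) N' a" "\<psi> \<in> hm p y N' b" by (rule repsD[OF m r])
  have "N' = N" "ix B m u y = x" using hmD[OF chmD[OF n(1)]] hmD[OF c] by auto
  thus "\<psi> \<in> hm p y N b" "ix B m u y = x" "\<pi> \<in> Car x N a" using n by auto
qed

lemma reps_ex:
  assumes m: "m \<in> hm R f0 (g, a) (h, b)" and s: "sq B f0 h u y" and k: "\<pi> \<in> Car (ix B m u y) N a"
  obtains \<psi> where "\<psi> \<in> hm p y N b" "Reps m u y \<pi> \<psi>"
proof -
  obtain f1 \<phi> where e: "m = FamArr (g, a) (h, b) f0 f1 \<phi>" and r: "rmor f0 g a h b f1 \<phi>" by (rule R_hmE[OF m])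
  note D = rmorD[OF r] and L = rmor_lifts[OF r]
  note P = pb_pair[OF D(2,9,11) s]
  note K = hmD[OF chmD[OF k]] and I = R_ix[OF m s]
  have i: "ix B m u y = f1 \<cdot> pb_pair B f0 h u y" by (simp add: ix_def e)
  have d: "Dom B (pb_pair B f0 h u y) = ob N" "Cod B (pb_pair B f0 h u y) = ob (pull f1 a)"
    using P K I hmD[OF chmD[OF L(2)]] D by auto
  obtain z where z: "z \<in> hm p (pb_pair B f0 h u y) N (pull f1 a)" "lft f1 a \<odot> z = \<pi>"
    using cart_fill[OF L(2) chmD[OF k] P(1) d i] .
  have "lft (pb2 B f0 h) b \<odot> (\<phi> \<odot> z) \<in> hm p y N b"
    using comp_hm[OF comp_vl[OF z(1) L(4)] chmD[OF L(3)]] P(5) by simp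
  thus ?thesis using that[of "lft (pb2 B f0 h) b \<odot> (\<phi> \<odot> z)"] z k unfolding reps_def e by auto
qed

lemma reps_ex':
  assumes m: "m \<in> hm R f0 (g, a) (h, b)" and s: "sq B f0 h u y"
  obtains N \<pi> \<psi> where "\<pi> \<in> Car (ix B m u y) N a" "\<psi> \<in> hm p y N b" "Reps m u y \<pi> \<psi>"
  using reps_ex[OF m s lift_chm[OF R_ix(1)[OF m s] R_ix(6,5)[OF m s]]] lift_chm[OF R_ix(1)[OF m s] R_ix(6,5)[OF m s]] by metis

lemma reps_fun:
  assumes m: "m \<in> hm R f0 (g, a) (h, b)" and "Reps m u y \<pi> \<psi>" "Reps m u y \<pi> \<psi>'"
  shows "\<psi> = \<psi>'"
proof -
  obtain f1 \<phi> where e: "m = FamArr (g, a) (h, b) f0 f1 \<phi>" and r: "rmor f0 g a h b f1 \<phi>" by (rule R_hmE[OF m])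
  note L = rmor_lifts[OF r]
  obtain N z where z: "\<pi> \<in> Car (ix B m u y) N a" "z \<in> hm p (pb_pair B f0 h u y) N (pull f1 a)" "lft f1 a \<odot> z = \<pi>"
    "lft (pb2 B f0 h) b \<odot> (\<phi> \<odot> z) = \<psi>" using assms(2) unfolding reps_def e by auto
  obtain N' z' where z': "\<pi> \<in> Car (ix B m u y) N' a" "z' \<in> hm p (pb_pair B f0 h u y) N' (pull f1 a)" "lft f1 a \<odot> z' = \<pi>"
    "lft (pb2 B f0 h) b \<odot> (\<phi> \<odot> z') = \<psi>'" using assms(3) unfolding reps_def e by auto
  have "N' = N" using hmD[OF chmD[OF z(1)]] hmD[OF chmD[OF z'(1)]] by blast
  hence "z = z'" using cart_eq[OF L(2) z(2)] z'(2,3) z(3) by simp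
  thus ?thesis using z z' by simp
qed

lemma reps_restr:
  assumes m: "m \<in> hm R f0 (g, a) (h, b)" and s: "sq B f0 h u y" and rp: "Reps m u y \<pi> \<psi>" and k: "\<pi> \<in> hm p x N a" and n: "n \<in> Car t N' N"
  shows "Reps m (u \<cdot> t) (y \<cdot> t) (\<pi> \<odot> n) (\<psi> \<odot> n)" "ix B m (u \<cdot> t) (y \<cdot> t) = x \<cdot> t" "sq B f0 h (u \<cdot> t) (y \<cdot> t)"
proof -
  obtain f1 \<phi> where e: "m = FamArr (g, a) (h, b) f0 f1 \<phi>" and r: "rmor f0 g a h b f1 \<phi>" by (rule R_hmE[OF m])
  note D = rmorD[OF r] and L = rmor_lifts[OF r]
  note q = reps_eq[OF m rp k]
  have t: "t \<in> Arr B" "Cod B t = Dom B u" using hmD[OF chmD[OF n]] hmD[OF k] R_ix[OF m s] q(2) by auto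
  note P = pb_pair[OF D(2,9,11) s] and PR = pb_pair_restr[OF D(2,9,11) s t]
  obtain N2 z where z: "\<pi> \<in> Car (ix B m u y) N2 a" "z \<in> hm p (pb_pair B f0 h u y) N2 (pull f1 a)" "lft f1 a \<odot> z = \<pi>"
    "lft (pb2 B f0 h) b \<odot> (\<phi> \<odot> z) = \<psi>" using rp unfolding reps_def e by auto
  have [simp]: "N2 = N" using hmD[OF chmD[OF z(1)]] hmD[OF k] by blast
  show i: "ix B m (u \<cdot> t) (y \<cdot> t) = x \<cdot> t" using q(2) P t D by (simp add: ix_def e PR flip: q(2))
  show "sq B f0 h (u \<cdot> t) (y \<cdot> t)" by (rule sq_restr[OF s t D(9,4)])
  note zn = comp_hm[OF chmD[OF n] z(2)[simplified]]
  show "Reps m (u \<cdot> t) (y \<cdot> t) (\<pi> \<odot> n) (\<psi> \<odot> n)"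
    unfolding reps_def i
  proof (intro exI conjI)
    show "\<pi> \<odot> n \<in> Car (x \<cdot> t) N' (snd (src m))" using cart_comp[OF q(3) n] by (simp add: e)
    show "\<psi> \<odot> n \<in> hm p (y \<cdot> t) N' (snd (tgt m))" using comp_hm[OF chmD[OF n] q(1)] by (simp add: e)
    show "z \<odot> n \<in> hm p (pb_pair B (bmap m) (fst (tgt m)) (u \<cdot> t) (y \<cdot> t)) N' (pull (imap m) (snd (src m)))"
      using zn by (simp add: e PR)
    show "lft (imap m) (snd (src m)) \<odot> (z \<odot> n) = \<pi> \<odot> n"
      using ac[OF chmD[OF n] z(2)[simplified] chmD[OF L(2)]] z(3) by (simp add: e)
    show "lft (pb2 B (bmap m) (fst (tgt m))) (snd (tgt m)) \<odot> (fmap m \<odot> (z \<odot> n)) = \<psi> \<odot> n"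
      using ac[OF chmD[OF n] z(2)[simplified] L(4)] ac[OF chmD[OF n] comp_vl[OF z(2)[simplified] L(4)] chmD[OF L(3)]] z(4) by (simp add: e)
  qed
qed

lemma reps_vert:
  assumes m: "m \<in> hm R f0 (g, a) (h, b)" and s: "sq B f0 h u y" and rp: "Reps m u y \<pi> \<psi>" and k: "\<pi> \<in> hm p x N a"
    and n: "n \<in> Car (Ide B (ob N')) N' N"
  shows "Reps m u y (\<pi> \<odot> n) (\<psi> \<odot> n)"
proof -
  have q: "ix B m u y = x" by (rule reps_eq(2)[OF m rp k])
  have "ob N' = Dom B u" "Dom B y = Dom B u" "u \<in> Arr B" "y \<in> Arr B" using vhmD[OF chmD[OF n]] hmD[OF k] R_ix(2)[OF m s] q s by (auto simp: sq_def)
  thus ?thesis using reps_restr(1)[OF m s rp k n] by simp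
qed

lemma reps_move:
  assumes m: "m \<in> hm R f0 (g, a) (h, b)" and s: "sq B f0 h u y" and rp: "Reps m u y \<pi> \<psi>" and k: "\<pi> \<in> hm p x N a"
    and k': "\<pi>' \<in> Car x N' a"
  obtains j j' where "Iso N' N j j'" "\<pi> \<odot> j = \<pi>'" "Reps m u y \<pi>' (\<psi> \<odot> j)"
proof -
  note q = reps_eq[OF m rp k]
  obtain j j' where j: "Iso N' N j j'" "\<pi> \<odot> j = \<pi>'" using cart_viso[OF k' q(3)] by blast
  from reps_vert[OF m s rp k viso_cart[OF j(1)]] j show ?thesis using that by simp
qed

lemma R_ext:
  assumes m: "m \<in> hm R f0 (g, a) (h, b)" and m': "m' \<in> hm R f0 (g, a) (h, b)" and P: "pbk f0 h u y"
    and r: "Reps m u y \<pi> \<psi>" and r': "Reps m' u y \<pi> \<psi>"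
  shows "m = m'"
proof -
  obtain f1 \<phi> where e: "m = FamArr (g, a) (h, b) f0 f1 \<phi>" and rm: "rmor f0 g a h b f1 \<phi>" by (rule R_hmE[OF m])
  obtain f1' \<phi>' where e': "m' = FamArr (g, a) (h, b) f0 f1' \<phi>'" and rm': "rmor f0 g a h b f1' \<phi>'" by (rule R_hmE[OF m'])
  note D = rmorD[OF rm] and L = rmor_lifts[OF rm] and L' = rmor_lifts[OF rm']
  note pc = is_pullbackD[OF L(1)] and pd = is_pullbackD[OF P]
  have s: "sq B f0 h u y" by (rule pb_sq[OF P])
  have s0: "sq B f0 h (pb1 B f0 h) (pb2 B f0 h)" by (rule pb_sq[OF L(1)])
  obtain t where t: "t \<in> Arr B" "Dom B t = Dom B (pb1 B f0 h)" "Cod B t = Dom B u" "u \<cdot> t = pb1 B f0 h" "y \<cdot> t = pb2 B f0 h"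
    using B.pb_fill[OF P pc(3,4) _ pc(7,8,9)] pc(6) by metis
  obtain N where N: "\<pi> \<in> Car (ix B m u y) N a" "\<psi> \<in> hm p y N b" by (rule repsD[OF m r])
  have Nt: "N \<in> Ob" "ob N = Cod B t" using hmD[OF chmD[OF N(1)]] R_ix[OF m s] t by auto
  note n = lift_chm[OF t(1) Nt]
  let ?N = "pull t N" and ?\<pi> = "\<pi> \<odot> lft t N" and ?\<psi> = "\<psi> \<odot> lft t N"
  have R: "Reps m (pb1 B f0 h) (pb2 B f0 h) ?\<pi> ?\<psi>" and R': "Reps m' (pb1 B f0 h) (pb2 B f0 h) ?\<pi> ?\<psi>"
    using reps_restr(1)[OF m s r chmD[OF N(1)] n] reps_restr(1)[OF m' s r' chmD[OF N(1)] n] t by simp_all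
  have "pb_pair B f0 h (pb1 B f0 h) (pb2 B f0 h) = Ide B (Dom B (pb1 B f0 h))"
    by (rule pb_pair_unique[OF D(2,9,11) s0, symmetric]) (use pc in simp_all)
  note pp = this
  obtain N1 z where z: "?\<pi> \<in> Car (f1 \<cdot> Ide B (Dom B (pb1 B f0 h))) N1 a" "z \<in> hm p (Ide B (Dom B (pb1 B f0 h))) N1 (pull f1 a)" "lft f1 a \<odot> z = ?\<pi>"
    "lft (pb2 B f0 h) b \<odot> (\<phi> \<odot> z) = ?\<psi>" using R unfolding reps_def e ix_def by (auto simp: pp)
  obtain N2 z' where z': "?\<pi> \<in> Car (f1' \<cdot> Ide B (Dom B (pb1 B f0 h))) N2 a" "z' \<in> hm p (Ide B (Dom B (pb1 B f0 h))) N2 (pull f1' a)" "lft f1' a \<odot> z' = ?\<pi>"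
    "lft (pb2 B f0 h) b \<odot> (\<phi>' \<odot> z') = ?\<psi>" using R' unfolding reps_def e' ix_def by (auto simp: pp)
  have [simp]: "N2 = N1" using hmD[OF chmD[OF z(1)]] hmD[OF chmD[OF z'(1)]] by blast
  have f: "f1' = f1" using hmD[OF chmD[OF z(1)]] hmD[OF chmD[OF z'(1)]] rmorD(12,13)[OF rm] rmorD(12,13)[OF rm'] by (metis B.ide_r)
  have zz: "z' = z" using cart_eq[OF L(2) z(2)] z'(2,3) z(3) f by simp
  have zc: "z \<in> Car (Ide B (Dom B (pb1 B f0 h))) N1 (pull f1 a)" using cart_cancel[OF L(2) z(2)] z(1,3) by simp
  have PN: "ob N1 = Dom B (pb1 B f0 h)" using hmD[OF z(2)] pc by auto
  obtain j where j: "Iso N1 (pull f1 a) z j" using vcart_viso[OF zc[folded PN]] .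
  have jh: "j \<in> Ver (pull f1 a) N1" "z \<odot> j = idt (pull f1 a)" "z \<in> Ver N1 (pull f1 a)" using visoD[OF j] by auto
  note L4 = L'(4)[unfolded f]
  have "\<phi> \<odot> z = \<phi>' \<odot> z"
    using cart_eq[OF L(3) comp_vl[OF z(2) L(4)] comp_vl[OF z(2) L4]] z(4) z'(4) zz by simp
  hence "\<phi> \<odot> z \<odot> j = \<phi>' \<odot> z \<odot> j" by simp
  hence "\<phi> = \<phi>'" using ac[OF jh(1,3) L(4)] ac[OF jh(1,3) L4] jh(2) idr[OF L(4)] idr[OF L4] by simp
  thus ?thesis using e e' f by simp
qed

lemma R_real:
  assumes o: "(g, a) \<in> Fam" "(h, b) \<in> Fam" and f0: "Dom B f0 = Cod B g" and P: "pbk f0 h u y"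
    and k: "\<pi> \<in> Car x N a" and gx: "g \<cdot> x = u" and ps: "\<psi> \<in> hm p y N b"
  obtains m where "m \<in> hm R f0 (g, a) (h, b)" "Reps m u y \<pi> \<psi>" "ix B m u y = x"
proof -
  have og: "g \<in> F" "a \<in> Ob" "ob a = Dom B g" "h \<in> F" "b \<in> Ob" "ob b = Dom B h" using o by (auto simp: fam_obj_iff)
  have ga: "g \<in> Arr B" "h \<in> Arr B" using og F_arr by auto
  note pd = is_pullbackD[OF P]
  have s: "sq B f0 h u y" by (rule pb_sq[OF P])
  note H = og(4) pd(1,5)
  note PC = pb_chosen(1)[OF H]
  note pc = is_pullbackD[OF PC] and PP = pb_pair[OF H s]
  let ?s = "pb_pair B f0 h u y" and ?P = "Dom B (pb1 B f0 h)"
  have xD: "x \<in> Arr B" "Dom B x = ob N" "Cod B x = Dom B g" using hmD[OF chmD[OF k]] og by auto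
  have NP: "N \<in> Ob" "ob N = Dom B u" using hmD[OF ps] pd by auto
  obtain t where t: "t \<in> Arr B" "Dom B t = ?P" "Cod B t = Dom B u" "u \<cdot> t = pb1 B f0 h" "y \<cdot> t = pb2 B f0 h"
    using B.pb_fill[OF P pc(3,4) _ pc(7,8,9)] pc(6) by metis
  have ts: "t \<cdot> ?s = Ide B (Dom B u)"
  proof (rule B.pb_eq[OF P])
    show "u \<cdot> (t \<cdot> ?s) = u \<cdot> Ide B (Dom B u)" using B.pre[OF t(4), of ?s] t PP pd by simp
    show "y \<cdot> (t \<cdot> ?s) = y \<cdot> Ide B (Dom B u)" using B.pre[OF t(5), of ?s] t PP pd by simp
  qed (use t PP pd in simp_all)
  have Nt: "ob N = Cod B t" using NP t by simp
  note n = lift_chm[OF t(1) NP(1) Nt]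
  let ?N = "pull t N" and ?n = "lft t N"
  have N'P: "ob ?N = ?P" using reind_obj(2)[OF t(1) NP(1) Nt] t by simp
  define f1 where "f1 = x \<cdot> t"
  have f1: "f1 \<in> Arr B" "Dom B f1 = ?P" "Cod B f1 = Dom B g" using xD t NP by (auto simp: f1_def)
  have gf: "g \<cdot> f1 = pb1 B f0 h" using B.pre[OF gx ga(1) xD(1,3) t(1)] t xD NP by (simp add: f1_def)
  have kn: "\<pi> \<odot> ?n \<in> Car f1 ?N a" using cart_comp[OF k n] by (simp add: f1_def)
  have aP: "ob a = Cod B f1" "ob b = Cod B (pb2 B f0 h)" using og f1 pc by auto
  note La = lift_chm[OF f1(1) og(2) aP(1)] and Lb = lift_chm[OF pc(4) og(5) aP(2)]
  obtain z z' where z: "Iso ?N (pull f1 a) z z'" "lft f1 a \<odot> z = \<pi> \<odot> ?n" using cart_viso[OF kn La] by blast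
  have zh: "z \<in> Ver ?N (pull f1 a)" "z' \<in> Ver (pull f1 a) ?N" "z' \<odot> z = idt ?N" using visoD[OF z(1)] by auto
  have "\<psi> \<odot> ?n \<in> hm p (pb2 B f0 h) ?N b" using comp_hm[OF chmD[OF n] ps] t(5) by simp
  then obtain w where w: "w \<in> Ver ?N (pull (pb2 B f0 h) b)" "lft (pb2 B f0 h) b \<odot> w = \<psi> \<odot> ?n" by (rule cart_vfill[OF Lb])
  have wz: "w \<odot> z' \<in> Ver (pull f1 a) (pull (pb2 B f0 h) b)" using comp_vr[OF zh(2) w(1)] vhmD[OF zh(2)] by simp
  have wz': "w \<odot> z' \<in> hm p (Ide B ?P) (pull f1 a) (pull (pb2 B f0 h) b)" using wz vhmD[OF zh(1)] N'P by simp
  define m where "m = FamArr (g, a) (h, b) f0 f1 (w \<odot> z')"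
  have m: "m \<in> hm R f0 (g, a) (h, b)" unfolding R_hm_iff m_def rmor_def using og pd f0 f1 gf wz' by blast
  have sD: "?s \<in> Arr B" "Dom B ?s = ob N" "Cod B ?s = ob ?N" using PP NP N'P by auto
  have tI: "Ide B (ob N) = t \<cdot> ?s" using ts NP by simp
  obtain n' where n': "n' \<in> hm p ?s N ?N" "?n \<odot> n' = idt N" using cart_fill[OF n ide_hm[OF NP(1)] sD tI] .
  have ixm: "ix B m u y = x" unfolding ix_def m_def using t PP xD NP ts by (simp add: f1_def)
  have zn: "z \<odot> n' \<in> hm p ?s N (pull f1 a)" by (rule comp_vl[OF n'(1) zh(1)])
  have 1: "lft f1 a \<odot> (z \<odot> n') = \<pi>"
    using ac[OF n'(1) zh(1) chmD[OF La]] z(2) ac[OF n'(1) chmD[OF n] chmD[OF k]] n'(2) idr[OF chmD[OF k]] by simp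
  have "w \<odot> z' \<odot> (z \<odot> n') = w \<odot> n'"
    using ac[OF zn zh(2) w(1)] ac[OF n'(1) zh(1,2)] zh(3) idl[OF n'(1)] by simp
  hence 2: "lft (pb2 B f0 h) b \<odot> (w \<odot> z' \<odot> (z \<odot> n')) = \<psi>"
    using ac[OF n'(1) w(1) chmD[OF Lb]] w(2) ac[OF n'(1) chmD[OF n] ps] n'(2) idr[OF ps] by simp
  have "Reps m u y \<pi> \<psi>" unfolding reps_def ixm
    by (intro exI[of _ N] exI[of _ "z \<odot> n'"]) (use k ps zn 1 2 in \<open>simp add: m_def\<close>)
  thus ?thesis using that m ixm by blast
qed

lemma R_ide:
  assumes o: "(g, a) \<in> Fam"
  shows "Ide (Tot R) (g, a) \<in> hm R (Ide B (Cod B g)) (g, a) (g, a)"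
    "\<And>u y. y \<in> Arr B ==> Cod B y = Dom B g ==> u = g \<cdot> y ==> sq B (Ide B (Cod B g)) g u y"
    "\<And>u y \<pi> N. \<pi> \<in> Car y N a ==> u = g \<cdot> y ==> Reps (Ide (Tot R) (g, a)) u y \<pi> \<pi>"
proof -
  have og: "g \<in> F" "a \<in> Ob" "ob a = Dom B g" using o by (auto simp: fam_obj_iff)
  have ga: "g \<in> Arr B" using og F_arr by auto
  let ?b = "Ide B (Cod B g)" and ?x = "pb2 B (Ide B (Cod B g)) g"
  have e: "Ide (Tot R) (g, a) = FamArr (g, a) (g, a) ?b ?x (idt (pull ?x a))"
    by (simp add: Pi_compl_def Let_def)
  have H: "g \<in> F" "?b \<in> Arr B" "Cod B ?b = Cod B g" using og ga by auto
  note P = pb_chosen(1)[OF H]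
  note pd = is_pullbackD[OF P]
  have aP: "ob a = Cod B ?x" using pd(8) og by simp
  have oI: "pull ?x a \<in> Ob" "ob (pull ?x a) = Dom B (pb1 B ?b g)" using reind_obj[OF pd(4) og(2) aP] pd(6) by auto
  have "?b \<cdot> pb1 B ?b g = pb1 B ?b g" using pd(1,3,7) ga by simp
  hence 1: "g \<cdot> ?x = pb1 B ?b g" using pd(9) by metis
  have r: "rmor ?b g a g a ?x (idt (pull ?x a))" unfolding rmor_def
    using og H pd(4,6,8) 1 ide_hm[OF oI(1)] oI(2) ga by simp
  show m: "Ide (Tot R) (g, a) \<in> hm R ?b (g, a) (g, a)" unfolding e R_hm_iff using r by blast
  show s: "sq B ?b g u y" if "y \<in> Arr B" "Cod B y = Dom B g" "u = g \<cdot> y" for u y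
    using that ga by (simp add: sq_def)
  fix u y \<pi> N assume k: "\<pi> \<in> Car y N a" and u: "u = g \<cdot> y"
  have yA: "y \<in> Arr B" "Cod B y = Dom B g" using hmD[OF chmD[OF k]] og by auto
  note s = s[OF yA u]
  note PP = pb_pair[OF H s]
  have i: "ix B (Ide (Tot R) (g, a)) u y = y" unfolding e ix_def using PP by simp
  obtain \<psi> where psi: "Reps (Ide (Tot R) (g, a)) u y \<pi> \<psi>" using reps_ex[OF m s] k i by metis
  obtain N' z where z: "z \<in> hm p (pb_pair B ?b g u y) N' (pull ?x a)" "lft ?x a \<odot> z = \<pi>"
    "lft ?x a \<odot> (idt (pull ?x a) \<odot> z) = \<psi>" using psi unfolding reps_def e by auto
  thus "Reps (Ide (Tot R) (g, a)) u y \<pi> \<pi>" using psi idl[OF z(1)] by simp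
qed

lemma R_comp:
  assumes m: "m \<in> hm R f (g, a) (h, b)" and n: "n \<in> hm R f' (h, b) (k, c)"
  shows "n \<odot>\<^sub>R m \<in> hm R (f' \<cdot> f) (g, a) (k, c)"
    "\<And>u z. sq B (f' \<cdot> f) k u z ==> sq B f' k (f \<cdot> u) z \<and> sq B f h u (ix B n (f \<cdot> u) z)"
    "\<And>u z l \<chi> \<pi> \<psi> v N N'. sq B (f' \<cdot> f) k u z ==> Reps n (f \<cdot> u) z l \<chi> ==> Reps m u (ix B n (f \<cdot> u) z) \<pi> \<psi> ==>
       \<pi> \<in> hm p x N a ==> l \<in> hm p x' N' b ==> v \<in> Ver N N' ==> l \<odot> v = \<psi> ==> Reps (n \<odot>\<^sub>R m) u z \<pi> (\<chi> \<odot> v)"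
proof -
  obtain m1 \<phi> where em: "m = FamArr (g, a) (h, b) f m1 \<phi>" and rm: "rmor f g a h b m1 \<phi>" by (rule R_hmE[OF m])
  obtain n1 \<phi>' where en: "n = FamArr (h, b) (k, c) f' n1 \<phi>'" and rn: "rmor f' h b k c n1 \<phi>'" by (rule R_hmE[OF n])
  note D = rmorD[OF rm] and D' = rmorD[OF rn] and L = rmor_lifts[OF rm] and L' = rmor_lifts[OF rn]
  note pm = is_pullbackD[OF L(1)] and pn = is_pullbackD[OF L'(1)]
  define w where "w = f' \<cdot> f"
  have w: "w \<in> Arr B" "Dom B w = Cod B g" "Cod B w = Cod B k" using D D' by (auto simp: w_def)
  note P = pb_chosen(1)[OF D'(2) w(1,3)]
  note pd = is_pullbackD[OF P]
  let ?P = "Dom B (pb1 B w k)"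
  have s1: "sq B f' k (f \<cdot> pb1 B w k) (pb2 B w k)" using pd D D' w by (simp add: sq_def w_def)
  define q where "q = pb_pair B f' k (f \<cdot> pb1 B w k) (pb2 B w k)"
  note Q = pb_pair[OF D'(2,9,11) s1, folded q_def]
  have q: "q \<in> Arr B" "Dom B q = ?P" "Cod B q = Dom B (pb1 B f' k)" using Q pd D w by auto
  have n1q: "n1 \<cdot> q \<in> Arr B" "Dom B (n1 \<cdot> q) = ?P" "Cod B (n1 \<cdot> q) = Dom B h" "h \<cdot> (n1 \<cdot> q) = f \<cdot> pb1 B w k"
    using q D' B.pre[OF D'(15), of q] Q by simp_all
  have s2: "sq B f h (pb1 B w k) (n1 \<cdot> q)" using n1q pd D w by (simp add: sq_def)
  define r where "r = pb_pair B f h (pb1 B w k) (n1 \<cdot> q)"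
  note RR = pb_pair[OF D(2,9,11) s2, folded r_def]
  have r: "r \<in> Arr B" "Dom B r = ?P" "Cod B r = Dom B (pb1 B f h)" using RR pd by auto
  define \<rho>n where "\<rho>n = restr B p n1 b (pb2 B f' k) c q \<phi>'"
  define \<rho>m where "\<rho>m = restr B p m1 a (pb2 B f h) b r \<phi>"
  have e: "n \<odot>\<^sub>R m = FamArr (g, a) (k, c) w (m1 \<cdot> r) (\<rho>n \<odot> \<rho>m)"
    unfolding R_simps Pi_comp_def em en by (simp add: Let_def w_def q_def r_def \<rho>n_def \<rho>m_def)
  have cn: "ob b = Cod B n1" "ob c = Cod B (pb2 B f' k)" "Dom B (pb2 B f' k) = Dom B n1" "Cod B q = Dom B n1"
    "\<phi>' \<in> hm p (Ide B (Dom B n1)) (pull n1 b) (pull (pb2 B f' k) c)" using D' pn q by auto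
  have cm: "ob a = Cod B m1" "ob b = Cod B (pb2 B f h)" "Dom B (pb2 B f h) = Dom B m1" "Cod B r = Dom B m1"
    "\<phi> \<in> hm p (Ide B (Dom B m1)) (pull m1 a) (pull (pb2 B f h) b)" using D pm r by auto
  note RN = restr_char[OF D'(12,5) cn(1) pn(4) D'(6) cn(2,3) q(1) cn(4,5), folded \<rho>n_def, unfolded Q(5) q(2)]
  note RM = restr_char[OF D(12,5) cm(1) pm(4) D(6) cm(2,3) r(1) cm(4,5), folded \<rho>m_def, unfolded RR(5) r(2)]
  have ra: "pull (m1 \<cdot> r) a \<in> Ob" "ob (pull (m1 \<cdot> r) a) = ?P"
    using reind_obj[of "m1 \<cdot> r" a] D r cm by auto
  have rmv: "\<rho>m \<in> Ver (pull (m1 \<cdot> r) a) (pull (n1 \<cdot> q) b)" using RM(1) ra by simp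
  have rnv: "\<rho>n \<in> Ver (pull (n1 \<cdot> q) b) (pull (pb2 B w k) c)" using RN(1) vhmD[OF rmv] ra by simp
  have rr: "\<rho>n \<odot> \<rho>m \<in> hm p (Ide B ?P) (pull (m1 \<cdot> r) a) (pull (pb2 B w k) c)"
    using comp_vl[OF rmv rnv] ra by simp
  have gm: "g \<cdot> (m1 \<cdot> r) = pb1 B w k" using B.pre[OF D(15), of r] D r RR by simp
  have rc: "rmor w g a k c (m1 \<cdot> r) (\<rho>n \<odot> \<rho>m)" unfolding rmor_def using D D' w r cm gm rr by simp
  show nm: "n \<odot>\<^sub>R m \<in> hm R (f' \<cdot> f) (g, a) (k, c)" unfolding e w_def[symmetric] R_hm_iff using rc by blast
  show SQ: "sq B f' k (f \<cdot> u) z \<and> sq B f h u (ix B n (f \<cdot> u) z)" if s: "sq B (f' \<cdot> f) k u z" for u z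
  proof
    have "u \<in> Arr B" "Cod B u = Dom B (f' \<cdot> f)" "f' \<cdot> f \<cdot> u = k \<cdot> z" using s unfolding sq_def by blast+
    hence "f' \<cdot> (f \<cdot> u) = k \<cdot> z" using D D' by simp
    thus 1: "sq B f' k (f \<cdot> u) z" using s D D' by (simp add: sq_def)
    show "sq B f h u (ix B n (f \<cdot> u) z)" using R_ix[OF n 1] s D D' by (simp add: sq_def)
  qed
  note LL = rmor_lifts[OF rc]
  fix u z l \<chi> \<pi> \<psi> v N N'
  assume s: "sq B (f' \<cdot> f) k u z" and rpn: "Reps n (f \<cdot> u) z l \<chi>" and rpm: "Reps m u (ix B n (f \<cdot> u) z) \<pi> \<psi>"
    and k: "\<pi> \<in> hm p x N a" and l: "l \<in> hm p x' N' b" and v: "v \<in> Ver N N'" and lv: "l \<odot> v = \<psi>"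
  note sn = conjunct1[OF SQ[OF s]] and sm = conjunct2[OF SQ[OF s]]
  have sw: "sq B w k u z" using s by (simp add: w_def)
  note T = pb_pair[OF D'(2) w(1,3) sw]
  let ?t = "pb_pair B w k u z" and ?tn = "pb_pair B f' k (f \<cdot> u) z"
  let ?y = "ix B n (f \<cdot> u) z"
  let ?tm = "pb_pair B f h u ?y"
  have ixn: "?y = n1 \<cdot> ?tn" by (simp add: ix_def en)
  have uD: "u \<in> Arr B" "Cod B u = Dom B f" using sm by (auto simp: sq_def)
  have qt: "q \<cdot> ?t = ?tn"
    by (rule pb_pair_unique[OF D'(2,9,11) sn]) (use q T Q uD w D pn pd B.pre[OF Q(4), of ?t] B.pre[OF Q(5), of ?t] in simp_all)
  have rt: "r \<cdot> ?t = ?tm"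
  proof (rule pb_pair_unique[OF D(2,9,11) sm])
    show "pb2 B f h \<cdot> (r \<cdot> ?t) = ?y" using B.pre[OF RR(5), of ?t] r T pm n1q q D' qt ixn by simp
  qed (use r T RR pm B.pre[OF RR(4), of ?t] in simp_all)
  have ixnm: "ix B (n \<odot>\<^sub>R m) u z = ix B m u ?y" unfolding e using rt D r T by (simp add: ix_def em)
  note qm = reps_eq[OF m rpm k]
  obtain N1 zm where zm: "\<pi> \<in> Car (ix B m u ?y) N1 a" "zm \<in> hm p ?tm N1 (pull m1 a)" "lft m1 a \<odot> zm = \<pi>"
    "lft (pb2 B f h) b \<odot> (\<phi> \<odot> zm) = \<psi>" using rpm unfolding reps_def em by auto
  have N1: "N1 = N" using hmD[OF chmD[OF zm(1)]] hmD[OF k] by blast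
  obtain N2 zn where zn: "l \<in> Car ?y N2 b" "zn \<in> hm p ?tn N2 (pull n1 b)" "lft n1 b \<odot> zn = l"
    "lft (pb2 B f' k) c \<odot> (\<phi>' \<odot> zn) = \<chi>" "\<chi> \<in> hm p z N2 c" using rpn unfolding reps_def en by auto
  have N2: "N2 = N'" using hmD[OF chmD[OF zn(1)]] hmD[OF l] by blast
  note zmh = zm(2)[unfolded N1] and znh = zn(2)[unfolded N2] and chh = zn(5)[unfolded N2]
  have NP: "ob N = Dom B u" using hmD[OF k] R_ix(2)[OF m sm] qm(2) by auto
  have tD: "Dom B ?t = ob N" "Cod B ?t = ob (pull (m1 \<cdot> r) a)" using T NP ra by auto
  have xe: "x = m1 \<cdot> r \<cdot> ?t" using qm(2) rt D r T by (simp add: ix_def em)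
  obtain z0 where z0: "z0 \<in> hm p ?t N (pull (m1 \<cdot> r) a)" "lft (m1 \<cdot> r) a \<odot> z0 = \<pi>"
    using cart_fill[OF LL(2) k T(1) tD xe] .
  have "lft m1 a \<odot> zm = lft (m1 \<cdot> r) a \<odot> z0" using zm(3) z0(2) by simp
  from RM(2)[OF z0(1) zmh[folded rt] this] zm(4) have 1: "lft (n1 \<cdot> q) b \<odot> (\<rho>m \<odot> z0) = \<psi>" by simp
  note x0 = comp_vl[OF z0(1) rmv]
  have znv: "zn \<odot> v \<in> hm p (q \<cdot> ?t) N (pull n1 b)" using comp_vr[OF v znh] qt by simp
  have Ln: "lft n1 b \<in> Car n1 (pull n1 b) b" by (rule L'(2))
  have "lft n1 b \<odot> (zn \<odot> v) = lft (n1 \<cdot> q) b \<odot> (\<rho>m \<odot> z0)"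
    using ac[OF v znh chmD[OF Ln]] zn(3) lv 1 by simp
  from RN(2)[OF x0 znv this]
  have 2: "lft (pb2 B w k) c \<odot> (\<rho>n \<odot> (\<rho>m \<odot> z0)) = lft (pb2 B f' k) c \<odot> (\<phi>' \<odot> (zn \<odot> v))" .
  also have "\<dots> = \<chi> \<odot> v" using ac[OF v znh L'(4)] ac[OF v comp_vl[OF znh L'(4)] chmD[OF L'(3)]] zn(4) by simp
  finally have 3: "lft (pb2 B w k) c \<odot> (\<rho>n \<odot> \<rho>m \<odot> z0) = \<chi> \<odot> v" using ac[OF z0(1) rmv rnv] by simp
  have "\<pi> \<in> Car (ix B (n \<odot>\<^sub>R m) u z) N a" "\<chi> \<odot> v \<in> hm p z N c" using zm(1) N1 ixnm comp_vr[OF v chh] by auto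
  thus "Reps (n \<odot>\<^sub>R m) u z \<pi> (\<chi> \<odot> v)" unfolding reps_def e
    by (intro exI[of _ N] exI[of _ z0]) (use z0 3 in simp)
qed

lemma R_comp_ex:
  assumes m: "m \<in> hm R f (g, a) (h, b)" and n: "n \<in> hm R f' (h, b) (k, c)" and s: "sq B (f' \<cdot> f) k u z"
    and l: "l \<in> Car (ix B n (f \<cdot> u) z) N' b" "Reps n (f \<cdot> u) z l \<chi>"
  obtains \<pi> \<psi> v N where "\<pi> \<in> Car (ix B m u (ix B n (f \<cdot> u) z)) N a" "Reps m u (ix B n (f \<cdot> u) z) \<pi> \<psi>"
    "v \<in> Ver N N'" "l \<odot> v = \<psi>" "Reps (n \<odot>\<^sub>R m) u z \<pi> (\<chi> \<odot> v)"
proof -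
  note S = R_comp(2)[OF m n s]
  obtain N \<pi> \<psi> where k: "\<pi> \<in> Car (ix B m u (ix B n (f \<cdot> u) z)) N a" "\<psi> \<in> hm p (ix B n (f \<cdot> u) z) N b" "Reps m u (ix B n (f \<cdot> u) z) \<pi> \<psi>"
    by (rule reps_ex'[OF m conjunct2[OF S]])
  obtain v where v: "v \<in> Ver N N'" "l \<odot> v = \<psi>" using cart_vfill[OF l(1) k(2)] .
  show ?thesis by (rule that[OF k(1,3) v R_comp(3)[OF m n s l(2) k(3) chmD[OF k(1)] chmD[OF l(1)] v]])
qed

end

context dfib
begin

lemma R_hm_obj:
  assumes "m \<in> hm R f (g, a) (h, b)"
  shows "(g, a) \<in> Fam" "(h, b) \<in> Fam" "f \<in> Arr B" "Dom B f = Cod B g" "Cod B f = Cod B h"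
    "g \<in> F" "h \<in> F" "g \<in> Arr B" "h \<in> Arr B" "pbk f h (pb1 B f h) (pb2 B f h)"
proof -
  obtain f1 \<phi> where r: "rmor f g a h b f1 \<phi>" by (rule R_hmE[OF assms])
  show "(g, a) \<in> Fam" "(h, b) \<in> Fam" "f \<in> Arr B" "Dom B f = Cod B g" "Cod B f = Cod B h"
    "g \<in> F" "h \<in> F" "g \<in> Arr B" "h \<in> Arr B" "pbk f h (pb1 B f h) (pb2 B f h)"
    using rmorD[OF r] rmor_lifts(1)[OF r] by (auto simp: fam_obj_iff)
qed
lemma R_unit_l:
  assumes m: "m \<in> hm R f (g, a) (h, b)"
  shows "Ide (Tot R) (h, b) \<odot>\<^sub>R m = m"
proof -
  note O = R_hm_obj[OF m]
  note I = R_ide[OF O(2)]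
  note c = R_comp[OF m I(1)]
  let ?u = "pb1 B f h" and ?z = "pb2 B f h"
  note pd = is_pullbackD[OF O(10)]
  have s: "sq B f h ?u ?z" by (rule pb_sq[OF O(10)])
  have f: "Ide B (Cod B h) \<cdot> f = f" using O by simp
  obtain N \<pi> \<psi> where k: "\<pi> \<in> Car (ix B m ?u ?z) N a" "\<psi> \<in> hm p ?z N b" "Reps m ?u ?z \<pi> \<psi>" by (rule reps_ex'[OF m s])
  have zb: "ob b = Cod B ?z" "b \<in> Ob" using hmD[OF k(2)] by auto
  note l = lift_chm[OF pd(4) zb(2,1)]
  have ri: "Reps (Ide (Tot R) (h, b)) (f \<cdot> ?u) ?z (lft ?z b) (lft ?z b)" by (rule I(3)[OF l pd(9)])
  have i: "ix B (Ide (Tot R) (h, b)) (f \<cdot> ?u) ?z = ?z" by (rule reps_eq(2)[OF I(1) ri chmD[OF l]])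
  obtain v where v: "v \<in> Ver N (pull ?z b)" "lft ?z b \<odot> v = \<psi>" using cart_vfill[OF l k(2)] .
  have "Reps (Ide (Tot R) (h, b) \<odot>\<^sub>R m) ?u ?z \<pi> (lft ?z b \<odot> v)"
    by (rule c(3)[OF _ ri _ chmD[OF k(1)] chmD[OF l] v]) (simp_all only: i f s k(3))
  hence "Reps (Ide (Tot R) (h, b) \<odot>\<^sub>R m) ?u ?z \<pi> \<psi>" unfolding v(2) .
  thus ?thesis using R_ext[OF c(1)[unfolded f] m O(10) _ k(3)] by blast
qed

lemma R_unit_r:
  assumes m: "m \<in> hm R f (g, a) (h, b)"
  shows "m \<odot>\<^sub>R Ide (Tot R) (g, a) = m"
proof -
  note O = R_hm_obj[OF m]
  note I = R_ide[OF O(1)]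
  note c = R_comp[OF I(1) m]
  let ?u = "pb1 B f h" and ?z = "pb2 B f h"
  note pd = is_pullbackD[OF O(10)]
  have s: "sq B f h ?u ?z" by (rule pb_sq[OF O(10)])
  have f: "f \<cdot> Ide B (Cod B g) = f" and u: "Ide B (Cod B g) \<cdot> ?u = ?u" using O pd(3,7) by simp_all
  obtain N \<pi> \<psi> where k: "\<pi> \<in> Car (ix B m ?u ?z) N a" "\<psi> \<in> hm p ?z N b" "Reps m ?u ?z \<pi> \<psi>" by (rule reps_ex'[OF m s])
  have gx: "?u = g \<cdot> ix B m ?u ?z" using R_ix(4)[OF m s] by simp
  have N: "N \<in> Ob" using hmD[OF k(2)] by blast
  note ri = I(3)[OF k(1) gx]
  have "Reps (m \<odot>\<^sub>R Ide (Tot R) (g, a)) ?u ?z \<pi> (\<psi> \<odot> idt N)"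
    by (rule c(3)[OF _ _ _ chmD[OF k(1)] chmD[OF k(1)] ide_hm[OF N] idr[OF chmD[OF k(1)]]]) (simp_all only: u f s k(3) ri)
  hence "Reps (m \<odot>\<^sub>R Ide (Tot R) (g, a)) ?u ?z \<pi> \<psi>" unfolding idr[OF k(2)] .
  thus ?thesis using R_ext[OF c(1)[unfolded f] m O(10) _ k(3)] by blast
qed

lemma R_assoc:
  assumes m: "m \<in> hm R f (g, a) (h, b)" and n: "n \<in> hm R f' (h, b) (k, c)" and q: "q \<in> hm R f'' (k, c) (l, d)"
  shows "q \<odot>\<^sub>R (n \<odot>\<^sub>R m) = q \<odot>\<^sub>R n \<odot>\<^sub>R m"
proof -
  note M = R_hm_obj[OF m] and Nn = R_hm_obj[OF n] and Q = R_hm_obj[OF q]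
  note nm = R_comp[OF m n] and qn = R_comp[OF n q]
  note T = R_comp[OF nm(1) q] and T' = R_comp[OF m qn(1)]
  have e: "f'' \<cdot> (f' \<cdot> f) = f'' \<cdot> f' \<cdot> f" using M Nn Q by simp
  note O = R_hm_obj[OF T(1)]
  let ?f = "f'' \<cdot> (f' \<cdot> f)"
  let ?u = "pb1 B ?f l" and ?z = "pb2 B ?f l"
  note pd = is_pullbackD[OF O(10)]
  have s: "sq B ?f l ?u ?z" by (rule pb_sq[OF O(10)])
  have fu: "f' \<cdot> f \<cdot> ?u = f' \<cdot> (f \<cdot> ?u)" using pd M Nn Q by simp
  have sq: "sq B f'' l (f' \<cdot> (f \<cdot> ?u)) ?z" using T(2)[OF s] fu by simp
  let ?zc = "ix B q (f' \<cdot> (f \<cdot> ?u)) ?z"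
  have s': "sq B (f'' \<cdot> f' \<cdot> f) l ?u ?z" using s by (simp only: e[symmetric])
  have sqn: "sq B (f'' \<cdot> f') l (f \<cdot> ?u) ?z" using T'(2)[OF s'] by blast
  have snm: "sq B (f' \<cdot> f) k ?u ?zc" using T(2)[OF s] fu by simp
  obtain N3 lo ko where o: "lo \<in> Car ?zc N3 c" "ko \<in> hm p ?z N3 d" "Reps q (f' \<cdot> (f \<cdot> ?u)) ?z lo ko" by (rule reps_ex'[OF q sq])
  obtain ln kn vn N2 where n2: "ln \<in> Car (ix B n (f \<cdot> ?u) ?zc) N2 b" "Reps n (f \<cdot> ?u) ?zc ln kn" "vn \<in> Ver N2 N3" "lo \<odot> vn = kn"
     "Reps (q \<odot>\<^sub>R n) (f \<cdot> ?u) ?z ln (ko \<odot> vn)" by (rule R_comp_ex[OF n q sqn o(1,3)])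
  let ?y = "ix B n (f \<cdot> ?u) ?zc"
  have iqn: "ix B (q \<odot>\<^sub>R n) (f \<cdot> ?u) ?z = ?y" by (rule reps_eq(2)[OF qn(1) n2(5) chmD[OF n2(1)]])
  obtain \<pi> \<psi> vm N1 where m1: "\<pi> \<in> Car (ix B m ?u ?y) N1 a" "Reps m ?u ?y \<pi> \<psi>" "vm \<in> Ver N1 N2" "ln \<odot> vm = \<psi>"
     "Reps (n \<odot>\<^sub>R m) ?u ?zc \<pi> (kn \<odot> vm)" by (rule R_comp_ex[OF m n snm n2(1,2)])
  have vv: "lo \<odot> (vn \<odot> vm) = kn \<odot> vm" using ac[OF m1(3) n2(3) chmD[OF o(1)]] n2(4) by simp
  have 1: "Reps (q \<odot>\<^sub>R (n \<odot>\<^sub>R m)) ?u ?z \<pi> (ko \<odot> (vn \<odot> vm))"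
    by (rule T(3)[OF s _ _ chmD[OF m1(1)] chmD[OF o(1)] comp_vl[OF m1(3) n2(3)] vv]) (use o m1 fu in simp_all)
  have 2: "Reps (q \<odot>\<^sub>R n \<odot>\<^sub>R m) ?u ?z \<pi> (ko \<odot> vn \<odot> vm)"
    by (rule T'(3)[OF s' n2(5) _ chmD[OF m1(1)] chmD[OF n2(1)] m1(3,4)]) (use m1 iqn in simp)
  have T'1: "q \<odot>\<^sub>R n \<odot>\<^sub>R m \<in> hm R ?f (g, a) (l, d)" using T'(1) by (simp only: e)
  show ?thesis using R_ext[OF T(1) T'1 O(10) 1] 2 ac[OF m1(3) n2(3) o(2)] by simp
qed

lemma R_lift:
  assumes o: "(h, b) \<in> Fam" and u: "u \<in> Arr B" "Cod B u = Cod B h"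
  defines "b' \<equiv> pull (pb2 B u h) b"
  shows "Lift R u (h, b) \<in> hm R u (pb1 B u h, b') (h, b)" "(pb1 B u h, b') \<in> Fam"
    "pbk u h (pb1 B u h) (pb2 B u h)" "lft (pb2 B u h) b \<in> Car (pb2 B u h) b' b"
    "\<And>s y N \<pi>. sq B u h s y ==> \<pi> \<in> Car (pb_pair B u h s y) N b' ==> Reps (Lift R u (h, b)) s y \<pi> (lft (pb2 B u h) b \<odot> \<pi>)"
    "\<And>s y. sq B u h s y ==> ix B (Lift R u (h, b)) s y = pb_pair B u h s y"
proof -
  have og: "h \<in> F" "b \<in> Ob" "ob b = Dom B h" "h \<in> Arr B" using o F_arr by (auto simp: fam_obj_iff)
  note H = og(1) u
  show P: "pbk u h (pb1 B u h) (pb2 B u h)" by (rule pb_chosen(1)[OF H])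
  note pd = is_pullbackD[OF P]
  have bP: "ob b = Cod B (pb2 B u h)" using og pd by simp
  show Lb: "lft (pb2 B u h) b \<in> Car (pb2 B u h) b' b" unfolding b'_def by (rule lift_chm[OF pd(4) og(2) bP])
  have b': "b' \<in> Ob" "ob b' = Dom B (pb1 B u h)" using reind_obj[OF pd(4) og(2) bP] pd by (auto simp: b'_def)
  show o': "(pb1 B u h, b') \<in> Fam" using pb_chosen(2)[OF H] b' by (simp add: fam_obj_iff)
  let ?P = "Dom B (pb1 B u h)"
  let ?i = "Ide B ?P"
  have i: "?i \<in> Arr B" "ob b' = Cod B ?i" "Dom B ?i = ?P" using pd b' by auto
  note Li = lift_chm[OF i(1) b'(1) i(2)]
  have e: "Lift R u (h, b) = FamArr (pb1 B u h, b') (h, b) u ?i (lft ?i b')" by (simp add: Pi_compl_def Let_def b'_def)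
  have "rmor u (pb1 B u h) b' h b ?i (lft ?i b')" unfolding rmor_def
    using H og o' pd(1-8) i chmD[OF Li] b' by (simp add: fam_obj_iff b'_def)
  thus m: "Lift R u (h, b) \<in> hm R u (pb1 B u h, b') (h, b)" unfolding e R_hm_iff by blast
  fix s y assume s: "sq B u h s y"
  note PP = pb_pair[OF H s]
  show ix: "ix B (Lift R u (h, b)) s y = pb_pair B u h s y" unfolding e ix_def using PP by simp
  fix N \<pi> assume k: "\<pi> \<in> Car (pb_pair B u h s y) N b'"
  have tD: "Dom B (pb_pair B u h s y) = ob N" using hmD[OF chmD[OF k]] by simp
  have tC: "Cod B (pb_pair B u h s y) = ob (pull ?i b')" using PP reind_obj(2)[OF i(1) b'(1) i(2)] i by simp
  have te: "pb_pair B u h s y = ?i \<cdot> pb_pair B u h s y" using PP by simp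
  obtain z where z: "z \<in> hm p (pb_pair B u h s y) N (pull ?i b')" "lft ?i b' \<odot> z = \<pi>"
    using cart_fill[OF Li chmD[OF k] PP(1) tD tC te] .
  have y: "lft (pb2 B u h) b \<odot> \<pi> \<in> hm p y N b" using comp_hm[OF chmD[OF k] chmD[OF Lb]] PP by simp
  show "Reps (Lift R u (h, b)) s y \<pi> (lft (pb2 B u h) b \<odot> \<pi>)"
    unfolding reps_def ix by (intro exI[of _ N] exI[of _ z]) (use z k y in \<open>simp add: e\<close>)
qed

lemma R_lift_comp:
  assumes o: "(h, b) \<in> Fam" and u: "u \<in> Arr B" "Cod B u = Cod B h"
    and m: "m \<in> hm R w (e, d) (pb1 B u h, pull (pb2 B u h) b)"
    and s: "sq B w (pb1 B u h) s x" and r: "Reps m s x \<pi> \<psi>"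
  shows "Reps (Lift R u (h, b) \<odot>\<^sub>R m) s (pb2 B u h \<cdot> x) \<pi> (lft (pb2 B u h) b \<odot> \<psi>)"
    "sq B (u \<cdot> w) h s (pb2 B u h \<cdot> x)" "pb_pair B u h (w \<cdot> s) (pb2 B u h \<cdot> x) = x"
proof -
  note L = R_lift[OF o u]
  note M = R_hm_obj[OF m]
  have H: "h \<in> F" "h \<in> Arr B" using o F_arr by (auto simp: fam_obj_iff)
  note pd = is_pullbackD[OF L(3)]
  have sD: "s \<in> Arr B" "x \<in> Arr B" "Dom B x = Dom B s" "Cod B s = Dom B w" "Cod B x = Dom B (pb1 B u h)" "w \<cdot> s = pb1 B u h \<cdot> x"
    using s by (auto simp: sq_def)
  have e1: "u \<cdot> (w \<cdot> s) = h \<cdot> (pb2 B u h \<cdot> x)" using sD pd(1-8) B.pre[OF pd(9), of x] by simp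
  have wD: "Cod B w = Dom B u" "w \<in> Arr B" using M pd by auto
  have uw: "u \<cdot> w \<cdot> s = u \<cdot> (w \<cdot> s)" using wD u sD by simp
  show s2: "sq B (u \<cdot> w) h s (pb2 B u h \<cdot> x)" unfolding sq_def uw using sD e1 pd(1-8) wD u by simp
  have s1: "sq B u h (w \<cdot> s) (pb2 B u h \<cdot> x)" unfolding sq_def using sD(1-5) e1 pd(1-8) wD u by simp
  show pp: "pb_pair B u h (w \<cdot> s) (pb2 B u h \<cdot> x) = x"
    by (rule pb_pair_unique[OF H(1) u s1, symmetric]) (use sD in auto)
  obtain N where N: "\<pi> \<in> Car (ix B m s x) N d" "\<psi> \<in> hm p x N (pull (pb2 B u h) b)" by (rule repsD[OF m r])
  let ?b = "pull (pb2 B u h) b"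
  have xb: "ob ?b = Cod B x" "?b \<in> Ob" using hmD[OF N(2)] by auto
  note lx = lift_chm[OF sD(2) xb(2,1)]
  obtain v where v: "v \<in> Ver N (pull x ?b)" "lft x ?b \<odot> v = \<psi>" using cart_vfill[OF lx N(2)] .
  have rl: "Reps (Lift R u (h, b)) (w \<cdot> s) (pb2 B u h \<cdot> x) (lft x ?b) (lft (pb2 B u h) b \<odot> lft x ?b)"
    by (rule L(5)[OF s1]) (use lx pp in simp)
  have il: "ix B (Lift R u (h, b)) (w \<cdot> s) (pb2 B u h \<cdot> x) = x" using L(6)[OF s1] pp by simp
  from R_comp(3)[OF m L(1) s2 rl _ chmD[OF N(1)] chmD[OF lx] v]
  have "Reps (Lift R u (h, b) \<odot>\<^sub>R m) s (pb2 B u h \<cdot> x) \<pi> (lft (pb2 B u h) b \<odot> lft x ?b \<odot> v)" unfolding il using r .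
  thus "Reps (Lift R u (h, b) \<odot>\<^sub>R m) s (pb2 B u h \<cdot> x) \<pi> (lft (pb2 B u h) b \<odot> \<psi>)"
    using ac[OF v(1) chmD[OF lx] chmD[OF L(4)]] v(2) by simp
qed

lemma R_fibration: "fibration B R"
proof (rule fibrationI[OF B.category])
  fix m u x y assume m: "m \<in> hm R u x y"
  obtain g a h b where xy: "x = (g, a)" "y = (h, b)" by (cases x, cases y)
  note m = m[unfolded xy]
  note O = R_hm_obj[OF m]
  show "x \<in> Obj (Tot R) \<and> y \<in> Obj (Tot R) \<and> u \<in> Arr B \<and> Dom B u = PObj R x \<and> Cod B u = PObj R y" using O unfolding xy by simp
  show "Ide (Tot R) y \<odot>\<^sub>R m = m \<and> m \<odot>\<^sub>R Ide (Tot R) x = m" unfolding xy using R_unit_l[OF m] R_unit_r[OF m] by blast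
  fix n v z assume n: "n \<in> hm R v y z"
  obtain k c where z: "z = (k, c)" by (cases z)
  note n = n[unfolded xy z]
  show "n \<odot>\<^sub>R m \<in> hm R (v \<cdot> u) x z" using R_comp(1)[OF m n] unfolding xy z .
  fix l w t assume l: "l \<in> hm R w z t"
  obtain r d where t: "t = (r, d)" by (cases t)
  show "l \<odot>\<^sub>R (n \<odot>\<^sub>R m) = l \<odot>\<^sub>R n \<odot>\<^sub>R m" by (rule R_assoc[OF m n l[unfolded z t]])
next
  fix x assume x: "x \<in> Obj (Tot R)"
  obtain g a where xe: "x = (g, a)" by (cases x)
  have o: "(g, a) \<in> Fam" using x xe by simp
  show "PObj R x \<in> Obj B \<and> Ide (Tot R) x \<in> hm R (Ide B (PObj R x)) x x"
    using R_ide(1)[OF o] R_hm_obj(8)[OF R_ide(1)[OF o]] unfolding xe by simp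
next
  fix u x assume u: "u \<in> Arr B" and x: "x \<in> Obj (Tot R)" "PObj R x = Cod B u"
  obtain h b where xe: "x = (h, b)" by (cases x)
  have o: "(h, b) \<in> Fam" and uh: "Cod B u = Cod B h" using x xe by auto
  note L = R_lift[OF o u uh]
  let ?h = "pb1 B u h" and ?b = "pull (pb2 B u h) b" and ?L = "Lift R u (h, b)"
  note pd = is_pullbackD[OF L(3)]
  have hF: "?h \<in> F" using L(2) by (simp add: fam_obj_iff)
  have ex: "\<exists>m. m \<in> hm R w z (?h, ?b) \<and> ?L \<odot>\<^sub>R m = n"
    if n: "n \<in> hm R (u \<cdot> w) z (h, b)" and w: "w \<in> Arr B" "Dom B w = PObj R z" "Cod B w = Dom B u" for n w z
  proof -
    obtain e d where z: "z = (e, d)" by (cases z)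
    note nh = n[unfolded z]
    note O = R_hm_obj[OF nh]
    have w': "w \<in> Arr B" "Dom B w = Cod B e" "Cod B w = Cod B ?h" using w z pd by auto
    note P = pb_chosen(1)[OF hF w'(1,3)]
    let ?s = "pb1 B w ?h" and ?x = "pb2 B w ?h"
    have s: "sq B w ?h ?s ?x" by (rule pb_sq[OF P])
    have PP: "pbk (u \<cdot> w) h ?s (pb2 B u h \<cdot> ?x)" by (rule B.pb_paste[OF L(3) P])
    note s2 = pb_sq[OF PP]
    note pP = is_pullbackD[OF P]
    obtain N \<pi> \<psi> where k: "\<pi> \<in> Car (ix B n ?s (pb2 B u h \<cdot> ?x)) N d" "\<psi> \<in> hm p (pb2 B u h \<cdot> ?x) N b" "Reps n ?s (pb2 B u h \<cdot> ?x) \<pi> \<psi>"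
      by (rule reps_ex'[OF nh s2])
    have xD: "Dom B ?x = ob N" "Cod B ?x = ob ?b"
      using hmD[OF k(2)] pP pd L(2) by (auto simp: fam_obj_iff)
    obtain \<psi>' where p': "\<psi>' \<in> hm p ?x N ?b" "lft (pb2 B u h) b \<odot> \<psi>' = \<psi>"
      using cart_fill[OF L(4) k(2) pP(4) xD refl] .
    obtain m where m: "m \<in> hm R w (e, d) (?h, ?b)" "Reps m ?s ?x \<pi> \<psi>'"
      using R_real[OF O(1) L(2) w'(2) P k(1) R_ix(4)[OF nh s2] p'(1)] by metis
    have Lm: "?L \<odot>\<^sub>R m \<in> hm R (u \<cdot> w) (e, d) (h, b)" by (rule R_comp(1)[OF m(1) L(1)])
    have "Reps (?L \<odot>\<^sub>R m) ?s (pb2 B u h \<cdot> ?x) \<pi> \<psi>"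
      using R_lift_comp(1)[OF o u uh m(1) s m(2)] p'(2) by simp
    hence eq: "?L \<odot>\<^sub>R m = n" by (rule R_ext[OF Lm nh PP _ k(3)])
    show ?thesis unfolding z using m(1) eq by blast
  qed
  have un: "m1 = m2" if m: "m1 \<in> hm R w z (?h, ?b)" "m2 \<in> hm R w z (?h, ?b)" "?L \<odot>\<^sub>R m1 = ?L \<odot>\<^sub>R m2" for m1 m2 w z
  proof -
    obtain e d where z: "z = (e, d)" by (cases z)
    note m1 = m(1)[unfolded z] and m2 = m(2)[unfolded z]
    note w' = R_hm_obj(3,5)[OF m1]
    note P = pb_chosen(1)[OF hF w']
    let ?s = "pb1 B w ?h" and ?x = "pb2 B w ?h"
    have s: "sq B w ?h ?s ?x" by (rule pb_sq[OF P])
    have nh: "?L \<odot>\<^sub>R m1 \<in> hm R (u \<cdot> w) (e, d) (h, b)" by (rule R_comp(1)[OF m1 L(1)])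
    obtain N1 \<pi>1 \<psi>1 where k1: "\<pi>1 \<in> Car (ix B m1 ?s ?x) N1 d" "\<psi>1 \<in> hm p ?x N1 ?b" "Reps m1 ?s ?x \<pi>1 \<psi>1" by (rule reps_ex'[OF m1 s])
    note r1 = R_lift_comp(1)[OF o u uh m1 s k1(3)]
    obtain N2 \<pi>2 \<psi>2 where k2: "\<pi>2 \<in> Car (ix B m2 ?s ?x) N2 d" "\<psi>2 \<in> hm p ?x N2 ?b" "Reps m2 ?s ?x \<pi>2 \<psi>2" by (rule reps_ex'[OF m2 s])
    note r2 = R_lift_comp(1)[OF o u uh m2 s k2(3), folded m(3)]
    have i: "ix B m2 ?s ?x = ix B m1 ?s ?x"
      using reps_eq(2)[OF nh r1 chmD[OF k1(1)]] reps_eq(2)[OF nh r2 chmD[OF k2(1)]] by simp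
    obtain \<psi>3 where k3: "\<psi>3 \<in> hm p ?x N1 ?b" "Reps m2 ?s ?x \<pi>1 \<psi>3" using reps_ex[OF m2 s] k1(1) i by metis
    note r3 = R_lift_comp(1)[OF o u uh m2 s k3(2), folded m(3)]
    have "lft (pb2 B u h) b \<odot> \<psi>1 = lft (pb2 B u h) b \<odot> \<psi>3" by (rule reps_fun[OF nh r1 r3])
    hence "\<psi>1 = \<psi>3" by (rule cart_eq[OF L(4) k1(2) k3(1)])
    thus ?thesis using R_ext[OF m1 m2 P k1(3)] k3(2) by simp
  qed
  show "\<exists>y. Lift R u x \<in> hm R u y x \<and>
      (\<forall>m w z. m \<in> hm R (u \<cdot> w) z x --> w \<in> Arr B --> Dom B w = PObj R z --> Cod B w = Dom B u --> (\<exists>n. n \<in> hm R w z y \<and> Lift R u x \<odot>\<^sub>R n = m)) \<and>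
      (\<forall>n n' w z. n \<in> hm R w z y --> n' \<in> hm R w z y --> Lift R u x \<odot>\<^sub>R n = Lift R u x \<odot>\<^sub>R n' --> n = n')"
    unfolding xe using L(1) ex un by blast
qed

end

section \<open>Products in the product completion\<close>

lemma (in dfib) reps_agree:
  assumes m: "m \<in> hm R f (e, d) (h, b)" and n: "n \<in> hm R f' (e, d) (h', b)" and s: "sq B f h u y" "sq B f' h' u y"
    and r: "Reps m u y \<pi> \<psi>" "Reps n u y \<pi> \<psi>" and r0: "Reps m u y \<pi>0 \<psi>0"
  shows "Reps n u y \<pi>0 \<psi>0"
proof -
  obtain N where N: "\<pi> \<in> Car (ix B m u y) N d" "\<psi> \<in> hm p y N b" by (rule repsD[OF m r(1)])
  obtain N0 where N0: "\<pi>0 \<in> Car (ix B m u y) N0 d" "\<psi>0 \<in> hm p y N0 b" by (rule repsD[OF m r0])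
  obtain j j' where j: "Iso N0 N j j'" "\<pi> \<odot> j = \<pi>0" "Reps m u y \<pi>0 (\<psi> \<odot> j)"
    by (rule reps_move[OF m s(1) r(1) chmD[OF N(1)] N0(1)])
  have "\<psi>0 = \<psi> \<odot> j" by (rule reps_fun[OF m r0 j(3)])
  thus ?thesis using reps_vert[OF n s(2) r(2) chmD[OF N(1)] viso_cart[OF j(1)]] j(2) by simp
qed

lemma (in dfib) sq_shift:
  assumes "sq B w k (u \<cdot> i) y" "w \<in> Arr B" "u \<in> Arr B" "i \<in> Arr B" "Cod B i = Dom B u" "Cod B u = Dom B w"
  shows "sq B (w \<cdot> u) k i y"
  using assms by (simp add: sq_def)

locale pifib = dfib B p F for B :: "('o, 'm) cat" (structure) and p :: "('o, 'm, 'e, 'f) fibn" and F +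
  assumes units: "has_units B F" and comps: "has_dependent_coproducts B F"

sublocale pifib \<subseteq> Rf: dfib B R F
  by (intro dfib.intro fib.intro dfib_axioms.intro R_fibration dmc)

locale picone = pifib B p F for B :: "('o, 'm) cat" (structure) and p :: "('o, 'm, 'e, 'f) fibn" and F +
  fixes v f b
  assumes vF: "v \<in> F" and fb: "(f, b) \<in> fam_obj B F p" and vf: "Cod B f = Dom B v"
begin

abbreviation "k \<equiv> v \<cdot> f"
abbreviation "b' \<equiv> pull (pb2 B v k) b"
abbreviation "M \<equiv> (pb1 B v k, b')"
abbreviation "\<pi> \<equiv> Lift R v (k, b)"
abbreviation "pr \<equiv> pb_pair B v k"
abbreviation "lb \<equiv> lft (pb2 B v k) b"

lemma basics: "v \<in> Arr B" "f \<in> F" "f \<in> Arr B" "b \<in> Ob" "ob b = Dom B f" "k \<in> F" "k \<in> Arr B" "Dom B k = Dom B f" "Cod B k = Cod B v"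
    "(k, b) \<in> Fam"
proof -
  show 1: "f \<in> F" "b \<in> Ob" "ob b = Dom B f" using fb by (auto simp: fam_obj_iff)
  show 2: "v \<in> Arr B" "f \<in> Arr B" using F_arr vF 1 by auto
  show 3: "k \<in> F" using comps vF 1 vf unfolding has_dependent_coproducts_def by blast
  show 4: "k \<in> Arr B" "Dom B k = Dom B f" "Cod B k = Cod B v" using 2 vf by auto
  show "(k, b) \<in> Fam" using 1 3 4 by (simp add: fam_obj_iff)
qed

lemma vk: "Cod B v = Cod B k" using basics by simp

lemmas L = R_lift[OF basics(10,1) vk]

lemma kappa: "\<pi> \<in> chm B R v M (k, b)"
proof -
  have "Dom (Tot R) \<pi> = M" using Rf.hmD[OF L(1)] by blast
  thus ?thesis using Rf.lift_chm[of v "(k, b)"] basics(1,9,10) by (simp add: reindex_def)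
qed

lemma sq_pr:
  assumes "y \<in> Arr B" "Cod B y = Dom B f" "x = f \<cdot> y"
  shows "sq B v k x y"
  using assms basics vf by (simp add: sq_def)

lemma eps_ex: "\<exists>\<xi> \<in> hm R (Ide B (Dom B v)) M (f, b). \<forall>y l N. y \<in> Arr B --> Cod B y = Dom B f --> l \<in> Car (pr (f \<cdot> y) y) N b' -->
    Reps \<xi> (f \<cdot> y) y l (lb \<odot> l)"
proof -
  have P: "pbk (Ide B (Dom B v)) f f (Ide B (Dom B f))" using B.pb_ide[OF basics(3)] vf by simp
  have s: "sq B v k f (Ide B (Dom B f))" by (rule sq_pr) (use basics in auto)
  note PP = pb_pair[OF basics(6,1) vk s]
  let ?x = "pr f (Ide B (Dom B f))"
  have b': "b' \<in> Ob" "ob b' = Dom B (pb1 B v k)" using L(2) by (auto simp: fam_obj_iff)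
  have xb: "ob b' = Cod B ?x" using PP b' by simp
  note l = lift_chm[OF PP(1) b'(1) xb]
  let ?N = "pull ?x b'" and ?l = "lft ?x b'"
  have ll: "lb \<odot> ?l \<in> hm p (Ide B (Dom B f)) ?N b" using comp_hm[OF chmD[OF l] chmD[OF L(4)]] PP by simp
  have d: "Dom B (Ide B (Dom B v)) = Cod B (pb1 B v k)" using is_pullbackD(1-8)[OF L(3)] basics(1,9) by simp
  obtain \<xi> where e: "\<xi> \<in> hm R (Ide B (Dom B v)) M (f, b)" "Reps \<xi> f (Ide B (Dom B f)) ?l (lb \<odot> ?l)"
    by (rule R_real[OF L(2) fb d P l PP(4) ll])
  note sP = pb_sq[OF P]
  have "Reps \<xi> (f \<cdot> y) y l2 (lb \<odot> l2)" if y: "y \<in> Arr B" "Cod B y = Dom B f" and l2: "l2 \<in> Car (pr (f \<cdot> y) y) N b'" for y l2 N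
  proof -
    have yN: "ob ?N = Cod B y" "?N \<in> Ob" using reind_obj[OF PP(1) b'(1) xb] PP y basics by auto
    note n = lift_chm[OF y(1) yN(2,1)]
    note rr = reps_restr[OF e(1) sP e(2) chmD[OF l] n]
    have yy: "Ide B (Dom B f) \<cdot> y = y" using y basics by simp
    have pp: "pr (f \<cdot> y) y = ?x \<cdot> y" using pb_pair_restr[OF basics(6,1) vk s y(1)] y basics by simp
    note r1 = rr(1)[unfolded yy] and s1 = rr(3)[unfolded yy]
    have kn: "?l \<odot> lft y ?N \<in> hm p (?x \<cdot> y) (pull y ?N) b'" by (rule comp_hm[OF chmD[OF n] chmD[OF l]])
    obtain j j' where j: "Iso N (pull y ?N) j j'" "?l \<odot> lft y ?N \<odot> j = l2"
      "Reps \<xi> (f \<cdot> y) y l2 (lb \<odot> ?l \<odot> lft y ?N \<odot> j)"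
      by (rule reps_move[OF e(1) s1 r1 kn l2[unfolded pp]])
    have jh: "j \<in> Ver N (pull y ?N)" using visoD[OF j(1)] by blast
    have "lb \<odot> ?l \<odot> lft y ?N \<odot> j = lb \<odot> l2"
      using ac[OF chmD[OF n] chmD[OF l] chmD[OF L(4)]] ac[OF jh kn chmD[OF L(4)]] j(2) by simp
    thus ?thesis using j(3) by simp
  qed
  thus ?thesis using e(1) by blast
qed

definition "\<xi> = (SOME e. e \<in> hm R (Ide B (Dom B v)) M (f, b) \<and> (\<forall>y l N. y \<in> Arr B --> Cod B y = Dom B f --> l \<in> Car (pr (f \<cdot> y) y) N b' -->
    Reps e (f \<cdot> y) y l (lb \<odot> l)))"

lemma eps: "\<xi> \<in> hm R (Ide B (Dom B v)) M (f, b)"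
  "y \<in> Arr B ==> Cod B y = Dom B f ==> l \<in> Car (pr (f \<cdot> y) y) N b' ==> Reps \<xi> (f \<cdot> y) y l (lb \<odot> l)"
proof -
  have "\<exists>e. e \<in> hm R (Ide B (Dom B v)) M (f, b) \<and> (\<forall>y l N. y \<in> Arr B --> Cod B y = Dom B f --> l \<in> Car (pr (f \<cdot> y) y) N b' -->
    Reps e (f \<cdot> y) y l (lb \<odot> l))" using eps_ex by blast
  from someI_ex[OF this, folded \<xi>_def] show "\<xi> \<in> hm R (Ide B (Dom B v)) M (f, b)"
    "y \<in> Arr B ==> Cod B y = Dom B f ==> l \<in> Car (pr (f \<cdot> y) y) N b' ==> Reps \<xi> (f \<cdot> y) y l (lb \<odot> l)" by blast+
qed

lemma cone: "pcone B R v \<pi> \<xi> M (k, b) (f, b)"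
  unfolding pcone_def using kappa eps(1) is_pullbackD[OF L(3)] by simp

text \<open>Evaluation at the product cone does not change the action of a morphism: it only restricts the elements on
  which the morphism acts.\<close>

lemma act:
  assumes X: "\<chi>' \<in> hm R g (e, d) M" and s: "sq B g f i y"
  shows "sq B (v \<cdot> g) k i y" "Reps (\<pi> \<odot>\<^sub>R \<chi>') i y \<pi>0 \<psi>0 \<longleftrightarrow> Reps (\<xi> \<odot>\<^sub>R \<chi>') i y \<pi>0 \<psi>0"
proof -
  note O = R_hm_obj[OF X]
  note pd = is_pullbackD[OF L(3)]
  have sD: "i \<in> Arr B" "y \<in> Arr B" "Dom B y = Dom B i" "Cod B i = Dom B g" "Cod B y = Dom B f" "g \<cdot> i = f \<cdot> y" using s by (auto simp: sq_def)
  have gD: "Cod B g = Dom B v" using O pd by simp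
  have vg: "v \<cdot> g \<cdot> i = k \<cdot> y" using basics O gD sD vf by simp
  show s2: "sq B (v \<cdot> g) k i y" using sD vg basics O gD unfolding sq_def by simp
  let ?X = "pr (f \<cdot> y) y"
  have s3: "sq B v k (f \<cdot> y) y" by (rule sq_pr[OF sD(2,5) refl])
  note PP = pb_pair[OF basics(6,1) vk s3]
  have sX: "sq B g (pb1 B v k) i ?X" using sD PP(1-4) pd(1-8) O(3-5) basics(3) by (simp add: sq_def)
  obtain N1 \<pi>1 \<psi>1 where k1: "\<pi>1 \<in> Car (ix B \<chi>' i ?X) N1 d" "\<psi>1 \<in> hm p ?X N1 b'" "Reps \<chi>' i ?X \<pi>1 \<psi>1" by (rule reps_ex'[OF X sX])
  have A: "Reps (\<pi> \<odot>\<^sub>R \<chi>') i y \<pi>1 (lb \<odot> \<psi>1)"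
    using R_lift_comp(1)[OF basics(10,1) vk X sX k1(3)] PP(5) by simp
  have Xb: "b' \<in> Ob" "ob b' = Cod B ?X" using hmD[OF k1(2)] by auto
  note l = lift_chm[OF PP(1) Xb]
  obtain w where w: "w \<in> Ver N1 (pull ?X b')" "lft ?X b' \<odot> w = \<psi>1" using cart_vfill[OF l k1(2)] .
  have re: "Reps \<xi> (g \<cdot> i) y (lft ?X b') (lb \<odot> lft ?X b')" unfolding sD(6) by (rule eps(2)[OF sD(2,5) l])
  have ie: "ix B \<xi> (g \<cdot> i) y = ?X" by (rule reps_eq(2)[OF eps(1) re chmD[OF l]])
  have Ig: "Ide B (Dom B v) \<cdot> g = g" using O gD by simp
  have "Reps (\<xi> \<odot>\<^sub>R \<chi>') i y \<pi>1 (lb \<odot> lft ?X b' \<odot> w)"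
    by (rule R_comp(3)[OF X eps(1) _ re _ chmD[OF k1(1)] chmD[OF l] w]) (simp_all only: Ig s ie k1(3))
  hence Bb: "Reps (\<xi> \<odot>\<^sub>R \<chi>') i y \<pi>1 (lb \<odot> \<psi>1)" using ac[OF w(1) chmD[OF l] chmD[OF L(4)]] w(2) by simp
  have h: "\<pi> \<odot>\<^sub>R \<chi>' \<in> hm R (v \<cdot> g) (e, d) (k, b)" "\<xi> \<odot>\<^sub>R \<chi>' \<in> hm R g (e, d) (f, b)"
    using R_comp(1)[OF X L(1)] R_comp(1)[OF X eps(1)] Ig by simp_all
  show "Reps (\<pi> \<odot>\<^sub>R \<chi>') i y \<pi>0 \<psi>0 \<longleftrightarrow> Reps (\<xi> \<odot>\<^sub>R \<chi>') i y \<pi>0 \<psi>0"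
    using reps_agree[OF h s2 s A Bb] reps_agree[OF h(2,1) s s2 Bb A] by blast
qed

lemma sprod: "sprod B R v \<pi> \<xi> M (k, b) (f, b)"
  unfolding sprod_def
proof (intro conjI allI impI)
  show C: "pcone B R v \<pi> \<xi> M (k, b) (f, b)" by (rule cone)
  fix w u g assume P: "pbk w v u g"
  note pd = is_pullbackD[OF P]
  show "ptest B R \<pi> \<xi> w u g"
  proof (rule Rf.ptestI[OF C pd(3,7)])
    fix \<gamma> assume "\<gamma> \<in> Obj (Tot R)" "PObj R \<gamma> = Dom B w"
    then obtain e d where g: "\<gamma> = (e, d)" "(e, d) \<in> Fam" "Cod B e = Dom B w" by (cases \<gamma>) auto
    have ed: "e \<in> F" "e \<in> Arr B" "d \<in> Ob" "ob d = Dom B e" using g F_arr by (auto simp: fam_obj_iff)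
    have uc: "Cod B u = Cod B e" using pd g by simp
    note Lu = R_lift[OF g(2) pd(3) uc]
    let ?d = "pull (pb2 B u e) d" and ?K = "Lift R u (e, d)"
    let ?N = "(pb1 B u e, ?d)" and ?ld = "lft (pb2 B u e) d"
    have Kc: "?K \<in> chm B R u ?N (e, d)"
      using Rf.lift_chm[of u "(e, d)"] pd g uc Rf.hmD[OF Lu(1)] by (simp add: reindex_def)
    note pu = is_pullbackD[OF Lu(3)]
    have gf: "Cod B g = Cod B f" using pd vf by simp
    note P1 = pb_chosen(1)[OF basics(2) pd(4) gf]
    let ?i = "pb1 B g f" and ?y = "pb2 B g f"
    have P2: "pbk w k (u \<cdot> ?i) ?y" by (rule B.pb_sym[OF B.pb_paste[OF B.pb_sym[OF P] B.pb_sym[OF P1]]])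
    note s1 = pb_sq[OF P1] and s2 = pb_sq[OF P2]
    note p1 = is_pullbackD[OF P1]
    have bwd: "\<exists>l. l \<in> Car (pb_pair B u e ?i (ix B x (u \<cdot> ?i) ?y)) N0 ?d \<and> ?ld \<odot> l = \<pi>x \<and> Reps (x \<odot>\<^sub>R ?K) ?i ?y l \<psi>x
        \<and> pb2 B u e \<cdot> pb_pair B u e ?i (ix B x (u \<cdot> ?i) ?y) = ix B x (u \<cdot> ?i) ?y"
      if x: "x \<in> hm R w (e, d) (k, b)" and kx: "\<pi>x \<in> Car (ix B x (u \<cdot> ?i) ?y) N0 d" and r: "Reps x (u \<cdot> ?i) ?y \<pi>x \<psi>x" for x \<pi>x \<psi>x N0
    proof -
      let ?s = "ix B x (u \<cdot> ?i) ?y"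
      note X = R_ix[OF x s2]
      have sq1: "sq B u e ?i ?s" using X p1 pd uc unfolding sq_def by simp
      note PP = pb_pair[OF ed(1) pd(3) uc sq1]
      have D: "Dom B (pb_pair B u e ?i ?s) = ob N0" "Cod B (pb_pair B u e ?i ?s) = ob ?d"
        using PP hmD[OF chmD[OF kx]] X Lu(2) p1 pd by (auto simp: fam_obj_iff)
      obtain l where l: "l \<in> hm p (pb_pair B u e ?i ?s) N0 ?d" "?ld \<odot> l = \<pi>x"
        using cart_fill[OF Lu(4) chmD[OF kx] PP(1) D PP(5)[symmetric]] .
      have lc: "l \<in> Car (pb_pair B u e ?i ?s) N0 ?d" using cart_cancel[OF Lu(4) l(1)] l(2) kx by simp
      have rK: "Reps ?K ?i ?s l \<pi>x" using Lu(5)[OF sq1 lc] l(2) by simp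
      have N0: "N0 \<in> Ob" using hmD[OF l(1)] by blast
      have s3: "sq B (w \<cdot> u) k ?i ?y" by (rule sq_shift[OF s2]) (use p1(1-8) pd(1-8) in simp_all)
      have psi: "\<psi>x \<in> hm p ?y N0 b" by (rule reps_eq(1)[OF x r chmD[OF kx]])
      have "Reps (x \<odot>\<^sub>R ?K) ?i ?y l (\<psi>x \<odot> idt N0)"
        by (rule R_comp(3)[OF Lu(1) x s3 r rK l(1) chmD[OF kx] ide_hm[OF N0] idr[OF chmD[OF kx]]])
      thus ?thesis using lc l(2) idr[OF psi] PP(5) by auto
    qed
    have "\<exists>!x. x \<in> hm R w (e, d) (k, b) \<and> pmed R \<pi> \<xi> ?K e0 x" if e0: "e0 \<in> hm R g ?N (f, b)" for e0
    proof -
      have med: "\<exists>x'. x' \<in> hm R g ?N M \<and> \<pi> \<odot>\<^sub>R x' = x \<odot>\<^sub>R ?K \<and> (pmed R \<pi> \<xi> ?K e0 x \<longleftrightarrow> \<xi> \<odot>\<^sub>R x' = e0) \<and> \<xi> \<odot>\<^sub>R x' \<in> hm R g ?N (f, b)"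
        if x: "x \<in> hm R w (e, d) (k, b)" for x
      proof -
        obtain x' where x': "x' \<in> hm R g ?N M" "\<pi> \<odot>\<^sub>R x' = x \<odot>\<^sub>R ?K"
          using Rf.pmed_ev[OF C Kc x pd(4) _ pd(8) pd(9)[symmetric]] pd pu by auto
        have "pmed R \<pi> \<xi> ?K e0 x \<longleftrightarrow> \<xi> \<odot>\<^sub>R x' = e0"
        proof
          assume "pmed R \<pi> \<xi> ?K e0 x"
          then obtain x2 where x2: "x2 \<in> hm R g ?N M" "\<pi> \<odot>\<^sub>R x2 = x \<odot>\<^sub>R ?K" "\<xi> \<odot>\<^sub>R x2 = e0" by (rule Rf.pmedE[OF C Kc e0])
          have "x2 = x'" by (rule Rf.cart_eq[OF kappa x2(1) x'(1)]) (use x2 x' in simp)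
          thus "\<xi> \<odot>\<^sub>R x' = e0" using x2 by simp
        next
          assume "\<xi> \<odot>\<^sub>R x' = e0"
          thus "pmed R \<pi> \<xi> ?K e0 x" by (rule Rf.pmedI[OF C Kc e0 x'])
        qed
        moreover have "\<xi> \<odot>\<^sub>R x' \<in> hm R g ?N (f, b)" using R_comp(1)[OF x'(1) eps(1)] pd by simp
        ultimately show ?thesis using x' by blast
      qed
      obtain Ne \<pi>e \<psi>e where ke: "\<pi>e \<in> Car (ix B e0 ?i ?y) Ne ?d" "\<psi>e \<in> hm p ?y Ne b" "Reps e0 ?i ?y \<pi>e \<psi>e" by (rule reps_ex'[OF e0 s1])
      let ?s = "ix B e0 ?i ?y"
      note E0 = R_ix[OF e0 s1]
      have ks: "?ld \<odot> \<pi>e \<in> Car (pb2 B u e \<cdot> ?s) Ne d" by (rule cart_comp[OF Lu(4) ke(1)])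
      have es: "e \<cdot> (pb2 B u e \<cdot> ?s) = u \<cdot> ?i" using B.pre[OF pu(9)[symmetric], of ?s] E0 pu(1-8) by simp
      obtain x where x: "x \<in> hm R w (e, d) (k, b)" "Reps x (u \<cdot> ?i) ?y (?ld \<odot> \<pi>e) \<psi>e" "ix B x (u \<cdot> ?i) ?y = pb2 B u e \<cdot> ?s"
        by (rule R_real[OF g(2) basics(10) g(3)[symmetric] P2 ks es ke(2)])
      obtain l where l: "l \<in> Car (pb_pair B u e ?i (pb2 B u e \<cdot> ?s)) Ne ?d" "?ld \<odot> l = ?ld \<odot> \<pi>e" "Reps (x \<odot>\<^sub>R ?K) ?i ?y l \<psi>e"
        using bwd[OF x(1) _ x(2)] ks unfolding x(3) by blast
      have sqs: "sq B u e ?i (pb2 B u e \<cdot> ?s)" unfolding sq_def es using E0 p1 pd pu by simp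
      have "pb_pair B u e ?i (pb2 B u e \<cdot> ?s) = ?s"
        by (rule pb_pair_unique[OF ed(1) pd(3) uc sqs, symmetric]) (use E0 in auto)
      hence "l = \<pi>e" using cart_eq[OF Lu(4) chmD[OF l(1)] _ l(2)] chmD[OF ke(1)] by simp
      hence rx: "Reps (x \<odot>\<^sub>R ?K) ?i ?y \<pi>e \<psi>e" using l(3) by simp
      obtain x' where x': "x' \<in> hm R g ?N M" "\<pi> \<odot>\<^sub>R x' = x \<odot>\<^sub>R ?K" "pmed R \<pi> \<xi> ?K e0 x \<longleftrightarrow> \<xi> \<odot>\<^sub>R x' = e0" "\<xi> \<odot>\<^sub>R x' \<in> hm R g ?N (f, b)"
        using med[OF x(1)] by blast
      have "Reps (\<xi> \<odot>\<^sub>R x') ?i ?y \<pi>e \<psi>e" using act(2)[OF x'(1) s1] rx x'(2) by simp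
      hence "\<xi> \<odot>\<^sub>R x' = e0" by (rule R_ext[OF x'(4) e0 P1 _ ke(3)])
      hence px: "pmed R \<pi> \<xi> ?K e0 x" using x'(3) by blast
      have fwd: "\<exists>\<pi>1 \<psi>1 N1 l. \<pi>1 \<in> Car (ix B z (u \<cdot> ?i) ?y) N1 d \<and> Reps z (u \<cdot> ?i) ?y \<pi>1 \<psi>1 \<and> l \<in> hm p ?s N1 ?d \<and> pb2 B u e \<cdot> ?s = ix B z (u \<cdot> ?i) ?y"
        if z: "z \<in> hm R w (e, d) (k, b)" "pmed R \<pi> \<xi> ?K e0 z" for z
      proof -
        obtain z' where z': "z' \<in> hm R g ?N M" "\<pi> \<odot>\<^sub>R z' = z \<odot>\<^sub>R ?K" "\<xi> \<odot>\<^sub>R z' = e0" using med[OF z(1)] z(2) by blast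
        obtain N1 \<pi>1 \<psi>1 where k1: "\<pi>1 \<in> Car (ix B z (u \<cdot> ?i) ?y) N1 d" "\<psi>1 \<in> hm p ?y N1 b" "Reps z (u \<cdot> ?i) ?y \<pi>1 \<psi>1" by (rule reps_ex'[OF z(1) s2])
        obtain l where l: "l \<in> Car (pb_pair B u e ?i (ix B z (u \<cdot> ?i) ?y)) N1 ?d" "Reps (z \<odot>\<^sub>R ?K) ?i ?y l \<psi>1"
          "pb2 B u e \<cdot> pb_pair B u e ?i (ix B z (u \<cdot> ?i) ?y) = ix B z (u \<cdot> ?i) ?y"
          using bwd[OF z(1) k1(1,3)] by blast
        have "Reps e0 ?i ?y l \<psi>1" using act(2)[OF z'(1) s1] l(2) z'(2,3) by simp
        hence "?s = pb_pair B u e ?i (ix B z (u \<cdot> ?i) ?y)" using reps_eq(2)[OF e0 _ chmD[OF l(1)]] by simp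
        thus ?thesis using k1 l chmD[OF l(1)] by auto
      qed
      have un: "z1 = z2" if z1: "z1 \<in> hm R w (e, d) (k, b)" "pmed R \<pi> \<xi> ?K e0 z1" and z2: "z2 \<in> hm R w (e, d) (k, b)" "pmed R \<pi> \<xi> ?K e0 z2" for z1 z2
      proof -
        obtain \<pi>1 \<psi>1 N1 where k1: "\<pi>1 \<in> Car (ix B z1 (u \<cdot> ?i) ?y) N1 d" "Reps z1 (u \<cdot> ?i) ?y \<pi>1 \<psi>1" "pb2 B u e \<cdot> ?s = ix B z1 (u \<cdot> ?i) ?y"
          using fwd[OF z1] by blast
        have "ix B z2 (u \<cdot> ?i) ?y = ix B z1 (u \<cdot> ?i) ?y" using fwd[OF z2] k1(3) by auto
        then obtain \<psi>2 where k2: "Reps z2 (u \<cdot> ?i) ?y \<pi>1 \<psi>2" using reps_ex[OF z2(1) s2] k1(1) by metis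
        have e0r: "\<exists>l. l \<in> hm p ?s N1 ?d \<and> ?ld \<odot> l = \<pi>1 \<and> Reps e0 ?i ?y l \<psi>"
          if z: "z \<in> hm R w (e, d) (k, b)" "pmed R \<pi> \<xi> ?K e0 z" and kz: "\<pi>1 \<in> Car (ix B z (u \<cdot> ?i) ?y) N1 d" and r: "Reps z (u \<cdot> ?i) ?y \<pi>1 \<psi>" for z \<psi>
        proof -
          obtain z' where z': "z' \<in> hm R g ?N M" "\<pi> \<odot>\<^sub>R z' = z \<odot>\<^sub>R ?K" "\<xi> \<odot>\<^sub>R z' = e0" using med[OF z(1)] z(2) by blast
          obtain l where l: "l \<in> Car (pb_pair B u e ?i (ix B z (u \<cdot> ?i) ?y)) N1 ?d" "?ld \<odot> l = \<pi>1" "Reps (z \<odot>\<^sub>R ?K) ?i ?y l \<psi>"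
            using bwd[OF z(1) kz r] by blast
          have rl: "Reps e0 ?i ?y l \<psi>" using act(2)[OF z'(1) s1] l(3) z'(2,3) by simp
          thus ?thesis using l reps_eq(2)[OF e0 rl chmD[OF l(1)]] chmD[OF l(1)] by auto
        qed
        obtain l1 where l1: "l1 \<in> hm p ?s N1 ?d" "?ld \<odot> l1 = \<pi>1" "Reps e0 ?i ?y l1 \<psi>1" using e0r[OF z1 k1(1,2)] by blast
        obtain l2 where l2: "l2 \<in> hm p ?s N1 ?d" "?ld \<odot> l2 = \<pi>1" "Reps e0 ?i ?y l2 \<psi>2"
          using e0r[OF z2 _ k2] k1(1) \<open>ix B z2 (u \<cdot> ?i) ?y = ix B z1 (u \<cdot> ?i) ?y\<close> by auto
        have "l2 = l1" using cart_eq[OF Lu(4) l2(1) l1(1)] l1 l2 by simp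
        hence "\<psi>2 = \<psi>1" using reps_fun[OF e0] l1(3) l2(3) by blast
        thus ?thesis using R_ext[OF z1(1) z2(1) P2 k1(2)] k2 by simp
      qed
      show ?thesis using x(1) px un by blast
    qed
    thus "\<exists>\<pi>' N. \<pi>' \<in> chm B R u N \<gamma> \<and> (\<forall>e0\<in>hm R g N (f, b). \<exists>!x. x \<in> hm R w \<gamma> (k, b) \<and> pmed R \<pi> \<xi> \<pi>' e0 x)"
      using Kc g(1) by blast
  qed
qed

text \<open>A morphism from the product into \<open>(g0, a)\<close> acts on the
  single generic element \<open>(id, g0')\<close>, and its index there is the required section.\<close>

lemma split:
  assumes g0: "(g0, a) \<in> Fam" "Cod B g0 = Cod B v" and g0': "g0' \<in> Arr B" "Dom B g0' = Cod B g0" "Cod B g0' = Dom B g0"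
    "g0 \<cdot> g0' = Ide B (Cod B g0)" "g0' \<cdot> g0 = Ide B (Dom B g0)"
    and h: "h \<in> hm R (Ide B (Cod B v)) (k, b) (g0, a)"
  shows "psplit B R \<pi> \<xi> (Ide (Tot R) (k, b)) h"
proof -
  let ?A = "Cod B v"
  let ?I = "Ide B ?A"
  have g0a: "g0 \<in> Arr B" using g0 F_arr by (auto simp: fam_obj_iff)
  have P0: "pbk ?I g0 ?I g0'"
  proof (rule B.pbI)
    fix x y assume a: "x \<in> Arr B" "y \<in> Arr B" "Dom B x = Dom B y" "Cod B x = Dom B ?I" "Cod B y = Dom B g0" "?I \<cdot> x = g0 \<cdot> y"
    hence "x = g0 \<cdot> y" using basics by simp
    hence "g0' \<cdot> x = y" using B.pre[OF g0'(5) g0'(1) g0a _ a(2)] g0' g0 a by simp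
    thus "\<exists>t. t \<in> Arr B \<and> Dom B t = Dom B x \<and> Cod B t = Dom B ?I \<and> ?I \<cdot> t = x \<and> g0' \<cdot> t = y"
      using a basics by (intro exI[of _ x]) simp
  qed (use g0 g0' g0a basics in simp_all)
  note s0 = pb_sq[OF P0]
  have II: "?I \<cdot> ?I = ?I" using basics by simp
  note cI = R_ide[OF basics(10)]
  have kc: "(k, b) \<in> Obj (Tot R)" using basics(10) by simp
  have Ide: "Ide (Tot R) (k, b) \<in> vhm B R (k, b) (k, b)" by (rule Rf.ide_hm[OF kc])
  have hv: "h \<in> vhm B R (k, b) (g0, a)" using h basics by simp
  have cP: "PObj R (k, b) = ?A" using basics by simp
  text \<open>Solutions over \<open>g\<close> are determined by their action on the generic element.\<close>
  have key: "f \<cdot> (pb2 B g f \<cdot> t1) = g \<and> Reps (q \<odot>\<^sub>R E) ?I g0' (lft (pb2 B g f) b \<odot> \<pi>1) \<psi>1 \<and>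
      lft (pb2 B g f) b \<odot> \<pi>1 \<in> Car (pb2 B g f \<cdot> t1) N1 b \<and> pb1 B g f \<cdot> t1 = ?I"
    if g: "g \<in> Arr B" "Cod B g = Dom B v" "v \<cdot> g = ?I" and X: "\<chi>' \<in> hm R g (k, b) M" "\<pi> \<odot>\<^sub>R \<chi>' = Ide (Tot R) (k, b)"
      and E: "E \<in> hm R ?I (k, b) (pb1 B g f, pull (pb2 B g f) b)" "Lift R g (f, b) \<odot>\<^sub>R E = \<xi> \<odot>\<^sub>R \<chi>'"
      and q: "q \<in> hm R ?I (pb1 B g f, pull (pb2 B g f) b) (g0, a)" "ix B q ?I g0' = t1"
      and r: "\<pi>1 \<in> Car t1 N1 (pull (pb2 B g f) b)" "Reps q ?I g0' \<pi>1 \<psi>1"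
    for g \<chi>' E q t1 \<pi>1 \<psi>1 N1
  proof -
    have gf: "Cod B g = Cod B f" using g vf by simp
    note Lg = R_lift[OF fb g(1) gf]
    note pg = is_pullbackD[OF Lg(3)]
    have gD: "Dom B g = ?A" using R_hm_obj[OF X(1)] basics by simp
    have t1: "t1 \<in> Arr B" "Dom B t1 = ?A" "Cod B t1 = Dom B (pb1 B g f)" "pb1 B g f \<cdot> t1 = ?I"
      using R_ix[OF q(1) s0] q(2) basics by auto
    let ?lg = "lft (pb2 B g f) b" and ?x = "pb2 B g f \<cdot> t1"
    have fx: "f \<cdot> ?x = g" using B.pre[OF pg(9)[symmetric], of t1] t1 pg(1-8) gD g by simp
    have lk: "?lg \<odot> \<pi>1 \<in> Car ?x N1 b" by (rule cart_comp[OF Lg(4) r(1)])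
    have sE: "sq B ?I (pb1 B g f) ?I t1" using t1 pg basics gD by (simp add: sq_def)
    obtain NE \<pi>E \<psi>E where kE: "\<pi>E \<in> Car (ix B E ?I t1) NE b" "\<psi>E \<in> hm p t1 NE (pull (pb2 B g f) b)" "Reps E ?I t1 \<pi>E \<psi>E"
      by (rule reps_ex'[OF E(1) sE])
    obtain w where w: "w \<in> Ver NE N1" "\<pi>1 \<odot> w = \<psi>E" using cart_vfill[OF r(1) kE(2)] .
    have rl: "Reps (\<xi> \<odot>\<^sub>R \<chi>') ?I ?x \<pi>E (?lg \<odot> \<psi>E)"
      using R_lift_comp(1)[OF fb g(1) gf E(1) sE kE(3)] E(2) by simp
    have sx: "sq B g f ?I ?x" using t1 pg fx gD g basics by (simp add: sq_def)
    have ri: "Reps (Ide (Tot R) (k, b)) ?I ?x \<pi>E (?lg \<odot> \<psi>E)" using act(2)[OF X(1) sx] rl X(2) by simp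
    have ixI: "?I = k \<cdot> ?x" using fx g basics t1 pg vf by simp
    have xb: "ob b = Cod B ?x" using t1 pg basics by simp
    have xA: "?x \<in> Arr B" using t1 pg by simp
    note lx = lift_chm[OF xA basics(4) xb]
    have ixx: "ix B (Ide (Tot R) (k, b)) ?I ?x = ?x" by (rule reps_eq(2)[OF cI(1) cI(3)[OF lx ixI] chmD[OF lx]])
    have kEx: "\<pi>E \<in> Car ?x NE b" using reps_eq(2)[OF cI(1) ri chmD[OF kE(1)]] ixx kE(1) by simp
    have "?lg \<odot> \<psi>E = \<pi>E" by (rule reps_fun[OF cI(1) ri cI(3)[OF kEx ixI]])
    hence kw: "?lg \<odot> \<pi>1 \<odot> w = \<pi>E" using ac[OF w(1) chmD[OF r(1)] chmD[OF Lg(4)]] w(2) by simp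
    have qE: "Reps (q \<odot>\<^sub>R E) ?I g0' \<pi>E (\<psi>1 \<odot> w)"
      by (rule R_comp(3)[OF E(1) q(1) _ _ _ chmD[OF kE(1)] chmD[OF r(1)] w]) (simp_all only: II s0 r(2) q(2) kE(3))
    have qEh: "q \<odot>\<^sub>R E \<in> hm R ?I (k, b) (g0, a)" using R_comp(1)[OF E(1) q(1)] by (simp only: II)
    obtain j j' where j: "Iso N1 NE j j'" "\<pi>E \<odot> j = ?lg \<odot> \<pi>1" "Reps (q \<odot>\<^sub>R E) ?I g0' (?lg \<odot> \<pi>1) (\<psi>1 \<odot> w \<odot> j)"
      by (rule reps_move[OF qEh s0 qE chmD[OF kEx] lk])
    have jh: "j \<in> Ver N1 NE" using visoD[OF j(1)] by blast
    have psi1: "\<psi>1 \<in> hm p g0' N1 a" by (rule reps_eq(1)[OF q(1) r(2) chmD[OF r(1)]])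
    have N1: "N1 \<in> Ob" using hmD[OF jh] by blast
    have "w \<odot> j = idt N1"
      by (rule cart_eq[OF lk comp_vl[OF jh w(1)] ide_hm[OF N1]])
        (use ac[OF jh w(1) chmD[OF lk]] kw j(2) idr[OF chmD[OF lk]] in simp)
    hence "\<psi>1 \<odot> w \<odot> j = \<psi>1" using ac[OF jh w(1) psi1] idr[OF psi1] by simp
    thus ?thesis using fx j(3) lk t1(4) by simp
  qed
  have Lc: "Lift R g (f, b) \<in> chm B R g (pb1 B g f, pull (pb2 B g f) b) (f, b)" if g: "g \<in> Arr B" "Cod B g = Dom B v" for g
  proof -
    have gf: "Cod B g = Cod B f" using g vf by simp
    show ?thesis using Rf.lift_chm[of g "(f, b)"] g gf fb Rf.hmD[OF R_lift(1)[OF fb g(1) gf]] by (simp add: reindex_def)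
  qed
  have sol: "\<exists>\<chi>' E. v \<cdot> g = ?I \<and> \<chi>' \<in> hm R g (k, b) M \<and> \<pi> \<odot>\<^sub>R \<chi>' = Ide (Tot R) (k, b) \<and>
      E \<in> hm R ?I (k, b) (pb1 B g f, pull (pb2 B g f) b) \<and> Lift R g (f, b) \<odot>\<^sub>R E = \<xi> \<odot>\<^sub>R \<chi>' \<and>
      q \<in> hm R ?I (pb1 B g f, pull (pb2 B g f) b) (g0, a) \<and> q \<odot>\<^sub>R E = h"
    if g: "g \<in> Arr B" "Cod B g = Dom B v" and s: "psol B R \<pi> \<xi> (Ide (Tot R) (k, b)) h (Lift R g (f, b)) q" for g q
  proof -
    obtain \<chi>' E where x: "\<chi>' \<in> hm R g (k, b) M" "\<pi> \<odot>\<^sub>R \<chi>' = Ide (Tot R) (k, b)"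
      "E \<in> vhm B R (k, b) (pb1 B g f, pull (pb2 B g f) b)" "Lift R g (f, b) \<odot>\<^sub>R E = \<xi> \<odot>\<^sub>R \<chi>'"
      "q \<in> hm R (Ide B (PObj R (k, b))) (pb1 B g f, pull (pb2 B g f) b) (g0, a)" "q \<odot>\<^sub>R E = h"
      by (rule Rf.psolE[OF cone Ide Rf.chmD[OF Lc[OF g]] hv s])
    have "v \<cdot> g = ?I" using Rf.hmD[OF R_comp(1)[OF x(1) L(1)]] x(2) Rf.hmD[OF Ide] cP by simp
    thus ?thesis using x unfolding cP by blast
  qed
  obtain Nh \<pi>h \<psi>h where kh: "\<pi>h \<in> Car (ix B h ?I g0') Nh b" "\<psi>h \<in> hm p g0' Nh a" "Reps h ?I g0' \<pi>h \<psi>h" by (rule reps_ex'[OF h s0])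
  let ?x = "ix B h ?I g0'"
  note xh = R_ix[OF h s0]
  have xA: "?x \<in> Arr B" "Dom B ?x = ?A" "Cod B ?x = Dom B f" "k \<cdot> ?x = ?I" using xh basics by auto
  define g where "g = f \<cdot> ?x"
  have g: "g \<in> Arr B" "Cod B g = Dom B v" "Dom B g = ?A" "v \<cdot> g = ?I" using xA basics vf by (auto simp: g_def)
  have gf: "Cod B g = Cod B f" using g vf by simp
  note Lg = R_lift[OF fb g(1) gf]
  note pg = is_pullbackD[OF Lg(3)]
  have sgx: "sq B g f ?I ?x" using xA g basics by (simp add: sq_def g_def)
  let ?t = "pb_pair B g f ?I ?x"
  note PP = pb_pair[OF basics(2) g(1) gf sgx]
  let ?bg = "pull (pb2 B g f) b" and ?lg = "lft (pb2 B g f) b"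
  have tD: "Dom B ?t = ob Nh" "Cod B ?t = ob ?bg" using PP hmD[OF chmD[OF kh(1)]] xA basics Lg(2) by (auto simp: fam_obj_iff)
  obtain \<pi>k where kk: "\<pi>k \<in> hm p ?t Nh ?bg" "?lg \<odot> \<pi>k = \<pi>h" using cart_fill[OF Lg(4) chmD[OF kh(1)] PP(1) tD PP(5)[symmetric]] .
  have kkc: "\<pi>k \<in> Car ?t Nh ?bg" using cart_cancel[OF Lg(4) kk(1)] kk(2) kh(1) by simp
  have dI: "Dom B ?I = Cod B (pb1 B g f)" using pg g basics by simp
  obtain q where q: "q \<in> hm R ?I (pb1 B g f, ?bg) (g0, a)" "Reps q ?I g0' \<pi>k \<psi>h" "ix B q ?I g0' = ?t"
    by (rule R_real[OF Lg(2) g0(1) dI P0 kkc PP(4) kh(2)])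
  have vgI: "Ide B (PObj R (k, b)) = v \<cdot> g" unfolding cP g(4) ..
  obtain \<chi>' where X: "\<chi>' \<in> hm R g (k, b) M" "\<pi> \<odot>\<^sub>R \<chi>' = Ide (Tot R) (k, b)"
    using Rf.cart_fill[OF kappa Ide g(1) _ _ vgI] g cP is_pullbackD[OF L(3)] by auto
  have eX: "\<xi> \<odot>\<^sub>R \<chi>' \<in> hm R g (k, b) (f, b)" using R_comp(1)[OF X(1) eps(1)] g by simp
  obtain E where E: "E \<in> vhm B R (k, b) (pb1 B g f, ?bg)" "Lift R g (f, b) \<odot>\<^sub>R E = \<xi> \<odot>\<^sub>R \<chi>'"
    using Rf.cart_vfill[OF Lc[OF g(1,2)] eX] .
  have E': "E \<in> hm R ?I (k, b) (pb1 B g f, ?bg)" using E(1) unfolding cP .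
  have qE: "q \<odot>\<^sub>R E = h"
  proof (rule R_ext[OF _ h P0 _ kh(3)])
    show "q \<odot>\<^sub>R E \<in> hm R ?I (k, b) (g0, a)" using R_comp(1)[OF E' q(1)] by (simp only: II)
    show "Reps (q \<odot>\<^sub>R E) ?I g0' \<pi>h \<psi>h" using key[OF g(1,2,4) X E' E(2) q(1,3) kkc q(2)] kk(2) by simp
  qed
  have s: "psol B R \<pi> \<xi> (Ide (Tot R) (k, b)) h (Lift R g (f, b)) q"
    by (rule Rf.psolI[OF cone Ide Rf.chmD[OF Lc[OF g(1,2)]] hv X E _ qE]) (use q(1) cP in simp)
  show ?thesis
  proof (rule Rf.psplit_chosenI[OF cone Ide hv Lc[OF g(1,2)] s])
    show "Lift R g (f, b) \<in> chm B R g (pb1 B g f, pull (pb2 B g f) b) (f, b)" if "g \<in> Arr B" "Cod B g = PObj R (f, b)" for g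
      using Lc[OF that(1)] that(2) vf by simp
    have main: "g1 = g \<and> (\<exists>\<pi>1 N1 \<psi>1. \<pi>1 \<in> Car ?t N1 ?bg \<and> Reps q1 ?I g0' \<pi>1 \<psi>1) \<and> q1 \<in> hm R ?I (pb1 B g f, ?bg) (g0, a) \<and> ix B q1 ?I g0' = ?t \<and>
       (\<forall>\<pi>1 N1 \<psi>1. \<pi>1 \<in> Car ?t N1 ?bg --> Reps q1 ?I g0' \<pi>1 \<psi>1 --> Reps h ?I g0' (?lg \<odot> \<pi>1) \<psi>1)"
      if g1: "g1 \<in> Arr B" "Cod B g1 = PObj R (f, b)" and s1: "psol B R \<pi> \<xi> (Ide (Tot R) (k, b)) h (Lift R g1 (f, b)) q1" for g1 q1
    proof -
      have g1': "Cod B g1 = Dom B v" using g1 vf by simp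
      obtain \<chi>1 E1 where x: "v \<cdot> g1 = ?I" "\<chi>1 \<in> hm R g1 (k, b) M" "\<pi> \<odot>\<^sub>R \<chi>1 = Ide (Tot R) (k, b)"
        "E1 \<in> hm R ?I (k, b) (pb1 B g1 f, pull (pb2 B g1 f) b)" "Lift R g1 (f, b) \<odot>\<^sub>R E1 = \<xi> \<odot>\<^sub>R \<chi>1"
        "q1 \<in> hm R ?I (pb1 B g1 f, pull (pb2 B g1 f) b) (g0, a)" "q1 \<odot>\<^sub>R E1 = h" using sol[OF g1(1) g1' s1] by blast
      let ?t1 = "ix B q1 ?I g0'"
      note K1 = key[OF g1(1) g1' x(1-6) refl, unfolded x(7)]
      obtain N1 \<pi>1 \<psi>1 where k1: "\<pi>1 \<in> Car ?t1 N1 (pull (pb2 B g1 f) b)" "\<psi>1 \<in> hm p g0' N1 a" "Reps q1 ?I g0' \<pi>1 \<psi>1"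
        by (rule reps_ex'[OF x(6) s0])
      note K = K1[OF k1(1,3)]
      have "?x = pb2 B g1 f \<cdot> ?t1" using reps_eq(2)[OF h _ chmD[of "lft (pb2 B g1 f) b \<odot> \<pi>1"]] K by blast
      hence gg: "g1 = g" using K by (simp add: g_def)
      have "?t1 = ?t"
        by (rule pb_pair_unique[OF basics(2) g(1) gf sgx]) (use K gg R_ix[OF x(6) s0] \<open>?x = pb2 B g1 f \<cdot> ?t1\<close> in auto)
      thus ?thesis using gg k1 x(6) K1 by auto
    qed
    fix g1 q1 g2 q2
    assume 1: "g1 \<in> Arr B" "Cod B g1 = PObj R (f, b)" "psol B R \<pi> \<xi> (Ide (Tot R) (k, b)) h (Lift R g1 (f, b)) q1"
      and 2: "g2 \<in> Arr B" "Cod B g2 = PObj R (f, b)" "psol B R \<pi> \<xi> (Ide (Tot R) (k, b)) h (Lift R g2 (f, b)) q2"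
    note m1 = main[OF 1] and m2 = main[OF 2]
    obtain \<pi>1 N1 \<psi>1 where k1: "\<pi>1 \<in> Car ?t N1 ?bg" "Reps q1 ?I g0' \<pi>1 \<psi>1" using m1 by blast
    have q2h: "q2 \<in> hm R ?I (pb1 B g f, ?bg) (g0, a)" and ix2: "ix B q2 ?I g0' = ?t" using m2 by auto
    obtain \<psi>2 where k2: "Reps q2 ?I g0' \<pi>1 \<psi>2" using reps_ex[OF q2h s0] k1(1) ix2 by metis
    have "Reps h ?I g0' (?lg \<odot> \<pi>1) \<psi>1" "Reps h ?I g0' (?lg \<odot> \<pi>1) \<psi>2" using m1 m2 k1 k2 by blast+
    hence "\<psi>1 = \<psi>2" by (rule reps_fun[OF h])
    hence "q1 = q2" using R_ext[OF _ q2h P0 k1(2)] k2 m1 by blast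
    thus "g1 = g2 \<and> q1 = q2" using m1 m2 by blast
  qed
qed

end

context pifib
begin

lemma R_products: "has_products B F R"
proof (rule Rf.has_productsI)
  fix v \<beta> assume v: "v \<in> F" and b: "\<beta> \<in> Obj (Tot R)" "PObj R \<beta> = Dom B v"
  obtain f b where eb: "\<beta> = (f, b)" "(f, b) \<in> Fam" "Cod B f = Dom B v" using b by (cases \<beta>) auto
  interpret picone B p F v f b by unfold_locales (use v eb in auto)
  show "\<exists>\<pi> \<xi> M c. sprod B R v \<pi> \<xi> M c \<beta>" unfolding eb(1) by (intro exI) (rule sprod)
qed

sublocale Rp: profib B R F
  by unfold_locales (rule R_products)

lemma iso_split:
  assumes g0: "(g0, a) \<in> Fam" and g0': "g0' \<in> Arr B" "Dom B g0' = Cod B g0" "Cod B g0' = Dom B g0"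
    "g0 \<cdot> g0' = Ide B (Cod B g0)" "g0' \<cdot> g0 = Ide B (Dom B g0)"
  shows "prod_splitting B F R (g0, a)"
proof (rule Rp.prod_splittingI)
  show "(g0, a) \<in> Obj (Tot R)" using g0 by simp
  fix v \<beta> assume v: "v \<in> F" "Cod B v = PObj R (g0, a)" and b: "\<beta> \<in> Obj (Tot R)" "PObj R \<beta> = Dom B v"
  obtain f b where eb: "\<beta> = (f, b)" "(f, b) \<in> Fam" "Cod B f = Dom B v" using b by (cases \<beta>) auto
  interpret picone B p F v f b by unfold_locales (use v eb in auto)
  have "psplit B R \<pi> \<xi> (Ide (Tot R) (k, b)) h" if "h \<in> vhm B R (k, b) (g0, a)" for h
    by (rule split[OF g0 _ g0']) (use v that basics in auto)
  hence "\<forall>h\<in>vhm B R (k, b) (g0, a). psplit B R \<pi> \<xi> (Ide (Tot R) (k, b)) h" by (rule ballI)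
  with Rf.sprod_nprod[OF sprod] Rf.viso_ide[OF b(1)[unfolded eb(1)]]
  show "\<exists>\<pi> \<xi> M c \<beta>' n n'. nprod B R v \<pi> \<xi> M c \<beta>' \<and> viso B R \<beta>' \<beta> n n' \<and> (\<forall>h\<in>vhm B R c (g0, a). psplit B R \<pi> \<xi> (Ide (Tot R) c) h)"
    unfolding eb(1) by (intro exI conjI)
qed

lemma iso_prod_qf:
  assumes g0: "(g0, a) \<in> Fam" and g0': "g0' \<in> Arr B" "Dom B g0' = Cod B g0" "Cod B g0' = Dom B g0"
    "g0 \<cdot> g0' = Ide B (Cod B g0)" "g0' \<cdot> g0 = Ide B (Dom B g0)"
  shows "prod_qf B F R (g0, a)"
  unfolding prod_qf_def
proof (intro ballI impI)
  fix f assume f: "f \<in> Arr B" "Cod B f = PObj R (g0, a)"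
  have fc: "Cod B f = Cod B g0" using f by simp
  have g: "g0 \<in> F" "g0 \<in> Arr B" using g0 F_arr by (auto simp: fam_obj_iff)
  note Lf = R_lift[OF g0 f(1) fc]
  note pd = is_pullbackD[OF Lf(3)]
  have e: "reindO B R f (g0, a) = (pb1 B f g0, pull (pb2 B f g0) a)" using Rf.hmD[OF Lf(1)] by (simp add: reindex_def)
  let ?p = "pb1 B f g0"
  have s: "sq B f g0 (Ide B (Dom B f)) (g0' \<cdot> f)"
    using f fc g g0' B.pre[OF g0'(4), of f] by (simp add: sq_def)
  note PP = pb_pair[OF g(1) f(1) fc s]
  let ?i = "pb_pair B f g0 (Ide B (Dom B f)) (g0' \<cdot> f)"
  have 1: "?p \<cdot> ?i = Ide B (Cod B ?p)" "?i \<in> Arr B" "Dom B ?i = Cod B ?p" "Cod B ?i = Dom B ?p" using PP f pd by auto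
  have "?i \<cdot> ?p = Ide B (Dom B ?p)"
  proof (rule B.pb_eq[OF Lf(3)])
    show "?p \<cdot> (?i \<cdot> ?p) = ?p \<cdot> Ide B (Dom B ?p)" using B.pre[OF PP(4), of ?p] PP pd f by simp
    have "pb2 B f g0 \<cdot> (?i \<cdot> ?p) = g0' \<cdot> (f \<cdot> ?p)" using B.pre[OF PP(5), of ?p] PP pd f g0' fc by simp
    also have "\<dots> = pb2 B f g0" using B.pre[OF g0'(5), of "pb2 B f g0"] pd g g0' by simp
    finally show "pb2 B f g0 \<cdot> (?i \<cdot> ?p) = pb2 B f g0 \<cdot> Ide B (Dom B ?p)" using pd by simp
  qed (use 1 pd in simp_all)
  from iso_split[OF Lf(2) 1(2,3,4,1) this] show "prod_splitting B F R (reindO B R f (g0, a))" unfolding e .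
qed

lemma R_enough: "enough_prod_qf B F R"
  unfolding enough_prod_qf_def
proof (intro conjI ballI)
  show "has_products B F R" by (rule R_products)
  fix \<alpha> assume a: "\<alpha> \<in> Obj (Tot R)"
  obtain f b where eb: "\<alpha> = (f, b)" "(f, b) \<in> Fam" using a by (cases \<alpha>) auto
  have f: "f \<in> F" "f \<in> Arr B" "b \<in> Ob" "ob b = Dom B f" using eb F_arr by (auto simp: fam_obj_iff)
  let ?I = "Ide B (Dom B f)"
  have "iso B ?I" unfolding iso_def using f by (auto simp: hom_def intro: bexI[of _ ?I])
  hence IF: "?I \<in> F" using units unfolding has_units_def by blast
  have o: "(?I, b) \<in> Fam" using IF f by (simp add: fam_obj_iff)
  have q: "prod_qf B F R (?I, b)" by (rule iso_prod_qf[OF o, of ?I]) (use f in simp_all)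
  interpret picone B p F f ?I b by unfold_locales (use f o in auto)
  have fI: "f \<cdot> ?I = f" using f by simp
  have N: "nprod B R f \<pi> \<xi> M (f, b) (?I, b)" using Rf.sprod_nprod[OF sprod] fI by simp
  have o': "(?I, b) \<in> Obj (Tot R)" "PObj R (?I, b) = Dom B f" using o f by auto
  obtain j j' where "viso B R (f, b) (fobj (prodt B R f) (?I, b)) j j'"
    using Rf.nprod_uniqueE[OF N Rf.prod_nprod[OF Rp.prod_ok[OF f(1)] o']] by metis
  hence V: "isomorphic (fibre B R (PObj R \<alpha>)) \<alpha> (fobj (prodt B R f) (?I, b))" unfolding Rf.isomorphic_fibre[OF a] unfolding eb(1) by (intro exI)
  show "\<exists>f\<in>F. Cod B f = PObj R \<alpha> \<and> (\<exists>\<beta>\<in>Obj (fibre B R (Dom B f)). prod_qf B F R \<beta> \<and> isomorphic (fibre B R (PObj R \<alpha>)) \<alpha> (fobj (prodt B R f) \<beta>))"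
    using f(1) o' q V eb(1) by (intro bexI[of _ f] conjI bexI[of _ "(?I, b)"]) auto
qed

end

section \<open>From Goedel fibrations to completions\<close>

locale prodqf = profib B p F for B :: "('o, 'm) cat" (structure) and p :: "('o, 'm, 'e, 'f) fibn" and F
begin

abbreviation "t \<equiv> full_sub p (prod_qf B F p)"

end

sublocale prodqf \<subseteq> t: dfib B t F
  by (intro dfib.intro fib.intro dfib_axioms.intro prod_qf_sub_fibration dmc)

context prodqf
begin

abbreviation "Pt \<equiv> Pi_compl B F t"
abbreviation "co g a \<equiv> Prd g a"
abbreviation "mo g a \<equiv> pull g (co g a)"
abbreviation "kp g a \<equiv> lft g (co g a)"
abbreviation "ep g a \<equiv> cou g a"

lemma t_hm: "f \<in> hm t u a b ==> f \<in> hm p u a b"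
  by (simp add: full_sub_hm)

lemma t_chm: "f \<in> chm B t u a b ==> f \<in> Car u a b"
  using full_sub_chm[OF prod_qf_sub_fibration] by simp

lemma t_obj: "(g, a) \<in> fam_obj B F t \<longleftrightarrow> (g, a) \<in> Fam \<and> prod_qf B F p a"
  by (auto simp: fam_obj_iff t.fam_obj_iff)

lemma cone:
  assumes "(g, a) \<in> Fam"
  shows "Sprod g (kp g a) (ep g a) (mo g a) (co g a) a" "Cone g (kp g a) (ep g a) (mo g a) (co g a) a"
    "kp g a \<in> Car g (mo g a) (co g a)" "ep g a \<in> Ver (mo g a) a" "g \<in> F" "g \<in> Arr B"
    "co g a \<in> Ob" "ob (co g a) = Cod B g" "ob (mo g a) = Dom B g" "a \<in> Ob"
proof -
  have o: "g \<in> F" "a \<in> Ob" "ob a = Dom B g" using assms by (auto simp: fam_obj_iff)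
  show S: "Sprod g (kp g a) (ep g a) (mo g a) (co g a) a" by (rule prod_sprod[OF o])
  thus C: "Cone g (kp g a) (ep g a) (mo g a) (co g a) a" by (simp add: sprod_def)
  show "kp g a \<in> Car g (mo g a) (co g a)" "ep g a \<in> Ver (mo g a) a" "ob (co g a) = Cod B g" "ob (mo g a) = Dom B g"
    by (rule pconeD[OF C])+
  show "g \<in> F" "g \<in> Arr B" "a \<in> Ob" using o F_arr by auto
  show "co g a \<in> Ob" by (rule prod_obj(1)[OF prod_ok[OF o(1)] o(2,3)])
qed

text \<open>The component at \<open>i\<close> of a generalised element \<open>\<chi>\<close> of the product of \<open>a\<close> along \<open>g\<close>.\<close>

definition "ev g a \<chi> i = ep g a \<odot> (THE x. x \<in> hm p i (dm \<chi>) (mo g a) \<and> kp g a \<odot> x = \<chi>)"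

lemma evI:
  assumes o: "(g, a) \<in> Fam" and x: "x \<in> hm p i N (mo g a)" "kp g a \<odot> x = \<chi>"
  shows "ev g a \<chi> i = ep g a \<odot> x" "ev g a \<chi> i \<in> hm p i N a"
proof -
  note C = cone[OF o]
  have N: "dm \<chi> = N" using hmD[OF comp_hm[OF x(1) chmD[OF C(3)], unfolded x(2)]] by blast
  have "(THE x. x \<in> hm p i (dm \<chi>) (mo g a) \<and> kp g a \<odot> x = \<chi>) = x" unfolding N
    by (rule the_equality, rule conjI[OF x], erule conjE, rule cart_eq[OF C(3) _ x(1)]) (simp_all only: x(2))
  thus "ev g a \<chi> i = ep g a \<odot> x" by (simp add: ev_def)
  thus "ev g a \<chi> i \<in> hm p i N a" using comp_vl[OF x(1)] C(4) hmD[OF x(1)] by simp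
qed

lemma evE:
  assumes o: "(g, a) \<in> Fam" and X: "\<chi> \<in> hm p u N (co g a)" and i: "i \<in> Arr B" "Cod B i = Dom B g" "g \<cdot> i = u"
  obtains x where "x \<in> hm p i N (mo g a)" "kp g a \<odot> x = \<chi>" "ev g a \<chi> i = ep g a \<odot> x" "ev g a \<chi> i \<in> hm p i N a"
proof -
  note C = cone[OF o]
  have d: "Dom B i = ob N" using hmD[OF X] i C(6) B.comp_dom[OF i(1) C(6) i(2)] by simp
  have c: "Cod B i = ob (mo g a)" using i C(9) by simp
  obtain x where x: "x \<in> hm p i N (mo g a)" "kp g a \<odot> x = \<chi>" by (rule cart_fill[OF C(3) X i(1) d c i(3)[symmetric]])
  show ?thesis by (rule that[OF x evI[OF o x]])
qed

lemma ev_pre: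
  assumes o: "(g, a) \<in> Fam" and X: "\<chi> \<in> hm p u N (co g a)" and i: "i \<in> Arr B" "Cod B i = Dom B g" "g \<cdot> i = u"
    and n: "n \<in> hm p w N' N"
  shows "ev g a (\<chi> \<odot> n) (i \<cdot> w) = ev g a \<chi> i \<odot> n"
proof -
  note C = cone[OF o]
  obtain x where x: "x \<in> hm p i N (mo g a)" "kp g a \<odot> x = \<chi>" "ev g a \<chi> i = ep g a \<odot> x" by (rule evE[OF o X i])
  have "kp g a \<odot> (x \<odot> n) = \<chi> \<odot> n" using ac[OF n x(1) chmD[OF C(3)]] x(2) by simp
  from evI(1)[OF o comp_hm[OF n x(1)] this] show ?thesis using ac[OF n x(1) C(4)] x(3) by simp
qed

lemma ev_universal:
  assumes o: "(h, b) \<in> Fam" and P: "pbk w h u y" and k: "\<pi> \<in> Car u N \<gamma>" and e: "e \<in> hm p y N b"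
  shows "\<exists>!x. x \<in> hm p w \<gamma> (co h b) \<and> ev h b (x \<odot> \<pi>) y = e"
proof -
  note C = cone[OF o]
  note pd = is_pullbackD[OF P]
  have T: "Test (kp h b) (ep h b) w u y" using C(1) P by (simp add: sprod_def)
  have "ev h b (x \<odot> \<pi>) y = e \<longleftrightarrow> pmed p (kp h b) (ep h b) \<pi> e x" if x: "x \<in> hm p w \<gamma> (co h b)" for x
  proof -
    have hu: "h \<cdot> y = w \<cdot> u" using pd(9) by simp
    obtain x' where x': "x' \<in> hm p y N (mo h b)" "kp h b \<odot> x' = x \<odot> \<pi>" "ev h b (x \<odot> \<pi>) y = ep h b \<odot> x'"
      by (rule evE[OF o comp_hm[OF chmD[OF k] x] pd(4,8) hu])
    show ?thesis
    proof
      assume "ev h b (x \<odot> \<pi>) y = e"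
      thus "pmed p (kp h b) (ep h b) \<pi> e x" using pmedI[OF C(2) k e x'(1,2)] x'(3) by simp
    next
      assume "pmed p (kp h b) (ep h b) \<pi> e x"
      then obtain x2 where x2: "x2 \<in> hm p y N (mo h b)" "kp h b \<odot> x2 = x \<odot> \<pi>" "ep h b \<odot> x2 = e" by (rule pmedE[OF C(2) k e])
      show "ev h b (x \<odot> \<pi>) y = e" using evI(1)[OF o x2(1,2)] x2(3) by simp
    qed
  qed
  thus ?thesis using ptestD[OF C(2) T k e] by (metis (no_types, lifting))
qed

lemma reps_slide:
  assumes m: "m \<in> hm Pt f (g, a) (h, b)" and s: "sq B f h u y" and r: "reps B t m u y \<pi> \<psi>" and k: "\<pi> \<in> hm p x N' a"
    and w: "w \<in> Arr B" "Cod B w = Dom B u" and r2: "reps B t m (u \<cdot> w) (y \<cdot> w) \<pi>2 \<psi>2" and k2: "\<pi>2 \<in> hm p x2 N2 a"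
    and v: "v \<in> hm p w N N'" "v2 \<in> Ver N N2" "\<pi> \<odot> v = \<pi>2 \<odot> v2"
  shows "\<psi> \<odot> v = \<psi>2 \<odot> v2" "ix B m u y = x" "\<psi> \<in> hm p y N' b" "ix B m (u \<cdot> w) (y \<cdot> w) = x \<cdot> w"
proof -
  obtain N0 where N0: "\<pi> \<in> chm B t (ix B m u y) N0 a" "\<psi> \<in> hm t y N0 b" by (rule t.repsD[OF m r])
  have e: "ix B m u y = x" "N0 = N'" using hmD[OF k] hmD[OF t_hm[OF t.chmD[OF N0(1)]]] by simp_all
  note kc = N0(1)[unfolded e] and ps = N0(2)[unfolded e]
  obtain N3 where N3: "\<pi>2 \<in> chm B t (ix B m (u \<cdot> w) (y \<cdot> w)) N3 a" "\<psi>2 \<in> hm t (y \<cdot> w) N3 b" by (rule t.repsD[OF m r2])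
  have "N3 = N2" using hmD[OF k2] hmD[OF t_hm[OF t.chmD[OF N3(1)]]] by simp
  note k2c = N3(1)[unfolded this]
  have o: "N' \<in> Obj (Tot t)" "PObj t N' = Cod B w" using t.hmD[OF ps] hmD[OF v(1)] by simp_all
  note n = t.lift_chm[OF w(1) o]
  let ?n = "Lift t w N'" and ?M = "reindO B t w N'"
  note rr = t.reps_restr[OF m s r t.chmD[OF kc] n]
  have k2c': "\<pi>2 \<in> chm B t (x \<cdot> w) N2 a" using k2c rr(2) by simp
  have kn: "\<pi> \<odot>\<^sub>t ?n \<in> chm B t (x \<cdot> w) ?M a" by (rule t.cart_comp[OF kc n])
  obtain j j' where j: "viso B t N2 ?M j j'" "\<pi> \<odot>\<^sub>t ?n \<odot>\<^sub>t j = \<pi>2" "reps B t m (u \<cdot> w) (y \<cdot> w) \<pi>2 (\<psi> \<odot>\<^sub>t ?n \<odot>\<^sub>t j)"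
    by (rule t.reps_move[OF m rr(3,1) t.chmD[OF kn] k2c'])
  have p2: "\<psi>2 = \<psi> \<odot>\<^sub>t ?n \<odot>\<^sub>t j" by (rule t.reps_fun[OF m r2 j(3)])
  have "j \<in> vhm B t N2 ?M" using t.visoD[OF j(1)] by blast
  hence jh: "j \<in> Ver N2 ?M" using t_hm by simp
  have nn: "?n \<in> Car w ?M N'" using t_chm[OF n] by simp
  obtain v1 where v1: "v1 \<in> Ver N ?M" "?n \<odot> v1 = v" using cart_vfill[OF nn v(1)] .
  have kn': "\<pi> \<odot> ?n \<in> Car (x \<cdot> w) ?M a" using t_chm[OF kn] by simp
  have jv: "j \<odot> v2 \<in> Ver N ?M" by (rule comp_vl[OF v(2) jh])
  have ps': "\<psi> \<in> hm p y N' b" by (rule t_hm[OF ps])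
  have "v1 = j \<odot> v2"
  proof (rule cart_eq[OF kn' v1(1) jv])
    show "\<pi> \<odot> ?n \<odot> v1 = \<pi> \<odot> ?n \<odot> (j \<odot> v2)"
      using ac[OF v1(1) chmD[OF nn] k] v1(2) v(3) ac[OF v(2) jh chmD[OF kn']] j(2) by simp
  qed
  hence "\<psi> \<odot> v = \<psi> \<odot> ?n \<odot> (j \<odot> v2)" using ac[OF v1(1) chmD[OF nn] ps'] v1(2) by simp
  also have "\<dots> = \<psi>2 \<odot> v2" using ac[OF v(2) jh comp_hm[OF chmD[OF nn] ps']] p2 by simp
  finally show "\<psi> \<odot> v = \<psi>2 \<odot> v2" .
  show "ix B m u y = x" by (rule e(1))
  show "\<psi> \<in> hm p y N' b" by (rule ps')
  show "ix B m (u \<cdot> w) (y \<cdot> w) = x \<cdot> w" by (rule rr(2))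
qed

text \<open>The arrow \<open>x\<close> between products is induced by \<open>m\<close>: the component of \<open>x \<odot> \<chi>\<close> at \<open>y\<close> is obtained by applying the fibre part
  of \<open>m\<close> to the component of \<open>\<chi>\<close> at the index named by \<open>m\<close>.\<close>

definition "mt g a h b m x \<longleftrightarrow> (\<forall>u y \<pi> \<psi> N N' \<chi> e. sq B (bmap m) h u y --> reps B t m u y \<pi> \<psi> -->
    \<pi> \<in> hm p (ix B m u y) N' a --> \<chi> \<in> hm p u N (co g a) --> e \<in> Ver N N' --> \<pi> \<odot> e = ev g a \<chi> (ix B m u y) -->
    ev h b (x \<odot> \<chi>) y = \<psi> \<odot> e)"

lemma Pt_obj:
  assumes "m \<in> hm Pt f (g, a) (h, b)"
  shows "(g, a) \<in> Fam" "(h, b) \<in> Fam" "bmap m = f" "prod_qf B F p b"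
proof -
  show "(g, a) \<in> Fam" "(h, b) \<in> Fam" "prod_qf B F p b" using t.R_hm_obj(1,2)[OF assms] unfolding t_obj by blast+
  show "bmap m = f" using assms by (simp add: hm_def)
qed

lemma mtD:
  assumes m: "m \<in> hm Pt f (g, a) (h, b)" and M: "mt g a h b m x" and s: "sq B f h u y" and r: "reps B t m u y \<pi> \<psi>"
    and k: "\<pi> \<in> hm p (ix B m u y) N' a" and X: "\<chi> \<in> hm p u N (co g a)" and e: "e \<in> Ver N N'" "\<pi> \<odot> e = ev g a \<chi> (ix B m u y)"
  shows "ev h b (x \<odot> \<chi>) y = \<psi> \<odot> e"
  using M Pt_obj(3)[OF m] assms(3-) unfolding mt_def by blast

lemma mt_generic:
  assumes m: "m \<in> hm Pt f (g, a) (h, b)" and P: "pbk f h u0 y0" and r0: "reps B t m u0 y0 \<pi>0 \<psi>0"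
    and k0: "\<pi>0 \<in> hm p (ix B m u0 y0) N0' a" and X0: "\<chi>0 \<in> Car u0 N0 (co g a)" and e0: "e0 \<in> Ver N0 N0'"
    "\<pi>0 \<odot> e0 = ev g a \<chi>0 (ix B m u0 y0)" and x: "x \<in> hm p f (co g a) (co h b)" and E: "ev h b (x \<odot> \<chi>0) y0 = \<psi>0 \<odot> e0"
  shows "mt g a h b m x"
  unfolding mt_def Pt_obj(3)[OF m]
proof (intro allI impI)
  note O = Pt_obj[OF m] and s0 = t.pb_sq[OF P]
  note I0 = t.R_ix[OF m s0]
  note pd = is_pullbackD[OF P]
  fix u y \<pi> \<psi> N N' \<chi> e
  assume s: "sq B f h u y" and r: "reps B t m u y \<pi> \<psi>" and k: "\<pi> \<in> hm p (ix B m u y) N' a" and X: "\<chi> \<in> hm p u N (co g a)"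
    and e: "e \<in> Ver N N'" "\<pi> \<odot> e = ev g a \<chi> (ix B m u y)"
  have sD: "u \<in> Arr B" "y \<in> Arr B" "Dom B u = Dom B y" "Cod B u = Dom B f" "Cod B y = Dom B h" "f \<cdot> u = h \<cdot> y" using s by (auto simp: sq_def)
  obtain w where w: "w \<in> Arr B" "Dom B w = Dom B u" "Cod B w = Dom B u0" "u0 \<cdot> w = u" "y0 \<cdot> w = y" by (rule B.pb_fill[OF P sD])
  have d: "Dom B w = ob N" "Cod B w = ob N0" using w hmD[OF X] hmD[OF chmD[OF X0]] by simp_all
  obtain n where n: "n \<in> hm p w N N0" "\<chi>0 \<odot> n = \<chi>" by (rule cart_fill[OF X0 X w(1) d w(4)[symmetric]])
  have en: "e0 \<odot> n \<in> hm p w N N0'" by (rule comp_vl[OF n(1) e0(1)])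
  have i: "ix B m u y = ix B m u0 y0 \<cdot> w"
  proof -
    obtain N1 \<pi>1 \<psi>1 where k1: "\<pi>1 \<in> chm B t (ix B m u0 y0) N1 a" "reps B t m u0 y0 \<pi>1 \<psi>1" by (rule t.reps_ex'[OF m s0])
    have o: "N1 \<in> Obj (Tot t)" "PObj t N1 = Cod B w" using t.hmD[OF t.chmD[OF k1(1)]] I0 w by simp_all
    show ?thesis using t.reps_restr(2)[OF m s0 k1(2) t.chmD[OF k1(1)] t.lift_chm[OF w(1) o]] w(4,5) by simp
  qed
  have kv: "\<pi>0 \<odot> (e0 \<odot> n) = \<pi> \<odot> e"
    using ev_pre[OF O(1) chmD[OF X0] I0(1,3,4) n(1)] ac[OF n(1) e0(1) k0] e0(2) e(2) i n(2) by simp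
  have r': "reps B t m (u0 \<cdot> w) (y0 \<cdot> w) \<pi> \<psi>" using r w(4,5) by simp
  note sl = reps_slide[OF m s0 r0 k0 w(1,3) r' k en e(1) kv]
  have hy: "h \<cdot> y0 = f \<cdot> u0" using pd(9) by simp
  have "ev h b (x \<odot> \<chi>) y = ev h b (x \<odot> \<chi>0) y0 \<odot> n"
    using ev_pre[OF O(2) comp_hm[OF chmD[OF X0] x] pd(4,8) hy n(1)] ac[OF n(1) chmD[OF X0] x] n(2) w(5) by simp
  also have "\<dots> = \<psi>0 \<odot> (e0 \<odot> n)" using E ac[OF n(1) e0(1) sl(3)] by simp
  finally show "ev h b (x \<odot> \<chi>) y = \<psi> \<odot> e" using sl(1) by simp
qed

lemma mt_test:
  assumes m: "m \<in> hm Pt f (g, a) (h, b)" and s: "sq B f h u y" and X: "\<chi> \<in> hm p u N (co g a)"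
    and r: "reps B t m u y \<pi> \<psi>" and k: "\<pi> \<in> chm B t (ix B m u y) N' a"
  obtains e where "e \<in> Ver N N'" "\<pi> \<odot> e = ev g a \<chi> (ix B m u y)"
proof -
  note I = t.R_ix[OF m s]
  obtain z where "ev g a \<chi> (ix B m u y) \<in> hm p (ix B m u y) N a" by (rule evE[OF Pt_obj(1)[OF m] X I(1,3,4)])
  thus ?thesis using cart_vfill[OF t_chm[OF k]] that by blast
qed

lemma mt_ex1:
  assumes m: "m \<in> hm Pt f (g, a) (h, b)"
  shows "\<exists>!x. x \<in> hm p f (co g a) (co h b) \<and> mt g a h b m x"
proof -
  note O = Pt_obj[OF m]
  note P = t.R_hm_obj(10)[OF m]
  note s = t.pb_sq[OF P]
  let ?u = "pb1 B f h" and ?y = "pb2 B f h"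
  note pd = is_pullbackD[OF P] and C = cone[OF O(1)]
  have uc: "ob (co g a) = Cod B ?u" using C(8) pd(7) t.R_hm_obj(4)[OF m] by simp
  note X = lift_chm[OF pd(3) C(7) uc]
  obtain N' \<pi> \<psi> where k: "\<pi> \<in> chm B t (ix B m ?u ?y) N' a" "\<psi> \<in> hm t ?y N' b" "reps B t m ?u ?y \<pi> \<psi>" by (rule t.reps_ex'[OF m s])
  obtain e where e: "e \<in> Ver (pull ?u (co g a)) N'" "\<pi> \<odot> e = ev g a (lft ?u (co g a)) (ix B m ?u ?y)"
    by (rule mt_test[OF m s chmD[OF X] k(3,1)])
  have "mt g a h b m x \<longleftrightarrow> ev h b (x \<odot> lft ?u (co g a)) ?y = \<psi> \<odot> e" if x: "x \<in> hm p f (co g a) (co h b)" for x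
    using mtD[OF m _ s k(3) t_hm[OF t.chmD[OF k(1)]] chmD[OF X] e] mt_generic[OF m P k(3) t_hm[OF t.chmD[OF k(1)]] X e x] by blast
  thus ?thesis using ev_universal[OF O(2) P X comp_vr[OF e(1) t_hm[OF k(2)]]] by (metis (no_types, lifting))
qed

definition "Ka m = (THE x. x \<in> hm p (bmap m) (co (fst (src m)) (snd (src m))) (co (fst (tgt m)) (snd (tgt m))) \<and>
    mt (fst (src m)) (snd (src m)) (fst (tgt m)) (snd (tgt m)) m x)"

definition "K = \<lparr>fobj = (\<lambda>(g, a). co g a), farr = Ka\<rparr>"

lemma Ka:
  assumes m: "m \<in> hm Pt f (g, a) (h, b)"
  shows "Ka m \<in> hm p f (co g a) (co h b)" "mt g a h b m (Ka m)" "\<And>x. x \<in> hm p f (co g a) (co h b) ==> mt g a h b m x ==> x = Ka m"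
proof -
  have st: "src m = (g, a)" "tgt m = (h, b)" "bmap m = f" using m by (auto simp: hm_def)
  have "Ka m = (THE x. x \<in> hm p f (co g a) (co h b) \<and> mt g a h b m x)" unfolding Ka_def st by simp
  with theI'[OF mt_ex1[OF m]] mt_ex1[OF m] show "Ka m \<in> hm p f (co g a) (co h b)" "mt g a h b m (Ka m)"
    "\<And>x. x \<in> hm p f (co g a) (co h b) ==> mt g a h b m x ==> x = Ka m" by auto
qed

lemma Ka_ide:
  assumes o: "(g, a) \<in> fam_obj B F t"
  shows "Ka (Ide (Tot Pt) (g, a)) = idt (co g a)"
proof -
  note i = t.R_ide[OF o]
  have o': "(g, a) \<in> Fam" using o unfolding t_obj by blast
  note C = cone[OF o']
  let ?I = "Ide B (Cod B g)"
  note P = t.R_hm_obj(10)[OF i(1)]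
  note s = t.pb_sq[OF P]
  let ?u = "pb1 B ?I g" and ?y = "pb2 B ?I g"
  note pd = is_pullbackD[OF P]
  have uy: "?u = g \<cdot> ?y" using pd(1,3,7,9) C(6) by simp
  have uc: "ob (co g a) = Cod B ?u" using C(6,8) pd(7) by simp
  note X = lift_chm[OF pd(3) C(7) uc]
  let ?m = "Ide (Tot Pt) (g, a)"
  obtain N' \<pi> \<psi> where k: "\<pi> \<in> chm B t (ix B ?m ?u ?y) N' a" "\<psi> \<in> hm t ?y N' a" "reps B t ?m ?u ?y \<pi> \<psi>"
    by (rule t.reps_ex'[OF i(1) s])
  have ya: "PObj t a = Cod B ?y" "a \<in> Obj (Tot t)" using o pd(8) by (auto simp: t.fam_obj_iff)
  note ly = t.lift_chm[OF pd(4) ya(2,1)]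
  have ixy: "ix B ?m ?u ?y = ?y" by (rule t.reps_eq(2)[OF i(1) i(3)[OF ly uy] t.chmD[OF ly]])
  have "\<psi> = \<pi>" by (rule t.reps_fun[OF i(1) k(3) i(3)[OF k(1)[unfolded ixy] uy]])
  obtain e where e: "e \<in> Ver (pull ?u (co g a)) N'" "\<pi> \<odot> e = ev g a (lft ?u (co g a)) (ix B ?m ?u ?y)"
    by (rule mt_test[OF i(1) s chmD[OF X] k(3,1)])
  have I: "idt (co g a) \<in> hm p ?I (co g a) (co g a)" using ide_hm[OF C(7)] C(8) by simp
  have "ev g a (idt (co g a) \<odot> lft ?u (co g a)) ?y = \<psi> \<odot> e"
    using e(2) idl[OF chmD[OF X]] \<open>\<psi> = \<pi>\<close> ixy by simp
  from mt_generic[OF i(1) P k(3) t_hm[OF t.chmD[OF k(1)]] X e I this] show ?thesis using Ka(3)[OF i(1) I] by simp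
qed

lemma Ka_comp:
  assumes m: "m \<in> hm Pt f (g, a) (h, b)" and n: "n \<in> hm Pt f' (h, b) (k, c)"
  shows "Ka (n \<odot>\<^sub>Pt m) = Ka n \<odot> Ka m"
proof -
  note O = Pt_obj[OF m]
  note nm = t.R_comp[OF m n]
  note P = t.R_hm_obj(10)[OF nm(1)]
  note s = t.pb_sq[OF P]
  let ?u = "pb1 B (f' \<cdot> f) k" and ?z = "pb2 B (f' \<cdot> f) k"
  note pd = is_pullbackD[OF P] and C = cone[OF O(1)]
  have ss: "sq B f' k (f \<cdot> ?u) ?z" "sq B f h ?u (ix B n (f \<cdot> ?u) ?z)" using nm(2)[OF s] by auto
  let ?w = "ix B n (f \<cdot> ?u) ?z"
  have uc: "ob (co g a) = Cod B ?u" using C(8) pd(7) t.R_hm_obj(4)[OF nm(1)] by simp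
  note X = lift_chm[OF pd(3) C(7) uc]
  obtain N' l \<chi> where l: "l \<in> chm B t ?w N' b" "\<chi> \<in> hm t ?z N' c" "reps B t n (f \<cdot> ?u) ?z l \<chi>" by (rule t.reps_ex'[OF n ss(1)])
  obtain \<pi> \<psi> v N where k: "\<pi> \<in> chm B t (ix B m ?u ?w) N a" "reps B t m ?u ?w \<pi> \<psi>" "v \<in> vhm B t N N'" "l \<odot>\<^sub>t v = \<psi>"
    "reps B t (n \<odot>\<^sub>Pt m) ?u ?z \<pi> (\<chi> \<odot>\<^sub>t v)" by (rule t.R_comp_ex[OF m n s l(1,3)])
  have v: "v \<in> Ver N N'" "l \<odot> v = \<psi>" "reps B t (n \<odot>\<^sub>Pt m) ?u ?z \<pi> (\<chi> \<odot> v)" using k(3-5) by (simp_all add: full_sub_hm)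
  let ?X = "lft ?u (co g a)"
  note kh = t_hm[OF t.chmD[OF k(1)]] and lh = t_hm[OF t.chmD[OF l(1)]] and ch = t_hm[OF l(2)]
  obtain e where e: "e \<in> Ver (pull ?u (co g a)) N" "\<pi> \<odot> e = ev g a ?X (ix B m ?u ?w)"
    by (rule mt_test[OF m ss(2) chmD[OF X] k(2,1)])
  have "ev h b (Ka m \<odot> ?X) ?w = \<psi> \<odot> e" by (rule mtD[OF m Ka(2)[OF m] ss(2) k(2) kh chmD[OF X] e])
  hence 1: "l \<odot> (v \<odot> e) = ev h b (Ka m \<odot> ?X) ?w" using v(2) ac[OF e(1) v(1) lh] by simp
  have "ev k c (Ka n \<odot> (Ka m \<odot> ?X)) ?z = \<chi> \<odot> (v \<odot> e)"
    by (rule mtD[OF n Ka(2)[OF n] ss(1) l(3) lh comp_hm[OF chmD[OF X] Ka(1)[OF m]] comp_vl[OF e(1) v(1)] 1])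
  hence 2: "ev k c (Ka n \<odot> Ka m \<odot> ?X) ?z = \<chi> \<odot> v \<odot> e"
    using ac[OF chmD[OF X] Ka(1)[OF m] Ka(1)[OF n]] ac[OF e(1) v(1) ch] by simp
  have i: "ix B (n \<odot>\<^sub>Pt m) ?u ?z = ix B m ?u ?w" by (rule t.reps_eq(2)[OF nm(1) v(3) t.chmD[OF k(1)]])
  have "mt g a k c (n \<odot>\<^sub>Pt m) (Ka n \<odot> Ka m)"
    by (rule mt_generic[OF nm(1) P v(3) _ X e(1) _ comp_hm[OF Ka(1)[OF m] Ka(1)[OF n]] 2]) (simp_all only: i kh e(2))
  thus ?thesis using Ka(3)[OF nm(1) comp_hm[OF Ka(1)[OF m] Ka(1)[OF n]]] by simp
qed

lemma K_over: "fun_over Pt p K"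
proof -
  have hmI: "m \<in> hm Pt (bmap m) (fst (src m), snd (src m)) (fst (tgt m), snd (tgt m))" if "m \<in> Arr (Tot Pt)" for m by (rule t.R_arr_hm[OF that])
  have "is_functor (Tot Pt) (Tot p) K" unfolding is_functor_def
  proof (intro conjI ballI impI)
    fix x assume x: "x \<in> Obj (Tot Pt)"
    obtain g a where xe: "x = (g, a)" by (cases x)
    hence o: "(g, a) \<in> fam_obj B F t" using x by simp
    hence "(g, a) \<in> Fam" unfolding t_obj by blast
    from cone(7)[OF this] Ka_ide[OF o] show "fobj K x \<in> Ob" "farr K (Ide (Tot Pt) x) = idt (fobj K x)" by (simp_all add: K_def xe)
  next
    fix m assume m: "m \<in> Arr (Tot Pt)"
    show "farr K m \<in> hom (Tot p) (fobj K (Dom (Tot Pt) m)) (fobj K (Cod (Tot Pt) m))"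
      using Ka(1)[OF hmI[OF m]] by (auto simp: K_def hm_def hom_def case_prod_beta)
    fix n assume n: "n \<in> Arr (Tot Pt)" "Cod (Tot Pt) m = Dom (Tot Pt) n"
    have "n \<in> hm Pt (bmap n) (fst (tgt m), snd (tgt m)) (fst (tgt n), snd (tgt n))" using hmI[OF n(1)] n(2) by simp
    from Ka_comp[OF hmI[OF m] this] show "farr K (n \<odot>\<^sub>Pt m) = farr K n \<odot> farr K m" by (simp add: K_def)
  qed
  moreover have "ob (fobj K \<alpha>) = PObj Pt \<alpha>" if a: "\<alpha> \<in> Obj (Tot Pt)" for \<alpha>
  proof -
    obtain g a where xe: "\<alpha> = (g, a)" by (cases \<alpha>)
    hence "(g, a) \<in> Fam" using a t_obj by simp
    from cone(8)[OF this] show ?thesis by (simp add: K_def xe)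
  qed
  moreover have "PArr p (farr K m) = PArr Pt m" if m: "m \<in> Arr (Tot Pt)" for m
    using Ka(1)[OF hmI[OF m]] by (simp add: K_def hm_def)
  ultimately show ?thesis unfolding fun_over_def by blast
qed

lemma K_ff: "fully_faithful Pt p K"
  unfolding fully_faithful_def
proof (intro ballI)
  fix xs ys H assume xy: "xs \<in> Obj (Tot Pt)" "ys \<in> Obj (Tot Pt)" and H: "H \<in> hom (Tot p) (fobj K xs) (fobj K ys)"
  obtain g a h b where e: "xs = (g, a)" "ys = (h, b)" by (cases xs, cases ys)
  have o: "(g, a) \<in> fam_obj B F t" "(h, b) \<in> fam_obj B F t" using xy e by simp_all
  hence o': "(g, a) \<in> Fam" "(h, b) \<in> Fam" and qb: "prod_qf B F p b" unfolding t_obj by blast+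
  define f where "f = PArr p H"
  have H: "H \<in> hm p f (co g a) (co h b)" using H by (simp add: hom_def hm_def f_def K_def e)
  note C = cone[OF o'(1)] and D = cone[OF o'(2)]
  have f: "f \<in> Arr B" "Dom B f = Cod B g" "Cod B f = Cod B h" using hmD[OF H] C(8) D(8) by simp_all
  note P = t.pb_chosen(1)[OF D(5) f(1,3)]
  note s = t.pb_sq[OF P]
  let ?u = "pb1 B f h" and ?y = "pb2 B f h"
  note pd = is_pullbackD[OF P]
  have uc: "ob (co g a) = Cod B ?u" using C(8) pd(7) f by simp
  note X = lift_chm[OF pd(3) C(7) uc]
  let ?X = "lft ?u (co g a)" and ?N = "pull ?u (co g a)"
  have hy: "h \<cdot> ?y = f \<cdot> ?u" using pd(9) by simp
  let ?E = "ev h b (H \<odot> ?X) ?y"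
  obtain z where E: "?E \<in> hm p ?y ?N b" by (rule evE[OF o'(2) comp_hm[OF chmD[OF X] H] pd(4,8) hy])
  have sp: "Split (kp g a) (ep g a) ?X ?E" by (rule prod_qf_psplit[OF qb C(5,1) X E])
  have sol: "Sol (kp g a) (ep g a) ?X ?E \<pi> \<psi>" "\<pi> \<in> Car (ix B m ?u ?y) N' a"
    if m: "m \<in> hm Pt f (g, a) (h, b)" "Ka m = H" and k: "\<pi> \<in> chm B t (ix B m ?u ?y) N' a" and r: "reps B t m ?u ?y \<pi> \<psi>" for m \<pi> \<psi> N'
  proof -
    note I = t.R_ix[OF m(1) s]
    have ps: "\<psi> \<in> hm p ?y N' b" by (rule t_hm[OF t.reps_eq(1)[OF m(1) r t.chmD[OF k]]])
    note kh = t_hm[OF t.chmD[OF k]]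
    obtain e where e: "e \<in> Ver ?N N'" "\<pi> \<odot> e = ev g a ?X (ix B m ?u ?y)" by (rule mt_test[OF m(1) s chmD[OF X] r k])
    have E': "\<psi> \<odot> e = ?E" using mtD[OF m(1) Ka(2)[OF m(1)] s r kh chmD[OF X] e] m(2) by simp
    obtain x where x: "x \<in> hm p (ix B m ?u ?y) ?N (mo g a)" "kp g a \<odot> x = ?X" "ev g a ?X (ix B m ?u ?y) = ep g a \<odot> x"
      by (rule evE[OF o'(1) chmD[OF X] I(1,3,4)])
    have ke: "\<pi> \<odot> e = ep g a \<odot> x" using e(2) x(3) by simp
    show "Sol (kp g a) (ep g a) ?X ?E \<pi> \<psi>" by (rule psolI[OF C(2) chmD[OF X] kh E x(1,2) e(1) ke ps E'])
    show "\<pi> \<in> Car (ix B m ?u ?y) N' a" by (rule t_chm[OF k])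
  qed
  have "\<exists>m. m \<in> hm Pt f (g, a) (h, b) \<and> Ka m = H"
  proof -
    obtain i N' l k where l: "l \<in> Car i N' a" "Sol (kp g a) (ep g a) ?X ?E l k" by (rule psplit_ex[OF C(2) sp])
    obtain x e where x: "x \<in> hm p i ?N (mo g a)" "kp g a \<odot> x = ?X" "e \<in> Ver ?N N'" "l \<odot> e = ep g a \<odot> x" "k \<in> hm p ?y N' b" "k \<odot> e = ?E"
      by (rule psolE[OF C(2) chmD[OF X] chmD[OF l(1)] E l(2)])
    have qa: "prod_qf B F p a" using o(1) unfolding t_obj by blast
    have lt: "l \<in> chm B t i N' a" using full_sub_chm[OF prod_qf_sub_fibration] l(1) qa prod_qf_cart(1)[OF l(1) qa] by simp
    have kt: "k \<in> hm t ?y N' b" using x(5) qb prod_qf_cart(1)[OF l(1) qa] by (simp add: full_sub_hm)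
    have gi: "g \<cdot> i = ?u" using hmD[OF comp_hm[OF x(1) chmD[OF C(3)]]] hmD[OF chmD[OF X]] x(2) by simp
    obtain m where m: "m \<in> hm Pt f (g, a) (h, b)" "reps B t m ?u ?y l k" "ix B m ?u ?y = i"
      by (rule t.R_real[OF o f(2) P lt gi kt])
    have le: "l \<odot> e = ev g a ?X (ix B m ?u ?y)" using evI(1)[OF o'(1) x(1,2)] x(4) m(3) by simp
    have "mt g a h b m H"
      by (rule mt_generic[OF m(1) P m(2) _ X x(3) le H]) (use m(3) chmD[OF l(1)] x(6) in simp_all)
    thus ?thesis using Ka(3)[OF m(1) H] m(1) by auto
  qed
  moreover have "m1 = m2" if m1: "m1 \<in> hm Pt f (g, a) (h, b)" "Ka m1 = H" and m2: "m2 \<in> hm Pt f (g, a) (h, b)" "Ka m2 = H" for m1 m2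
  proof -
    obtain N' \<pi> \<psi> where k: "\<pi> \<in> chm B t (ix B m1 ?u ?y) N' a" "reps B t m1 ?u ?y \<pi> \<psi>" by (rule t.reps_ex'[OF m1(1) s])
    obtain N2 \<pi>2 \<psi>2 where k2: "\<pi>2 \<in> chm B t (ix B m2 ?u ?y) N2 a" "reps B t m2 ?u ?y \<pi>2 \<psi>2" by (rule t.reps_ex'[OF m2(1) s])
    note s1 = sol[OF m1 k] and s2 = sol[OF m2 k2]
    have "ix B m1 ?u ?y = ix B m2 ?u ?y" by (rule psplit_un(1)[OF C(2) sp s1(2,1) s2(2,1)])
    hence k': "\<pi> \<in> chm B t (ix B m2 ?u ?y) N' a" using k(1) by simp
    obtain \<psi>' where r': "reps B t m2 ?u ?y \<pi> \<psi>'" by (rule t.reps_ex[OF m2(1) s k'])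
    note s3 = sol[OF m2 k' r']
    have "\<psi> = \<psi>'" by (rule psplit_un(2)[OF C(2) sp s1(2,1) s3(2,1) refl])
    thus ?thesis using t.R_ext[OF m1(1) m2(1) P k(2)] r' by simp
  qed
  moreover have "m \<in> hom (Tot Pt) xs ys \<and> farr K m = H \<longleftrightarrow> m \<in> hm Pt f (g, a) (h, b) \<and> Ka m = H" for m
    using K_over by (auto simp: hom_def hm_def e K_def fun_over_def f_def)
  ultimately show "\<exists>!m. m \<in> hom (Tot Pt) xs ys \<and> farr K m = H" by (metis (no_types, lifting))
qed

lemma K_surj:
  assumes "enough_prod_qf B F p" shows "ess_surj B Pt p K"
  unfolding ess_surj_def
proof
  fix \<alpha> assume a: "\<alpha> \<in> Ob"
  obtain f \<beta> where f: "f \<in> F" "Cod B f = ob \<alpha>" "\<beta> \<in> Obj (fibre B p (Dom B f))" "prod_qf B F p \<beta>"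
    "isomorphic (fibre B p (ob \<alpha>)) \<alpha> (Prd f \<beta>)" using assms a unfolding enough_prod_qf_def by blast
  obtain j j' where "Iso \<alpha> (co f \<beta>) j j'" using f(5) unfolding isomorphic_fibre[OF a] by blast
  hence "Iso (fobj K (f, \<beta>)) \<alpha> j' j" using viso_sym by (simp add: K_def)
  moreover have "(f, \<beta>) \<in> Obj (Tot Pt)" using f t_obj by (simp add: fam_obj_iff)
  ultimately show "\<exists>a\<in>Obj (Tot Pt). \<exists>j j'. Iso (fobj K a) \<alpha> j j'" by blast
qed

end

lemma (in cofib) goedel_completion:
  assumes units: "has_units B F" and comps: "has_dependent_coproducts B F" and G: "dependent_Goedel B F p"
  shows "fibration B (qf_sub B F p)" "fibred_equivalent B (Dial B F (qf_sub B F p)) p"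
proof -
  let ?s = "coprod_qf_sub B F p"
  have en: "enough_prod_qf B F ?s" "enough_coprod_qf B F p" using G unfolding dependent_Goedel_def dependent_Skolem_def by auto
  have hp: "has_products B F ?s" using en(1) unfolding enough_prod_qf_def by blast
  interpret s: prodqf B ?s F
    by (intro prodqf.intro profib.intro dfib.intro fib.intro dfib_axioms.intro profib_axioms.intro coprod_qf_sub_fibration dmc hp)
  have t: "s.t = qf_sub B F p" by (simp add: qf_sub_def)
  show "fibration B (qf_sub B F p)" using s.prod_qf_sub_fibration unfolding t .
  let ?r = "Pi_compl B F s.t"
  interpret ti: pifib B s.t F by (intro pifib.intro pifib_axioms.intro s.t.dfib_axioms units comps)
  have Ko: "fobj s.K a \<in> Ob" "coprod_qf B F p (fobj s.K a)" if "a \<in> Obj (Tot ?r)" for a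
    using s.K_over that unfolding fun_over_def is_functor_def coprod_qf_sub_def by auto
  have 1: "fun_over ?r p s.K" using s.K_over unfolding fun_over_def is_functor_def coprod_qf_sub_def by (auto simp: hom_def)
  have 2: "fully_faithful ?r p s.K" using s.K_ff Ko unfolding fully_faithful_def coprod_qf_sub_def full_sub_hom by auto
  interpret k: coprod_ff B ?r p F s.K
    by unfold_locales (use 1 2 coprod_qf_cproj Ko in auto)
  have "fibred_equivalent B (Sigma_compl B F ?r) p"
  proof (rule k.L_equivalence)
    fix \<alpha> assume a: "\<alpha> \<in> Ob"
    obtain f \<beta> where f: "f \<in> F" "Cod B f = ob \<alpha>" "\<beta> \<in> Obj (fibre B p (Dom B f))" "coprod_qf B F p \<beta>"
      "isomorphic (fibre B p (ob \<alpha>)) \<alpha> (Cop f \<beta>)" using en(2) a unfolding enough_coprod_qf_def by blast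
    have b: "\<beta> \<in> Ob" "ob \<beta> = Dom B f" using f(3) by auto
    have "\<beta> \<in> Obj (Tot ?s)" using b f(4) by (simp add: coprod_qf_sub_def)
    then obtain d j j' where d: "d \<in> Obj (Tot ?r)" "viso B ?s (fobj s.K d) \<beta> j j'" using s.K_surj[OF en(1)] unfolding ess_surj_def by blast
    have j: "Iso (fobj s.K d) \<beta> j j'" using d(2) by (simp add: coprod_qf_sub_def full_sub_viso)
    obtain i i' where "Iso \<alpha> (Cop f \<beta>) i i'" using f(5) unfolding isomorphic_fibre[OF a] by blast
    note i = viso_sym[OF this]
    note c1 = opcart_pre[OF coprod_obj(4)[OF f(1) b] cin_opcart[OF f(1) b] j]
    note c2 = opcart_post[OF c1(2,1) i]
    show "\<exists>g\<in>F. \<exists>a\<in>Obj (Tot ?r). \<exists>\<iota>. \<iota> \<in> hm p g (fobj s.K a) \<alpha> \<and> Opc \<iota>" using f(1) d(1) c2 by blast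
  qed
  thus "fibred_equivalent B (Dial B F (qf_sub B F p)) p" unfolding Dial_def t .
qed

section \<open>From completions to Goedel fibrations\<close>

text \<open>A fibration equivalent to a coproduct completion of \<open>r\<close> contains \<open>r\<close> as the families indexed by identities.\<close>

locale sigmafun = r: dfib B r F + e: cofib B p F + fibfun B "Sigma_compl B F r" p G
  for B :: "('o, 'm) cat" (structure) and r :: "('o, 'm, 'e1, 'f1) fibn" and p :: "('o, 'm, 'e2, 'f2) fibn" and F G +
  assumes units: "has_units B F" and comps: "has_dependent_coproducts B F" and surj: "ess_surj B (Sigma_compl B F r) p G"
begin

abbreviation "J a \<equiv> (Ide B (PObj r a), a)"
abbreviation "cc v w a \<equiv> FamArr (w, a) (v \<cdot> w, a) v (Ide B (Dom B w)) (Ide (Tot r) a)"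

definition "K = \<lparr>fobj = (\<lambda>a. fobj G (J a)), farr = (\<lambda>\<phi>. farr G (FamArr (J (Dom (Tot r) \<phi>)) (J (Cod (Tot r) \<phi>)) (PArr r \<phi>) (PArr r \<phi>) \<phi>))\<rparr>"

lemma J_obj:
  assumes a: "a \<in> Obj (Tot r)" shows "J a \<in> fam_obj B F r" "Ide B (PObj r a) \<in> F"
proof -
  let ?I = "Ide B (PObj r a)"
  have "iso B ?I" unfolding iso_def using a by (auto simp: hom_def intro: bexI[of _ ?I])
  thus "?I \<in> F" using units a unfolding has_units_def by simp
  thus "J a \<in> fam_obj B F r" using a by (simp add: r.fam_obj_iff)
qed

lemma J_hm:
  assumes f: "\<phi> \<in> hm r u a b"
  shows "FamArr (J a) (J b) u u \<phi> \<in> hm r.S u (J a) (J b)" "farr K \<phi> = farr G (FamArr (J a) (J b) u u \<phi>)"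
proof -
  note d = r.hmD[OF f]
  show "FamArr (J a) (J b) u u \<phi> \<in> hm r.S u (J a) (J b)"
    by (rule r.S_hmI) (use d J_obj(2) f in simp_all)
  show "farr K \<phi> = farr G (FamArr (J a) (J b) u u \<phi>)" using d by (simp add: K_def)
qed

lemma J_into:
  assumes a: "a \<in> Obj (Tot r)" and m: "m \<in> hm r.S u (J a) (h, b)"
  obtains f \<phi> where "m = FamArr (J a) (h, b) u f \<phi>" "h \<cdot> f = u" "\<phi> \<in> hm r f a b"
proof -
  obtain f \<phi> where f: "m = FamArr (J a) (h, b) u f \<phi>" "u \<in> Arr B" "Dom B u = Cod B (Ide B (PObj r a))"
    "h \<cdot> f = u \<cdot> Ide B (PObj r a)" "\<phi> \<in> hm r f a b" by (rule r.S_hmE[OF m])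
  have "h \<cdot> f = u" using f(2-4) a by simp
  thus ?thesis using that f by blast
qed

lemma K_obj: "a \<in> Obj (Tot r) ==> fobj K a = Go (J a) \<and> fobj K a \<in> Obj (Tot p) \<and> PObj p (fobj K a) = PObj r a"
  using G_obj[of "J a"] J_obj(1)[of a] by (simp add: K_def)

lemma K_over: "fun_over r p K"
proof -
  have hmI: "\<phi> \<in> hm r (PArr r \<phi>) (Dom (Tot r) \<phi>) (Cod (Tot r) \<phi>)" if "\<phi> \<in> Arr (Tot r)" for \<phi> using that by (simp add: hm_def)
  have Kh: "farr K \<phi> \<in> hm p u (fobj K a) (fobj K b)" if f: "\<phi> \<in> hm r u a b" for \<phi> u a b
    using G_hm[OF J_hm(1)[OF f]] J_hm(2)[OF f] by (simp add: K_def)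
  have "is_functor (Tot r) (Tot p) K" unfolding is_functor_def
  proof (intro conjI ballI impI)
    fix a assume a: "a \<in> Obj (Tot r)"
    show "fobj K a \<in> Obj (Tot p)" using K_obj[OF a] by blast
    have "farr K (Ide (Tot r) a) = Ga (Ide (Tot r.S) (J a))" using J_hm(2)[OF r.ide_hm[OF a]] a by simp
    also have "\<dots> = Ide (Tot p) (Go (J a))" by (rule G_ide) (use J_obj(1)[OF a] in simp)
    finally show "farr K (Ide (Tot r) a) = Ide (Tot p) (fobj K a)" using K_obj[OF a] by simp
  next
    fix f assume f: "f \<in> Arr (Tot r)"
    show "farr K f \<in> hom (Tot p) (fobj K (Dom (Tot r) f)) (fobj K (Cod (Tot r) f))"
      using Kh[OF hmI[OF f]] by (simp add: hm_def hom_def)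
    fix g assume g: "g \<in> Arr (Tot r)" "Cod (Tot r) f = Dom (Tot r) g"
    note F = hmI[OF f] and G = hmI[OF g(1), folded g(2)]
    note FG = r.comp_hm[OF F G]
    show "farr K (g \<odot>\<^sub>r f) = farr K g \<odot> farr K f"
      unfolding J_hm(2)[OF F] J_hm(2)[OF G] J_hm(2)[OF FG] G_comp[OF J_hm(1)[OF F] J_hm(1)[OF G], symmetric] by simp
  qed
  moreover have "PArr p (farr K \<phi>) = PArr r \<phi>" if "\<phi> \<in> Arr (Tot r)" for \<phi> using Kh[OF hmI[OF that]] by (simp add: hm_def)
  ultimately show ?thesis unfolding fun_over_def using K_obj by blast
qed

lemma K_ff: "fully_faithful r p K"
  unfolding fully_faithful_def
proof (intro ballI)
  fix a b h assume a: "a \<in> Obj (Tot r)" and b: "b \<in> Obj (Tot r)" and "h \<in> hom (Tot p) (fobj K a) (fobj K b)"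
  hence h: "h \<in> hm p (PArr p h) (Go (J a)) (Go (J b))" using K_obj[OF a] K_obj[OF b] by (simp add: hom_def hm_def)
  have o: "J a \<in> Obj (Tot r.S)" "J b \<in> Obj (Tot r.S)" using J_obj(1)[OF a] J_obj(1)[OF b] by simp_all
  obtain m where m: "m \<in> hm r.S (PArr p h) (J a) (J b)" "Ga m = h" by (rule G_full[OF h o])
  obtain f \<phi> where f: "m = FamArr (J a) (J b) (PArr p h) f \<phi>" "Ide B (PObj r b) \<cdot> f = PArr p h" "\<phi> \<in> hm r f a b" by (rule J_into[OF a m(1)])
  have "Ide B (PObj r b) \<cdot> f = f" using r.hmD[OF f(3)] by simp
  hence fe: "PArr p h = f" using f(2) by simp
  have 1: "\<phi> \<in> hom (Tot r) a b" "farr K \<phi> = h" using f(3) J_hm(2)[OF f(3)] m(2) f(1) fe by (simp_all add: hom_def hm_def)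
  have "\<psi> = \<phi>" if x: "\<psi> \<in> hom (Tot r) a b" "farr K \<psi> = h" for \<psi>
  proof -
    have x': "\<psi> \<in> hm r (PArr r \<psi>) a b" using x(1) by (simp add: hom_def hm_def)
    have "FamArr (J a) (J b) (PArr r \<psi>) (PArr r \<psi>) \<psi> = FamArr (J a) (J b) f f \<phi>"
      by (rule G_faithful[OF J_hm(1)[OF x'] J_hm(1)[OF f(3)]]) (use J_hm(2)[OF x'] J_hm(2)[OF f(3)] x(2) 1(2) in simp)
    thus ?thesis by simp
  qed
  thus "\<exists>!\<phi>. \<phi> \<in> hom (Tot r) a b \<and> farr K \<phi> = h" using 1 by blast
qed

lemma cc:
  assumes v: "v \<in> F" and w: "(w, a) \<in> fam_obj B F r" "Cod B w = Dom B v"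
  shows "(v \<cdot> w, a) \<in> fam_obj B F r" "cc v w a \<in> hm r.S v (w, a) (v \<cdot> w, a)"
    "\<And>m n u u' d. d \<in> Obj (Tot r) ==> m \<in> hm r.S u (J d) (w, a) ==> n \<in> hm r.S u' (J d) (w, a) ==>
       cc v w a \<odot>\<^sub>r.S m = cc v w a \<odot>\<^sub>r.S n ==> m = n"
proof -
  have wD: "w \<in> F" "w \<in> Arr B" "a \<in> Obj (Tot r)" "PObj r a = Dom B w" using w(1) r.F_arr by (auto simp: r.fam_obj_iff)
  have vw: "v \<cdot> w \<in> F" using comps v wD(1) w(2) unfolding has_dependent_coproducts_def by blast
  have va: "v \<in> Arr B" using r.F_arr[OF v] .
  show "(v \<cdot> w, a) \<in> fam_obj B F r" using vw wD va w(2) by (simp add: r.fam_obj_iff)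
  have "Ide (Tot r) a \<in> hm r (Ide B (Dom B w)) a a" using r.ide_hm[OF wD(3)] wD(4) by simp
  thus "cc v w a \<in> hm r.S v (w, a) (v \<cdot> w, a)" by (intro r.S_hmI) (use vw wD(1,2,4) va w(2) in simp_all)
  fix m n u u' d assume d: "d \<in> Obj (Tot r)" and m: "m \<in> hm r.S u (J d) (w, a)" and n: "n \<in> hm r.S u' (J d) (w, a)"
    and e: "cc v w a \<odot>\<^sub>r.S m = cc v w a \<odot>\<^sub>r.S n"
  obtain f \<phi> where f: "m = FamArr (J d) (w, a) u f \<phi>" "w \<cdot> f = u" "\<phi> \<in> hm r f d a" by (rule J_into[OF d m])
  obtain f' \<phi>' where f': "n = FamArr (J d) (w, a) u' f' \<phi>'" "w \<cdot> f' = u'" "\<phi>' \<in> hm r f' d a" by (rule J_into[OF d n])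
  have "Ide B (Dom B w) \<cdot> f = f" "Ide B (Dom B w) \<cdot> f' = f'" using r.hmD[OF f(3)] r.hmD[OF f'(3)] wD(4) by simp_all
  hence "f = f'" "\<phi> = \<phi>'" using e r.idl[OF f(3)] r.idl[OF f'(3)] by (simp_all add: f(1) f'(1))
  thus "m = n" using f(1,2) f'(1,2) by simp
qed

lemma cc_opcart:
  assumes v: "v \<in> F" and w: "(w, a) \<in> fam_obj B F r" "Cod B w = Dom B v"
  shows "opcart B p (Ga (cc v w a))"
proof (rule e.opcartI)
  note c = cc(2)[OF v w] and vo = cc(1)[OF v w]
  show "Ga (cc v w a) \<in> hm p v (Go (w, a)) (Go (v \<cdot> w, a))" by (rule G_hm[OF c])
  have wD: "w \<in> F" "w \<in> Arr B" "a \<in> Obj (Tot r)" "PObj r a = Dom B w" "v \<in> Arr B" using w(1) r.F_arr v by (auto simp: r.fam_obj_iff)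
  have o: "(w, a) \<in> Obj (Tot r.S)" "(v \<cdot> w, a) \<in> Obj (Tot r.S)" using w(1) vo by simp_all
  have ob: "\<exists>h b j j'. (h, b) \<in> fam_obj B F r \<and> viso B p (Go (h, b)) d j j'" if "d \<in> Obj (Tot p)" for d
    using surj that unfolding ess_surj_def by fastforce
  have fI: "f \<cdot> Ide B (Dom B w) = f \<and> \<phi> \<odot>\<^sub>r Ide (Tot r) a = \<phi>" if "\<phi> \<in> hm r f a b" for \<phi> f b
    using r.hmD[OF that] wD(4) r.idr[OF that] by simp
  {
    fix x k d assume x: "x \<in> Arr B" "Dom B x = PObj p (Go (v \<cdot> w, a))" and k: "k \<in> hm p (x \<cdot> v) (Go (w, a)) d"
    obtain h b j j' where h: "(h, b) \<in> fam_obj B F r" and j: "viso B p (Go (h, b)) d j j'" using ob e.hmD[OF k] by blast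
    note jh = e.visoD[OF j]
    have jk: "j' \<odot> k \<in> hm p (x \<cdot> v) (Go (w, a)) (Go (h, b))" using e.comp_vl[OF k] jh by blast
    have oh: "(h, b) \<in> Obj (Tot r.S)" using h by simp
    obtain m where m: "m \<in> hm r.S (x \<cdot> v) (w, a) (h, b)" "Ga m = j' \<odot> k" by (rule G_full[OF jk o(1) oh])
    obtain f \<phi> where f: "m = FamArr (w, a) (h, b) (x \<cdot> v) f \<phi>" "h \<in> F" "Cod B (x \<cdot> v) = Cod B h" "PObj r b = Dom B h" "h \<cdot> f = x \<cdot> v \<cdot> w" "\<phi> \<in> hm r f a b"
      by (rule r.S_hmE[OF m(1)])
    have xD: "Dom B x = Cod B v" using x(2) G_obj(2)[OF o(2)] wD w(2) by simp
    let ?n = "FamArr (v \<cdot> w, a) (h, b) x f \<phi>"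
    have n: "?n \<in> hm r.S x (v \<cdot> w, a) (h, b)"
    proof (rule r.S_hmI)
      show "v \<cdot> w \<in> F" using vo by (simp add: r.fam_obj_iff)
      show "Cod B x = Cod B h" using f(3) x xD wD by simp
      show "h \<cdot> f = x \<cdot> (v \<cdot> w)" using f(5) x xD wD w(2) by simp
    qed (use f x xD wD w(2) in simp_all)
    have nc: "?n \<odot>\<^sub>r.S cc v w a = m" using fI[OF f(6)] f(1) by simp
    have jv: "j \<in> vhm B p (Go (h, b)) d" and jc0: "j' \<in> vhm B p d (Go (h, b))" using jh by blast+
    have jn: "j \<odot> Ga ?n \<in> hm p x (Go (v \<cdot> w, a)) d" using e.comp_vl[OF G_hm[OF n]] jv e.hmD[OF G_hm[OF n]] by simp
    have "j \<odot> Ga ?n \<odot> Ga (cc v w a) = j \<odot> (j' \<odot> k)"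
      using e.ac[OF G_hm[OF c] G_hm[OF n] jv] G_comp[OF c n] nc m(2) by simp
    also have "\<dots> = k" using e.ac[OF k jc0 jv] jh e.idl[OF k] by simp
    finally show "\<exists>x'. x' \<in> hm p x (Go (v \<cdot> w, a)) d \<and> x' \<odot> Ga (cc v w a) = k" using jn by blast
  }
  fix x y z d assume y: "y \<in> hm p x (Go (v \<cdot> w, a)) d" and z: "z \<in> hm p x (Go (v \<cdot> w, a)) d" and e: "y \<odot> Ga (cc v w a) = z \<odot> Ga (cc v w a)"
  obtain h b j j' where h: "(h, b) \<in> fam_obj B F r" and j: "viso B p (Go (h, b)) d j j'" using ob e.hmD[OF y] by blast
  have oh: "(h, b) \<in> Obj (Tot r.S)" using h by simp
  have jc: "j' \<in> vhm B p d (Go (h, b))" using e.visoD[OF j] by blast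
  have jc': "j' \<in> chm B p (Ide B (PObj p d)) d (Go (h, b))" by (rule e.viso_cart[OF e.viso_sym[OF j]])
  obtain m where m: "m \<in> hm r.S x (v \<cdot> w, a) (h, b)" "Ga m = j' \<odot> y" by (rule G_full[OF e.comp_vl[OF y _] o(2) oh]) (use jc e.vhmD[OF jc] in simp)
  obtain n where n: "n \<in> hm r.S x (v \<cdot> w, a) (h, b)" "Ga n = j' \<odot> z" by (rule G_full[OF e.comp_vl[OF z _] o(2) oh]) (use jc e.vhmD[OF jc] in simp)
  have "Ga (m \<odot>\<^sub>r.S cc v w a) = Ga (n \<odot>\<^sub>r.S cc v w a)"
    using G_comp[OF c m(1)] G_comp[OF c n(1)] m(2) n(2) e e.ac[OF G_hm[OF c] y jc] e.ac[OF G_hm[OF c] z jc] by simp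
  hence mn: "m \<odot>\<^sub>r.S cc v w a = n \<odot>\<^sub>r.S cc v w a" by (rule G_faithful[OF r.S_comp_hm[OF c m(1)] r.S_comp_hm[OF c n(1)]])
  obtain f \<phi> where f: "m = FamArr (v \<cdot> w, a) (h, b) x f \<phi>" "\<phi> \<in> hm r f a b" by (rule r.S_hmE[OF m(1)])
  obtain f' \<phi>' where f': "n = FamArr (v \<cdot> w, a) (h, b) x f' \<phi>'" "\<phi>' \<in> hm r f' a b" by (rule r.S_hmE[OF n(1)])
  have "m = n" using mn fI[OF f(2)] fI[OF f'(2)] by (simp add: f(1) f'(1))
  hence "j' \<odot> y = j' \<odot> z" using m(2) n(2) by simp
  thus "y = z" by (rule e.cart_eq[OF jc' y z])
qed

lemma K_cproj:
  assumes a: "a \<in> Obj (Tot r)"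
  shows "cproj B F p (fobj K a)"
  unfolding cproj_def
proof (intro ballI allI impI)
  fix u \<iota> b c H w assume u: "u \<in> F" and i: "\<iota> \<in> hm p u b c" "opcart B p \<iota>" and "H \<in> hm p w (fobj K a) c"
  hence H: "H \<in> hm p w (Go (J a)) c" using K_obj[OF a] by simp
  have "b \<in> Obj (Tot p)" using e.hmD[OF i(1)] by blast
  then obtain e d j j' where o: "(e, d) \<in> fam_obj B F r" and j: "viso B p (Go (e, d)) b j j'" using surj unfolding ess_surj_def by fastforce
  have oe: "(e, d) \<in> Obj (Tot r.S)" "J a \<in> Obj (Tot r.S)" using o J_obj(1)[OF a] by simp_all
  note jh = e.visoD[OF j]
  have ij: "opcart B p (\<iota> \<odot> j)" "\<iota> \<odot> j \<in> hm p u (Go (e, d)) c" by (rule e.opcart_pre[OF i j])+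
  have eD: "Cod B e = Dom B u" using e.hmD[OF ij(2)] G_obj(2)[OF oe(1)] by simp
  note c = cc[OF u o eD] and co = cc_opcart[OF u o eD]
  have oc: "(u \<cdot> e, d) \<in> Obj (Tot r.S)" using c(1) by simp
  let ?c = "cc u e d"
  obtain q q' where q: "viso B p (Go (u \<cdot> e, d)) c q q'" "q \<odot> Ga ?c = \<iota> \<odot> j" "q' \<odot> (\<iota> \<odot> j) = Ga ?c"
    by (rule e.opcart_viso[OF G_hm[OF c(2)] co ij(2,1)])
  note qh = e.visoD[OF q(1)]
  have qv: "q \<in> vhm B p (Go (u \<cdot> e, d)) c" "q' \<in> vhm B p c (Go (u \<cdot> e, d))" and jv: "j \<in> vhm B p (Go (e, d)) b" "j' \<in> vhm B p b (Go (e, d))" using qh jh by blast+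
  have qH: "q' \<odot> H \<in> hm p w (Go (J a)) (Go (u \<cdot> e, d))" by (rule e.comp_vl[OF H qv(2)])
  obtain M where M: "M \<in> hm r.S w (J a) (u \<cdot> e, d)" "Ga M = q' \<odot> H" by (rule G_full[OF qH oe(2) oc])
  obtain f \<phi> where f: "M = FamArr (J a) (u \<cdot> e, d) w f \<phi>" "u \<cdot> e \<cdot> f = w" "\<phi> \<in> hm r f a d" by (rule J_into[OF a M(1)])
  have fD: "f \<in> Arr B" "Dom B f = PObj r a" "Cod B f = PObj r d" using r.hmD[OF f(3)] by simp_all
  have dD: "e \<in> F" "e \<in> Arr B" "d \<in> Obj (Tot r)" "PObj r d = Dom B e" "u \<in> Arr B" using o r.F_arr u by (auto simp: r.fam_obj_iff)
  let ?m = "FamArr (J a) (e, d) (e \<cdot> f) f \<phi>"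
  have m: "?m \<in> hm r.S (e \<cdot> f) (J a) (e, d)"
    by (rule r.S_hmI) (use fD dD f(3) J_obj(2)[OF a] a in simp_all)
  have cm: "?c \<odot>\<^sub>r.S ?m = M" using f(1,2) fD dD eD r.idl[OF f(3)] by simp
  let ?k = "j \<odot> Ga ?m"
  have kh: "?k \<in> hm p (e \<cdot> f) (Go (J a)) b" by (rule e.comp_vl[OF G_hm[OF m] jv(1)])
  have "\<iota> \<odot> ?k = q \<odot> (Ga ?c \<odot> Ga ?m)"
    using e.ac[OF G_hm[OF m] jv(1) i(1)] e.ac[OF G_hm[OF m] G_hm[OF c(2)] qv(1)] q(2) by simp
  also have "\<dots> = q \<odot> (q' \<odot> H)" using G_comp[OF m c(2)] cm M(2) by simp
  also have "\<dots> = H" using e.ac[OF H qv(2,1)] qh e.idl[OF H] by simp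
  finally have ik: "\<iota> \<odot> ?k = H" .
  have un: "\<exists>n u'. n \<in> hm r.S u' (J a) (e, d) \<and> Ga n = j' \<odot> k \<and> ?c \<odot>\<^sub>r.S n = M" if k: "k \<in> hom (Tot p) (Go (J a)) b" "\<iota> \<odot> k = H" for k
  proof -
    have k': "k \<in> hm p (PArr p k) (Go (J a)) b" using k(1) by (simp add: hom_def hm_def)
    have jk: "j' \<odot> k \<in> hm p (PArr p k) (Go (J a)) (Go (e, d))" by (rule e.comp_vl[OF k' jv(2)])
    obtain n where n: "n \<in> hm r.S (PArr p k) (J a) (e, d)" "Ga n = j' \<odot> k" by (rule G_full[OF jk oe(2,1)])
    have jjk: "j \<odot> (j' \<odot> k) = k" using e.ac[OF k' jv(2,1)] jh e.idl[OF k'] by simp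
    have "Ga (?c \<odot>\<^sub>r.S n) = q' \<odot> (\<iota> \<odot> j) \<odot> (j' \<odot> k)" using G_comp[OF n(1) c(2)] n(2) q(3) by simp
    also have "\<dots> = q' \<odot> H" using e.ac[OF jk ij(2) qv(2)] e.ac[OF jk jv(1) i(1)] jjk k(2) by simp
    finally have "Ga (?c \<odot>\<^sub>r.S n) = Ga M" using M(2) by simp
    hence "?c \<odot>\<^sub>r.S n = M" by (rule G_faithful[OF r.S_comp_hm[OF n(1) c(2)] M(1)])
    thus ?thesis using n by blast
  qed
  have "k1 = k2" if k1: "k1 \<in> hom (Tot p) (Go (J a)) b" "\<iota> \<odot> k1 = H" and k2: "k2 \<in> hom (Tot p) (Go (J a)) b" "\<iota> \<odot> k2 = H" for k1 k2
  proof -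
    obtain n1 u1 where n1: "n1 \<in> hm r.S u1 (J a) (e, d)" "Ga n1 = j' \<odot> k1" "?c \<odot>\<^sub>r.S n1 = M" using un[OF k1] by blast
    obtain n2 u2 where n2: "n2 \<in> hm r.S u2 (J a) (e, d)" "Ga n2 = j' \<odot> k2" "?c \<odot>\<^sub>r.S n2 = M" using un[OF k2] by blast
    have "n1 = n2" by (rule c(3)[OF a n1(1) n2(1)]) (simp only: n1(3) n2(3))
    hence e: "j' \<odot> k1 = j' \<odot> k2" using n1(2) n2(2) by simp
    have h: "k1 \<in> hm p (PArr p k1) (Go (J a)) b" "k2 \<in> hm p (PArr p k2) (Go (J a)) b" using k1 k2 by (simp_all add: hom_def hm_def)
    have "j \<odot> j' = Ide (Tot p) b" using jh by blast
    hence "k = j \<odot> (j' \<odot> k)" if "k \<in> hm p x (Go (J a)) b" for k x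
      using e.ac[OF that jv(2,1)] e.idl[OF that] by simp
    from this[OF h(1)] this[OF h(2)] show ?thesis using e by simp
  qed
  moreover have "?k \<in> hom (Tot p) (Go (J a)) b" using kh by (simp add: hom_def hm_def)
  ultimately show "\<exists>!k. k \<in> hom (Tot p) (fobj K a) b \<and> \<iota> \<odot> k = H" using ik K_obj[OF a] by metis
qed

lemma K_dense:
  assumes a: "\<alpha> \<in> Obj (Tot p)"
  shows "\<exists>g \<in> F. \<exists>a \<in> Obj (Tot r). \<exists>\<iota>. \<iota> \<in> hm p g (fobj K a) \<alpha> \<and> opcart B p \<iota>"
proof -
  obtain g d j j' where o: "(g, d) \<in> fam_obj B F r" and j: "viso B p (Go (g, d)) \<alpha> j j'" using surj a unfolding ess_surj_def by fastforce
  have g: "g \<in> F" "g \<in> Arr B" "d \<in> Obj (Tot r)" "PObj r d = Dom B g" using o r.F_arr by (auto simp: r.fam_obj_iff)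
  have cd: "Cod B (Ide B (PObj r d)) = Dom B g" using g by simp
  note c = cc(2)[OF g(1) J_obj(1)[OF g(3)] cd] and co = cc_opcart[OF g(1) J_obj(1)[OF g(3)] cd]
  have gI: "g \<cdot> Ide B (PObj r d) = g" using g by simp
  have j': "viso B p (Go (g \<cdot> Ide B (PObj r d), d)) \<alpha> j j'" unfolding gI by (rule j)
  note i = e.opcart_post[OF G_hm[OF c] co j']
  show ?thesis using g(1,3) i K_obj[OF g(3)] by metis
qed

lemma dense: "densefun B r p F K"
  by (intro densefun.intro densefun_axioms.intro coprod_ff.intro coprod_ff_axioms.intro fibfun.intro fibfun_axioms.intro
    r.dfib_axioms e.cofib_axioms r.fib_axioms e.fib_axioms K_over K_ff K_cproj K_dense)

end

lemma (in cofib) completion_goedel: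
  fixes q :: "('o, 'm, 'e3, 'f3) fibn"
  assumes units: "has_units B F" and comps: "has_dependent_coproducts B F" and "has_dependent_products B F" and "has_products B F p"
    and q: "fibration B q" and E: "fibred_equivalent B (Dial B F q) p"
  shows "dependent_Goedel B F p"
proof -
  interpret q: pifib B q F
    by (intro pifib.intro dfib.intro fib.intro dfib_axioms.intro pifib_axioms.intro units comps q dmc)
  obtain G where G: "fun_over (Dial B F q) p G" "fully_faithful (Dial B F q) p G" "ess_surj B (Dial B F q) p G"
    by (rule equivalenceD[OF _ fib E]) (simp only: Dial_def q.Rf.S_fibration)
  interpret s: sigmafun B q.R p F G
    by unfold_locales (use G q.Rf.S_fibration units comps in \<open>simp_all add: Dial_def\<close>)
  show ?thesis by (rule densefun.goedel[OF s.dense assms(3,4) q.R_enough])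
qed

theorem theorem5p11:
  fixes B :: "('o, 'm) cat" and F :: "'m set" and p :: "('o, 'm, 'e, 'f) fibn"
  assumes "display_map_category B F"
    and "has_units B F"
    and "has_dependent_coproducts B F"
    and "has_dependent_products B F"
    and "fibration B p"
    and "has_products B F p"
    and "has_coproducts B F p"
  shows "((\<exists>p' :: ('o, 'm, 'e, 'f) fibn. fibration B p' \<and> fibred_equivalent B (Dial B F p') p)
            \<longleftrightarrow> dependent_Goedel B F p) \<and>
         (\<forall>p' :: ('o, 'm, 'e2, 'f2) fibn. fibration B p' \<and> fibred_equivalent B (Dial B F p') p
            \<longrightarrow> dependent_Goedel B F p) \<and>
         (dependent_Goedel B F p
            \<longrightarrow> fibration B (qf_sub B F p) \<and> fibred_equivalent B (Dial B F (qf_sub B F p)) p)"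
proof -
  interpret p: cofib B p F
    by (intro cofib.intro dfib.intro fib.intro dfib_axioms.intro cofib_axioms.intro assms)
  note compl = p.goedel_completion[OF assms(2,3)] and goedel = p.completion_goedel[OF assms(2-4,6)]
  show ?thesis
  proof (intro conjI allI impI iffI)
    show "dependent_Goedel B F p" if "\<exists>p' :: ('o, 'm, 'e, 'f) fibn. fibration B p' \<and> fibred_equivalent B (Dial B F p') p"
      using that goedel by blast
    show "dependent_Goedel B F p" if "fibration B p' \<and> fibred_equivalent B (Dial B F p') p" for p' :: "('o, 'm, 'e2, 'f2) fibn"
      by (rule goedel[OF conjunct1[OF that] conjunct2[OF that]])
  qed (use compl in blast)+
qed

end
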